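(* Let $\mathcal{C}$ be a finitary proto-abelian category, and let $\mathcal{S}_\bullet$ be its simplicial groupoid of flags. The datum $(\mathrm{Fun}(\mathcal{S}_1),\otimes,I)$ naturally extends to a monoidal structure on the category $\mathrm{Fun}(\mathcal{S}_1)$; that is, there are natural associativity and unit isomorphisms making $\mathrm{Fun}(\mathcal{S}_1)$ a monoidal category with tensor product $\otimes$ and unit object $I$.
   Context: Monomorphisms are denoted $\hookrightarrow$ and epimorphisms $\twoheadrightarrow$. A category $\mathcal{C}$ is called proto-abelian if: (1) $\mathcal{C}$ is pointed (has a zero object). (2)(a) Every diagram $C \twoheadleftarrow A \hookrightarrow B$ can be completed to a pushout square with $A\hookrightarrow B$, $A \twoheadrightarrow C$, $B \twoheadrightarrow D$, $C \hookrightarrow D$. (b) Every diagram $C \hookrightarrow D \twoheadleftarrow B$ can be completed to a pullback square with $A\hookrightarrow B$, $A \twoheadrightarrow C$, $B \twoheadrightarrow D$, $C \hookrightarrow D$. (3) A commutative square with $A\hookrightarrow B$, $A \twoheadrightarrow C$, $B \twoheadrightarrow D$, $C \hookrightarrow D$ is a pushout square if and only if it is a pullback square; such a square is called biCartesian. An extension of $A'$ by $A$ is such a biCartesian square with $C=0$, $D=A'$, written $A\hookrightarrow B\twoheadrightarrow A'$; two extensions are equivalent if there is an isomorphism of middle terms compatible with the identities of $A$ and $A'$. $\mathcal{C}$ is finitary if for all objects $A,A'$ the set $\mathrm{Hom}(A',A)$ and the set $\mathrm{Ext}(A',A)$ of equivalence classes of extensions are finite. Groupoid of flags. Fix a zero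 object $0$ of $\mathcal{C}$. $\mathcal{S}_n$ is the maximal groupoid in the category of commutative triangular diagrams in $\mathcal{C}$ consisting of objects $A_{i,j}$, $0\le i\le j\le n$, with $A_{i,i}=0$, monomorphisms $A_{i,j}\hookrightarrow A_{i,j+1}$ and epimorphisms $A_{i,j}\twoheadrightarrow A_{i+1,j}$, such that all squares are biCartesian. In particular, $\mathcal{S}_0$ is the trivial groupoid, $\mathcal{S}_1$ is equivalent to the maximal groupoid of $\mathcal{C}$, and $\mathcal{S}_2$ is the groupoid of short exact sequences $A_{0,1}\hookrightarrow A_{0,2}\twoheadrightarrow A_{1,2}$. Let $G:\mathcal{S}_2\to\mathcal{S}_1\times\mathcal{S}_1$ send such a sequence to $(A_{0,1},A_{1,2})$, let $F:\mathcal{S}_2\to\mathcal{S}_1$ send it to $A_{0,2}$, and let $\sigma_0:\mathcal{S}_0\to\mathcal{S}_1$ send the unique object to $0$. Functor categories. For a groupoid $\mathcal{A}$, $\mathrm{Fun}(\mathcal{A})$ is the category of functors from $\mathcal{A}$ to the category $\mathbf{Vect}_{\mathbb{C}}$ of finite dimensional complex vector spaces which are nonzero on only finitely many isomorphism classes of $\mathcal{A}$. For a functor $H:\mathcal{A}\to\mathcal{B}$ of groupoids, the $2$-fiber $\mathcal{A}_b$ over $b\in\mathcal{B}$ is the groupoid of pairs $(a,\varphi:H(a)\cong b)$, with morphisms the morphisms $a\to a'$ compatible with the $\varphi$'s. A groupoid is finite if it has finitely many isomorphism classes and finite automorphism groups. $H$ is $\pi_0$-finite if the induced map on sets of isomorphism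 classes has finite fibers; $H$ is locally finite if for each $a\in\mathcal{A}$ the restriction of $H$ to the connected component of $a$ has finite $2$-fibers. If $H$ is $\pi_0$-finite, $H^*:\mathrm{Fun}(\mathcal{B})\to\mathrm{Fun}(\mathcal{A})$ is $\varphi\mapsto\varphi\circ H$. If $H$ is locally finite, $H_!:\mathrm{Fun}(\mathcal{A})\to\mathrm{Fun}(\mathcal{B})$ is left Kan extension, $H_!(\varphi)(b)=\mathrm{colim}_{\mathcal{A}_b}\varphi|_{\mathcal{A}_b}$. For $\mathcal{C}$ finitary, $G$ is $\pi_0$-finite and $F,\sigma_0$ are locally finite. Define $\otimes:\mathrm{Fun}(\mathcal{S}_1)\times\mathrm{Fun}(\mathcal{S}_1)\to\mathrm{Fun}(\mathcal{S}_1)$ by $\varphi\otimes\psi = F_!\,G^*(\varphi\boxtimes\psi)$, where $(\varphi\boxtimes\psi)(x,y)=\varphi(x)\otimes_{\mathbb{C}}\psi(y)$, and $I=(\sigma_0)_!(\mathbb{C})\in\mathrm{Fun}(\mathcal{S}_1)$, where $\mathbb{C}$ denotes the functor on $\mathcal{S}_0$ with value $\mathbb{C}$. *)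

theory Defs
  imports "Jordan_Normal_Form.VS_Connect" "HOL-Library.FuncSet"
begin

section \<open>Categories and functors\<close>

record ('o, 'a) cat =
  Obj :: "'o set"
  Arr :: "'a set"
  Dom :: "'a \<Rightarrow> 'o"
  Cod :: "'a \<Rightarrow> 'o"
  Ident :: "'o \<Rightarrow> 'a"
  Comp :: "'a \<Rightarrow> 'a \<Rightarrow> 'a"  (infixl "\<cdot>\<index>" 70)

definition Hom :: "('o, 'a) cat \<Rightarrow> 'o \<Rightarrow> 'o \<Rightarrow> 'a set" where
  "Hom C x y = {f \<in> Arr C. Dom C f = x \<and> Cod C f = y}"

locale category =
  fixes C :: "('o, 'a) cat" (structure)
  assumes Dom_Obj: "f \<in> Arr C \<Longrightarrow> Dom C f \<in> Obj C"
    and Cod_Obj: "f \<in> Arr C \<Longrightarrow> Cod C f \<in> Obj C"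
    and Ident_Hom: "x \<in> Obj C \<Longrightarrow> Ident C x \<in> Hom C x x"
    and Comp_Hom: "f \<in> Hom C x y \<Longrightarrow> g \<in> Hom C y z \<Longrightarrow> g \<cdot> f \<in> Hom C x z"
    and Comp_assoc: "f \<in> Hom C w x \<Longrightarrow> g \<in> Hom C x y \<Longrightarrow> h \<in> Hom C y z \<Longrightarrow>
          h \<cdot> (g \<cdot> f) = h \<cdot> g \<cdot> f"
    and Ident_left: "f \<in> Hom C x y \<Longrightarrow> Ident C y \<cdot> f = f"
    and Ident_right: "f \<in> Hom C x y \<Longrightarrow> f \<cdot> Ident C x = f"

definition mono_arr :: "('o, 'a) cat \<Rightarrow> 'a \<Rightarrow> bool" where
  "mono_arr C f \<longleftrightarrow> f \<in> Arr C \<and>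
     (\<forall>w. \<forall>g \<in> Hom C w (Dom C f). \<forall>h \<in> Hom C w (Dom C f). f \<cdot>\<^bsub>C\<^esub> g = f \<cdot>\<^bsub>C\<^esub> h \<longrightarrow> g = h)"

definition epi_arr :: "('o, 'a) cat \<Rightarrow> 'a \<Rightarrow> bool" where
  "epi_arr C f \<longleftrightarrow> f \<in> Arr C \<and>
     (\<forall>w. \<forall>g \<in> Hom C (Cod C f) w. \<forall>h \<in> Hom C (Cod C f) w. g \<cdot>\<^bsub>C\<^esub> f = h \<cdot>\<^bsub>C\<^esub> f \<longrightarrow> g = h)"

definition iso_arr :: "('o, 'a) cat \<Rightarrow> 'a \<Rightarrow> bool" where
  "iso_arr C f \<longleftrightarrow> f \<in> Arr C \<and>
     (\<exists>g \<in> Hom C (Cod C f) (Dom C f).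
        g \<cdot>\<^bsub>C\<^esub> f = Ident C (Dom C f) \<and> f \<cdot>\<^bsub>C\<^esub> g = Ident C (Cod C f))"

definition iso_class :: "('o, 'a) cat \<Rightarrow> 'o \<Rightarrow> 'o set" where
  "iso_class C x = {y. \<exists>f \<in> Hom C x y. iso_arr C f}"

definition zero_object :: "('o, 'a) cat \<Rightarrow> 'o \<Rightarrow> bool" where
  "zero_object C z \<longleftrightarrow> z \<in> Obj C \<and>
     (\<forall>x \<in> Obj C. (\<exists>!f. f \<in> Hom C z x) \<and> (\<exists>!f. f \<in> Hom C x z))"

definition from_zero :: "('o, 'a) cat \<Rightarrow> 'o \<Rightarrow> 'o \<Rightarrow> 'a" where
  "from_zero C z x = (THE f. f \<in> Hom C z x)"

definition to_zero :: "('o, 'a) cat \<Rightarrow> 'o \<Rightarrow> 'o \<Rightarrow> 'a" where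
  "to_zero C z x = (THE f. f \<in> Hom C x z)"

text \<open>The maximal groupoid (core) of a category.\<close>

definition core :: "('o, 'a) cat \<Rightarrow> ('o, 'a) cat" where
  "core K = K\<lparr>Arr := {f. iso_arr K f}\<rparr>"

definition full_subcat :: "('o, 'a) cat \<Rightarrow> ('o \<Rightarrow> bool) \<Rightarrow> ('o, 'a) cat" where
  "full_subcat K P = K\<lparr>Obj := {x \<in> Obj K. P x},
                       Arr := {f \<in> Arr K. P (Dom K f) \<and> P (Cod K f)}\<rparr>"

definition prod_cat :: "('o, 'a) cat \<Rightarrow> ('p, 'b) cat \<Rightarrow> ('o \<times> 'p, 'a \<times> 'b) cat" where
  "prod_cat A B = \<lparr>
     Obj = Obj A \<times> Obj B,
     Arr = Arr A \<times> Arr B,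
     Dom = map_prod (Dom A) (Dom B),
     Cod = map_prod (Cod A) (Cod B),
     Ident = map_prod (Ident A) (Ident B),
     Comp = (\<lambda>(g, g') (f, f'). (g \<cdot>\<^bsub>A\<^esub> f, g' \<cdot>\<^bsub>B\<^esub> f'))\<rparr>"

text \<open>Functors and natural transformations are required to be \<open>undefined\<close> outside their domains,
  so that their HOL equality is the mathematical one.\<close>

record ('o, 'a, 'p, 'b) fct =
  on_obj :: "'o \<Rightarrow> 'p"
  on_arr :: "'a \<Rightarrow> 'b"

locale cat_functor = A: category A + B: category B
  for A :: "('o, 'a) cat" and B :: "('p, 'b) cat" +
  fixes H :: "('o, 'a, 'p, 'b) fct"
  assumes obj_maps: "on_obj H \<in> Obj A \<rightarrow>\<^sub>E Obj B"
    and arr_ext: "on_arr H \<in> extensional (Arr A)"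
    and arr_maps: "f \<in> Hom A x y \<Longrightarrow> on_arr H f \<in> Hom B (on_obj H x) (on_obj H y)"
    and pres_Ident: "x \<in> Obj A \<Longrightarrow> on_arr H (Ident A x) = Ident B (on_obj H x)"
    and pres_Comp: "f \<in> Hom A x y \<Longrightarrow> g \<in> Hom A y z \<Longrightarrow>
          on_arr H (g \<cdot>\<^bsub>A\<^esub> f) = on_arr H g \<cdot>\<^bsub>B\<^esub> on_arr H f"

text \<open>\<open>fcomp A K H\<close> is the composite \<open>K \<circ> H\<close>, where \<open>A\<close> is the source of \<open>H\<close>.\<close>

definition fcomp :: "('o, 'a) cat \<Rightarrow> ('p, 'b, 'q, 'c) fct \<Rightarrow> ('o, 'a, 'p, 'b) fct \<Rightarrow>
    ('o, 'a, 'q, 'c) fct" where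
  "fcomp A K H = \<lparr>on_obj = compose (Obj A) (on_obj K) (on_obj H),
                  on_arr = compose (Arr A) (on_arr K) (on_arr H)\<rparr>"

definition const_fct :: "('o, 'a) cat \<Rightarrow> ('p, 'b) cat \<Rightarrow> 'p \<Rightarrow> ('o, 'a, 'p, 'b) fct" where
  "const_fct A B y = \<lparr>on_obj = (\<lambda>x\<in>Obj A. y), on_arr = (\<lambda>f\<in>Arr A. Ident B y)\<rparr>"

type_synonym ('o, 'a, 'p, 'b) ntrans =
  "('o, 'a, 'p, 'b) fct \<times> ('o, 'a, 'p, 'b) fct \<times> ('o \<Rightarrow> 'b)"

definition nat_trans :: "('o, 'a) cat \<Rightarrow> ('p, 'b) cat \<Rightarrow>
    ('o, 'a, 'p, 'b) fct \<Rightarrow> ('o, 'a, 'p, 'b) fct \<Rightarrow> ('o \<Rightarrow> 'b) \<Rightarrow> bool" where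
  "nat_trans A B \<Phi> \<Psi> \<eta> \<longleftrightarrow> cat_functor A B \<Phi> \<and> cat_functor A B \<Psi> \<and> \<eta> \<in> extensional (Obj A) \<and>
     (\<forall>x \<in> Obj A. \<eta> x \<in> Hom B (on_obj \<Phi> x) (on_obj \<Psi> x)) \<and>
     (\<forall>f \<in> Arr A. \<eta> (Cod A f) \<cdot>\<^bsub>B\<^esub> on_arr \<Phi> f = on_arr \<Psi> f \<cdot>\<^bsub>B\<^esub> \<eta> (Dom A f))"

definition functor_cat :: "('o, 'a) cat \<Rightarrow> ('p, 'b) cat \<Rightarrow>
    (('o, 'a, 'p, 'b) fct, ('o, 'a, 'p, 'b) ntrans) cat" where
  "functor_cat A B = \<lparr>
     Obj = {\<Phi>. cat_functor A B \<Phi>},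
     Arr = {(\<Phi>, \<Psi>, \<eta>). nat_trans A B \<Phi> \<Psi> \<eta>},
     Dom = (\<lambda>(\<Phi>, \<Psi>, \<eta>). \<Phi>),
     Cod = (\<lambda>(\<Phi>, \<Psi>, \<eta>). \<Psi>),
     Ident = (\<lambda>\<Phi>. (\<Phi>, \<Phi>, \<lambda>x\<in>Obj A. Ident B (on_obj \<Phi> x))),
     Comp = (\<lambda>(_, \<Psi>, \<theta>) (\<Phi>, _, \<eta>). (\<Phi>, \<Psi>, \<lambda>x\<in>Obj A. \<theta> x \<cdot>\<^bsub>B\<^esub> \<eta> x))\<rparr>"

definition is_colimit :: "('o, 'a) cat \<Rightarrow> ('p, 'b) cat \<Rightarrow> ('o, 'a, 'p, 'b) fct \<Rightarrow>
    'p \<Rightarrow> ('o \<Rightarrow> 'b) \<Rightarrow> bool" where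
  "is_colimit J K D c \<kappa> \<longleftrightarrow>
     nat_trans J K D (const_fct J K c) \<kappa> \<and>
     (\<forall>d \<in> Obj K. \<forall>\<mu>. nat_trans J K D (const_fct J K d) \<mu> \<longrightarrow>
        (\<exists>!m. m \<in> Hom K c d \<and> (\<forall>j \<in> Obj J. m \<cdot>\<^bsub>K\<^esub> \<kappa> j = \<mu> j)))"

definition colim :: "('o, 'a) cat \<Rightarrow> ('p, 'b) cat \<Rightarrow> ('o, 'a, 'p, 'b) fct \<Rightarrow> 'p \<times> ('o \<Rightarrow> 'b)" where
  "colim J K D = (SOME (c, \<kappa>). is_colimit J K D c \<kappa>)"

locale monoidal_category = category K + cat_functor "prod_cat K K" K T
  for K :: "('o, 'a) cat" (structure) and T :: "('o \<times> 'o, 'a \<times> 'a, 'o, 'a) fct" +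
  fixes I :: 'o
    and \<alpha> :: "'o \<Rightarrow> 'o \<Rightarrow> 'o \<Rightarrow> 'a" and l r :: "'o \<Rightarrow> 'a"
  assumes unit_Obj: "I \<in> Obj K"
    and assoc_Hom: "x \<in> Obj K \<Longrightarrow> y \<in> Obj K \<Longrightarrow> z \<in> Obj K \<Longrightarrow>
          \<alpha> x y z \<in> Hom K (on_obj T (on_obj T (x, y), z)) (on_obj T (x, on_obj T (y, z)))"
    and assoc_iso: "x \<in> Obj K \<Longrightarrow> y \<in> Obj K \<Longrightarrow> z \<in> Obj K \<Longrightarrow> iso_arr K (\<alpha> x y z)"
    and assoc_natural: "f \<in> Hom K x x' \<Longrightarrow> g \<in> Hom K y y' \<Longrightarrow> h \<in> Hom K z z' \<Longrightarrow>
          \<alpha> x' y' z' \<cdot> on_arr T (on_arr T (f, g), h) = on_arr T (f, on_arr T (g, h)) \<cdot> \<alpha> x y z"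
    and lunit_Hom: "x \<in> Obj K \<Longrightarrow> l x \<in> Hom K (on_obj T (I, x)) x"
    and lunit_iso: "x \<in> Obj K \<Longrightarrow> iso_arr K (l x)"
    and lunit_natural: "f \<in> Hom K x x' \<Longrightarrow> l x' \<cdot> on_arr T (Ident K I, f) = f \<cdot> l x"
    and runit_Hom: "x \<in> Obj K \<Longrightarrow> r x \<in> Hom K (on_obj T (x, I)) x"
    and runit_iso: "x \<in> Obj K \<Longrightarrow> iso_arr K (r x)"
    and runit_natural: "f \<in> Hom K x x' \<Longrightarrow> r x' \<cdot> on_arr T (f, Ident K I) = f \<cdot> r x"
    and pentagon: "w \<in> Obj K \<Longrightarrow> x \<in> Obj K \<Longrightarrow> y \<in> Obj K \<Longrightarrow> z \<in> Obj K \<Longrightarrow>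
          \<alpha> w x (on_obj T (y, z)) \<cdot> \<alpha> (on_obj T (w, x)) y z =
          on_arr T (Ident K w, \<alpha> x y z) \<cdot> \<alpha> w (on_obj T (x, y)) z \<cdot> on_arr T (\<alpha> w x y, Ident K z)"
    and triangle: "x \<in> Obj K \<Longrightarrow> y \<in> Obj K \<Longrightarrow>
          on_arr T (Ident K x, l y) \<cdot> \<alpha> x I y = on_arr T (r x, Ident K y)"


section \<open>Finitary proto-abelian categories\<close>

text \<open>In the squares below \<open>f : A \<rightarrow> B\<close>, \<open>g : A \<rightarrow> C'\<close>, \<open>h : B \<rightarrow> D\<close> and \<open>k : C' \<rightarrow> D\<close>.\<close>

definition comm_square :: "('o, 'a) cat \<Rightarrow> 'a \<Rightarrow> 'a \<Rightarrow> 'a \<Rightarrow> 'a \<Rightarrow> bool" where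
  "comm_square C f g h k \<longleftrightarrow>
     f \<in> Arr C \<and> g \<in> Arr C \<and> h \<in> Arr C \<and> k \<in> Arr C \<and>
     Dom C f = Dom C g \<and> Cod C f = Dom C h \<and> Cod C g = Dom C k \<and> Cod C h = Cod C k \<and>
     h \<cdot>\<^bsub>C\<^esub> f = k \<cdot>\<^bsub>C\<^esub> g"

definition is_pushout :: "('o, 'a) cat \<Rightarrow> 'a \<Rightarrow> 'a \<Rightarrow> 'a \<Rightarrow> 'a \<Rightarrow> bool" where
  "is_pushout C f g h k \<longleftrightarrow> comm_square C f g h k \<and>
     (\<forall>h' k'. comm_square C f g h' k' \<longrightarrow>
        (\<exists>!u. u \<in> Hom C (Cod C h) (Cod C h') \<and> u \<cdot>\<^bsub>C\<^esub> h = h' \<and> u \<cdot>\<^bsub>C\<^esub> k = k'))"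

definition is_pullback :: "('o, 'a) cat \<Rightarrow> 'a \<Rightarrow> 'a \<Rightarrow> 'a \<Rightarrow> 'a \<Rightarrow> bool" where
  "is_pullback C f g h k \<longleftrightarrow> comm_square C f g h k \<and>
     (\<forall>f' g'. comm_square C f' g' h k \<longrightarrow>
        (\<exists>!u. u \<in> Hom C (Dom C f') (Dom C f) \<and> f \<cdot>\<^bsub>C\<^esub> u = f' \<and> g \<cdot>\<^bsub>C\<^esub> u = g'))"

locale proto_abelian = category C for C :: "('o, 'a) cat" +
  assumes pointed: "\<exists>z. zero_object C z"
    and completes_to_pushout: "mono_arr C f \<Longrightarrow> epi_arr C g \<Longrightarrow> Dom C f = Dom C g \<Longrightarrow>
          \<exists>h k. epi_arr C h \<and> mono_arr C k \<and> is_pushout C f g h k"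
    and completes_to_pullback: "mono_arr C k \<Longrightarrow> epi_arr C h \<Longrightarrow> Cod C k = Cod C h \<Longrightarrow>
          \<exists>f g. mono_arr C f \<and> epi_arr C g \<and> is_pullback C f g h k"
    and pushout_iff_pullback: "comm_square C f g h k \<Longrightarrow>
          mono_arr C f \<Longrightarrow> epi_arr C g \<Longrightarrow> epi_arr C h \<Longrightarrow> mono_arr C k \<Longrightarrow>
          is_pushout C f g h k \<longleftrightarrow> is_pullback C f g h k"

definition bicartesian :: "('o, 'a) cat \<Rightarrow> 'a \<Rightarrow> 'a \<Rightarrow> 'a \<Rightarrow> 'a \<Rightarrow> bool" where
  "bicartesian C f g h k \<longleftrightarrow>
     mono_arr C f \<and> epi_arr C g \<and> epi_arr C h \<and> mono_arr C k \<and>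
     is_pushout C f g h k \<and> is_pullback C f g h k"

text \<open>Extensions \<open>A \<hookrightarrow> B \<twoheadrightarrow> A'\<close> of \<open>A'\<close> by \<open>A\<close>, with respect to the zero object \<open>z\<close>.\<close>

definition extensions :: "('o, 'a) cat \<Rightarrow> 'o \<Rightarrow> 'o \<Rightarrow> 'o \<Rightarrow> ('a \<times> 'a) set" where
  "extensions C z A' A = {(f, g). Dom C f = A \<and> Cod C g = A' \<and>
     bicartesian C f (to_zero C z A) g (from_zero C z A')}"

definition ext_equiv :: "('o, 'a) cat \<Rightarrow> 'o \<Rightarrow> 'o \<Rightarrow> 'o \<Rightarrow> (('a \<times> 'a) \<times> ('a \<times> 'a)) set" where
  "ext_equiv C z A' A = {((f, g), (f', g')).
     (f, g) \<in> extensions C z A' A \<and> (f', g') \<in> extensions C z A' A \<and>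
     (\<exists>u \<in> Hom C (Cod C f) (Cod C f'). iso_arr C u \<and> u \<cdot>\<^bsub>C\<^esub> f = f' \<and> g' \<cdot>\<^bsub>C\<^esub> u = g)}"

definition Ext :: "('o, 'a) cat \<Rightarrow> 'o \<Rightarrow> 'o \<Rightarrow> 'o \<Rightarrow> ('a \<times> 'a) set set" where
  "Ext C z A' A = extensions C z A' A // ext_equiv C z A' A"

definition finitary :: "('o, 'a) cat \<Rightarrow> 'o \<Rightarrow> bool" where
  "finitary C z \<longleftrightarrow>
     (\<forall>A \<in> Obj C. \<forall>A' \<in> Obj C. finite (Hom C A' A) \<and> finite (Ext C z A' A))"


section \<open>The groupoids of flags\<close>

definition tri :: "nat \<Rightarrow> (nat \<times> nat) set" where
  "tri n = {(i, j). i \<le> j \<and> j \<le> n}"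

text \<open>\<open>vertex A (i, j)\<close> is \<open>A\<^sub>i\<^sub>,\<^sub>j\<close>; \<open>hor A (i, j)\<close> is the arrow \<open>A\<^sub>i\<^sub>,\<^sub>j \<hookrightarrow> A\<^sub>i\<^sub>,\<^sub>j\<^sub>+\<^sub>1\<close>
  and \<open>ver A (i, j)\<close> is the arrow \<open>A\<^sub>i\<^sub>,\<^sub>j \<twoheadrightarrow> A\<^sub>i\<^sub>+\<^sub>1\<^sub>,\<^sub>j\<close>. As for functors, these functions are
  \<open>undefined\<close> at indices outside the triangle.\<close>

record ('o, 'a) flag =
  vertex :: "nat \<times> nat \<Rightarrow> 'o"
  hor :: "nat \<times> nat \<Rightarrow> 'a"
  ver :: "nat \<times> nat \<Rightarrow> 'a"

definition flags :: "('o, 'a) cat \<Rightarrow> 'o \<Rightarrow> nat \<Rightarrow> ('o, 'a) flag set" where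
  "flags C z n = {A.
     vertex A \<in> tri n \<rightarrow>\<^sub>E Obj C \<and>
     hor A \<in> extensional {(i, j). i \<le> j \<and> j < n} \<and>
     ver A \<in> extensional {(i, j). i < j \<and> j \<le> n} \<and>
     (\<forall>i \<le> n. vertex A (i, i) = z) \<and>
     (\<forall>i j. i \<le> j \<and> j < n \<longrightarrow>
        hor A (i, j) \<in> Hom C (vertex A (i, j)) (vertex A (i, j + 1)) \<and> mono_arr C (hor A (i, j))) \<and>
     (\<forall>i j. i < j \<and> j \<le> n \<longrightarrow>
        ver A (i, j) \<in> Hom C (vertex A (i, j)) (vertex A (i + 1, j)) \<and> epi_arr C (ver A (i, j))) \<and>
     (\<forall>i j. i < j \<and> j < n \<longrightarrow>
        bicartesian C (hor A (i, j)) (ver A (i, j)) (ver A (i, j + 1)) (hor A (i + 1, j)))}"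

type_synonym ('o, 'a) flag_arr = "('o, 'a) flag \<times> ('o, 'a) flag \<times> (nat \<times> nat \<Rightarrow> 'a)"

definition flag_cat :: "('o, 'a) cat \<Rightarrow> 'o \<Rightarrow> nat \<Rightarrow> (('o, 'a) flag, ('o, 'a) flag_arr) cat" where
  "flag_cat C z n = \<lparr>
     Obj = flags C z n,
     Arr = {(A, B, u). A \<in> flags C z n \<and> B \<in> flags C z n \<and> u \<in> extensional (tri n) \<and>
        (\<forall>p \<in> tri n. u p \<in> Hom C (vertex A p) (vertex B p)) \<and>
        (\<forall>i j. i \<le> j \<and> j < n \<longrightarrow> hor B (i, j) \<cdot>\<^bsub>C\<^esub> u (i, j) = u (i, j + 1) \<cdot>\<^bsub>C\<^esub> hor A (i, j)) \<and>
        (\<forall>i j. i < j \<and> j \<le> n \<longrightarrow> ver B (i, j) \<cdot>\<^bsub>C\<^esub> u (i, j) = u (i + 1, j) \<cdot>\<^bsub>C\<^esub> ver A (i, j))},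
     Dom = (\<lambda>(A, B, u). A),
     Cod = (\<lambda>(A, B, u). B),
     Ident = (\<lambda>A. (A, A, \<lambda>p\<in>tri n. Ident C (vertex A p))),
     Comp = (\<lambda>(_, D, v) (A, _, u). (A, D, \<lambda>p\<in>tri n. v p \<cdot>\<^bsub>C\<^esub> u p))\<rparr>"

definition S :: "('o, 'a) cat \<Rightarrow> 'o \<Rightarrow> nat \<Rightarrow> (('o, 'a) flag, ('o, 'a) flag_arr) cat" where
  "S C z n = core (flag_cat C z n)"

text \<open>An object \<open>X\<close> of \<open>C\<close>, viewed as the object \<open>z \<hookrightarrow> X \<twoheadrightarrow> z\<close> of \<open>S C z 1\<close>, and likewise for
  isomorphisms.\<close>

definition flag1 :: "('o, 'a) cat \<Rightarrow> 'o \<Rightarrow> 'o \<Rightarrow> ('o, 'a) flag" where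
  "flag1 C z X = \<lparr>
     vertex = (\<lambda>p\<in>tri 1. if p = (0, 1) then X else z),
     hor = (\<lambda>p\<in>{(0, 0)}. from_zero C z X),
     ver = (\<lambda>p\<in>{(0, 1)}. to_zero C z X)\<rparr>"

definition flag1_arr :: "('o, 'a) cat \<Rightarrow> 'o \<Rightarrow> 'a \<Rightarrow> ('o, 'a) flag_arr" where
  "flag1_arr C z f = (flag1 C z (Dom C f), flag1 C z (Cod C f),
     \<lambda>p\<in>tri 1. if p = (0, 1) then f else Ident C z)"

definition F_functor :: "('o, 'a) cat \<Rightarrow> 'o \<Rightarrow>
    (('o, 'a) flag, ('o, 'a) flag_arr, ('o, 'a) flag, ('o, 'a) flag_arr) fct" where
  "F_functor C z = \<lparr>
     on_obj = (\<lambda>A\<in>Obj (S C z 2). flag1 C z (vertex A (0, 2))),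
     on_arr = (\<lambda>(A, B, u)\<in>Arr (S C z 2). flag1_arr C z (u (0, 2)))\<rparr>"

definition G_functor :: "('o, 'a) cat \<Rightarrow> 'o \<Rightarrow>
    (('o, 'a) flag, ('o, 'a) flag_arr,
     ('o, 'a) flag \<times> ('o, 'a) flag, ('o, 'a) flag_arr \<times> ('o, 'a) flag_arr) fct" where
  "G_functor C z = \<lparr>
     on_obj = (\<lambda>A\<in>Obj (S C z 2). (flag1 C z (vertex A (0, 1)), flag1 C z (vertex A (1, 2)))),
     on_arr = (\<lambda>(A, B, u)\<in>Arr (S C z 2). (flag1_arr C z (u (0, 1)), flag1_arr C z (u (1, 2))))\<rparr>"

definition sigma0 :: "('o, 'a) cat \<Rightarrow> 'o \<Rightarrow>
    (('o, 'a) flag, ('o, 'a) flag_arr, ('o, 'a) flag, ('o, 'a) flag_arr) fct" where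
  "sigma0 C z = const_fct (S C z 0) (S C z 1) (flag1 C z z)"


section \<open>Finite-dimensional complex vector spaces\<close>

text \<open>The objects of \<open>vect\<close> are all finite-dimensional complex vector spaces whose underlying set
  is a subset of the universe type \<^typ>\<open>'v\<close>. As soon as \<^typ>\<open>complex\<close> embeds into \<^typ>\<open>'v\<close>, every
  finite-dimensional complex vector space is isomorphic to one of these. The fields \<^const>\<open>mult\<close>
  and \<^const>\<open>one\<close> inherited from the ring record are irrelevant.\<close>

type_synonym 'v vspace = "(complex, 'v) module"

type_synonym 'v lin = "'v vspace \<times> 'v vspace \<times> ('v \<Rightarrow> 'v)"

abbreviation CC :: "complex ring" where
  "CC \<equiv> class_ring"

definition vect :: "('v vspace, 'v lin) cat" where
  "vect = \<lparr>
     Obj = {V. vectorspace CC V \<and> vectorspace.fin_dim CC V},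
     Arr = {(V, W, f). vectorspace CC V \<and> vectorspace.fin_dim CC V \<and>
                       vectorspace CC W \<and> vectorspace.fin_dim CC W \<and>
                       f \<in> LinearCombinations.module_hom CC V W \<and> f \<in> extensional (carrier V)},
     Dom = (\<lambda>(V, W, f). V),
     Cod = (\<lambda>(V, W, f). W),
     Ident = (\<lambda>V. (V, V, \<lambda>v\<in>carrier V. v)),
     Comp = (\<lambda>(_, X, g) (V, _, f). (V, X, compose (carrier V) g f))\<rparr>"

definition app :: "'v lin \<Rightarrow> 'v \<Rightarrow> 'v" where
  "app = (\<lambda>(V, W, f). f)"

definition bilinear_map :: "'v vspace \<Rightarrow> 'v vspace \<Rightarrow> 'v vspace \<Rightarrow> ('v \<Rightarrow> 'v \<Rightarrow> 'v) \<Rightarrow> bool" where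
  "bilinear_map V W U \<beta> \<longleftrightarrow>
     (\<forall>v \<in> carrier V. (\<lambda>w. \<beta> v w) \<in> LinearCombinations.module_hom CC W U) \<and>
     (\<forall>w \<in> carrier W. (\<lambda>v. \<beta> v w) \<in> LinearCombinations.module_hom CC V U)"

definition is_tensor_product :: "'v vspace \<Rightarrow> 'v vspace \<Rightarrow> 'v vspace \<Rightarrow> ('v \<Rightarrow> 'v \<Rightarrow> 'v) \<Rightarrow> bool" where
  "is_tensor_product V W P \<tau> \<longleftrightarrow> P \<in> Obj vect \<and> bilinear_map V W P \<tau> \<and>
     (\<forall>U \<in> Obj vect. \<forall>\<beta>. bilinear_map V W U \<beta> \<longrightarrow>
        (\<exists>!m. m \<in> Hom vect P U \<and> (\<forall>v \<in> carrier V. \<forall>w \<in> carrier W. app m (\<tau> v w) = \<beta> v w)))"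

definition tensor :: "'v vspace \<Rightarrow> 'v vspace \<Rightarrow> 'v vspace \<times> ('v \<Rightarrow> 'v \<Rightarrow> 'v)" where
  "tensor V W = (SOME (P, \<tau>). is_tensor_product V W P \<tau>)"

definition tensor_obj :: "'v vspace \<Rightarrow> 'v vspace \<Rightarrow> 'v vspace" where
  "tensor_obj V W = fst (tensor V W)"

definition tensor_vec :: "'v vspace \<Rightarrow> 'v vspace \<Rightarrow> 'v \<Rightarrow> 'v \<Rightarrow> 'v" where
  "tensor_vec V W = snd (tensor V W)"

definition tensor_arr :: "'v lin \<Rightarrow> 'v lin \<Rightarrow> 'v lin" where
  "tensor_arr f g = (THE m.
     m \<in> Hom vect (tensor_obj (Dom vect f) (Dom vect g)) (tensor_obj (Cod vect f) (Cod vect g)) \<and>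
     (\<forall>v \<in> carrier (Dom vect f). \<forall>w \<in> carrier (Dom vect g).
        app m (tensor_vec (Dom vect f) (Dom vect g) v w) =
        tensor_vec (Cod vect f) (Cod vect g) (app f v) (app g w)))"

text \<open>The vector space of complex numbers, transported along an injection \<open>\<iota>\<close> into the universe.\<close>

definition complex_line :: "(complex \<Rightarrow> 'v) \<Rightarrow> 'v vspace" where
  "complex_line \<iota> = \<lparr>
     carrier = range \<iota>,
     mult = (\<lambda>x y. \<iota> (the_inv \<iota> x * the_inv \<iota> y)),
     one = \<iota> 1,
     zero = \<iota> 0,
     add = (\<lambda>x y. \<iota> (the_inv \<iota> x + the_inv \<iota> y)),
     smult = (\<lambda>c x. \<iota> (c * the_inv \<iota> x))\<rparr>"


section \<open>Finitely supported functors on groupoids\<close>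

type_synonym ('o, 'a, 'v) vfct = "('o, 'a, 'v vspace, 'v lin) fct"

type_synonym ('o, 'a, 'v) vntrans = "('o, 'a, 'v vspace, 'v lin) ntrans"

definition finite_support :: "('o, 'a) cat \<Rightarrow> ('o, 'a, 'v) vfct \<Rightarrow> bool" where
  "finite_support A \<Phi> \<longleftrightarrow>
     finite {iso_class A x |x. x \<in> Obj A \<and> carrier (on_obj \<Phi> x) \<noteq> {\<zero>\<^bsub>on_obj \<Phi> x\<^esub>}}"

definition Fun :: "('o, 'a) cat \<Rightarrow> (('o, 'a, 'v) vfct, ('o, 'a, 'v) vntrans) cat" where
  "Fun A = full_subcat (functor_cat A vect) (finite_support A)"

text \<open>The 2-fiber of \<open>H : A \<rightarrow> B\<close> over \<open>b\<close>, and its forgetful functor to \<open>A\<close>.\<close>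

definition two_fiber :: "('o, 'a) cat \<Rightarrow> ('p, 'b) cat \<Rightarrow> ('o, 'a, 'p, 'b) fct \<Rightarrow> 'p \<Rightarrow>
    ('o \<times> 'b, ('o \<times> 'b) \<times> ('o \<times> 'b) \<times> 'a) cat" where
  "two_fiber A B H b =
     (let X = {(a, \<phi>). a \<in> Obj A \<and> \<phi> \<in> Hom B (on_obj H a) b \<and> iso_arr B \<phi>} in \<lparr>
     Obj = X,
     Arr = {((a, \<phi>), (a', \<phi>'), u). (a, \<phi>) \<in> X \<and> (a', \<phi>') \<in> X \<and>
              u \<in> Hom A a a' \<and> \<phi>' \<cdot>\<^bsub>B\<^esub> on_arr H u = \<phi>},
     Dom = (\<lambda>(p, q, u). p),
     Cod = (\<lambda>(p, q, u). q),
     Ident = (\<lambda>(a, \<phi>). ((a, \<phi>), (a, \<phi>), Ident A a)),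
     Comp = (\<lambda>(_, q, v) (p, _, u). (p, q, v \<cdot>\<^bsub>A\<^esub> u))\<rparr>)"

definition fiber_proj :: "('o, 'a) cat \<Rightarrow> ('p, 'b) cat \<Rightarrow> ('o, 'a, 'p, 'b) fct \<Rightarrow> 'p \<Rightarrow>
    ('o \<times> 'b, ('o \<times> 'b) \<times> ('o \<times> 'b) \<times> 'a, 'o, 'a) fct" where
  "fiber_proj A B H b = \<lparr>
     on_obj = (\<lambda>(a, \<phi>)\<in>Obj (two_fiber A B H b). a),
     on_arr = (\<lambda>(p, q, u)\<in>Arr (two_fiber A B H b). u)\<rparr>"

text \<open>\<open>pull\<close> is \<open>H\<^sup>*\<close>, meant for \<open>\<pi>\<^sub>0\<close>-finite \<open>H\<close>, and \<open>push\<close> below is \<open>H\<^sub>!\<close>, meant for locally finite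
  \<open>H\<close>. Outside these cases \<open>pull\<close> need not preserve finite support and the colimits selected in
  \<open>push\<close> need not exist; that the composite used below does take values in \<open>Fun\<close> is part of
  what \<^locale>\<open>monoidal_category\<close> demands of the tensor functor.\<close>

definition pull :: "('o, 'a) cat \<Rightarrow> ('p, 'b) cat \<Rightarrow> ('o, 'a, 'p, 'b) fct \<Rightarrow>
    (('p, 'b, 'v) vfct, ('p, 'b, 'v) vntrans, ('o, 'a, 'v) vfct, ('o, 'a, 'v) vntrans) fct" where
  "pull A B H = \<lparr>
     on_obj = (\<lambda>\<Phi>\<in>Obj (Fun B). fcomp A \<Phi> H),
     on_arr = (\<lambda>(\<Phi>, \<Psi>, \<eta>)\<in>Arr (Fun B).
        (fcomp A \<Phi> H, fcomp A \<Psi> H, \<lambda>a\<in>Obj A. \<eta> (on_obj H a)))\<rparr>"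

definition kan :: "('o, 'a) cat \<Rightarrow> ('p, 'b) cat \<Rightarrow> ('o, 'a, 'p, 'b) fct \<Rightarrow> ('o, 'a, 'v) vfct \<Rightarrow>
    'p \<Rightarrow> 'v vspace \<times> ('o \<times> 'b \<Rightarrow> 'v lin)" where
  "kan A B H \<Phi> b =
     colim (two_fiber A B H b) vect (fcomp (two_fiber A B H b) \<Phi> (fiber_proj A B H b))"

text \<open>The left Kan extension of \<open>\<Phi>\<close> along \<open>H\<close>: an arrow \<open>\<beta> : b \<rightarrow> b'\<close> acts by the map of
  colimits induced by \<open>(a, \<phi>) \<mapsto> (a, \<beta> \<cdot> \<phi>)\<close>.\<close>

definition kan_fct :: "('o, 'a) cat \<Rightarrow> ('p, 'b) cat \<Rightarrow> ('o, 'a, 'p, 'b) fct \<Rightarrow> ('o, 'a, 'v) vfct \<Rightarrow>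
    ('p, 'b, 'v) vfct" where
  "kan_fct A B H \<Phi> = \<lparr>
     on_obj = (\<lambda>b\<in>Obj B. fst (kan A B H \<Phi> b)),
     on_arr = (\<lambda>\<beta>\<in>Arr B. THE m.
        m \<in> Hom vect (fst (kan A B H \<Phi> (Dom B \<beta>))) (fst (kan A B H \<Phi> (Cod B \<beta>))) \<and>
        (\<forall>(a, \<phi>) \<in> Obj (two_fiber A B H (Dom B \<beta>)).
           m \<cdot>\<^bsub>vect\<^esub> snd (kan A B H \<Phi> (Dom B \<beta>)) (a, \<phi>) =
           snd (kan A B H \<Phi> (Cod B \<beta>)) (a, \<beta> \<cdot>\<^bsub>B\<^esub> \<phi>)))\<rparr>"

definition push :: "('o, 'a) cat \<Rightarrow> ('p, 'b) cat \<Rightarrow> ('o, 'a, 'p, 'b) fct \<Rightarrow>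
    (('o, 'a, 'v) vfct, ('o, 'a, 'v) vntrans, ('p, 'b, 'v) vfct, ('p, 'b, 'v) vntrans) fct" where
  "push A B H = \<lparr>
     on_obj = (\<lambda>\<Phi>\<in>Obj (Fun A). kan_fct A B H \<Phi>),
     on_arr = (\<lambda>(\<Phi>, \<Psi>, \<eta>)\<in>Arr (Fun A).
        (kan_fct A B H \<Phi>, kan_fct A B H \<Psi>,
         \<lambda>b\<in>Obj B. THE m.
           m \<in> Hom vect (fst (kan A B H \<Phi> b)) (fst (kan A B H \<Psi> b)) \<and>
           (\<forall>(a, \<phi>) \<in> Obj (two_fiber A B H b).
              m \<cdot>\<^bsub>vect\<^esub> snd (kan A B H \<Phi> b) (a, \<phi>) =
              snd (kan A B H \<Psi> b) (a, \<phi>) \<cdot>\<^bsub>vect\<^esub> \<eta> a)))\<rparr>"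

definition box_fct :: "('o, 'a) cat \<Rightarrow> ('p, 'b) cat \<Rightarrow> ('o, 'a, 'v) vfct \<Rightarrow> ('p, 'b, 'v) vfct \<Rightarrow>
    ('o \<times> 'p, 'a \<times> 'b, 'v) vfct" where
  "box_fct A B \<Phi> \<Psi> = \<lparr>
     on_obj = (\<lambda>(x, y)\<in>Obj A \<times> Obj B. tensor_obj (on_obj \<Phi> x) (on_obj \<Psi> y)),
     on_arr = (\<lambda>(f, g)\<in>Arr A \<times> Arr B. tensor_arr (on_arr \<Phi> f) (on_arr \<Psi> g))\<rparr>"

definition box :: "('o, 'a) cat \<Rightarrow> ('p, 'b) cat \<Rightarrow>
    (('o, 'a, 'v) vfct \<times> ('p, 'b, 'v) vfct, ('o, 'a, 'v) vntrans \<times> ('p, 'b, 'v) vntrans,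
     ('o \<times> 'p, 'a \<times> 'b, 'v) vfct, ('o \<times> 'p, 'a \<times> 'b, 'v) vntrans) fct" where
  "box A B = \<lparr>
     on_obj = (\<lambda>(\<Phi>, \<Psi>)\<in>Obj (Fun A) \<times> Obj (Fun B). box_fct A B \<Phi> \<Psi>),
     on_arr = (\<lambda>((\<Phi>, \<Phi>', \<eta>), (\<Psi>, \<Psi>', \<theta>))\<in>Arr (Fun A) \<times> Arr (Fun B).
        (box_fct A B \<Phi> \<Psi>, box_fct A B \<Phi>' \<Psi>',
         \<lambda>(x, y)\<in>Obj A \<times> Obj B. tensor_arr (\<eta> x) (\<theta> y)))\<rparr>"


section \<open>The Hall monoidal datum\<close>

definition hall_tensor :: "('o, 'a) cat \<Rightarrow> 'o \<Rightarrow>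
    ((('o, 'a) flag, ('o, 'a) flag_arr, 'v) vfct \<times> (('o, 'a) flag, ('o, 'a) flag_arr, 'v) vfct,
     (('o, 'a) flag, ('o, 'a) flag_arr, 'v) vntrans \<times> (('o, 'a) flag, ('o, 'a) flag_arr, 'v) vntrans,
     (('o, 'a) flag, ('o, 'a) flag_arr, 'v) vfct,
     (('o, 'a) flag, ('o, 'a) flag_arr, 'v) vntrans) fct" where
  "hall_tensor C z =
     (let P = prod_cat (Fun (S C z 1)) (Fun (S C z 1)) in
      fcomp P (push (S C z 2) (S C z 1) (F_functor C z))
        (fcomp P (pull (S C z 2) (prod_cat (S C z 1) (S C z 1)) (G_functor C z))
          (box (S C z 1) (S C z 1))))"

definition hall_unit :: "('o, 'a) cat \<Rightarrow> 'o \<Rightarrow> (complex \<Rightarrow> 'v) \<Rightarrow>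
    (('o, 'a) flag, ('o, 'a) flag_arr, 'v) vfct" where
  "hall_unit C z \<iota> =
     on_obj (push (S C z 0) (S C z 1) (sigma0 C z)) (const_fct (S C z 0) vect (complex_line \<iota>))"

end

theory Submission
  imports Defs
begin

text \<open>The value of \<open>F \<otimes> G\<close> at \<open>X\<close> is spanned by symbols \<open>inn F G f g x y\<close>, where \<open>f : A \<rightarrow> X\<close> and
  \<open>g : X \<rightarrow> B\<close> form an exact sequence, \<open>x \<in> F A\<close> and \<open>y \<in> G B\<close>; the symbols are bilinear in \<open>x, y\<close> and
  subject only to transport along isomorphisms of \<open>A\<close> and \<open>B\<close>. Both triple tensor products at \<open>X\<close> are
  spanned by filtrations \<open>A\<^sub>1 \<hookrightarrow> A\<^sub>2 \<hookrightarrow> X\<close>: one bracketing reads such a filtration as a subobject \<open>A\<^sub>1\<close> of the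
  subobject \<open>A\<^sub>2\<close>, the other one as a subobject \<open>A\<^sub>2 / A\<^sub>1\<close> of the quotient \<open>X / A\<^sub>1\<close>. In a proto-abelian category a
  bicartesian square completes either datum to the other one, uniquely up to isomorphism; this is
  the associator. Both sides of the pentagon send the symbol of a filtration with four steps to
  the same symbol. The unit is supported on the zero objects, and in an exact sequence with an
  outer term zero the other map is an isomorphism, which gives the unitors.\<close>

section \<open>Vector spaces given by generators and relations\<close>

text \<open>\<open>tensor\<close> and \<open>colim\<close> are chosen by \<open>SOME\<close>, with
  values that must live inside the type \<open>'v\<close>, of which only an injection of the complex
  numbers is known. Quotients of free spaces need not fit there, so existence is proved by
  coordinates: a finitely generated presentation has a minimal generating list, this gives a space
  of coordinate vectors, and such vectors can be coded in \<open>'v\<close> because pairs of complex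
  numbers can be coded by complex numbers. The colimits may run over infinite index categories;
  finite support together with finite Hom sets supplies finitely many indices that control
  everything. Afterwards only universal properties of the chosen spaces are available, so every map
  is specified on symbols. Well-definedness is then the real work: completions of filtrations, and
  maps depending on a fixed vector, are picked by \<open>SOME\<close>; independence of the pick
  comes from uniqueness up to isomorphism, and linearity in the fixed vector has to be recovered on
  symbols. The unit needs a device of its own: at objects that are not zero objects it vanishes and
  has no symbol.\<close>

definition linmap :: "'v vspace \<Rightarrow> 'w vspace \<Rightarrow> ('v \<Rightarrow> 'w) \<Rightarrow> bool" where
  "linmap V W f \<longleftrightarrow> f \<in> carrier V \<rightarrow> carrier W \<and>
     (\<forall>u \<in> carrier V. \<forall>v \<in> carrier V. f (u \<oplus>\<^bsub>V\<^esub> v) = f u \<oplus>\<^bsub>W\<^esub> f v) \<and>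
     (\<forall>c. \<forall>v \<in> carrier V. f (c \<odot>\<^bsub>V\<^esub> v) = c \<odot>\<^bsub>W\<^esub> f v)"

lemma linmap_iff_module_hom: "linmap V W f \<longleftrightarrow> f \<in> LinearCombinations.module_hom CC V W"
  by (auto simp: linmap_def LinearCombinations.module_hom_def)

lemma vect_Obj_iff: "V \<in> Obj vect \<longleftrightarrow> vectorspace CC V \<and> vectorspace.fin_dim CC V"
  by (simp add: vect_def)

context
  fixes V :: "'v vspace"
  assumes V: "V \<in> Obj vect"
begin

interpretation vectorspace CC V
  using V by (simp add: vect_Obj_iff)

lemma vs_zero [simp, intro]: "\<zero>\<^bsub>V\<^esub> \<in> carrier V"
  by simp

lemma vs_add [simp, intro]: "u \<in> carrier V \<Longrightarrow> v \<in> carrier V \<Longrightarrow> u \<oplus>\<^bsub>V\<^esub> v \<in> carrier V"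
  by simp

lemma vs_smult [simp, intro]: "v \<in> carrier V \<Longrightarrow> c \<odot>\<^bsub>V\<^esub> v \<in> carrier V"
  by simp

lemma vs_add_assoc: "u \<in> carrier V \<Longrightarrow> v \<in> carrier V \<Longrightarrow> w \<in> carrier V \<Longrightarrow>
    u \<oplus>\<^bsub>V\<^esub> v \<oplus>\<^bsub>V\<^esub> w = u \<oplus>\<^bsub>V\<^esub> (v \<oplus>\<^bsub>V\<^esub> w)"
  by (rule M.a_assoc)

lemma vs_add_commute: "u \<in> carrier V \<Longrightarrow> v \<in> carrier V \<Longrightarrow> u \<oplus>\<^bsub>V\<^esub> v = v \<oplus>\<^bsub>V\<^esub> u"
  by (rule M.a_comm)

lemma vs_add_left_commute: "u \<in> carrier V \<Longrightarrow> v \<in> carrier V \<Longrightarrow> w \<in> carrier V \<Longrightarrow>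
    u \<oplus>\<^bsub>V\<^esub> (v \<oplus>\<^bsub>V\<^esub> w) = v \<oplus>\<^bsub>V\<^esub> (u \<oplus>\<^bsub>V\<^esub> w)"
  by (rule M.a_lcomm)

lemma vs_zero_left [simp]: "v \<in> carrier V \<Longrightarrow> \<zero>\<^bsub>V\<^esub> \<oplus>\<^bsub>V\<^esub> v = v"
  by simp

lemma vs_zero_right [simp]: "v \<in> carrier V \<Longrightarrow> v \<oplus>\<^bsub>V\<^esub> \<zero>\<^bsub>V\<^esub> = v"
  by simp

lemma vs_one [simp]: "v \<in> carrier V \<Longrightarrow> 1 \<odot>\<^bsub>V\<^esub> v = v"
  using smult_one by simp

lemma vs_smult_smult: "v \<in> carrier V \<Longrightarrow> a \<odot>\<^bsub>V\<^esub> (b \<odot>\<^bsub>V\<^esub> v) = (a * b) \<odot>\<^bsub>V\<^esub> v"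
  using smult_assoc1[of a b v] by simp

lemma vs_smult_add_left: "v \<in> carrier V \<Longrightarrow> (a + b) \<odot>\<^bsub>V\<^esub> v = a \<odot>\<^bsub>V\<^esub> v \<oplus>\<^bsub>V\<^esub> b \<odot>\<^bsub>V\<^esub> v"
  using smult_l_distr[of a b v] by simp

lemma vs_smult_add_right: "u \<in> carrier V \<Longrightarrow> v \<in> carrier V \<Longrightarrow>
    a \<odot>\<^bsub>V\<^esub> (u \<oplus>\<^bsub>V\<^esub> v) = a \<odot>\<^bsub>V\<^esub> u \<oplus>\<^bsub>V\<^esub> a \<odot>\<^bsub>V\<^esub> v"
  using smult_r_distr[of a u v] by simp

lemma vs_smult_zero_left [simp]: "v \<in> carrier V \<Longrightarrow> 0 \<odot>\<^bsub>V\<^esub> v = \<zero>\<^bsub>V\<^esub>"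
  using lmult_0[of v] by simp

lemma vs_smult_zero_right [simp]: "a \<odot>\<^bsub>V\<^esub> \<zero>\<^bsub>V\<^esub> = \<zero>\<^bsub>V\<^esub>"
  using rmult_0[of a] by simp

text \<open>An equation is turned into a vanishing sum with coefficient -1, the form in which
  relations between generators are stated later.\<close>

lemma vs_eq_iff: "u \<in> carrier V \<Longrightarrow> v \<in> carrier V \<Longrightarrow> u \<oplus>\<^bsub>V\<^esub> (-1) \<odot>\<^bsub>V\<^esub> v = \<zero>\<^bsub>V\<^esub> \<longleftrightarrow> u = v"
proof
  assume uv: "u \<in> carrier V" "v \<in> carrier V" and "u \<oplus>\<^bsub>V\<^esub> (-1) \<odot>\<^bsub>V\<^esub> v = \<zero>\<^bsub>V\<^esub>"
  then have "u \<oplus>\<^bsub>V\<^esub> (-1) \<odot>\<^bsub>V\<^esub> v \<oplus>\<^bsub>V\<^esub> v = v" by simp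
  moreover have "(-1) \<odot>\<^bsub>V\<^esub> v \<oplus>\<^bsub>V\<^esub> v = \<zero>\<^bsub>V\<^esub>"
    using vs_smult_add_left[of v "-1" 1] uv by simp
  ultimately show "u = v" using uv by (simp add: vs_add_assoc)
next
  assume "v \<in> carrier V" "u = v"
  then show "u \<oplus>\<^bsub>V\<^esub> (-1) \<odot>\<^bsub>V\<^esub> v = \<zero>\<^bsub>V\<^esub>"
    using vs_smult_add_left[of v 1 "-1"] by simp
qed

end

text \<open>Combinations are lists of coefficients and indices, repetitions allowed. Such a list
  mentions neither the space nor the family \<open>k\<close>, so one list can serve as a relation in
  all spaces at once.\<close>

fun lc :: "'v vspace \<Rightarrow> ('i \<Rightarrow> 'v) \<Rightarrow> (complex \<times> 'i) list \<Rightarrow> 'v" where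
  "lc V k [] = \<zero>\<^bsub>V\<^esub>"
| "lc V k ((a, i) # r) = a \<odot>\<^bsub>V\<^esub> k i \<oplus>\<^bsub>V\<^esub> lc V k r"

lemma lc_closed: "V \<in> Obj vect \<Longrightarrow> (\<And>i. i \<in> snd ` set r \<Longrightarrow> k i \<in> carrier V) \<Longrightarrow> lc V k r \<in> carrier V"
  by (induction r) auto

lemma lc_append: "V \<in> Obj vect \<Longrightarrow> (\<And>i. i \<in> snd ` set (r @ s) \<Longrightarrow> k i \<in> carrier V) \<Longrightarrow>
    lc V k (r @ s) = lc V k r \<oplus>\<^bsub>V\<^esub> lc V k s"
proof (induction r)
  case Nil
  then show ?case by (auto simp: lc_closed)
next
  case (Cons p r)
  have "lc V k r \<in> carrier V" "lc V k s \<in> carrier V" using Cons by (auto intro!: lc_closed)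
  with Cons show ?case by (cases p) (auto simp: vs_add_assoc)
qed

lemma lc_scale: "V \<in> Obj vect \<Longrightarrow> (\<And>i. i \<in> snd ` set r \<Longrightarrow> k i \<in> carrier V) \<Longrightarrow>
    lc V k (map (\<lambda>(a, i). (c * a, i)) r) = c \<odot>\<^bsub>V\<^esub> lc V k r"
proof (induction r)
  case (Cons p r)
  have "lc V k r \<in> carrier V" using Cons by (auto intro!: lc_closed)
  with Cons show ?case by (cases p) (auto simp: vs_smult_smult vs_smult_add_right)
qed auto

lemma lc_cong: "(\<And>i. i \<in> snd ` set r \<Longrightarrow> k i = k' i) \<Longrightarrow> lc V k r = lc V k' r"
  by (induction r) auto

section \<open>Linear maps and their effect on linear combinations\<close>

lemma linmap_closed: "linmap V W f \<Longrightarrow> v \<in> carrier V \<Longrightarrow> f v \<in> carrier W"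
  and linmap_add: "linmap V W f \<Longrightarrow> u \<in> carrier V \<Longrightarrow> v \<in> carrier V \<Longrightarrow> f (u \<oplus>\<^bsub>V\<^esub> v) = f u \<oplus>\<^bsub>W\<^esub> f v"
  and linmap_smult: "linmap V W f \<Longrightarrow> v \<in> carrier V \<Longrightarrow> f (c \<odot>\<^bsub>V\<^esub> v) = c \<odot>\<^bsub>W\<^esub> f v"
  by (auto simp: linmap_def)

lemma linmapI:
  assumes "\<And>v. v \<in> carrier V \<Longrightarrow> f v \<in> carrier W"
    and "\<And>u v. u \<in> carrier V \<Longrightarrow> v \<in> carrier V \<Longrightarrow> f (u \<oplus>\<^bsub>V\<^esub> v) = f u \<oplus>\<^bsub>W\<^esub> f v"
    and "\<And>c v. v \<in> carrier V \<Longrightarrow> f (c \<odot>\<^bsub>V\<^esub> v) = c \<odot>\<^bsub>W\<^esub> f v"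
  shows "linmap V W f"
  using assms by (auto simp: linmap_def)

lemma linmap_zero:
  assumes "V \<in> Obj vect" "W \<in> Obj vect" "linmap V W f"
  shows "f \<zero>\<^bsub>V\<^esub> = \<zero>\<^bsub>W\<^esub>"
  using linmap_smult[OF assms(3), of "\<zero>\<^bsub>V\<^esub>" 0] linmap_closed[OF assms(3), of "\<zero>\<^bsub>V\<^esub>"] assms by simp

lemma linmap_cong: "V \<in> Obj vect \<Longrightarrow> (\<And>v. v \<in> carrier V \<Longrightarrow> f v = g v) \<Longrightarrow> linmap V W f \<longleftrightarrow> linmap V W g"
  unfolding linmap_def by (auto 0 0 simp: Pi_def)

lemma linmap_id: "linmap V V (\<lambda>v. v)"
  by (auto simp: linmap_def)

lemma linmap_comp: "linmap V W f \<Longrightarrow> linmap W X g \<Longrightarrow> linmap V X (\<lambda>v. g (f v))"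
  by (auto simp: linmap_def Pi_def)

lemma linmap_sum:
  assumes "W \<in> Obj vect" "linmap V W f" "linmap V W g"
  shows "linmap V W (\<lambda>v. f v \<oplus>\<^bsub>W\<^esub> g v)"
  using assms by (intro linmapI) (auto simp: linmap_closed linmap_add linmap_smult
    vs_add_assoc vs_add_left_commute vs_smult_add_right)

lemma linmap_scale:
  assumes "W \<in> Obj vect" "linmap V W f"
  shows "linmap V W (\<lambda>v. c \<odot>\<^bsub>W\<^esub> f v)"
  using assms by (intro linmapI) (auto simp: linmap_closed linmap_add linmap_smult
    vs_smult_smult vs_smult_add_right mult.commute)

lemma linmap_zero_map: "W \<in> Obj vect \<Longrightarrow> linmap V W (\<lambda>v. \<zero>\<^bsub>W\<^esub>)"
  by (intro linmapI) auto

lemma linmap_lc: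
  assumes "V \<in> Obj vect" "W \<in> Obj vect" "linmap V W f"
  shows "(\<And>i. i \<in> snd ` set r \<Longrightarrow> k i \<in> carrier V) \<Longrightarrow> f (lc V k r) = lc W (\<lambda>i. f (k i)) r"
proof (induction r)
  case Nil
  then show ?case using linmap_zero[OF assms] by simp
next
  case (Cons p r)
  obtain a i where p: "p = (a, i)" by (cases p)
  have "lc V k r \<in> carrier V" using Cons assms by (intro lc_closed) auto
  with Cons assms show ?case by (auto simp: p linmap_add linmap_smult)
qed

text \<open>Negation is multiplication by -1, so no additive inverse has to be supplied, and
  \<open>B\<close> is only asked to span.\<close>

lemma vect_ObjI:
  fixes V :: "'v vspace"
  assumes z: "\<zero>\<^bsub>V\<^esub> \<in> carrier V"
    and a: "\<And>u v. u \<in> carrier V \<Longrightarrow> v \<in> carrier V \<Longrightarrow> u \<oplus>\<^bsub>V\<^esub> v \<in> carrier V"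
    and s: "\<And>c v. v \<in> carrier V \<Longrightarrow> c \<odot>\<^bsub>V\<^esub> v \<in> carrier V"
    and aa: "\<And>u v w. u \<in> carrier V \<Longrightarrow> v \<in> carrier V \<Longrightarrow> w \<in> carrier V \<Longrightarrow> u \<oplus>\<^bsub>V\<^esub> v \<oplus>\<^bsub>V\<^esub> w = u \<oplus>\<^bsub>V\<^esub> (v \<oplus>\<^bsub>V\<^esub> w)"
    and ac: "\<And>u v. u \<in> carrier V \<Longrightarrow> v \<in> carrier V \<Longrightarrow> u \<oplus>\<^bsub>V\<^esub> v = v \<oplus>\<^bsub>V\<^esub> u"
    and z0: "\<And>v. v \<in> carrier V \<Longrightarrow> \<zero>\<^bsub>V\<^esub> \<oplus>\<^bsub>V\<^esub> v = v"
    and s0: "\<And>v. v \<in> carrier V \<Longrightarrow> 0 \<odot>\<^bsub>V\<^esub> v = \<zero>\<^bsub>V\<^esub>"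
    and s1: "\<And>v. v \<in> carrier V \<Longrightarrow> 1 \<odot>\<^bsub>V\<^esub> v = v"
    and ss: "\<And>a b v. v \<in> carrier V \<Longrightarrow> (a * b) \<odot>\<^bsub>V\<^esub> v = a \<odot>\<^bsub>V\<^esub> (b \<odot>\<^bsub>V\<^esub> v)"
    and sl: "\<And>a b v. v \<in> carrier V \<Longrightarrow> (a + b) \<odot>\<^bsub>V\<^esub> v = a \<odot>\<^bsub>V\<^esub> v \<oplus>\<^bsub>V\<^esub> b \<odot>\<^bsub>V\<^esub> v"
    and sr: "\<And>a u v. u \<in> carrier V \<Longrightarrow> v \<in> carrier V \<Longrightarrow> a \<odot>\<^bsub>V\<^esub> (u \<oplus>\<^bsub>V\<^esub> v) = a \<odot>\<^bsub>V\<^esub> u \<oplus>\<^bsub>V\<^esub> a \<odot>\<^bsub>V\<^esub> v"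
    and B: "finite B" "B \<subseteq> carrier V" "\<And>v. v \<in> carrier V \<Longrightarrow> \<exists>r. snd ` set r \<subseteq> B \<and> v = lc V (\<lambda>i. i) r"
  shows "V \<in> Obj vect"
proof -
  have "abelian_group V"
  proof (rule abelian_groupI)
    fix x assume x: "x \<in> carrier V"
    have "(-1) \<odot>\<^bsub>V\<^esub> x \<oplus>\<^bsub>V\<^esub> x = \<zero>\<^bsub>V\<^esub>" using sl[OF x, of "-1" 1] s0[OF x] s1[OF x] by simp
    then show "\<exists>y\<in>carrier V. y \<oplus>\<^bsub>V\<^esub> x = \<zero>\<^bsub>V\<^esub>" using s[OF x] by blast
  qed (use z a aa ac z0 in auto)
  then have "vectorspace CC V"
    using class_cring.is_cring s s1 ss sl sr
    by (auto simp: vectorspace_def Module.module_def module_axioms_def class_field)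
  moreover then interpret vectorspace CC V .
  have "fin_dim" unfolding fin_dim_def
  proof (intro exI conjI)
    have sp: "lc V (\<lambda>i. i) r \<in> span B" if "snd ` set r \<subseteq> B" for r
      using that
    proof (induction r)
      case Nil
      have "lincomb (\<lambda>_. 0) {} \<in> span B" unfolding span_def by blast
      then show ?case by (simp add: lincomb_def)
    next
      case (Cons p r)
      obtain a i where p: "p = (a, i)" by (cases p)
      have "i \<in> span B" using Cons p in_own_span[OF B(2)] by auto
      then show ?case using Cons p span_is_submodule[OF B(2)]
        by (auto simp: span_add1 submodule.smult_closed B(2))
    qed
    then have "carrier V \<subseteq> span B" using B(3) by (metis subsetI)
    then show "span B = carrier V" using span_is_subset2[OF B(2)] by auto
  qed (use B in auto)
  ultimately show ?thesis by (simp add: vect_Obj_iff)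
qed

text \<open>Converts the \<open>lincomb\<close> of the library, a sum over a finite set, into list
  form.\<close>

lemma vect_finite_span:
  assumes "V \<in> Obj vect"
  obtains B where "finite B" "B \<subseteq> carrier V"
    "\<And>v. v \<in> carrier V \<Longrightarrow> \<exists>r. snd ` set r \<subseteq> B \<and> v = lc V (\<lambda>i. i) r"
proof -
  interpret vectorspace CC V using assms by (simp add: vect_Obj_iff)
  obtain B where B: "finite B" "B \<subseteq> carrier V" "span B = carrier V"
    using assms by (auto simp: vect_Obj_iff fin_dim_def)
  have "\<exists>r. snd ` set r \<subseteq> A \<and> lincomb a A = lc V (\<lambda>i. i) r" if "A \<subseteq> B" for a A
    using finite_subset[OF that B(1)] that
  proof (induction A)
    case empty
    then show ?case by (intro exI[of _ "[]"]) (auto simp: lincomb_def)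
  next
    case (insert x A)
    then obtain r where r: "snd ` set r \<subseteq> A" "lincomb a A = lc V (\<lambda>i. i) r" by auto
    have "lincomb a (insert x A) = a x \<odot>\<^bsub>V\<^esub> x \<oplus>\<^bsub>V\<^esub> lincomb a A"
      using insert B(2) unfolding lincomb_def by (subst finsum_insert) auto
    then show ?case using r by (intro exI[of _ "(a x, x) # r"]) auto
  qed
  then have "\<exists>r. snd ` set r \<subseteq> B \<and> v = lc V (\<lambda>i. i) r" if "v \<in> carrier V" for v
    using that unfolding B(3)[symmetric] span_def by (auto 0 0) (metis (no_types) order_trans)
  with B that show thesis by blast
qed

section \<open>Coordinate spaces and their embedding into the universe type\<close>

definition coord_space :: "'i list \<Rightarrow> ('i \<Rightarrow> complex) vspace" where
  "coord_space js = \<lparr>carrier = {c. \<forall>j. j \<notin> set js \<longrightarrow> c j = 0}, mult = undefined, one = undefined,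
     zero = (\<lambda>_. 0), add = (\<lambda>c d j. c j + d j), smult = (\<lambda>a c j. a * c j)\<rparr>"

lemma coord_space_simps [simp]:
  "c \<in> carrier (coord_space js) \<longleftrightarrow> (\<forall>j. j \<notin> set js \<longrightarrow> c j = 0)"
  "\<zero>\<^bsub>coord_space js\<^esub> = (\<lambda>_. 0)"
  "c \<oplus>\<^bsub>coord_space js\<^esub> d = (\<lambda>j. c j + d j)"
  "a \<odot>\<^bsub>coord_space js\<^esub> c = (\<lambda>j. a * c j)"
  by (auto simp: coord_space_def)

definition unit_coord :: "'i \<Rightarrow> 'i \<Rightarrow> complex" where
  "unit_coord i = (\<lambda>j. if j = i then 1 else 0)"

text \<open>\<open>js'\<close> is kept apart from \<open>js\<close>: the operations do not depend on
  the index list, and the induction shortens \<open>js\<close> while the ambient space stays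
  fixed.\<close>

lemma coord_space_expand:
  assumes "distinct js" and "\<forall>j. j \<notin> set js \<longrightarrow> c j = 0"
  shows "c = lc (coord_space js') unit_coord (map (\<lambda>j. (c j, j)) js)"
proof
  fix i
  have "lc (coord_space js') unit_coord (map (\<lambda>j. (c j, j)) js) i = (if i \<in> set js then c i else 0)"
    using assms(1) by (induction js) (auto simp: unit_coord_def)
  then show "c i = lc (coord_space js') unit_coord (map (\<lambda>j. (c j, j)) js) i"
    using assms(2) by auto
qed

lemma coord_space_vect: "distinct js \<Longrightarrow> coord_space js \<in> Obj vect"
proof (rule vect_ObjI[where B = "unit_coord ` set js"])
  fix v assume v: "v \<in> carrier (coord_space js)" and d: "distinct js"
  let ?r = "map (\<lambda>j. (v j, j)) js"
  have "lc (coord_space js) (\<lambda>i. i) (map (map_prod id unit_coord) r) = lc (coord_space js) unit_coord r" for r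
    by (induction r) auto
  then have "v = lc (coord_space js) (\<lambda>i. i) (map (map_prod id unit_coord) ?r)"
    using coord_space_expand[OF d, of v js] v by (metis coord_space_simps(1))
  then show "\<exists>r. snd ` set r \<subseteq> unit_coord ` set js \<and> v = lc (coord_space js) (\<lambda>i. i) r"
    by (intro exI[of _ "map (map_prod id unit_coord) ?r"]) auto
qed (auto simp: unit_coord_def algebra_simps)

lemma inj_complex_pair: "\<exists>p :: complex \<times> complex \<Rightarrow> complex. inj p"
proof -
  have "infinite (UNIV :: complex set)" by (rule infinite_UNIV_char_0)
  then have "(card_of ((UNIV :: complex set) \<times> (UNIV :: complex set)), card_of (UNIV :: complex set)) \<in> ordIso"
    by (rule card_of_Times_same_infinite)
  then show ?thesis unfolding card_of_ordIso[symmetric] bij_betw_def by auto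
qed

text \<open>The coordinates are folded over \<open>js\<close> with an injective pairing of complex
  numbers; since \<open>js\<close> is fixed, the fold can be undone step by step, and \<iota>
  carries the resulting number into \<open>'v\<close>.\<close>

lemma coord_space_inj:
  assumes "inj (\<iota> :: complex \<Rightarrow> 'v)"
  shows "\<exists>e :: ('i \<Rightarrow> complex) \<Rightarrow> 'v. inj_on e (carrier (coord_space js))"
proof -
  obtain p :: "complex \<times> complex \<Rightarrow> complex" where p: "inj p" using inj_complex_pair by blast
  define enc where "enc c = foldr (\<lambda>j a. p (c j, a)) js 0" for c :: "'i \<Rightarrow> complex"
  have *: "foldr (\<lambda>j a. p (c j, a)) js 0 = foldr (\<lambda>j a. p (d j, a)) js 0 \<Longrightarrow> \<forall>j\<in>set js. c j = d j" for c d
    by (induction js) (auto dest: injD[OF p])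
  have "inj_on enc (carrier (coord_space js))"
  proof (rule inj_onI)
    fix c d assume cd: "c \<in> carrier (coord_space js)" "d \<in> carrier (coord_space js)" "enc c = enc d"
    then have "\<forall>j\<in>set js. c j = d j" by (intro *) (simp add: enc_def)
    with cd show "c = d" by (intro ext) (metis coord_space_simps(1))
  qed
  then have "inj_on (\<lambda>c. \<iota> (enc c)) (carrier (coord_space js))"
    using assms by (auto simp: inj_on_def inj_def)
  then show ?thesis by blast
qed

text \<open>Transport of structure along \<open>e\<close>. It moves a coordinate space, whose
  vectors are functions, into the type \<open>'v\<close>.\<close>

lemma vect_transport:
  fixes V :: "'b vspace" and e :: "'b \<Rightarrow> 'v"
  assumes V: "V \<in> Obj vect" and e: "inj_on e (carrier V)"
  shows "\<exists>W \<in> Obj vect. linmap V W e \<and> bij_betw e (carrier V) (carrier W)"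
proof -
  define h where "h = inv_into (carrier V) e"
  have he[simp]: "h (e v) = v" if "v \<in> carrier V" for v using e that by (simp add: h_def)
  define W :: "'v vspace" where "W = \<lparr>carrier = e ` carrier V, mult = undefined, one = undefined,
     zero = e \<zero>\<^bsub>V\<^esub>, add = (\<lambda>x y. e (h x \<oplus>\<^bsub>V\<^esub> h y)), smult = (\<lambda>a x. e (a \<odot>\<^bsub>V\<^esub> h x))\<rparr>"
  have W: "carrier W = e ` carrier V" "\<zero>\<^bsub>W\<^esub> = e \<zero>\<^bsub>V\<^esub>" "x \<oplus>\<^bsub>W\<^esub> y = e (h x \<oplus>\<^bsub>V\<^esub> h y)"
    "a \<odot>\<^bsub>W\<^esub> x = e (a \<odot>\<^bsub>V\<^esub> h x)" for x y a by (auto simp: W_def)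
  obtain B where B: "finite B" "B \<subseteq> carrier V"
    "\<And>v. v \<in> carrier V \<Longrightarrow> \<exists>r. snd ` set r \<subseteq> B \<and> v = lc V (\<lambda>i. i) r"
    using vect_finite_span[OF V] by blast
  have lcW: "e (lc V (\<lambda>i. i) r) = lc W (\<lambda>i. i) (map (map_prod id e) r)" if "snd ` set r \<subseteq> carrier V" for r
    using that
  proof (induction r)
    case (Cons q r)
    moreover have "lc V (\<lambda>i. i) r \<in> carrier V" using Cons by (intro lc_closed V) auto
    moreover from this have "h (lc W (\<lambda>i. i) (map (map_prod id e) r)) = lc V (\<lambda>i. i) r"
      using Cons by (metis (no_types, lifting) he image_subset_iff list.set_intros(2))
    ultimately show ?case using V by (cases q) (auto simp: W id_def)
  qed (simp add: W)
  have "W \<in> Obj vect"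
  proof (rule vect_ObjI[where B = "e ` B"])
    fix w assume "w \<in> carrier W"
    then obtain v where v: "v \<in> carrier V" "w = e v" by (auto simp: W)
    then obtain r where r: "snd ` set r \<subseteq> B" "v = lc V (\<lambda>i. i) r" using B by blast
    then have "snd ` set r \<subseteq> carrier V" using B by auto
    then have "w = lc W (\<lambda>i. i) (map (map_prod id e) r)" using v r lcW by simp
    moreover have "snd ` set (map (map_prod id e) r) \<subseteq> e ` B" using r by force
    ultimately show "\<exists>r. snd ` set r \<subseteq> e ` B \<and> w = lc W (\<lambda>i. i) r" by blast
  qed (use V B in \<open>auto simp: W vs_smult_smult vs_smult_add_left vs_smult_add_right vs_add_assoc
      intro!: arg_cong[where f = e] intro: vs_add_commute\<close>)
  moreover have "linmap V W e" by (rule linmapI) (use V in \<open>auto simp: W\<close>)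
  ultimately show ?thesis using e by (auto simp: bij_betw_def W(1))
qed

text \<open>Such a family amounts to a linear map to \<open>U\<close> out of the space with
  generators \<open>I\<close> and relations \<open>R\<close>. Speaking only of families avoids
  forming that quotient of a free space.\<close>

definition rel_family :: "'i set \<Rightarrow> (complex \<times> 'i) list set \<Rightarrow> 'v vspace \<Rightarrow> ('i \<Rightarrow> 'v) \<Rightarrow> bool" where
  "rel_family I R U k \<longleftrightarrow> U \<in> Obj vect \<and> (\<forall>i\<in>I. k i \<in> carrier U) \<and> (\<forall>r\<in>R. lc U k r = \<zero>\<^bsub>U\<^esub>)"

lemma lc_coeffs:
  assumes U: "U \<in> Obj vect" and "distinct js" "\<And>j. j \<in> set js \<Longrightarrow> k j \<in> carrier U"
  shows "lc U k (map (\<lambda>j. (c j + a * d j, j)) js) =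
         lc U k (map (\<lambda>j. (c j, j)) js) \<oplus>\<^bsub>U\<^esub> a \<odot>\<^bsub>U\<^esub> lc U k (map (\<lambda>j. (d j, j)) js)"
  using assms(2,3)
proof (induction js)
  case (Cons j js)
  have "lc U k (map (\<lambda>j. (c j, j)) js) \<in> carrier U" "lc U k (map (\<lambda>j. (d j, j)) js) \<in> carrier U"
    using Cons by (auto intro!: lc_closed U)
  with Cons U show ?case
    by (simp add: vs_smult_add_right vs_smult_add_left vs_smult_smult vs_add_assoc vs_add_left_commute)
qed (use U in simp)

lemma lc_coeffs_scale:
  assumes U: "U \<in> Obj vect" and "\<And>j. j \<in> set js \<Longrightarrow> k j \<in> carrier U"
  shows "lc U k (map (\<lambda>j. (a * d j, j)) js) = a \<odot>\<^bsub>U\<^esub> lc U k (map (\<lambda>j. (d j, j)) js)"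
  using assms(2)
proof (induction js)
  case (Cons j js)
  have "lc U k (map (\<lambda>j. (d j, j)) js) \<in> carrier U" using Cons by (auto intro!: lc_closed U)
  with Cons U show ?case by (simp add: vs_smult_add_right vs_smult_smult)
qed (use U in simp)

lemma lc_remove1:
  assumes U: "U \<in> Obj vect" and "j0 \<in> set js" "distinct js" "\<And>j. j \<in> set js \<Longrightarrow> k j \<in> carrier U"
  shows "lc U k (map (\<lambda>j. (c j, j)) js) =
         c j0 \<odot>\<^bsub>U\<^esub> k j0 \<oplus>\<^bsub>U\<^esub> lc U k (map (\<lambda>j. (c j, j)) (remove1 j0 js))"
  using assms(2-)
proof (induction js)
  case (Cons j js)
  have "lc U k (map (\<lambda>j. (c j, j)) (remove1 j0 js)) \<in> carrier U"
    using Cons(4) set_remove1_subset[of j0 js] by (intro lc_closed U) auto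
  with Cons U show ?case by (auto simp: vs_add_left_commute)
qed simp

text \<open>Repeated indices are added up, after which a combination is a coefficient function on
  the duplicate-free list \<open>js\<close>.\<close>

lemma lc_collect:
  fixes k :: "'i \<Rightarrow> 'v"
  assumes U: "U \<in> Obj vect" and "distinct js" "snd ` set r \<subseteq> set js" "\<And>j. j \<in> set js \<Longrightarrow> k j \<in> carrier U"
  shows "lc U k r = lc U k (map (\<lambda>j. (sum_list (map fst (filter (\<lambda>p. snd p = j) r)), j)) js)"
  using assms(3)
proof (induction r)
  case Nil
  have "lc U k (map (\<lambda>j. (0, j)) js) = \<zero>\<^bsub>U\<^esub>"
    using lc_coeffs_scale[where a = 0 and d = "\<lambda>_. 0" and k = k and js = js, OF U assms(4)] lc_closed[OF U, of "map (\<lambda>j. (0, j)) js" k] assms(4) U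
    by (force simp: image_def)
  then show ?case by simp
next
  case (Cons p r)
  obtain a i where p: "p = (a, i)" by (cases p)
  have i: "i \<in> set js" using Cons p by auto
  define s where "s r j = sum_list (map fst (filter (\<lambda>p. snd p = j) r))" for r :: "(complex \<times> 'i) list" and j
  have "lc U k (map (\<lambda>j. (s (p # r) j, j)) js) = lc U k (map (\<lambda>j. (s r j + a * unit_coord i j, j)) js)"
    by (intro arg_cong[where f = "lc U k"] map_cong) (auto simp: s_def p unit_coord_def)
  also have "\<dots> = lc U k r \<oplus>\<^bsub>U\<^esub> a \<odot>\<^bsub>U\<^esub> lc U k (map (\<lambda>j. (unit_coord i j, j)) js)"
    using lc_coeffs[OF U assms(2,4), where c = "s r" and a = a and d = "unit_coord i"] Cons by (simp add: s_def)
  also have "lc U k (map (\<lambda>j. (unit_coord i j, j)) js) = k i"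
    using i assms(2,4)
  proof (induction js)
    case (Cons j js)
    have "lc U k (map (\<lambda>j. (unit_coord i j, j)) js) = \<zero>\<^bsub>U\<^esub>" if "i \<notin> set js"
    proof -
      have "lc U k (map (\<lambda>j. (unit_coord i j, j)) js) = lc U k (map (\<lambda>j. (0 * unit_coord i j, j)) js)"
        using that by (intro arg_cong[where f = "lc U k"] map_cong) (auto simp: unit_coord_def)
      also have "\<dots> = 0 \<odot>\<^bsub>U\<^esub> lc U k (map (\<lambda>j. (unit_coord i j, j)) js)"
        using Cons by (intro lc_coeffs_scale U) auto
      also have "\<dots> = \<zero>\<^bsub>U\<^esub>" using Cons by (intro vs_smult_zero_left lc_closed U) auto
      finally show ?thesis .
    qed
    with Cons U show ?case by (auto simp: unit_coord_def)
  qed simp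
  finally have e: "lc U k (map (\<lambda>j. (s (p # r) j, j)) js) = lc U k r \<oplus>\<^bsub>U\<^esub> a \<odot>\<^bsub>U\<^esub> k i" .
  have "lc U k r \<in> carrier U" using Cons assms(4) by (intro lc_closed U) auto
  then have "a \<odot>\<^bsub>U\<^esub> k i \<oplus>\<^bsub>U\<^esub> lc U k r = lc U k r \<oplus>\<^bsub>U\<^esub> a \<odot>\<^bsub>U\<^esub> k i"
    using i assms(4) U by (intro vs_add_commute) auto
  then show ?case using e by (simp add: p s_def)
qed

text \<open>A minimal finite generating subset \<open>js\<close> of the index set is automatically independent, so
  that the coordinates with respect to it are unique and define the universal family.\<close>

theorem universal_family:
  fixes I :: "'i set"
  assumes \<iota>: "inj (\<iota> :: complex \<Rightarrow> 'v)"
    and R: "\<And>r. r \<in> R \<Longrightarrow> snd ` set r \<subseteq> I"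
    and J0: "finite J0" "J0 \<subseteq> I"
      "\<And>i. i \<in> I \<Longrightarrow> \<exists>r. snd ` set r \<subseteq> J0 \<and> (\<forall>(U :: 'v vspace) k. rel_family I R U k \<longrightarrow> k i = lc U k r)"
  obtains U :: "'v vspace" and k where "rel_family I R U k"
    "\<And>(W :: 'v vspace) h. rel_family I R W h \<Longrightarrow> \<exists>m. linmap U W m \<and> (\<forall>i\<in>I. m (k i) = h i)"
    "\<And>(W :: 'v vspace) m m'. W \<in> Obj vect \<Longrightarrow> linmap U W m \<Longrightarrow> linmap U W m' \<Longrightarrow> \<forall>i\<in>I. m (k i) = m' (k i) \<Longrightarrow>
       \<forall>u\<in>carrier U. m u = m' u"
proof -
  \<comment> \<open>The coefficients \<open>c\<close> are chosen before \<open>U\<close> and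
    \<open>k\<close>: the same \<open>c\<close> must express \<open>k i\<close> in every
    family.\<close>
  define gen where "gen js \<longleftrightarrow> distinct js \<and> set js \<subseteq> I \<and>
    (\<forall>i\<in>I. \<exists>c. \<forall>(U :: 'v vspace) k. rel_family I R U k \<longrightarrow> k i = lc U k (map (\<lambda>j. (c j, j)) js))" for js
  have fm: "U \<in> Obj vect" "i \<in> I \<Longrightarrow> k i \<in> carrier U" "r \<in> R \<Longrightarrow> lc U k r = \<zero>\<^bsub>U\<^esub>"
    if "rel_family I R U k" for U :: "'v vspace" and k i r using that by (auto simp: rel_family_def)
  obtain js0 where js0: "set js0 = J0" "distinct js0" using finite_distinct_list[OF J0(1)] by blast
  have "gen js0" unfolding gen_def
  proof (intro conjI ballI)
    fix i assume "i \<in> I"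
    then obtain r where r: "snd ` set r \<subseteq> set js0"
      "\<And>(U :: 'v vspace) k. rel_family I R U k \<Longrightarrow> k i = lc U k r" using J0(3) js0(1) by metis
    have "k i = lc U k (map (\<lambda>j. (sum_list (map fst (filter (\<lambda>p. snd p = j) r)), j)) js0)"
      if "rel_family I R U k" for U :: "'v vspace" and k
      using r(2)[OF that] lc_collect[OF fm(1)[OF that] js0(2) r(1), of k] fm(2)[OF that] J0(2) js0(1) by auto
    then show "\<exists>c. \<forall>(U :: 'v vspace) k. rel_family I R U k \<longrightarrow> k i = lc U k (map (\<lambda>j. (c j, j)) js0)"
      by (intro exI[of _ "\<lambda>j. sum_list (map fst (filter (\<lambda>p. snd p = j) r))"]) blast
  qed (use js0 J0 in auto)
  \<comment> \<open>A generating list of least length.\<close>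
  then obtain js where js: "gen js" and min: "\<And>js'. gen js' \<Longrightarrow> length js \<le> length js'"
    using ex_has_least_nat[of gen js0 length] by blast
  have d: "distinct js" and jI: "set js \<subseteq> I" using js by (auto simp: gen_def)
  have kjs: "j \<in> set js \<Longrightarrow> k j \<in> carrier U" if "rel_family I R U k" for U :: "'v vspace" and k j
    using fm(2)[OF that] jI by auto
  have indep: "d j0 = 0" if j0: "j0 \<in> set js"
    and rel: "\<And>(U :: 'v vspace) k. rel_family I R U k \<Longrightarrow> lc U k (map (\<lambda>j. (d j, j)) js) = \<zero>\<^bsub>U\<^esub>" for j0 d
  proof (rule ccontr)
    assume d0: "d j0 \<noteq> 0"
    have "gen (remove1 j0 js)" unfolding gen_def
    proof (intro conjI ballI)
      fix i assume "i \<in> I"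
      then obtain c where c: "\<And>(U :: 'v vspace) k. rel_family I R U k \<Longrightarrow> k i = lc U k (map (\<lambda>j. (c j, j)) js)"
        using js gen_def by metis
      \<comment> \<open>Adding this multiple of the vanishing combination \<open>d\<close> kills the
        coefficient at \<open>j0\<close> and changes no value.\<close>
      define c' where "c' j = c j + (- (c j0 / d j0)) * d j" for j
      have "k i = lc U k (map (\<lambda>j. (c' j, j)) (remove1 j0 js))" if f: "rel_family I R U k" for U :: "'v vspace" and k
      proof -
        have U: "U \<in> Obj vect" using fm f by blast
        have l: "lc U k (map (\<lambda>j. (c' j, j)) (remove1 j0 js)) \<in> carrier U"
          using kjs[OF f] set_remove1_subset[of j0 js] by (intro lc_closed U) auto
        have "lc U k (map (\<lambda>j. (c' j, j)) js) = k i"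
          unfolding c'_def using kjs[OF f] c[OF f] rel[OF f] U fm(2)[OF f \<open>i \<in> I\<close>]
          by (subst lc_coeffs[OF U d]) auto
        moreover have "lc U k (map (\<lambda>j. (c' j, j)) js) = c' j0 \<odot>\<^bsub>U\<^esub> k j0 \<oplus>\<^bsub>U\<^esub> lc U k (map (\<lambda>j. (c' j, j)) (remove1 j0 js))"
          using kjs[OF f] by (intro lc_remove1 U j0 d) auto
        moreover have "c' j0 = 0" using d0 by (simp add: c'_def)
        ultimately show ?thesis using l U kjs[OF f j0] by simp
      qed
      then show "\<exists>c. \<forall>(U :: 'v vspace) k. rel_family I R U k \<longrightarrow> k i = lc U k (map (\<lambda>j. (c j, j)) (remove1 j0 js))" by blast
    qed (use d jI set_remove1_subset[of j0 js] in auto)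
    from min[OF this] j0 show False by (auto simp: length_remove1 split: if_splits) (metis One_nat_def Suc_pred length_pos_if_in_set not_less_eq_eq order_refl)
  qed
  have "\<forall>i\<in>I. \<exists>c. c \<in> carrier (coord_space js) \<and>
    (\<forall>(U :: 'v vspace) k. rel_family I R U k \<longrightarrow> k i = lc U k (map (\<lambda>j. (c j, j)) js))"
  proof
    fix i assume "i \<in> I"
    then obtain c where c: "\<And>(U :: 'v vspace) k. rel_family I R U k \<Longrightarrow> k i = lc U k (map (\<lambda>j. (c j, j)) js)"
      using js gen_def by metis
    \<comment> \<open>Coefficients off \<open>js\<close> do not enter the combination; setting them
      to 0 puts the vector into \<open>coord_space js\<close>.\<close>
    define c' where "c' j = (if j \<in> set js then c j else 0)" for j
    have "map (\<lambda>j. (c' j, j)) js = map (\<lambda>j. (c j, j)) js" by (auto simp: c'_def)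
    then have "\<forall>(U :: 'v vspace) k. rel_family I R U k \<longrightarrow> k i = lc U k (map (\<lambda>j. (c' j, j)) js)"
      using c by metis
    moreover have "c' \<in> carrier (coord_space js)" by (auto simp: c'_def)
    ultimately have "c' \<in> carrier (coord_space js) \<and>
      (\<forall>(U :: 'v vspace) k. rel_family I R U k \<longrightarrow> k i = lc U k (map (\<lambda>j. (c' j, j)) js))" by blast
    then show "\<exists>c. c \<in> carrier (coord_space js) \<and>
      (\<forall>(U :: 'v vspace) k. rel_family I R U k \<longrightarrow> k i = lc U k (map (\<lambda>j. (c j, j)) js))" by blast
  qed
  then obtain c where cc: "\<And>i. i \<in> I \<Longrightarrow> c i \<in> carrier (coord_space js)"
    and ck: "\<And>i (U :: 'v vspace) k. i \<in> I \<Longrightarrow> rel_family I R U k \<Longrightarrow> k i = lc U k (map (\<lambda>j. (c i j, j)) js)"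
    by metis
  let ?C = "coord_space js"
  have CV: "?C \<in> Obj vect" using d by (rule coord_space_vect)
  have lin: "linmap ?C W (\<lambda>c. lc W h (map (\<lambda>j. (c j, j)) js))" if "rel_family I R W h" for W :: "'v vspace" and h
  proof (rule linmapI)
    fix u v assume "u \<in> carrier ?C" "v \<in> carrier ?C"
    show "lc W h (map (\<lambda>j. ((u \<oplus>\<^bsub>?C\<^esub> v) j, j)) js) =
       lc W h (map (\<lambda>j. (u j, j)) js) \<oplus>\<^bsub>W\<^esub> lc W h (map (\<lambda>j. (v j, j)) js)"
      using lc_coeffs[OF fm(1)[OF that] d kjs[OF that], where c = u and a = 1 and d = v]
        lc_closed[OF fm(1)[OF that], of "map (\<lambda>j. (v j, j)) js" h] kjs[OF that] fm(1)[OF that] by force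
  next
    fix a v assume "v \<in> carrier ?C"
    show "lc W h (map (\<lambda>j. ((a \<odot>\<^bsub>?C\<^esub> v) j, j)) js) = a \<odot>\<^bsub>W\<^esub> lc W h (map (\<lambda>j. (v j, j)) js)"
      using lc_coeffs_scale[OF fm(1)[OF that] kjs[OF that], where a = a and d = v] by simp
  qed (use fm(1)[OF that] kjs[OF that] in \<open>auto intro!: lc_closed\<close>)
  \<comment> \<open>The coordinates of a relation, evaluated in any family, give the value of the
    relation there, which is 0; \<open>indep\<close> then kills each coordinate.\<close>
  have rel0: "lc ?C c r = (\<lambda>_. 0)" if r: "r \<in> R" for r
  proof
    fix j
    have cl: "lc ?C c r \<in> carrier ?C" using cc R[OF r] by (intro lc_closed CV) blast
    show "lc ?C c r j = 0"
    proof (cases "j \<in> set js")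
      case True
      show ?thesis
      proof (rule indep[OF True])
        fix U :: "'v vspace" and k assume f: "rel_family I R U k"
        have "lc U k (map (\<lambda>j. (lc ?C c r j, j)) js) = lc U (\<lambda>i. lc U k (map (\<lambda>j. (c i j, j)) js)) r"
          using linmap_lc[OF CV fm(1)[OF f] lin[OF f], of r c] cc R[OF r] by blast
        also have "\<dots> = lc U k r" using ck[OF _ f] R[OF r] by (intro lc_cong) auto
        finally show "lc U k (map (\<lambda>j. (lc ?C c r j, j)) js) = \<zero>\<^bsub>U\<^esub>" using fm(3)[OF f r] by simp
      qed
    qed (use cl in auto)
  qed
  \<comment> \<open>A generator in \<open>js\<close> is expressed both by \<open>c j\<close> and by
    itself; the difference of the two expressions vanishes in every family, so \<open>indep\<close>
    applies.\<close>
  have cu: "c j = unit_coord j" if j: "j \<in> set js" for j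
  proof
    fix i
    show "c j i = unit_coord j i"
    proof (cases "i \<in> set js")
      case True
      have "c j i + (-1) * unit_coord j i = 0"
      proof (rule indep[OF True])
        fix U :: "'v vspace" and k assume f: "rel_family I R U k"
        have "lc U k (map (\<lambda>i. (c j i, i)) js) = k j" using ck[OF _ f] j jI by auto
        moreover have "lc U k (map (\<lambda>i. (unit_coord j i, i)) js) = k j"
        proof -
          have "lc U k [(1, j)] = lc U k (map (\<lambda>i. (sum_list (map fst (filter (\<lambda>p. snd p = i) [(1, j)])), i)) js)"
            using j kjs[OF f] by (intro lc_collect fm(1)[OF f] d) auto
          also have "map (\<lambda>i. (sum_list (map fst (filter (\<lambda>p. snd p = i) [(1, j)])), i)) js = map (\<lambda>i. (unit_coord j i, i)) js"
            by (auto simp: unit_coord_def)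
          finally show ?thesis using fm(1)[OF f] kjs[OF f j] by simp
        qed
        ultimately show "lc U k (map (\<lambda>i. (c j i + (-1) * unit_coord j i, i)) js) = \<zero>\<^bsub>U\<^esub>"
          using lc_coeffs[OF fm(1)[OF f] d kjs[OF f], where c = "c j" and a = "-1" and d = "unit_coord j"] vs_eq_iff[OF fm(1)[OF f]] kjs[OF f j] by auto
      qed
      then show ?thesis by simp
    qed (use cc[of j] j jI in \<open>auto simp: unit_coord_def\<close>)
  qed
  \<comment> \<open>\<open>U\<close> is the copy of the coordinate space inside \<open>'v\<close>,
    and the universal family sends \<open>i\<close> to \<open>e (c i)\<close>.\<close>
  obtain e :: "('i \<Rightarrow> complex) \<Rightarrow> 'v" where "inj_on e (carrier ?C)" using coord_space_inj[OF \<iota>] by blast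
  then obtain U where U: "U \<in> Obj vect" "linmap ?C U e" "bij_betw e (carrier ?C) (carrier U)"
    using vect_transport[OF CV] by blast
  define g where "g = inv_into (carrier ?C) e"
  have ge: "v \<in> carrier ?C \<Longrightarrow> g (e v) = v" for v using U(3) by (simp add: g_def bij_betw_inv_into_left)
  have linmap_inv: "linmap U ?C g"
  proof (rule linmapI)
    show gc: "g u \<in> carrier ?C" if "u \<in> carrier U" for u
      using that bij_betw_apply[OF bij_betw_inv_into[OF U(3)]] unfolding g_def by blast
    have eg: "e (g u) = u" if "u \<in> carrier U" for u using that U(3) by (simp add: g_def bij_betw_inv_into_right)
    show "g (u \<oplus>\<^bsub>U\<^esub> v) = g u \<oplus>\<^bsub>?C\<^esub> g v" if "u \<in> carrier U" "v \<in> carrier U" for u v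
      using linmap_add[OF U(2) gc[OF that(1)] gc[OF that(2)]] eg that ge vs_add[OF CV gc[OF that(1)] gc[OF that(2)]] by metis
    show "g (a \<odot>\<^bsub>U\<^esub> u) = a \<odot>\<^bsub>?C\<^esub> g u" if "u \<in> carrier U" for a u
      using linmap_smult[OF U(2) gc[OF that], of a] eg that ge vs_smult[OF CV gc[OF that], of a] by metis
  qed
  show thesis
  proof (rule that)
    show "rel_family I R U (\<lambda>i. e (c i))"
      unfolding rel_family_def
    proof (intro conjI ballI)
      fix r assume r: "r \<in> R"
      have "lc U (\<lambda>i. e (c i)) r = e (lc ?C c r)"
        using linmap_lc[OF CV U(1,2), of r c] cc R[OF r] by (metis subsetD)
      then show "lc U (\<lambda>i. e (c i)) r = \<zero>\<^bsub>U\<^esub>"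
        using rel0[OF r] linmap_zero[OF CV U(1,2)] by simp
    qed (use U cc linmap_closed[OF U(2)] in auto)
  next
    fix W :: "'v vspace" and h assume f: "rel_family I R W h"
    \<comment> \<open>The mediating map reads off coordinates by \<open>g\<close> and evaluates them
      in the given family.\<close>
    have "linmap U W (\<lambda>u. lc W h (map (\<lambda>j. (g u j, j)) js))"
      using linmap_comp[OF linmap_inv lin[OF f]] .
    then show "\<exists>m. linmap U W m \<and> (\<forall>i\<in>I. m (e (c i)) = h i)"
      using ck[OF _ f] ge cc by (intro exI[of _ "\<lambda>u. lc W h (map (\<lambda>j. (g u j, j)) js)"]) auto
  next
    fix W :: "'v vspace" and m m' assume W: "W \<in> Obj vect" and m: "linmap U W m" "linmap U W m'"
      and eq: "\<forall>i\<in>I. m (e (c i)) = m' (e (c i))"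
    show "\<forall>u\<in>carrier U. m u = m' u"
    proof
      fix u assume "u \<in> carrier U"
      then obtain v where v: "v \<in> carrier ?C" "u = e v" using bij_betw_imp_surj_on[OF U(3)] by blast
      have ve: "v = lc ?C unit_coord (map (\<lambda>j. (v j, j)) js)"
        using v by (intro coord_space_expand d) auto
      have *: "n u = lc W (\<lambda>j. n (e (c j))) (map (\<lambda>j. (v j, j)) js)" if "linmap U W n" for n
      proof -
        have "n u = n (e (lc ?C unit_coord (map (\<lambda>j. (v j, j)) js)))" using v ve by simp
        also have "\<dots> = lc W (\<lambda>j. n (e (unit_coord j))) (map (\<lambda>j. (v j, j)) js)"
          by (rule linmap_lc[OF CV W linmap_comp[OF U(2) that]]) (auto simp: unit_coord_def)
        also have "\<dots> = lc W (\<lambda>j. n (e (c j))) (map (\<lambda>j. (v j, j)) js)"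
          by (intro lc_cong) (auto simp: cu)
        finally show ?thesis .
      qed
      have "lc W (\<lambda>j. m (e (c j))) (map (\<lambda>j. (v j, j)) js) = lc W (\<lambda>j. m' (e (c j))) (map (\<lambda>j. (v j, j)) js)"
        using eq jI by (intro lc_cong) auto
      then show "m u = m' u" using *[OF m(1)] *[OF m(2)] by simp
    qed
  qed
qed

section \<open>Tensor products and colimits of vector spaces\<close>

lemma HomD: "f \<in> Hom C x y \<Longrightarrow> f \<in> Arr C" "f \<in> Hom C x y \<Longrightarrow> Dom C f = x" "f \<in> Hom C x y \<Longrightarrow> Cod C f = y"
  by (auto simp: Hom_def)

lemma HomI: "f \<in> Arr C \<Longrightarrow> f \<in> Hom C (Dom C f) (Cod C f)"
  by (auto simp: Hom_def)

lemma (in category) Hom_Obj: "f \<in> Hom C x y \<Longrightarrow> x \<in> Obj C" "f \<in> Hom C x y \<Longrightarrow> y \<in> Obj C"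
  using Dom_Obj Cod_Obj by (auto simp: Hom_def)

section \<open>The category of finite-dimensional vector spaces\<close>

definition mk_lin :: "'v vspace \<Rightarrow> 'v vspace \<Rightarrow> ('v \<Rightarrow> 'v) \<Rightarrow> 'v lin" where
  "mk_lin V W f = (V, W, restrict f (carrier V))"

lemma vect_Hom_iff: "m \<in> Hom vect V W \<longleftrightarrow> V \<in> Obj vect \<and> W \<in> Obj vect \<and>
    (\<exists>f. m = (V, W, f) \<and> linmap V W f \<and> f \<in> extensional (carrier V))"
  by (auto simp: Hom_def vect_def linmap_iff_module_hom)

lemma vect_HomD:
  assumes "m \<in> Hom vect V W"
  shows "V \<in> Obj vect" "W \<in> Obj vect" "linmap V W (app m)" "app m \<in> extensional (carrier V)" "m = (V, W, app m)"
  using assms by (auto simp: vect_Hom_iff app_def)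

lemma vect_app_closed: "m \<in> Hom vect V W \<Longrightarrow> v \<in> carrier V \<Longrightarrow> app m v \<in> carrier W"
  by (blast dest: vect_HomD intro: linmap_closed)

lemma vect_eqI:
  assumes "m \<in> Hom vect V W" "n \<in> Hom vect V W" "\<And>v. v \<in> carrier V \<Longrightarrow> app m v = app n v"
  shows "m = n"
  using vect_HomD(4,5)[OF assms(1)] vect_HomD(4,5)[OF assms(2)] assms(3) by (metis extensionalityI)

lemma mk_lin_Hom: "V \<in> Obj vect \<Longrightarrow> W \<in> Obj vect \<Longrightarrow> linmap V W f \<Longrightarrow> mk_lin V W f \<in> Hom vect V W"
  using linmap_cong[of V "restrict f (carrier V)" f W] by (auto simp: vect_Hom_iff mk_lin_def)

lemma app_mk_lin [simp]: "v \<in> carrier V \<Longrightarrow> app (mk_lin V W f) v = f v"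
  by (simp add: app_def mk_lin_def)

lemma app_comp:
  assumes "m \<in> Hom vect V W" "v \<in> carrier V"
  shows "app (n \<cdot>\<^bsub>vect\<^esub> m) v = app n (app m v)"
proof -
  obtain f where m: "m = (V, W, f)" using vect_HomD(5)[OF assms(1)] by blast
  show ?thesis using assms(2) by (cases n) (simp add: m app_def vect_def compose_def)
qed

lemma app_Ident [simp]: "v \<in> carrier V \<Longrightarrow> app (Ident vect V) v = v"
  by (simp add: app_def vect_def)

interpretation vect: category vect
proof
  show Id: "Ident vect x \<in> Hom vect x x" if "x \<in> Obj vect" for x :: "'a vspace"
    using mk_lin_Hom[OF that that linmap_id] by (simp add: mk_lin_def vect_def restrict_def)
  show cl: "g \<cdot>\<^bsub>vect\<^esub> f \<in> Hom vect x z" if f: "f \<in> Hom vect x y" and g: "g \<in> Hom vect y z" for x y z :: "'a vspace" and f g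
  proof -
    obtain f' g' where fg: "f = (x, y, f')" "g = (y, z, g')"
      using vect_HomD(5)[OF f] vect_HomD(5)[OF g] by blast
    have "g \<cdot>\<^bsub>vect\<^esub> f = mk_lin x z (\<lambda>v. g' (f' v))"
      by (simp add: fg mk_lin_def vect_def compose_def restrict_def)
    moreover have "linmap x z (\<lambda>v. g' (f' v))"
      using linmap_comp[OF vect_HomD(3)[OF f] vect_HomD(3)[OF g]] by (simp add: fg app_def)
    ultimately show ?thesis
      using mk_lin_Hom[OF vect_HomD(1)[OF f] vect_HomD(2)[OF g]] by simp
  qed
  fix w x y z :: "'a vspace" and f g h
  assume f: "f \<in> Hom vect w x"
  show "Ident vect x \<cdot>\<^bsub>vect\<^esub> f = f"
    by (rule vect_eqI[OF cl[OF f Id[OF vect_HomD(2)[OF f]]] f]) (simp add: app_comp[OF f] vect_app_closed[OF f])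
  show "f \<cdot>\<^bsub>vect\<^esub> Ident vect w = f"
    by (intro vect_eqI[OF cl[OF Id[OF vect_HomD(1)[OF f]] f] f])
       (simp add: app_comp[OF Id[OF vect_HomD(1)[OF f]]])
  assume g: "g \<in> Hom vect x y" and h: "h \<in> Hom vect y z"
  show "h \<cdot>\<^bsub>vect\<^esub> (g \<cdot>\<^bsub>vect\<^esub> f) = h \<cdot>\<^bsub>vect\<^esub> g \<cdot>\<^bsub>vect\<^esub> f"
    by (intro vect_eqI[OF cl[OF cl[OF f g] h] cl[OF f cl[OF g h]]])
       (simp add: app_comp[OF f] app_comp[OF g] app_comp[OF cl[OF f g]] vect_app_closed[OF f])
next
  fix f :: "'a lin" assume "f \<in> Arr vect"
  then have "f \<in> Hom vect (Dom vect f) (Cod vect f)" by (rule HomI)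
  then show "Dom vect f \<in> Obj vect" "Cod vect f \<in> Obj vect" by (rule vect_HomD)+
qed

abbreviation vect_comp (infixl "\<cdot>\<^sub>v" 70) where
  "g \<cdot>\<^sub>v f \<equiv> g \<cdot>\<^bsub>vect\<^esub> f"

text \<open>The left side is the value under \<open>lc\<close> of the three-term list that expresses
  additivity in \<open>linear_relations\<close>.\<close>

lemma lc_sum_relation:
  assumes "U \<in> Obj vect" "x \<in> carrier U" "y \<in> carrier U" "t \<in> carrier U"
  shows "1 \<odot>\<^bsub>U\<^esub> x \<oplus>\<^bsub>U\<^esub> ((-1) \<odot>\<^bsub>U\<^esub> y \<oplus>\<^bsub>U\<^esub> ((-1) \<odot>\<^bsub>U\<^esub> t \<oplus>\<^bsub>U\<^esub> \<zero>\<^bsub>U\<^esub>)) = \<zero>\<^bsub>U\<^esub> \<longleftrightarrow> x = y \<oplus>\<^bsub>U\<^esub> t"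
  using vs_eq_iff[OF assms(1,2), of "y \<oplus>\<^bsub>U\<^esub> t"] assms by (simp add: vs_smult_add_right)

lemma lc_smult_relation:
  assumes "U \<in> Obj vect" "x \<in> carrier U" "y \<in> carrier U"
  shows "1 \<odot>\<^bsub>U\<^esub> x \<oplus>\<^bsub>U\<^esub> ((-c) \<odot>\<^bsub>U\<^esub> y \<oplus>\<^bsub>U\<^esub> \<zero>\<^bsub>U\<^esub>) = \<zero>\<^bsub>U\<^esub> \<longleftrightarrow> x = c \<odot>\<^bsub>U\<^esub> y"
  using vs_eq_iff[OF assms(1,2), of "c \<odot>\<^bsub>U\<^esub> y"] assms by (simp add: vs_smult_smult)

text \<open>\<open>p\<close> places the vectors of \<open>V\<close> among the generators. Every
  vector is a generator and linearity is imposed by relations, so no basis has to be chosen.\<close>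

definition linear_relations :: "'v vspace \<Rightarrow> ('v \<Rightarrow> 'i) \<Rightarrow> (complex \<times> 'i) list set" where
  "linear_relations V p =
     {[(1, p (u \<oplus>\<^bsub>V\<^esub> v)), (-1, p u), (-1, p v)] | u v. u \<in> carrier V \<and> v \<in> carrier V} \<union>
     {[(1, p (c \<odot>\<^bsub>V\<^esub> v)), (-c, p v)] | c v. v \<in> carrier V}"

lemma linear_relations_iff:
  assumes V: "V \<in> Obj vect" and U: "U \<in> Obj vect" and k: "\<And>v. v \<in> carrier V \<Longrightarrow> k (p v) \<in> carrier U"
  shows "(\<forall>r \<in> linear_relations V p. lc U k r = \<zero>\<^bsub>U\<^esub>) \<longleftrightarrow> linmap V U (\<lambda>v. k (p v))"
proof
  assume *: "\<forall>r \<in> linear_relations V p. lc U k r = \<zero>\<^bsub>U\<^esub>"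
  show "linmap V U (\<lambda>v. k (p v))"
  proof (rule linmapI)
    fix u v assume uv: "u \<in> carrier V" "v \<in> carrier V"
    then have "lc U k [(1, p (u \<oplus>\<^bsub>V\<^esub> v)), (-1, p u), (-1, p v)] = \<zero>\<^bsub>U\<^esub>"
      using * by (intro bspec[OF *]) (unfold linear_relations_def, blast)
    then show "k (p (u \<oplus>\<^bsub>V\<^esub> v)) = k (p u) \<oplus>\<^bsub>U\<^esub> k (p v)"
      using lc_sum_relation[OF U k k k, of "u \<oplus>\<^bsub>V\<^esub> v" u v] uv V by simp
  next
    fix c v assume v: "v \<in> carrier V"
    then have "lc U k [(1, p (c \<odot>\<^bsub>V\<^esub> v)), (-c, p v)] = \<zero>\<^bsub>U\<^esub>"
      using * by (intro bspec[OF *]) (unfold linear_relations_def, blast)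
    then show "k (p (c \<odot>\<^bsub>V\<^esub> v)) = c \<odot>\<^bsub>U\<^esub> k (p v)"
      using lc_smult_relation[OF U k k, of "c \<odot>\<^bsub>V\<^esub> v" v] v V by simp
  qed (rule k)
next
  assume l: "linmap V U (\<lambda>v. k (p v))"
  have 1: "lc U k [(1, p (u \<oplus>\<^bsub>V\<^esub> v)), (-1, p u), (-1, p v)] = \<zero>\<^bsub>U\<^esub>" if "u \<in> carrier V" "v \<in> carrier V" for u v
    using lc_sum_relation[OF U k k k, of "u \<oplus>\<^bsub>V\<^esub> v" u v] that V linmap_add[OF l that] by simp
  have 2: "lc U k [(1, p (c \<odot>\<^bsub>V\<^esub> v)), (-c, p v)] = \<zero>\<^bsub>U\<^esub>" if "v \<in> carrier V" for c v
    using lc_smult_relation[OF U k k, of "c \<odot>\<^bsub>V\<^esub> v" v c] that V linmap_smult[OF l that] by simp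
  show "\<forall>r \<in> linear_relations V p. lc U k r = \<zero>\<^bsub>U\<^esub>"
    using 1 2 by (auto simp only: linear_relations_def Un_iff mem_Collect_eq ball_Un)
qed

lemma bilinear_map_iff: "bilinear_map V W U \<beta> \<longleftrightarrow>
    (\<forall>v \<in> carrier V. linmap W U (\<beta> v)) \<and> (\<forall>w \<in> carrier W. linmap V U (\<lambda>v. \<beta> v w))"
  by (simp add: bilinear_map_def linmap_iff_module_hom)

lemma linmap_expand:
  assumes "V \<in> Obj vect" "U \<in> Obj vect" "linmap V U f" "snd ` set r \<subseteq> carrier V"
  shows "f (lc V (\<lambda>i. i) r) = lc U f r"
  using linmap_lc[OF assms(1-3), of r "\<lambda>i. i"] assms(4) by auto

text \<open>The tensor product is the universal family on all pairs of vectors subject to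
  bilinearity. The finiteness demanded by \<open>universal_family\<close> holds because pairs from
  two finite spanning sets generate.\<close>

theorem tensor_exists:
  assumes \<iota>: "inj (\<iota> :: complex \<Rightarrow> 'v)" and V: "(V :: 'v vspace) \<in> Obj vect" and W: "W \<in> Obj vect"
  shows "\<exists>P \<tau>. is_tensor_product V W P \<tau>"
proof -
  define I where "I = carrier V \<times> carrier W"
  define R where "R = (\<Union>w\<in>carrier W. linear_relations V (\<lambda>v. (v, w))) \<union> (\<Union>v\<in>carrier V. linear_relations W (\<lambda>w. (v, w)))"
  have fam: "rel_family I R U k \<longleftrightarrow> U \<in> Obj vect \<and> bilinear_map V W U (\<lambda>v w. k (v, w))" for U :: "'v vspace" and k
  proof (cases "U \<in> Obj vect \<and> (\<forall>i\<in>I. k i \<in> carrier U)")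
    case True
    then have "w \<in> carrier W \<Longrightarrow> (\<forall>r\<in>linear_relations V (\<lambda>v. (v, w)). lc U k r = \<zero>\<^bsub>U\<^esub>) \<longleftrightarrow> linmap V U (\<lambda>v. k (v, w))"
      "v \<in> carrier V \<Longrightarrow> (\<forall>r\<in>linear_relations W (\<lambda>w. (v, w)). lc U k r = \<zero>\<^bsub>U\<^esub>) \<longleftrightarrow> linmap W U (\<lambda>w. k (v, w))" for v w
      using linear_relations_iff[OF V, of U k "\<lambda>v. (v, w)"] linear_relations_iff[OF W, of U k "\<lambda>w. (v, w)"] by (auto simp: I_def)
    then have "(\<forall>r\<in>R. lc U k r = \<zero>\<^bsub>U\<^esub>) \<longleftrightarrow> bilinear_map V W U (\<lambda>v w. k (v, w))"
      unfolding R_def bilinear_map_iff by (simp only: ball_Un ball_UN cong: ball_cong) blast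
    then show ?thesis using True by (simp add: rel_family_def)
  next
    case False
    moreover have "k (v, w) \<in> carrier U" if "bilinear_map V W U (\<lambda>v w. k (v, w))" "v \<in> carrier V" "w \<in> carrier W" for v w
      using that linmap_closed[of W U "\<lambda>w. k (v, w)" w] by (simp add: bilinear_map_iff)
    ultimately show ?thesis by (auto simp: rel_family_def I_def)
  qed
  obtain BV where BV: "finite BV" "BV \<subseteq> carrier V" "\<And>v. v \<in> carrier V \<Longrightarrow> \<exists>r. snd ` set r \<subseteq> BV \<and> v = lc V (\<lambda>i. i) r"
    using vect_finite_span[OF V] by blast
  obtain BW where BW: "finite BW" "BW \<subseteq> carrier W" "\<And>v. v \<in> carrier W \<Longrightarrow> \<exists>r. snd ` set r \<subseteq> BW \<and> v = lc W (\<lambda>i. i) r"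
    using vect_finite_span[OF W] by blast
  \<comment> \<open>With \<open>w\<close> expanded once and for all in \<open>BW\<close>, the
    induction runs over the expansion of the first argument. The resulting list \<open>q\<close>
    does not depend on \<open>U\<close> and \<open>k\<close>.\<close>
  have expand: "\<exists>q. snd ` set q \<subseteq> BV \<times> BW \<and>
      (\<forall>(U :: 'v vspace) k. rel_family I R U k \<longrightarrow> lc U (\<lambda>v. k (v, w)) r = lc U k q)"
    if r: "snd ` set r \<subseteq> BV" and w: "w \<in> carrier W" for r w
  proof -
    obtain s where s: "snd ` set s \<subseteq> BW" "w = lc W (\<lambda>i. i) s" using BW w by blast
    show ?thesis using r
    proof (induction r)
      case Nil
      then show ?case by (intro exI[of _ "[]"]) simp
    next
      case (Cons p r)
      obtain a v where p: "p = (a, v)" by (cases p)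
      then have v: "v \<in> BV" using Cons by auto
      obtain q where q: "snd ` set q \<subseteq> BV \<times> BW"
        "\<And>(U :: 'v vspace) k. rel_family I R U k \<Longrightarrow> lc U (\<lambda>v. k (v, w)) r = lc U k q" using Cons by auto
      \<comment> \<open>The contribution of the single term \<open>a\<close> times \<open>v\<close>:
        the expansion of \<open>w\<close>, paired with \<open>v\<close> and scaled by
        \<open>a\<close>.\<close>
      define t where "t = map (\<lambda>(b, u). (a * b, u)) (map (map_prod id (Pair v)) s)"
      have "lc U (\<lambda>v. k (v, w)) (p # r) = lc U k (t @ q)" if f: "rel_family I R U k" for U :: "'v vspace" and k
      proof -
        have U: "U \<in> Obj vect" and k: "\<And>i. i \<in> I \<Longrightarrow> k i \<in> carrier U" using f by (auto simp: rel_family_def)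
        have l: "linmap W U (\<lambda>w. k (v, w))" using f v BV(2) fam by (auto simp: bilinear_map_iff)
        have lm: "lc U k (map (map_prod id (Pair v)) s) = lc U (\<lambda>w. k (v, w)) s" by (induction s) auto
        have "k (v, w) = lc U (\<lambda>w. k (v, w)) s"
          using linmap_expand[OF W U l, of s] s BW(2) by auto
        moreover have "lc U k t = a \<odot>\<^bsub>U\<^esub> lc U k (map (map_prod id (Pair v)) s)"
          unfolding t_def using s(1) v BV(2) BW(2) by (intro lc_scale U k) (force simp: I_def)
        moreover have "lc U k (t @ q) = lc U k t \<oplus>\<^bsub>U\<^esub> lc U k q"
          using s(1) v BV(2) BW(2) q(1) by (intro lc_append U k) (force simp: I_def t_def)
        ultimately show ?thesis using q(2)[OF f] lm by (simp add: p)
      qed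
      moreover have "snd ` set (t @ q) \<subseteq> BV \<times> BW" using s(1) v q(1) by (force simp: t_def)
      ultimately show ?case by blast
    qed
  qed
  have RI: "snd ` set r \<subseteq> I" if "r \<in> R" for r
    using that V W by (auto simp: R_def I_def linear_relations_def)
  have fin: "finite (BV \<times> BW)" and sub: "BV \<times> BW \<subseteq> I" using BV(1,2) BW(1,2) by (auto simp: I_def)
  have span: "\<exists>q. snd ` set q \<subseteq> BV \<times> BW \<and> (\<forall>(U :: 'v vspace) k. rel_family I R U k \<longrightarrow> k i = lc U k q)" if iI: "i \<in> I" for i
  proof -
    obtain v w where i: "i = (v, w)" "v \<in> carrier V" "w \<in> carrier W" using iI unfolding I_def by blast
    obtain r where r: "snd ` set r \<subseteq> BV" "v = lc V (\<lambda>i. i) r" using BV i by blast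
    obtain q where q: "snd ` set q \<subseteq> BV \<times> BW"
        "\<And>(U :: 'v vspace) k. rel_family I R U k \<Longrightarrow> lc U (\<lambda>v. k (v, w)) r = lc U k q" using expand[OF r(1) i(3)] by blast
    have "k i = lc U k q" if f: "rel_family I R U k" for U :: "'v vspace" and k
    proof -
      have "U \<in> Obj vect" "linmap V U (\<lambda>v. k (v, w))" using f fam i(3) by (auto simp: bilinear_map_iff)
      then have "k (v, w) = lc U (\<lambda>v. k (v, w)) r" using linmap_expand[OF V, of U "\<lambda>v. k (v, w)" r] r BV(2) by auto
      then show ?thesis using q(2)[OF f] i by simp
    qed
    with q(1) show ?thesis by blast
  qed
  obtain P :: "'v vspace" and t where t: "rel_family I R P t"
    "\<And>(U :: 'v vspace) h. rel_family I R U h \<Longrightarrow> \<exists>m. linmap P U m \<and> (\<forall>i\<in>I. m (t i) = h i)"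
    "\<And>(U :: 'v vspace) m m'. U \<in> Obj vect \<Longrightarrow> linmap P U m \<Longrightarrow> linmap P U m' \<Longrightarrow> \<forall>i\<in>I. m (t i) = m' (t i) \<Longrightarrow>
       \<forall>u\<in>carrier P. m u = m' u"
    by (rule universal_family[OF \<iota> RI fin sub span]) blast+
  have P: "P \<in> Obj vect" using t(1) fam by blast
  have "is_tensor_product V W P (\<lambda>v w. t (v, w))"
    unfolding is_tensor_product_def
  proof (intro conjI ballI allI impI)
    fix U :: "'v vspace" and \<beta> assume U: "U \<in> Obj vect" and "bilinear_map V W U \<beta>"
    then have "rel_family I R U (\<lambda>(v, w). \<beta> v w)" by (simp add: fam)
    then obtain m where m: "linmap P U m" "\<forall>i\<in>I. m (t i) = (\<lambda>(v, w). \<beta> v w) i" using t(2) by blast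
    have tc: "v \<in> carrier V \<Longrightarrow> w \<in> carrier W \<Longrightarrow> t (v, w) \<in> carrier P" for v w
      using t(1) by (auto simp: rel_family_def I_def)
    show "\<exists>!m. m \<in> Hom vect P U \<and> (\<forall>v\<in>carrier V. \<forall>w\<in>carrier W. app m (t (v, w)) = \<beta> v w)"
    proof (rule ex1I)
      show "mk_lin P U m \<in> Hom vect P U \<and> (\<forall>v\<in>carrier V. \<forall>w\<in>carrier W. app (mk_lin P U m) (t (v, w)) = \<beta> v w)"
        using mk_lin_Hom[OF P U m(1)] m(2) tc by (auto simp: I_def)
      fix n assume n: "n \<in> Hom vect P U \<and> (\<forall>v\<in>carrier V. \<forall>w\<in>carrier W. app n (t (v, w)) = \<beta> v w)"
      then have "\<forall>i\<in>I. app n (t i) = m (t i)" using m(2) by (auto simp: I_def)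
      then have "\<forall>u\<in>carrier P. app n u = m u" using t(3)[OF U vect_HomD(3) m(1)] n by blast
      then show "n = mk_lin P U m"
        using n mk_lin_Hom[OF P U m(1)] by (intro vect_eqI[where V = P and W = U]) auto
    qed
  qed (use t(1) fam in auto)
  then show ?thesis by blast
qed

lemma nat_transD:
  assumes "nat_trans A B \<Phi> \<Psi> \<eta>"
  shows "cat_functor A B \<Phi>" "cat_functor A B \<Psi>" "\<eta> \<in> extensional (Obj A)"
    "x \<in> Obj A \<Longrightarrow> \<eta> x \<in> Hom B (on_obj \<Phi> x) (on_obj \<Psi> x)"
    "f \<in> Hom A x y \<Longrightarrow> \<eta> y \<cdot>\<^bsub>B\<^esub> on_arr \<Phi> f = on_arr \<Psi> f \<cdot>\<^bsub>B\<^esub> \<eta> x"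
  using assms by (auto simp: nat_trans_def Hom_def)

lemma const_fct_functor:
  assumes "category A" "category B" "y' \<in> Obj B"
  shows "cat_functor A B (const_fct A B y')"
proof -
  interpret A: category A by fact
  interpret B: category B by fact
  note BI = B.Ident_Hom[OF assms(3)]
  show ?thesis
  proof
    fix f x y assume f: "f \<in> Hom A x y"
    then show "on_arr (const_fct A B y') f \<in> Hom B (on_obj (const_fct A B y') x) (on_obj (const_fct A B y') y)"
      using BI A.Hom_Obj[OF f] HomD(1)[OF f] by (simp add: const_fct_def)
    fix g w assume g: "g \<in> Hom A y w"
    show "on_arr (const_fct A B y') (g \<cdot>\<^bsub>A\<^esub> f) = on_arr (const_fct A B y') g \<cdot>\<^bsub>B\<^esub> on_arr (const_fct A B y') f"
      using B.Ident_left[OF BI] HomD(1)[OF f] HomD(1)[OF g] HomD(1)[OF A.Comp_Hom[OF f g]] by (simp add: const_fct_def)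
  next
    fix x assume x: "x \<in> Obj A"
    then show "on_arr (const_fct A B y') (Ident A x) = Ident B (on_obj (const_fct A B y') x)"
      using HomD(1)[OF A.Ident_Hom[OF x]] by (simp add: const_fct_def)
  qed (use assms(3) in \<open>auto simp: const_fct_def\<close>)
qed

text \<open>The diagram may be infinite. Generators are vectors tagged by their index, relations are
  linearity and naturality. A vector at \<open>j\<close> equals its image at some index in
  \<open>J0\<close>, or is zero, so spanning sets at the finitely many indices of \<open>J0\<close>
  generate the colimit.\<close>

theorem vect_colimit_exists:
  fixes D :: "('o, 'a, 'v vspace, 'v lin) fct"
  assumes \<iota>: "inj (\<iota> :: complex \<Rightarrow> 'v)" and D: "cat_functor J vect D"
    and J0: "finite J0" "J0 \<subseteq> Obj J"
    and gen: "\<And>j. j \<in> Obj J \<Longrightarrow> carrier (on_obj D j) = {\<zero>\<^bsub>on_obj D j\<^esub>} \<or> (\<exists>j0\<in>J0. \<exists>f. f \<in> Hom J j j0)"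
  shows "\<exists>c \<kappa>. is_colimit J vect D c \<kappa>"
proof -
  interpret cat_functor J vect D by fact
  have DO: "j \<in> Obj J \<Longrightarrow> on_obj D j \<in> Obj vect" for j by (rule PiE_mem[OF obj_maps])
  define I where "I = Sigma (Obj J) (\<lambda>j. carrier (on_obj D j))"
  define R where "R = (\<Union>j\<in>Obj J. linear_relations (on_obj D j) (Pair j)) \<union>
    {[(1, (j', app (on_arr D f) v)), (-1, (j, v))] | f j j' v. f \<in> Hom J j j' \<and> v \<in> carrier (on_obj D j)}"
  have Dc: "f \<in> Hom J j j' \<Longrightarrow> v \<in> carrier (on_obj D j) \<Longrightarrow> app (on_arr D f) v \<in> carrier (on_obj D j')" for f j j' v
    by (rule vect_app_closed[OF arr_maps])
  have RI: "snd ` set r \<subseteq> I" if rR: "r \<in> R" for r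
  proof -
    consider (lin) j where "j \<in> Obj J" "r \<in> linear_relations (on_obj D j) (Pair j)"
      | (nat) f j j' v where "r = [(1, (j', app (on_arr D f) v)), (-1, (j, v))]" "f \<in> Hom J j j'" "v \<in> carrier (on_obj D j)"
      using rR unfolding R_def by blast
    then show ?thesis
    proof cases
      case lin
      then show ?thesis using DO[OF lin(1)] by (auto simp: I_def linear_relations_def)
    next
      case nat
      then show ?thesis using A.Hom_Obj[OF nat(2)] Dc[OF nat(2,3)] by (simp add: I_def)
    qed
  qed
  \<comment> \<open>Families for these relations are the cocones on \<open>D\<close>.\<close>
  have fam: "rel_family I R U k \<longleftrightarrow> U \<in> Obj vect \<and> (\<forall>j\<in>Obj J. linmap (on_obj D j) U (\<lambda>v. k (j, v))) \<and>
     (\<forall>f j j' v. f \<in> Hom J j j' \<longrightarrow> v \<in> carrier (on_obj D j) \<longrightarrow> k (j', app (on_arr D f) v) = k (j, v))"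
    for U :: "'v vspace" and k
  proof (cases "U \<in> Obj vect \<and> (\<forall>i\<in>I. k i \<in> carrier U)")
    case True
    have 1: "(\<forall>r\<in>linear_relations (on_obj D j) (Pair j). lc U k r = \<zero>\<^bsub>U\<^esub>) \<longleftrightarrow> linmap (on_obj D j) U (\<lambda>v. k (j, v))"
      if "j \<in> Obj J" for j using True that by (intro linear_relations_iff DO) (auto simp: I_def)
    have 2: "lc U k [(1, (j', app (on_arr D f) v)), (-1, (j, v))] = \<zero>\<^bsub>U\<^esub> \<longleftrightarrow> k (j', app (on_arr D f) v) = k (j, v)"
      if "f \<in> Hom J j j'" "v \<in> carrier (on_obj D j)" for f j j' v
    proof -
      have "(j', app (on_arr D f) v) \<in> I" "(j, v) \<in> I" using that Dc[OF that] A.Hom_Obj[OF that(1)] by (auto simp: I_def)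
      then show ?thesis using True lc_smult_relation[of U "k (j', app (on_arr D f) v)" "k (j, v)" 1] by auto
    qed
    have "(\<forall>r\<in>R. lc U k r = \<zero>\<^bsub>U\<^esub>) \<longleftrightarrow> (\<forall>j\<in>Obj J. linmap (on_obj D j) U (\<lambda>v. k (j, v))) \<and>
      (\<forall>f j j' v. f \<in> Hom J j j' \<longrightarrow> v \<in> carrier (on_obj D j) \<longrightarrow> lc U k [(1, (j', app (on_arr D f) v)), (-1, (j, v))] = \<zero>\<^bsub>U\<^esub>)"
      unfolding R_def by (simp only: ball_Un ball_UN 1 cong: ball_cong) blast
    then show ?thesis using True 2 by (simp add: rel_family_def)
  next
    case False
    moreover have "k (j, v) \<in> carrier U" if "linmap (on_obj D j) U (\<lambda>v. k (j, v))" "v \<in> carrier (on_obj D j)" for j v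
      using linmap_closed[OF that] .
    ultimately show ?thesis by (auto simp: rel_family_def I_def)
  qed
  have famD: "U \<in> Obj vect" "j \<in> Obj J \<Longrightarrow> linmap (on_obj D j) U (\<lambda>v. k (j, v))"
    "f \<in> Hom J j j' \<Longrightarrow> v \<in> carrier (on_obj D j) \<Longrightarrow> k (j', app (on_arr D f) v) = k (j, v)"
    if "rel_family I R U k" for U :: "'v vspace" and k f j j' v
    using that unfolding fam by blast+
  have "\<forall>j\<in>Obj J. \<exists>B. finite B \<and> B \<subseteq> carrier (on_obj D j) \<and>
    (\<forall>v\<in>carrier (on_obj D j). \<exists>r. snd ` set r \<subseteq> B \<and> v = lc (on_obj D j) (\<lambda>i. i) r)"
    using vect_finite_span[OF DO] by metis
  then obtain B where B: "\<And>j. j \<in> Obj J \<Longrightarrow> finite (B j)" "\<And>j. j \<in> Obj J \<Longrightarrow> B j \<subseteq> carrier (on_obj D j)"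
    "\<And>j v. j \<in> Obj J \<Longrightarrow> v \<in> carrier (on_obj D j) \<Longrightarrow> \<exists>r. snd ` set r \<subseteq> B j \<and> v = lc (on_obj D j) (\<lambda>i. i) r"
    by metis
  have fin: "finite (Sigma J0 B)" using J0 B(1) by (intro finite_SigmaI) auto
  have sub: "Sigma J0 B \<subseteq> I" using J0(2) B(2) unfolding I_def by blast
  have span: "\<exists>q. snd ` set q \<subseteq> Sigma J0 B \<and> (\<forall>(U :: 'v vspace) k. rel_family I R U k \<longrightarrow> k i = lc U k q)" if iI: "i \<in> I" for i
  proof -
    obtain j v where i: "i = (j, v)" "j \<in> Obj J" "v \<in> carrier (on_obj D j)" using iI unfolding I_def by blast
    show ?thesis using gen[OF i(2)]
    proof (elim disjE bexE exE)
      assume "carrier (on_obj D j) = {\<zero>\<^bsub>on_obj D j\<^esub>}"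
      then have v: "v = \<zero>\<^bsub>on_obj D j\<^esub>" using i by auto
      have "k i = \<zero>\<^bsub>U\<^esub>" if "rel_family I R U k" for U :: "'v vspace" and k
        using linmap_zero[OF DO[OF i(2)] famD(1)[OF that] famD(2)[OF that i(2)]] that v i(1) by simp
      then show ?thesis by (intro exI[of _ "[]"]) simp
    next
      fix j0 f assume j0: "j0 \<in> J0" and f: "f \<in> Hom J j j0"
      have j0O: "j0 \<in> Obj J" using j0 J0 by auto
      obtain r where r: "snd ` set r \<subseteq> B j0" "app (on_arr D f) v = lc (on_obj D j0) (\<lambda>i. i) r"
        using B(3)[OF j0O Dc[OF f i(3)]] by blast
      \<comment> \<open>Naturality along \<open>f\<close> moves the generator from \<open>j\<close>
        to \<open>j0\<close>, where a finite spanning set is available.\<close>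
      have "k i = lc U k (map (map_prod id (Pair j0)) r)" if "rel_family I R U k" for U :: "'v vspace" and k
      proof -
        have "k i = k (j0, app (on_arr D f) v)" using famD(3)[OF that f i(3)] i(1) by simp
        also have "\<dots> = lc U (\<lambda>v. k (j0, v)) r"
          using linmap_expand[OF DO[OF j0O] famD(1)[OF that] famD(2)[OF that j0O], of r] r B(2)[OF j0O] by simp
        also have "\<dots> = lc U k (map (map_prod id (Pair j0)) r)" by (induction r) auto
        finally show ?thesis .
      qed
      moreover have "snd ` set (map (map_prod id (Pair j0)) r) \<subseteq> Sigma J0 B" using r(1) j0 by force
      ultimately show ?thesis by blast
    qed
  qed
  obtain P :: "'v vspace" and t where t: "rel_family I R P t"
    "\<And>(U :: 'v vspace) h. rel_family I R U h \<Longrightarrow> \<exists>m. linmap P U m \<and> (\<forall>i\<in>I. m (t i) = h i)"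
    "\<And>(U :: 'v vspace) m m'. U \<in> Obj vect \<Longrightarrow> linmap P U m \<Longrightarrow> linmap P U m' \<Longrightarrow> \<forall>i\<in>I. m (t i) = m' (t i) \<Longrightarrow>
       \<forall>u\<in>carrier P. m u = m' u"
    by (rule universal_family[OF \<iota> RI fin sub span]) blast+
  have P: "P \<in> Obj vect" using famD(1)[OF t(1)] .
  define \<kappa> where "\<kappa> = (\<lambda>j\<in>Obj J. mk_lin (on_obj D j) P (\<lambda>v. t (j, v)))"
  have \<kappa>: "j \<in> Obj J \<Longrightarrow> \<kappa> j \<in> Hom vect (on_obj D j) P" for j
    using famD(2)[OF t(1)] DO P by (auto simp: \<kappa>_def intro!: mk_lin_Hom)
  have cst: "cat_functor J vect (const_fct J vect d)" if "d \<in> Obj vect" for d :: "'v vspace"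
    using that by (intro const_fct_functor A.category_axioms vect.category_axioms)
  have "is_colimit J vect D P \<kappa>"
    unfolding is_colimit_def
  proof (intro conjI ballI allI impI)
    show "nat_trans J vect D (const_fct J vect P) \<kappa>" unfolding nat_trans_def
    proof (intro conjI ballI)
      fix f assume f: "f \<in> Arr J"
      let ?j = "Dom J f" and ?j' = "Cod J f"
      have h: "f \<in> Hom J ?j ?j'" using f by (rule HomI)
      note o = A.Hom_Obj[OF h]
      have "\<kappa> ?j' \<cdot>\<^sub>v on_arr D f = \<kappa> ?j"
      proof (rule vect_eqI[OF vect.Comp_Hom[OF arr_maps[OF h] \<kappa>[OF o(2)]] \<kappa>[OF o(1)]])
        fix v assume v: "v \<in> carrier (on_obj D ?j)"
        then have "t (?j', app (on_arr D f) v) = t (?j, v)" using famD(3)[OF t(1) h] by blast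
        then show "app (\<kappa> ?j' \<cdot>\<^sub>v on_arr D f) v = app (\<kappa> ?j) v"
          using v o Dc[OF h v] by (simp add: app_comp[OF arr_maps[OF h]] \<kappa>_def)
      qed
      then show "\<kappa> ?j' \<cdot>\<^sub>v on_arr D f = on_arr (const_fct J vect P) f \<cdot>\<^sub>v \<kappa> ?j"
        using f vect.Ident_left[OF \<kappa>[OF o(1)]] by (simp add: const_fct_def)
    qed (use \<kappa> cst P cat_functor_axioms in \<open>auto simp: const_fct_def \<kappa>_def\<close>)
  next
    fix d :: "'v vspace" and \<mu> assume d: "d \<in> Obj vect" and \<mu>: "nat_trans J vect D (const_fct J vect d) \<mu>"
    have \<mu>H: "j \<in> Obj J \<Longrightarrow> \<mu> j \<in> Hom vect (on_obj D j) d" for j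
      using nat_transD(4)[OF \<mu>, of j] by (simp add: const_fct_def)
    have "rel_family I R d (\<lambda>(j, v). app (\<mu> j) v)" unfolding fam
    proof (intro conjI ballI allI impI)
      fix f j j' v assume f: "f \<in> Hom J j j'" and v: "v \<in> carrier (on_obj D j)"
      have "\<mu> j' \<cdot>\<^sub>v on_arr D f = \<mu> j"
        using nat_transD(5)[OF \<mu> f] HomD[OF f] vect.Ident_left[OF \<mu>H[OF A.Hom_Obj(1)[OF f]]] by (simp add: const_fct_def)
      then show "(case (j', app (on_arr D f) v) of (j, v) \<Rightarrow> app (\<mu> j) v) = (case (j, v) of (j, v) \<Rightarrow> app (\<mu> j) v)"
        using app_comp[OF arr_maps[OF f] v, of "\<mu> j'"] by simp
    qed (use d vect_HomD(3)[OF \<mu>H] in simp_all)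
    then obtain m where m: "linmap P d m" "\<forall>i\<in>I. m (t i) = (\<lambda>(j, v). app (\<mu> j) v) i" using t(2) by blast
    have mH: "mk_lin P d m \<in> Hom vect P d" using m(1) P d by (intro mk_lin_Hom)
    have tc: "i \<in> I \<Longrightarrow> t i \<in> carrier P" for i using t(1) by (auto simp: rel_family_def)
    show "\<exists>!m. m \<in> Hom vect P d \<and> (\<forall>j\<in>Obj J. m \<cdot>\<^sub>v \<kappa> j = \<mu> j)"
    proof (rule ex1I)
      have "mk_lin P d m \<cdot>\<^sub>v \<kappa> j = \<mu> j" if j: "j \<in> Obj J" for j
      proof (rule vect_eqI[OF vect.Comp_Hom[OF \<kappa>[OF j] mH] \<mu>H[OF j]])
        fix v assume v: "v \<in> carrier (on_obj D j)"
        then have jv: "(j, v) \<in> I" using j by (simp add: I_def)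
        have k: "app (\<kappa> j) v = t (j, v)" using j v by (simp add: \<kappa>_def)
        show "app (mk_lin P d m \<cdot>\<^sub>v \<kappa> j) v = app (\<mu> j) v"
          unfolding app_comp[OF \<kappa>[OF j] v] k using bspec[OF m(2) jv] tc[OF jv] by simp
      qed
      then show "mk_lin P d m \<in> Hom vect P d \<and> (\<forall>j\<in>Obj J. mk_lin P d m \<cdot>\<^sub>v \<kappa> j = \<mu> j)" using mH by blast
    next
      fix n assume n: "n \<in> Hom vect P d \<and> (\<forall>j\<in>Obj J. n \<cdot>\<^sub>v \<kappa> j = \<mu> j)"
      have "\<forall>i\<in>I. app n (t i) = m (t i)"
      proof
        fix i assume i: "i \<in> I"
        then obtain j v where jv: "i = (j, v)" "j \<in> Obj J" "v \<in> carrier (on_obj D j)" by (auto simp: I_def)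
        have "app n (t (j, v)) = app (n \<cdot>\<^sub>v \<kappa> j) v"
          unfolding app_comp[OF \<kappa>[OF jv(2)] jv(3)] using jv by (simp add: \<kappa>_def)
        also have "\<dots> = m (t (j, v))" using n bspec[OF m(2) i] vect_HomD(4) jv by simp
        finally show "app n (t i) = m (t i)" using jv by simp
      qed
      then have "\<forall>u\<in>carrier P. app n u = m u" using t(3)[OF d vect_HomD(3) m(1)] n by blast
      then show "n = mk_lin P d m"
        using n mH by (intro vect_eqI[where V = P and W = d]) auto
    qed
  qed
  then show ?thesis by blast
qed

section \<open>Categories of finitely supported functors\<close>

context category
begin

lemma isoI: "f \<in> Hom C x y \<Longrightarrow> g \<in> Hom C y x \<Longrightarrow> g \<cdot> f = Ident C x \<Longrightarrow> f \<cdot> g = Ident C y \<Longrightarrow> iso_arr C f"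
  unfolding iso_arr_def by (intro conjI bexI[of _ g]) (simp_all add: Hom_def)

lemma iso_Ident: "x \<in> Obj C \<Longrightarrow> iso_arr C (Ident C x)"
  by (rule isoI[OF Ident_Hom Ident_Hom]) (simp_all add: Ident_left[OF Ident_Hom])

lemma iso_inverse:
  assumes "f \<in> Hom C x y" "iso_arr C f"
  obtains g where "g \<in> Hom C y x" "g \<cdot> f = Ident C x" "f \<cdot> g = Ident C y" "iso_arr C g"
proof -
  obtain g where g: "g \<in> Hom C y x" "g \<cdot> f = Ident C x" "f \<cdot> g = Ident C y"
    using assms(2) HomD(2,3)[OF assms(1)] unfolding iso_arr_def by blast
  then show thesis using that isoI[OF g(1) assms(1)] by simp
qed

lemma iso_comp:
  assumes f: "f \<in> Hom C x y" "iso_arr C f" and g: "g \<in> Hom C y w" "iso_arr C g"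
  shows "iso_arr C (g \<cdot> f)"
proof -
  obtain f' where f': "f' \<in> Hom C y x" "f' \<cdot> f = Ident C x" "f \<cdot> f' = Ident C y"
    by (rule iso_inverse[OF f])
  obtain g' where g': "g' \<in> Hom C w y" "g' \<cdot> g = Ident C y" "g \<cdot> g' = Ident C w"
    by (rule iso_inverse[OF g])
  have "(f' \<cdot> g') \<cdot> (g \<cdot> f) = f' \<cdot> (g' \<cdot> g \<cdot> f)"
    unfolding Comp_assoc[OF f(1) g(1) g'(1), symmetric] Comp_assoc[OF Comp_Hom[OF f(1) g(1)] g'(1) f'(1)] ..
  also have "\<dots> = Ident C x" using f' g'(2) Ident_left[OF f(1)] by simp
  finally have 1: "(f' \<cdot> g') \<cdot> (g \<cdot> f) = Ident C x" .
  have "(g \<cdot> f) \<cdot> (f' \<cdot> g') = g \<cdot> (f \<cdot> f' \<cdot> g')"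
    unfolding Comp_assoc[OF g'(1) f'(1) f(1), symmetric] Comp_assoc[OF Comp_Hom[OF g'(1) f'(1)] f(1) g(1)] ..
  also have "\<dots> = Ident C w" using f' g' Ident_left[OF g'(1)] by simp
  finally have 2: "(g \<cdot> f) \<cdot> (f' \<cdot> g') = Ident C w" .
  show ?thesis
    by (rule isoI[OF Comp_Hom[OF f(1) g(1)] Comp_Hom[OF g'(1) f'(1)] 1 2])
qed

lemma iso_class_eq:
  assumes f: "f \<in> Hom C x y" "iso_arr C f"
  shows "iso_class C x = iso_class C y"
proof -
  obtain g where g: "g \<in> Hom C y x" "iso_arr C g" by (rule iso_inverse[OF f])
  show ?thesis
  proof (intro equalityI subsetI)
    fix w assume "w \<in> iso_class C x"
    then obtain h where h: "h \<in> Hom C x w" "iso_arr C h" by (auto simp: iso_class_def)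
    show "w \<in> iso_class C y"
      unfolding iso_class_def using Comp_Hom[OF g(1) h(1)] iso_comp[OF g h] by blast
  next
    fix w assume "w \<in> iso_class C y"
    then obtain h where h: "h \<in> Hom C y w" "iso_arr C h" by (auto simp: iso_class_def)
    show "w \<in> iso_class C x"
      unfolding iso_class_def using Comp_Hom[OF f(1) h(1)] iso_comp[OF f h] by blast
  qed
qed

lemma iso_class_self: "x \<in> Obj C \<Longrightarrow> x \<in> iso_class C x"
  unfolding iso_class_def using Ident_Hom[of x] iso_Ident[of x] by blast

end

section \<open>Groupoids, cores and products of categories\<close>

definition groupoid :: "('o, 'a) cat \<Rightarrow> bool" where
  "groupoid K \<longleftrightarrow> category K \<and> (\<forall>f \<in> Arr K. iso_arr K f)"

lemma Hom_core: "f \<in> Hom (core K) x y \<longleftrightarrow> f \<in> Hom K x y \<and> iso_arr K f"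
  by (auto simp: core_def Hom_def iso_arr_def)

lemma core_simps [simp]: "Obj (core K) = Obj K" "Dom (core K) = Dom K" "Cod (core K) = Cod K"
  "Ident (core K) = Ident K" "Comp (core K) = Comp K"
  by (auto simp: core_def)

lemma Arr_core: "f \<in> Arr (core K) \<longleftrightarrow> f \<in> Arr K \<and> iso_arr K f"
  by (auto simp: core_def iso_arr_def)

lemma core_groupoid:
  assumes "category K"
  shows "groupoid (core K)"
proof -
  interpret category K by fact
  have "category (core K)"
  proof
    show "g \<cdot>\<^bsub>core K\<^esub> f \<in> Hom (core K) x z" if "f \<in> Hom (core K) x y" "g \<in> Hom (core K) y z" for f g x y z
      using that Comp_Hom[of f x y g z] iso_comp[of f x y g z] by (simp add: Hom_core)
    show "h \<cdot>\<^bsub>core K\<^esub> (g \<cdot>\<^bsub>core K\<^esub> f) = h \<cdot>\<^bsub>core K\<^esub> g \<cdot>\<^bsub>core K\<^esub> f"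
      if "f \<in> Hom (core K) w x" "g \<in> Hom (core K) x y" "h \<in> Hom (core K) y z" for f g h w x y z
      using that Comp_assoc[of f w x g y h z] by (simp add: Hom_core)
    show "Ident (core K) y \<cdot>\<^bsub>core K\<^esub> f = f" "f \<cdot>\<^bsub>core K\<^esub> Ident (core K) x = f" if "f \<in> Hom (core K) x y" for f x y
      using that Ident_left[of f x y] Ident_right[of f x y] by (simp_all add: Hom_core)
  qed (simp_all add: Hom_core Arr_core Dom_Obj Cod_Obj Ident_Hom iso_Ident)
  moreover have "iso_arr (core K) f" if f: "f \<in> Arr (core K)" for f
  proof -
    have "f \<in> Hom K (Dom K f) (Cod K f)" "iso_arr K f" using f by (auto simp: Hom_def Arr_core)
    then obtain g where g: "g \<in> Hom K (Cod K f) (Dom K f)" "g \<cdot>\<^bsub>K\<^esub> f = Ident K (Dom K f)"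
      "f \<cdot>\<^bsub>K\<^esub> g = Ident K (Cod K f)" "iso_arr K g"
      by (rule iso_inverse)
    show ?thesis unfolding iso_arr_def[of "core K"]
      using f g by (intro conjI bexI[of _ g]) (simp_all add: Hom_core)
  qed
  ultimately show ?thesis by (simp add: groupoid_def)
qed

lemma Hom_prod_cat: "p \<in> Hom (prod_cat A B) x y \<longleftrightarrow>
    fst p \<in> Hom A (fst x) (fst y) \<and> snd p \<in> Hom B (snd x) (snd y)"
  by (cases p; cases x; cases y) (auto simp: prod_cat_def Hom_def)

lemma prod_cat_simps [simp]: "Obj (prod_cat A B) = Obj A \<times> Obj B" "Arr (prod_cat A B) = Arr A \<times> Arr B"
  "Ident (prod_cat A B) (x, y) = (Ident A x, Ident B y)"
  "(g, g') \<cdot>\<^bsub>prod_cat A B\<^esub> (f, f') = (g \<cdot>\<^bsub>A\<^esub> f, g' \<cdot>\<^bsub>B\<^esub> f')"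
  "Dom (prod_cat A B) (f, f') = (Dom A f, Dom B f')" "Cod (prod_cat A B) (f, f') = (Cod A f, Cod B f')"
  by (auto simp: prod_cat_def)

lemma prod_category:
  assumes "category A" "category B"
  shows "category (prod_cat A B)"
proof -
  interpret A: category A by fact
  interpret B: category B by fact
  show ?thesis
  proof
    fix f assume "f \<in> Arr (prod_cat A B)"
    then show "Dom (prod_cat A B) f \<in> Obj (prod_cat A B)" "Cod (prod_cat A B) f \<in> Obj (prod_cat A B)"
      by (cases f, simp add: A.Dom_Obj B.Dom_Obj A.Cod_Obj B.Cod_Obj)+
  next
    fix x assume "x \<in> Obj (prod_cat A B)"
    then show "Ident (prod_cat A B) x \<in> Hom (prod_cat A B) x x"
      by (cases x) (simp add: Hom_prod_cat A.Ident_Hom B.Ident_Hom)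
  next
    fix w x f assume f: "f \<in> Hom (prod_cat A B) w x"
    obtain f1 f2 w1 w2 x1 x2 where ff: "f = (f1, f2)" "w = (w1, w2)" "x = (x1, x2)"
      by (metis surj_pair)
    have f': "f1 \<in> Hom A w1 x1" "f2 \<in> Hom B w2 x2" using f by (simp_all add: Hom_prod_cat ff)
    show "Ident (prod_cat A B) x \<cdot>\<^bsub>prod_cat A B\<^esub> f = f" "f \<cdot>\<^bsub>prod_cat A B\<^esub> Ident (prod_cat A B) w = f"
      using A.Ident_left[OF f'(1)] B.Ident_left[OF f'(2)] A.Ident_right[OF f'(1)] B.Ident_right[OF f'(2)]
      by (simp_all add: ff)
    fix y g assume g: "g \<in> Hom (prod_cat A B) x y"
    obtain g1 g2 y1 y2 where gg: "g = (g1, g2)" "y = (y1, y2)" by (metis surj_pair)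
    have g': "g1 \<in> Hom A x1 y1" "g2 \<in> Hom B x2 y2" using g by (simp_all add: Hom_prod_cat ff gg)
    show "g \<cdot>\<^bsub>prod_cat A B\<^esub> f \<in> Hom (prod_cat A B) w y"
      using A.Comp_Hom[OF f'(1) g'(1)] B.Comp_Hom[OF f'(2) g'(2)] by (simp add: Hom_prod_cat ff gg)
    fix z h assume h: "h \<in> Hom (prod_cat A B) y z"
    obtain h1 h2 z1 z2 where hh: "h = (h1, h2)" "z = (z1, z2)" by (metis surj_pair)
    have h': "h1 \<in> Hom A y1 z1" "h2 \<in> Hom B y2 z2" using h by (simp_all add: Hom_prod_cat gg hh)
    show "h \<cdot>\<^bsub>prod_cat A B\<^esub> (g \<cdot>\<^bsub>prod_cat A B\<^esub> f) = h \<cdot>\<^bsub>prod_cat A B\<^esub> g \<cdot>\<^bsub>prod_cat A B\<^esub> f"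
      using A.Comp_assoc[OF f'(1) g'(1) h'(1)] B.Comp_assoc[OF f'(2) g'(2) h'(2)] by (simp add: ff gg hh)
  qed
qed

lemma iso_prod_cat:
  assumes "iso_arr (prod_cat A B) p"
  shows "iso_arr A (fst p) \<and> iso_arr B (snd p)"
proof -
  obtain f g where p: "p = (f, g)" by (cases p)
  obtain q where q: "q \<in> Hom (prod_cat A B) (Cod (prod_cat A B) p) (Dom (prod_cat A B) p)"
    "q \<cdot>\<^bsub>prod_cat A B\<^esub> p = Ident (prod_cat A B) (Dom (prod_cat A B) p)"
    "p \<cdot>\<^bsub>prod_cat A B\<^esub> q = Ident (prod_cat A B) (Cod (prod_cat A B) p)" "p \<in> Arr (prod_cat A B)"
    using assms unfolding iso_arr_def by blast
  obtain f' g' where q': "q = (f', g')" by (cases q)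
  show ?thesis
    using q unfolding p q' prod_cat_simps Hom_prod_cat by (simp add: iso_arr_def) blast
qed

lemma iso_prod_catI:
  assumes "iso_arr A f" "iso_arr B g"
  shows "iso_arr (prod_cat A B) (f, g)"
proof -
  obtain f' where f': "f' \<in> Hom A (Cod A f) (Dom A f)" "f' \<cdot>\<^bsub>A\<^esub> f = Ident A (Dom A f)" "f \<cdot>\<^bsub>A\<^esub> f' = Ident A (Cod A f)"
    using assms unfolding iso_arr_def by blast
  obtain g' where g': "g' \<in> Hom B (Cod B g) (Dom B g)" "g' \<cdot>\<^bsub>B\<^esub> g = Ident B (Dom B g)" "g \<cdot>\<^bsub>B\<^esub> g' = Ident B (Cod B g)"
    using assms unfolding iso_arr_def by blast
  show ?thesis unfolding iso_arr_def[of "prod_cat A B"]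
    using assms[unfolded iso_arr_def] f' g' by (intro conjI bexI[of _ "(f', g')"]) (simp_all add: Hom_prod_cat)
qed

section \<open>Functors, natural transformations and the categories \<open>Fun\<close>\<close>

lemma nat_transI:
  assumes "cat_functor A B \<Phi>" "cat_functor A B \<Psi>" "\<eta> \<in> extensional (Obj A)"
    "\<And>x. x \<in> Obj A \<Longrightarrow> \<eta> x \<in> Hom B (on_obj \<Phi> x) (on_obj \<Psi> x)"
    "\<And>f x y. f \<in> Hom A x y \<Longrightarrow> \<eta> y \<cdot>\<^bsub>B\<^esub> on_arr \<Phi> f = on_arr \<Psi> f \<cdot>\<^bsub>B\<^esub> \<eta> x"
  shows "nat_trans A B \<Phi> \<Psi> \<eta>"
  using assms by (auto simp: nat_trans_def Hom_def)

lemma cat_functorD: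
  assumes "cat_functor A B H"
  shows "category A" "category B" "x \<in> Obj A \<Longrightarrow> on_obj H x \<in> Obj B"
    "f \<in> Hom A x y \<Longrightarrow> on_arr H f \<in> Hom B (on_obj H x) (on_obj H y)"
proof -
  interpret cat_functor A B H by fact
  show "category A" "category B" by (rule A.category_axioms B.category_axioms)+
  show "x \<in> Obj A \<Longrightarrow> on_obj H x \<in> Obj B" by (rule PiE_mem[OF obj_maps])
  show "f \<in> Hom A x y \<Longrightarrow> on_arr H f \<in> Hom B (on_obj H x) (on_obj H y)" by (rule arr_maps)
qed

lemma functor_iso:
  assumes "cat_functor A B H" "f \<in> Hom A x y" "iso_arr A f"
  shows "iso_arr B (on_arr H f)"
proof -
  interpret cat_functor A B H by fact
  obtain g where g: "g \<in> Hom A y x" "g \<cdot>\<^bsub>A\<^esub> f = Ident A x" "f \<cdot>\<^bsub>A\<^esub> g = Ident A y" "iso_arr A g"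
    by (rule A.iso_inverse[OF assms(2,3)])
  show ?thesis
    using B.isoI[OF arr_maps[OF assms(2)] arr_maps[OF g(1)]] pres_Comp[OF assms(2) g(1)] pres_Comp[OF g(1) assms(2)]
      pres_Ident A.Hom_Obj[OF g(1)] g by simp
qed

lemma nat_trans_Ident:
  assumes "cat_functor A B \<Phi>"
  shows "nat_trans A B \<Phi> \<Phi> (\<lambda>x\<in>Obj A. Ident B (on_obj \<Phi> x))"
proof -
  interpret cat_functor A B \<Phi> by fact
  show ?thesis
  proof (rule nat_transI[OF assms assms])
    fix f x y assume f: "f \<in> Hom A x y"
    show "(\<lambda>x\<in>Obj A. Ident B (on_obj \<Phi> x)) y \<cdot>\<^bsub>B\<^esub> on_arr \<Phi> f = on_arr \<Phi> f \<cdot>\<^bsub>B\<^esub> (\<lambda>x\<in>Obj A. Ident B (on_obj \<Phi> x)) x"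
      using A.Hom_Obj[OF f] B.Ident_left[OF arr_maps[OF f]] B.Ident_right[OF arr_maps[OF f]] by simp
  qed (simp_all add: B.Ident_Hom cat_functorD(3)[OF assms])
qed

lemma nat_trans_comp:
  assumes 1: "nat_trans A B \<Phi> \<Psi> \<eta>" and 2: "nat_trans A B \<Psi> \<Xi> \<theta>"
  shows "nat_trans A B \<Phi> \<Xi> (\<lambda>x\<in>Obj A. \<theta> x \<cdot>\<^bsub>B\<^esub> \<eta> x)"
proof -
  note n1 = nat_transD[OF 1] and n2 = nat_transD[OF 2]
  interpret F: cat_functor A B \<Phi> by (rule n1)
  interpret G: cat_functor A B \<Psi> by (rule n1)
  interpret H: cat_functor A B \<Xi> by (rule n2)
  show ?thesis
  proof (rule nat_transI[OF n1(1) n2(2)])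
    fix f x y assume f: "f \<in> Hom A x y"
    note o = F.A.Hom_Obj[OF f]
    have "\<theta> y \<cdot>\<^bsub>B\<^esub> \<eta> y \<cdot>\<^bsub>B\<^esub> on_arr \<Phi> f = \<theta> y \<cdot>\<^bsub>B\<^esub> (on_arr \<Psi> f \<cdot>\<^bsub>B\<^esub> \<eta> x)"
      using F.B.Comp_assoc[OF F.arr_maps[OF f] n1(4)[OF o(2)] n2(4)[OF o(2)]] n1(5)[OF f] by simp
    also have "\<dots> = on_arr \<Xi> f \<cdot>\<^bsub>B\<^esub> \<theta> x \<cdot>\<^bsub>B\<^esub> \<eta> x"
      using F.B.Comp_assoc[OF n1(4)[OF o(1)] G.arr_maps[OF f] n2(4)[OF o(2)]] n2(5)[OF f] by simp
    also have "\<dots> = on_arr \<Xi> f \<cdot>\<^bsub>B\<^esub> (\<theta> x \<cdot>\<^bsub>B\<^esub> \<eta> x)"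
      using F.B.Comp_assoc[OF n1(4)[OF o(1)] n2(4)[OF o(1)] H.arr_maps[OF f]] by simp
    finally show "(\<lambda>x\<in>Obj A. \<theta> x \<cdot>\<^bsub>B\<^esub> \<eta> x) y \<cdot>\<^bsub>B\<^esub> on_arr \<Phi> f = on_arr \<Xi> f \<cdot>\<^bsub>B\<^esub> (\<lambda>x\<in>Obj A. \<theta> x \<cdot>\<^bsub>B\<^esub> \<eta> x) x"
      using o by simp
  next
    fix x assume x: "x \<in> Obj A"
    then show "(\<lambda>x\<in>Obj A. \<theta> x \<cdot>\<^bsub>B\<^esub> \<eta> x) x \<in> Hom B (on_obj \<Phi> x) (on_obj \<Xi> x)"
      using F.B.Comp_Hom[OF n1(4)[OF x] n2(4)[OF x]] by simp
  qed simp
qed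

lemma Obj_Fun: "\<Phi> \<in> Obj (Fun A) \<longleftrightarrow> cat_functor A vect \<Phi> \<and> finite_support A \<Phi>"
  by (auto simp: Fun_def full_subcat_def functor_cat_def)

lemma Hom_Fun: "t \<in> Hom (Fun A) \<Phi> \<Psi> \<longleftrightarrow> finite_support A \<Phi> \<and> finite_support A \<Psi> \<and>
    (\<exists>\<eta>. t = (\<Phi>, \<Psi>, \<eta>) \<and> nat_trans A vect \<Phi> \<Psi> \<eta>)"
  by (auto simp: Fun_def full_subcat_def functor_cat_def Hom_def)

lemma Ident_Fun: "Ident (Fun A) \<Phi> = (\<Phi>, \<Phi>, \<lambda>x\<in>Obj A. Ident vect (on_obj \<Phi> x))"
  by (simp add: Fun_def full_subcat_def functor_cat_def)

lemma Comp_Fun: "(\<Psi>, \<Xi>, \<theta>) \<cdot>\<^bsub>Fun A\<^esub> (\<Phi>, \<Psi>', \<eta>) = (\<Phi>, \<Xi>, \<lambda>x\<in>Obj A. \<theta> x \<cdot>\<^sub>v \<eta> x)"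
  by (simp add: Fun_def full_subcat_def functor_cat_def)

lemma Fun_simps [simp]: "Dom (Fun A) (\<Phi>, \<Psi>, \<eta>) = \<Phi>" "Cod (Fun A) (\<Phi>, \<Psi>, \<eta>) = \<Psi>"
  by (simp_all add: Fun_def full_subcat_def functor_cat_def)

lemma category_Fun: "category (Fun A)"
proof
  fix f :: "('a, 'b, 'c) vntrans" assume "f \<in> Arr (Fun A)"
  then have "f \<in> Hom (Fun A) (Dom (Fun A) f) (Cod (Fun A) f)" by (rule HomI)
  then show "Dom (Fun A) f \<in> Obj (Fun A)" "Cod (Fun A) f \<in> Obj (Fun A)"
    by (auto simp: Hom_Fun Obj_Fun dest: nat_transD(1,2))
next
  fix \<Phi> :: "('a, 'b, 'c) vfct" assume "\<Phi> \<in> Obj (Fun A)"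
  then show "Ident (Fun A) \<Phi> \<in> Hom (Fun A) \<Phi> \<Phi>"
    by (simp add: Hom_Fun Ident_Fun Obj_Fun nat_trans_Ident)
next
  fix w x :: "('a, 'b, 'c) vfct" and f assume "f \<in> Hom (Fun A) w x"
  then obtain f' where f: "f = (w, x, f')" "nat_trans A vect w x f'" "finite_support A w" "finite_support A x"
    by (auto simp: Hom_Fun)
  note F = nat_transD[OF f(2)]
  show "Ident (Fun A) x \<cdot>\<^bsub>Fun A\<^esub> f = f" "f \<cdot>\<^bsub>Fun A\<^esub> Ident (Fun A) w = f"
    using F(3) by (auto simp: f Ident_Fun Comp_Fun vect.Ident_left[OF F(4)] vect.Ident_right[OF F(4)]
        intro!: extensionalityI[of _ "Obj A"])
  fix y g assume "g \<in> Hom (Fun A) x y"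
  then obtain g' where g: "g = (x, y, g')" "nat_trans A vect x y g'" "finite_support A y"
    by (auto simp: Hom_Fun)
  note G = nat_transD[OF g(2)]
  show "g \<cdot>\<^bsub>Fun A\<^esub> f \<in> Hom (Fun A) w y"
    using nat_trans_comp[OF f(2) g(2)] f(3) g(3) by (simp add: f g Comp_Fun Hom_Fun)
  fix z h assume "h \<in> Hom (Fun A) y z"
  then obtain h' where h: "h = (y, z, h')" "nat_trans A vect y z h'" by (auto simp: Hom_Fun)
  note H = nat_transD[OF h(2)]
  show "h \<cdot>\<^bsub>Fun A\<^esub> (g \<cdot>\<^bsub>Fun A\<^esub> f) = h \<cdot>\<^bsub>Fun A\<^esub> g \<cdot>\<^bsub>Fun A\<^esub> f"
    by (auto simp: f g h Comp_Fun vect.Comp_assoc[OF F(4) G(4) H(4)] intro!: restrict_ext)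
qed

lemma fcomp_functor:
  assumes H: "cat_functor A B H" and K: "cat_functor B D K"
  shows "cat_functor A D (fcomp A K H)"
proof -
  interpret H: cat_functor A B H by fact
  interpret K: cat_functor B D K by fact
  have o: "x \<in> Obj A \<Longrightarrow> on_obj (fcomp A K H) x = on_obj K (on_obj H x)" for x
    by (simp add: fcomp_def compose_def)
  have a: "f \<in> Hom A x y \<Longrightarrow> on_arr (fcomp A K H) f = on_arr K (on_arr H f)" for f x y
    by (simp add: fcomp_def compose_def HomD)
  show ?thesis
  proof
    show "on_obj (fcomp A K H) \<in> Obj A \<rightarrow>\<^sub>E Obj D"
      by (rule PiE_I) (simp_all add: fcomp_def compose_def cat_functorD(3)[OF H] cat_functorD(3)[OF K])
    show "on_arr (fcomp A K H) \<in> extensional (Arr A)" by (simp add: fcomp_def compose_def)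
    fix x y f assume f: "f \<in> Hom A x y"
    show "on_arr (fcomp A K H) f \<in> Hom D (on_obj (fcomp A K H) x) (on_obj (fcomp A K H) y)"
      using K.arr_maps[OF H.arr_maps[OF f]] H.A.Hom_Obj[OF f] by (simp add: o a[OF f])
    fix w g assume g: "g \<in> Hom A y w"
    show "on_arr (fcomp A K H) (g \<cdot>\<^bsub>A\<^esub> f) = on_arr (fcomp A K H) g \<cdot>\<^bsub>D\<^esub> on_arr (fcomp A K H) f"
      using K.pres_Comp[OF H.arr_maps[OF f] H.arr_maps[OF g]] H.pres_Comp[OF f g]
      by (simp add: a[OF f] a[OF g] a[OF H.A.Comp_Hom[OF f g]])
  next
    fix x assume x: "x \<in> Obj A"
    show "on_arr (fcomp A K H) (Ident A x) = Ident D (on_obj (fcomp A K H) x)"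
      using K.pres_Ident[OF cat_functorD(3)[OF H x]] H.pres_Ident[OF x]
      by (simp add: o[OF x] a[OF H.A.Ident_Hom[OF x]])
  qed
qed

lemma fcomp_simps:
  "x \<in> Obj A \<Longrightarrow> on_obj (fcomp A K H) x = on_obj K (on_obj H x)"
  "f \<in> Hom A x y \<Longrightarrow> on_arr (fcomp A K H) f = on_arr K (on_arr H f)"
  by (simp_all add: fcomp_def compose_def HomD)

section \<open>Two-fibers and their projections\<close>

lemma two_fiber_Obj: "(a, \<phi>) \<in> Obj (two_fiber A B H b) \<longleftrightarrow>
    a \<in> Obj A \<and> \<phi> \<in> Hom B (on_obj H a) b \<and> iso_arr B \<phi>"
  by (simp add: two_fiber_def)

lemma two_fiber_Hom: "t \<in> Hom (two_fiber A B H b) p q \<longleftrightarrow>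
    p \<in> Obj (two_fiber A B H b) \<and> q \<in> Obj (two_fiber A B H b) \<and>
    (\<exists>u \<in> Hom A (fst p) (fst q). t = (p, q, u) \<and> snd q \<cdot>\<^bsub>B\<^esub> on_arr H u = snd p)"
  by (cases p; cases q) (auto simp: two_fiber_def Hom_def)

lemma two_fiber_simps:
  "Ident (two_fiber A B H b) (a, \<phi>) = ((a, \<phi>), (a, \<phi>), Ident A a)"
  "(q, r, v) \<cdot>\<^bsub>two_fiber A B H b\<^esub> (p, q', u) = (p, r, v \<cdot>\<^bsub>A\<^esub> u)"
  by (simp_all add: two_fiber_def)

lemma two_fiber_category:
  assumes "cat_functor A B H"
  shows "category (two_fiber A B H b)"
proof -
  interpret cat_functor A B H by fact
  let ?T = "two_fiber A B H b"
  show ?thesis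
  proof
    fix f assume "f \<in> Arr ?T"
    then have "f \<in> Hom ?T (Dom ?T f) (Cod ?T f)" by (rule HomI)
    then show "Dom ?T f \<in> Obj ?T" "Cod ?T f \<in> Obj ?T" by (auto simp: two_fiber_Hom)
  next
    fix x assume x: "x \<in> Obj ?T"
    obtain a \<phi> where p: "x = (a, \<phi>)" by (cases x)
    have h: "a \<in> Obj A" "\<phi> \<in> Hom B (on_obj H a) b" using x by (auto simp: p two_fiber_Obj)
    show "Ident ?T x \<in> Hom ?T x x"
      using x A.Ident_Hom[OF h(1)] pres_Ident[OF h(1)] B.Ident_right[OF h(2)] by (simp add: p two_fiber_Hom two_fiber_simps)
  next
    fix w x f assume f0: "f \<in> Hom ?T w x"
    then obtain u where f: "f = (w, x, u)" "u \<in> Hom A (fst w) (fst x)" "snd x \<cdot>\<^bsub>B\<^esub> on_arr H u = snd w"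
      "w \<in> Obj ?T" "x \<in> Obj ?T"
      by (auto simp: two_fiber_Hom)
    show "Ident ?T x \<cdot>\<^bsub>?T\<^esub> f = f" "f \<cdot>\<^bsub>?T\<^esub> Ident ?T w = f"
      using A.Ident_left[OF f(2)] A.Ident_right[OF f(2)] by (cases x; cases w; simp add: f(1) two_fiber_simps)+
    fix y g assume "g \<in> Hom ?T x y"
    then obtain v where g: "g = (x, y, v)" "v \<in> Hom A (fst x) (fst y)" "snd y \<cdot>\<^bsub>B\<^esub> on_arr H v = snd x" "y \<in> Obj ?T"
      by (auto simp: two_fiber_Hom)
    have "snd y \<in> Hom B (on_obj H (fst y)) b" using g(4) by (cases y) (simp add: two_fiber_Obj)
    then have "snd y \<cdot>\<^bsub>B\<^esub> on_arr H (v \<cdot>\<^bsub>A\<^esub> u) = snd w"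
      using B.Comp_assoc[OF arr_maps[OF f(2)] arr_maps[OF g(2)]] pres_Comp[OF f(2) g(2)] f(3) g(3) by metis
    then show "g \<cdot>\<^bsub>?T\<^esub> f \<in> Hom ?T w y"
      using A.Comp_Hom[OF f(2) g(2)] f(4) g(4) by (simp add: f(1) g(1) two_fiber_simps two_fiber_Hom)
    fix z h assume "h \<in> Hom ?T y z"
    then obtain t where h: "h = (y, z, t)" "t \<in> Hom A (fst y) (fst z)" by (auto simp: two_fiber_Hom)
    show "h \<cdot>\<^bsub>?T\<^esub> (g \<cdot>\<^bsub>?T\<^esub> f) = h \<cdot>\<^bsub>?T\<^esub> g \<cdot>\<^bsub>?T\<^esub> f"
      using A.Comp_assoc[OF f(2) g(2) h(2)] by (simp add: f(1) g(1) h(1) two_fiber_simps)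
  qed
qed

lemma fiber_proj_functor:
  assumes "cat_functor A B H"
  shows "cat_functor (two_fiber A B H b) A (fiber_proj A B H b)"
proof -
  interpret cat_functor A B H by fact
  let ?T = "two_fiber A B H b" and ?P = "fiber_proj A B H b"
  interpret T: category ?T by (rule two_fiber_category[OF assms])
  have o: "on_obj ?P (a, \<phi>) = a" if "(a, \<phi>) \<in> Obj ?T" for a \<phi> using that by (simp add: fiber_proj_def)
  have a: "on_arr ?P t = snd (snd t)" if "t \<in> Arr ?T" for t using that by (cases t) (simp add: fiber_proj_def)
  show ?thesis
  proof
    show "on_obj ?P \<in> Obj ?T \<rightarrow>\<^sub>E Obj A"
      by (rule PiE_I) (auto simp: fiber_proj_def two_fiber_Obj split: prod.splits)
    show "on_arr ?P \<in> extensional (Arr ?T)" by (simp add: fiber_proj_def)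
    fix w x f assume f0: "f \<in> Hom ?T w x"
    then obtain u where f: "f = (w, x, u)" "u \<in> Hom A (fst w) (fst x)" "w \<in> Obj ?T" "x \<in> Obj ?T" by (auto simp: two_fiber_Hom)
    then show "on_arr ?P f \<in> Hom A (on_obj ?P w) (on_obj ?P x)"
      using a[OF HomD(1)[OF f0]] by (cases w; cases x) (simp add: o)
    fix y g assume g0: "g \<in> Hom ?T x y"
    then obtain v where g: "g = (x, y, v)" by (auto simp: two_fiber_Hom)
    show "on_arr ?P (g \<cdot>\<^bsub>?T\<^esub> f) = on_arr ?P g \<cdot>\<^bsub>A\<^esub> on_arr ?P f"
      unfolding a[OF HomD(1)[OF T.Comp_Hom[OF f0 g0]]] a[OF HomD(1)[OF f0]] a[OF HomD(1)[OF g0]]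
      by (simp add: f g two_fiber_simps)
  next
    fix x assume x: "x \<in> Obj ?T"
    show "on_arr ?P (Ident ?T x) = Ident A (on_obj ?P x)"
      unfolding a[OF HomD(1)[OF T.Ident_Hom[OF x]]] using x by (cases x) (simp add: two_fiber_simps o)
  qed
qed

text \<open>The injection makes \<open>'v\<close> large enough for a copy of every coordinate space
  over the complex numbers, by \<open>coord_space_inj\<close>; hence the chosen tensor products and
  colimits exist.\<close>

locale complex_universe =
  fixes \<iota> :: "complex \<Rightarrow> 'v"
  assumes inj_\<iota>: "inj \<iota>"
begin

context
  fixes V W :: "'v vspace"
  assumes V: "V \<in> Obj vect" and W: "W \<in> Obj vect"
begin

text \<open>\<open>tensor_exists\<close> justifies the \<open>SOME\<close> in \<open>tensor\<close>.
  From here on tensor products are accessed through the universal property.\<close>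

lemma tensor_product: "is_tensor_product V W (tensor_obj V W) (tensor_vec V W)"
proof -
  have "\<exists>p. case p of (P, \<tau>) \<Rightarrow> is_tensor_product V W P \<tau>"
    using tensor_exists[OF inj_\<iota> V W] by auto
  from someI_ex[OF this] show ?thesis
    unfolding tensor_obj_def tensor_vec_def tensor_def case_prod_unfold .
qed

lemma tensor_obj_vect: "tensor_obj V W \<in> Obj vect"
  using tensor_product by (simp add: is_tensor_product_def)

lemma tensor_vec_linear_right: "v \<in> carrier V \<Longrightarrow> linmap W (tensor_obj V W) (tensor_vec V W v)"
  using tensor_product by (simp add: is_tensor_product_def bilinear_map_iff)

lemma tensor_vec_linear_left: "w \<in> carrier W \<Longrightarrow> linmap V (tensor_obj V W) (\<lambda>v. tensor_vec V W v w)"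
  using tensor_product by (simp add: is_tensor_product_def bilinear_map_iff)

lemma tensor_vec_closed: "v \<in> carrier V \<Longrightarrow> w \<in> carrier W \<Longrightarrow> tensor_vec V W v w \<in> carrier (tensor_obj V W)"
  by (rule linmap_closed[OF tensor_vec_linear_right])

lemma tensor_universal:
  assumes "U \<in> Obj vect" "bilinear_map V W U \<beta>"
  obtains m where "m \<in> Hom vect (tensor_obj V W) U"
    "\<And>v w. v \<in> carrier V \<Longrightarrow> w \<in> carrier W \<Longrightarrow> app m (tensor_vec V W v w) = \<beta> v w"
  using tensor_product assms unfolding is_tensor_product_def by blast

lemma tensor_ext:
  assumes m: "m \<in> Hom vect (tensor_obj V W) U" and n: "n \<in> Hom vect (tensor_obj V W) U"
    and eq: "\<And>v w. v \<in> carrier V \<Longrightarrow> w \<in> carrier W \<Longrightarrow> app m (tensor_vec V W v w) = app n (tensor_vec V W v w)"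
  shows "m = n"
proof -
  note mD = vect_HomD[OF m]
  have "bilinear_map V W U (\<lambda>v w. app m (tensor_vec V W v w))"
    unfolding bilinear_map_iff
    using linmap_comp[OF tensor_vec_linear_right mD(3)] linmap_comp[OF tensor_vec_linear_left mD(3)] by blast
  then have "\<exists>!n. n \<in> Hom vect (tensor_obj V W) U \<and>
      (\<forall>v\<in>carrier V. \<forall>w\<in>carrier W. app n (tensor_vec V W v w) = app m (tensor_vec V W v w))"
    using tensor_product mD(2) unfolding is_tensor_product_def by blast
  then show ?thesis using m n eq by metis
qed

text \<open>If one factor is zero, all pure tensors vanish, so the identity and the zero map agree
  on them and are equal by \<open>tensor_ext\<close>.\<close>

lemma tensor_obj_zero:
  assumes "carrier V = {\<zero>\<^bsub>V\<^esub>} \<or> carrier W = {\<zero>\<^bsub>W\<^esub>}"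
  shows "carrier (tensor_obj V W) = {\<zero>\<^bsub>tensor_obj V W\<^esub>}"
proof -
  let ?T = "tensor_obj V W"
  note T = tensor_obj_vect
  have "Ident vect ?T = mk_lin ?T ?T (\<lambda>_. \<zero>\<^bsub>?T\<^esub>)"
  proof (rule tensor_ext[OF vect.Ident_Hom[OF T] mk_lin_Hom[OF T T linmap_zero_map[OF T]]])
    fix v w assume v: "v \<in> carrier V" and w: "w \<in> carrier W"
    have "tensor_vec V W v w = \<zero>\<^bsub>?T\<^esub>"
      using assms linmap_zero[OF V T tensor_vec_linear_left[OF w]] linmap_zero[OF W T tensor_vec_linear_right[OF v]] v w
      by auto
    then show "app (Ident vect ?T) (tensor_vec V W v w) = app (mk_lin ?T ?T (\<lambda>_. \<zero>\<^bsub>?T\<^esub>)) (tensor_vec V W v w)"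
      using T by simp
  qed
  then have "v = \<zero>\<^bsub>?T\<^esub>" if "v \<in> carrier ?T" for v
    using app_Ident[OF that] app_mk_lin[OF that, of ?T "\<lambda>_. \<zero>\<^bsub>?T\<^esub>"] by simp
  then show ?thesis using vs_zero[OF T] by blast
qed

end

text \<open>Existence and uniqueness from the universal property give the \<open>THE\<close> in
  \<open>tensor_arr\<close> its meaning.\<close>

lemma tensor_arr_spec:
  fixes f :: "'v lin"
  assumes f: "f \<in> Hom vect V V'" and g: "g \<in> Hom vect W W'"
  shows "tensor_arr f g \<in> Hom vect (tensor_obj V W) (tensor_obj V' W') \<and>
    (\<forall>v\<in>carrier V. \<forall>w\<in>carrier W. app (tensor_arr f g) (tensor_vec V W v w) = tensor_vec V' W' (app f v) (app g w))"
proof -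
  note F = vect_HomD[OF f] and G = vect_HomD[OF g]
  have "bilinear_map V W (tensor_obj V' W') (\<lambda>v w. tensor_vec V' W' (app f v) (app g w))"
    unfolding bilinear_map_iff
    using linmap_comp[OF G(3) tensor_vec_linear_right[OF F(2) G(2) vect_app_closed[OF f]]]
      linmap_comp[OF F(3) tensor_vec_linear_left[OF F(2) G(2) vect_app_closed[OF g]]] by blast
  then obtain m where m: "m \<in> Hom vect (tensor_obj V W) (tensor_obj V' W')"
    "\<And>v w. v \<in> carrier V \<Longrightarrow> w \<in> carrier W \<Longrightarrow> app m (tensor_vec V W v w) = tensor_vec V' W' (app f v) (app g w)"
    using tensor_universal[OF F(1) G(1) tensor_obj_vect[OF F(2) G(2)]] by blast
  let ?P = "\<lambda>m. m \<in> Hom vect (tensor_obj V W) (tensor_obj V' W') \<and>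
    (\<forall>v\<in>carrier V. \<forall>w\<in>carrier W. app m (tensor_vec V W v w) = tensor_vec V' W' (app f v) (app g w))"
  have "?P (THE m. ?P m)"
  proof (rule theI[of ?P m])
    show "?P m" using m by blast
    show "n = m" if "?P n" for n
      using that m by (intro tensor_ext[OF F(1) G(1), where U = "tensor_obj V' W'"]) auto
  qed
  then show ?thesis unfolding tensor_arr_def HomD[OF f] HomD[OF g] .
qed

lemma tensor_arr_Hom: fixes f :: "'v lin" shows "f \<in> Hom vect V V' \<Longrightarrow> g \<in> Hom vect W W' \<Longrightarrow>
    tensor_arr f g \<in> Hom vect (tensor_obj V W) (tensor_obj V' W')"
  using tensor_arr_spec by blast

lemma app_tensor_arr: fixes f :: "'v lin" shows "f \<in> Hom vect V V' \<Longrightarrow> g \<in> Hom vect W W' \<Longrightarrow> v \<in> carrier V \<Longrightarrow> w \<in> carrier W \<Longrightarrow>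
    app (tensor_arr f g) (tensor_vec V W v w) = tensor_vec V' W' (app f v) (app g w)"
  using tensor_arr_spec by blast

lemma tensor_arr_Ident:
  fixes V :: "'v vspace"
  assumes V: "V \<in> Obj vect" and W: "W \<in> Obj vect"
  shows "tensor_arr (Ident vect V) (Ident vect W) = Ident vect (tensor_obj V W)"
proof (rule tensor_ext[OF V W])
  note i = vect.Ident_Hom[OF V] vect.Ident_Hom[OF W]
  show "tensor_arr (Ident vect V) (Ident vect W) \<in> Hom vect (tensor_obj V W) (tensor_obj V W)"
    by (rule tensor_arr_Hom[OF i])
  show "Ident vect (tensor_obj V W) \<in> Hom vect (tensor_obj V W) (tensor_obj V W)"
    by (rule vect.Ident_Hom[OF tensor_obj_vect[OF V W]])
  fix v w assume v: "v \<in> carrier V" "w \<in> carrier W"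
  show "app (tensor_arr (Ident vect V) (Ident vect W)) (tensor_vec V W v w) = app (Ident vect (tensor_obj V W)) (tensor_vec V W v w)"
    using v by (simp add: app_tensor_arr[OF i] tensor_vec_closed[OF V W])
qed

lemma tensor_arr_comp:
  fixes f :: "'v lin"
  assumes f: "f \<in> Hom vect V V'" "f' \<in> Hom vect V' V''" and g: "g \<in> Hom vect W W'" "g' \<in> Hom vect W' W''"
  shows "tensor_arr (f' \<cdot>\<^sub>v f) (g' \<cdot>\<^sub>v g) = tensor_arr f' g' \<cdot>\<^sub>v tensor_arr f g"
proof (rule tensor_ext[OF vect_HomD(1)[OF f(1)] vect_HomD(1)[OF g(1)]])
  note F = vect.Comp_Hom[OF f] and G = vect.Comp_Hom[OF g]
  show "tensor_arr (f' \<cdot>\<^sub>v f) (g' \<cdot>\<^sub>v g) \<in> Hom vect (tensor_obj V W) (tensor_obj V'' W'')"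
    by (rule tensor_arr_Hom[OF F G])
  show "tensor_arr f' g' \<cdot>\<^sub>v tensor_arr f g \<in> Hom vect (tensor_obj V W) (tensor_obj V'' W'')"
    by (rule vect.Comp_Hom[OF tensor_arr_Hom[OF f(1) g(1)] tensor_arr_Hom[OF f(2) g(2)]])
  fix v w assume v: "v \<in> carrier V" "w \<in> carrier W"
  note t = tensor_vec_closed[OF vect_HomD(1)[OF f(1)] vect_HomD(1)[OF g(1)] v]
  show "app (tensor_arr (f' \<cdot>\<^sub>v f) (g' \<cdot>\<^sub>v g)) (tensor_vec V W v w) =
      app (tensor_arr f' g' \<cdot>\<^sub>v tensor_arr f g) (tensor_vec V W v w)"
    unfolding app_comp[OF tensor_arr_Hom[OF f(1) g(1)] t] app_tensor_arr[OF F G v]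
      app_tensor_arr[OF f(1) g(1) v] app_comp[OF f(1) v(1)] app_comp[OF g(1) v(2)]
    using app_tensor_arr[OF f(2) g(2) vect_app_closed[OF f(1) v(1)] vect_app_closed[OF g(1) v(2)]] ..
qed

section \<open>The external tensor product of functors\<close>

lemma box_fct_simps:
  "x \<in> Obj A \<Longrightarrow> y \<in> Obj B \<Longrightarrow> on_obj (box_fct A B \<Phi> \<Psi>) (x, y) = tensor_obj (on_obj \<Phi> x) (on_obj \<Psi> y)"
  "f \<in> Arr A \<Longrightarrow> g \<in> Arr B \<Longrightarrow> on_arr (box_fct A B \<Phi> \<Psi>) (f, g) = tensor_arr (on_arr \<Phi> f) (on_arr \<Psi> g)"
  by (simp_all add: box_fct_def)

lemma box_fct_functor:
  fixes \<Phi> :: "('o, 'a, 'v) vfct" and \<Psi> :: "('p, 'b, 'v) vfct"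
  assumes \<Phi>: "cat_functor A vect \<Phi>" and \<Psi>: "cat_functor B vect \<Psi>"
  shows "cat_functor (prod_cat A B) vect (box_fct A B \<Phi> \<Psi>)"
proof -
  interpret F: cat_functor A vect \<Phi> by fact
  interpret G: cat_functor B vect \<Psi> by fact
  interpret P: category "prod_cat A B"
    by (rule prod_category[OF F.A.category_axioms G.A.category_axioms])
  let ?X = "box_fct A B \<Phi> \<Psi>"
  show ?thesis
  proof
    show "on_obj ?X \<in> Obj (prod_cat A B) \<rightarrow>\<^sub>E Obj vect"
      by (rule PiE_I) (auto simp: box_fct_def tensor_obj_vect cat_functorD(3)[OF \<Phi>] cat_functorD(3)[OF \<Psi>])
    show "on_arr ?X \<in> extensional (Arr (prod_cat A B))" by (simp add: box_fct_def)
  next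
    fix x assume "x \<in> Obj (prod_cat A B)"
    then obtain a b where x: "x = (a, b)" "a \<in> Obj A" "b \<in> Obj B" by auto
    show "on_arr ?X (Ident (prod_cat A B) x) = Ident vect (on_obj ?X x)"
      using x by (simp add: box_fct_simps HomD(1)[OF F.A.Ident_Hom] HomD(1)[OF G.A.Ident_Hom] F.pres_Ident G.pres_Ident
          tensor_arr_Ident cat_functorD(3)[OF \<Phi>] cat_functorD(3)[OF \<Psi>])
  next
    fix p x y assume p: "p \<in> Hom (prod_cat A B) x y"
    obtain f g a b a' b' where e: "p = (f, g)" "x = (a, b)" "y = (a', b')" by (metis surj_pair)
    have f: "f \<in> Hom A a a'" and g: "g \<in> Hom B b b'" using p by (simp_all add: e Hom_prod_cat)
    show "on_arr ?X p \<in> Hom vect (on_obj ?X x) (on_obj ?X y)"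
      using tensor_arr_Hom[OF F.arr_maps[OF f] G.arr_maps[OF g]] F.A.Hom_Obj[OF f] G.A.Hom_Obj[OF g]
      by (simp add: e box_fct_simps HomD(1)[OF f] HomD(1)[OF g])
    fix q w assume q: "q \<in> Hom (prod_cat A B) y w"
    obtain f' g' a'' b'' where e': "q = (f', g')" "w = (a'', b'')" by (metis surj_pair)
    have f': "f' \<in> Hom A a' a''" and g': "g' \<in> Hom B b' b''" using q by (simp_all add: e e' Hom_prod_cat)
    show "on_arr ?X (q \<cdot>\<^bsub>prod_cat A B\<^esub> p) = on_arr ?X q \<cdot>\<^sub>v on_arr ?X p"
      using tensor_arr_comp[OF F.arr_maps[OF f] F.arr_maps[OF f'] G.arr_maps[OF g] G.arr_maps[OF g']]
      by (simp add: e e' box_fct_simps HomD(1)[OF f] HomD(1)[OF g] HomD(1)[OF f'] HomD(1)[OF g']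
          HomD(1)[OF F.A.Comp_Hom[OF f f']] HomD(1)[OF G.A.Comp_Hom[OF g g']] F.pres_Comp[OF f f'] G.pres_Comp[OF g g'])
  qed
qed

lemma iso_class_prod: "iso_class (prod_cat A B) (x, y) \<subseteq> iso_class A x \<times> iso_class B y"
  unfolding iso_class_def using iso_prod_cat by (fastforce simp: Hom_prod_cat)

lemma iso_class_prod_eq: "iso_class (prod_cat A B) (x, y) = iso_class A x \<times> iso_class B y"
proof
  show "iso_class A x \<times> iso_class B y \<subseteq> iso_class (prod_cat A B) (x, y)"
  proof clarify
    fix a b assume "a \<in> iso_class A x" "b \<in> iso_class B y"
    then obtain f g where "f \<in> Hom A x a" "iso_arr A f" "g \<in> Hom B y b" "iso_arr B g"
      unfolding iso_class_def by blast
    then show "(a, b) \<in> iso_class (prod_cat A B) (x, y)"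
      unfolding iso_class_def by (auto intro!: bexI[of _ "(f, g)"] iso_prod_catI simp: Hom_prod_cat)
  qed
qed (rule iso_class_prod)

text \<open>A tensor product is nonzero only if both factors are, so the supporting classes are
  products of supporting classes of the two functors.\<close>

lemma box_fct_Obj:
  fixes \<Phi> :: "('o, 'a, 'v) vfct" and \<Psi> :: "('p, 'b, 'v) vfct"
  assumes \<Phi>: "\<Phi> \<in> Obj (Fun A)" and \<Psi>: "\<Psi> \<in> Obj (Fun B)"
  shows "box_fct A B \<Phi> \<Psi> \<in> Obj (Fun (prod_cat A B))"
proof -
  have F: "cat_functor A vect \<Phi>" "finite_support A \<Phi>" and G: "cat_functor B vect \<Psi>" "finite_support B \<Psi>"
    using \<Phi> \<Psi> by (simp_all add: Obj_Fun)
  let ?S = "\<lambda>A \<Phi>. {iso_class A x |x. x \<in> Obj A \<and> carrier (on_obj \<Phi> x) \<noteq> {\<zero>\<^bsub>on_obj \<Phi> x\<^esub>}}"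
  have "?S (prod_cat A B) (box_fct A B \<Phi> \<Psi>) \<subseteq> (\<lambda>(c, d). c \<times> d) ` (?S A \<Phi> \<times> ?S B \<Psi>)"
  proof
    fix c assume "c \<in> ?S (prod_cat A B) (box_fct A B \<Phi> \<Psi>)"
    then obtain x y where c: "c = iso_class (prod_cat A B) (x, y)" "x \<in> Obj A" "y \<in> Obj B"
      "carrier (on_obj (box_fct A B \<Phi> \<Psi>) (x, y)) \<noteq> {\<zero>\<^bsub>on_obj (box_fct A B \<Phi> \<Psi>) (x, y)\<^esub>}" by auto
    then have "carrier (on_obj \<Phi> x) \<noteq> {\<zero>\<^bsub>on_obj \<Phi> x\<^esub>} \<and> carrier (on_obj \<Psi> y) \<noteq> {\<zero>\<^bsub>on_obj \<Psi> y\<^esub>}"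
      using tensor_obj_zero[OF cat_functorD(3)[OF F(1) c(2)] cat_functorD(3)[OF G(1) c(3)]]
      by (auto simp: box_fct_simps)
    then have "(iso_class A x, iso_class B y) \<in> ?S A \<Phi> \<times> ?S B \<Psi>" using c by blast
    then show "c \<in> (\<lambda>(c, d). c \<times> d) ` (?S A \<Phi> \<times> ?S B \<Psi>)"
      unfolding c(1) iso_class_prod_eq by (rule rev_image_eqI) simp
  qed
  then have "finite_support (prod_cat A B) (box_fct A B \<Phi> \<Psi>)"
    using F(2) G(2) unfolding finite_support_def by (meson finite_SigmaI finite_imageI finite_subset)
  then show ?thesis using box_fct_functor[OF F(1) G(1)] by (simp add: Obj_Fun)
qed

lemma box_simps:
  "\<Phi> \<in> Obj (Fun A) \<Longrightarrow> \<Psi> \<in> Obj (Fun B) \<Longrightarrow> on_obj (box A B) (\<Phi>, \<Psi>) = box_fct A B \<Phi> \<Psi>"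
  "(\<Phi>, \<Phi>', \<eta>) \<in> Arr (Fun A) \<Longrightarrow> (\<Psi>, \<Psi>', \<theta>) \<in> Arr (Fun B) \<Longrightarrow> on_arr (box A B) ((\<Phi>, \<Phi>', \<eta>), (\<Psi>, \<Psi>', \<theta>)) =
    (box_fct A B \<Phi> \<Psi>, box_fct A B \<Phi>' \<Psi>', \<lambda>(x, y)\<in>Obj A \<times> Obj B. tensor_arr (\<eta> x) (\<theta> y))"
  by (simp_all add: box_def)

lemma box_functor:
  fixes A :: "('o, 'a) cat" and B :: "('p, 'b) cat"
  shows "cat_functor (prod_cat (Fun A) (Fun B)) (Fun (prod_cat A B) :: (('o \<times> 'p, 'a \<times> 'b, 'v) vfct, _) cat) (box A B)"
proof -
  interpret FA: category "Fun A :: (('o, 'a, 'v) vfct, _) cat" by (rule category_Fun)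
  interpret FB: category "Fun B :: (('p, 'b, 'v) vfct, _) cat" by (rule category_Fun)
  interpret P: category "prod_cat (Fun A :: (('o, 'a, 'v) vfct, _) cat) (Fun B :: (('p, 'b, 'v) vfct, _) cat)"
    by (rule prod_category) (rule category_Fun)+
  interpret K: category "Fun (prod_cat A B) :: (('o \<times> 'p, 'a \<times> 'b, 'v) vfct, _) cat" by (rule category_Fun)
  show ?thesis
  proof
    show "on_obj (box A B) \<in> Obj (prod_cat (Fun A) (Fun B)) \<rightarrow>\<^sub>E Obj (Fun (prod_cat A B) :: (('o \<times> 'p, 'a \<times> 'b, 'v) vfct, _) cat)"
      by (rule PiE_I) (auto simp: box_def box_fct_Obj)
    show "on_arr (box A B) \<in> extensional (Arr (prod_cat (Fun A :: (('o, 'a, 'v) vfct, _) cat) (Fun B)))" by (simp add: box_def)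
  next
    fix x :: "('o, 'a, 'v) vfct \<times> ('p, 'b, 'v) vfct"
    assume "x \<in> Obj (prod_cat (Fun A) (Fun B))"
    then obtain \<Phi> \<Psi> where x: "x = (\<Phi>, \<Psi>)" and O: "\<Phi> \<in> Obj (Fun A)" "\<Psi> \<in> Obj (Fun B)" by auto
    have a: "(\<Phi>, \<Phi>, \<lambda>x\<in>Obj A. Ident vect (on_obj \<Phi> x)) \<in> Arr (Fun A)"
      using HomD(1)[OF FA.Ident_Hom[OF O(1)]] by (simp add: Ident_Fun)
    have b: "(\<Psi>, \<Psi>, \<lambda>x\<in>Obj B. Ident vect (on_obj \<Psi> x)) \<in> Arr (Fun B)"
      using HomD(1)[OF FB.Ident_Hom[OF O(2)]] by (simp add: Ident_Fun)
    have c: "cat_functor A vect \<Phi>" "cat_functor B vect \<Psi>" using O by (simp_all add: Obj_Fun)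
    show "on_arr (box A B) (Ident (prod_cat (Fun A) (Fun B)) x) = Ident (Fun (prod_cat A B)) (on_obj (box A B) x)"
      by (auto simp: x Ident_Fun box_simps O box_simps(2)[OF a b] box_fct_simps tensor_arr_Ident
          cat_functorD(3)[OF c(1)] cat_functorD(3)[OF c(2)] intro!: restrict_ext)
  next
    fix p and x y :: "('o, 'a, 'v) vfct \<times> ('p, 'b, 'v) vfct"
    assume p: "p \<in> Hom (prod_cat (Fun A) (Fun B)) x y"
    obtain \<Phi> \<Psi> \<Phi>' \<Psi>' where xy: "x = (\<Phi>, \<Psi>)" "y = (\<Phi>', \<Psi>')" by (metis surj_pair)
    obtain f g where fg: "p = (f, g)" by (cases p)
    have fH: "f \<in> Hom (Fun A) \<Phi> \<Phi>'" and gH: "g \<in> Hom (Fun B) \<Psi> \<Psi>'" using p by (simp_all add: xy fg Hom_prod_cat)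
    then obtain \<eta> \<theta> where e: "f = (\<Phi>, \<Phi>', \<eta>)" "nat_trans A vect \<Phi> \<Phi>' \<eta>" "g = (\<Psi>, \<Psi>', \<theta>)" "nat_trans B vect \<Psi> \<Psi>' \<theta>"
      unfolding Hom_Fun by blast
    note n1 = nat_transD[OF e(2)] and n2 = nat_transD[OF e(4)]
    interpret F1: cat_functor A vect \<Phi> by (rule n1)
    interpret F2: cat_functor A vect \<Phi>' by (rule n1)
    interpret G1: cat_functor B vect \<Psi> by (rule n2)
    interpret G2: cat_functor B vect \<Psi>' by (rule n2)
    have O: "\<Phi> \<in> Obj (Fun A)" "\<Phi>' \<in> Obj (Fun A)" "\<Psi> \<in> Obj (Fun B)" "\<Psi>' \<in> Obj (Fun B)"
      by (rule FA.Hom_Obj[OF fH] FB.Hom_Obj[OF gH])+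
    have bx: "on_arr (box A B) p = (box_fct A B \<Phi> \<Psi>, box_fct A B \<Phi>' \<Psi>', \<lambda>(x, y)\<in>Obj A \<times> Obj B. tensor_arr (\<eta> x) (\<theta> y))"
      using HomD(1)[OF fH] HomD(1)[OF gH] unfolding fg e(1,3) by (rule box_simps(2))
    have fs: "finite_support (prod_cat A B) (box_fct A B \<Phi> \<Psi>)" "finite_support (prod_cat A B) (box_fct A B \<Phi>' \<Psi>')"
      using box_fct_Obj[OF O(1,3)] box_fct_Obj[OF O(2,4)] by (simp_all add: Obj_Fun)
    have "nat_trans (prod_cat A B) vect (box_fct A B \<Phi> \<Psi>) (box_fct A B \<Phi>' \<Psi>') (\<lambda>(x, y)\<in>Obj A \<times> Obj B. tensor_arr (\<eta> x) (\<theta> y))"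
    proof (rule nat_transI[OF box_fct_functor[OF n1(1) n2(1)] box_fct_functor[OF n1(2) n2(2)]])
      fix x assume "x \<in> Obj (prod_cat A B)"
      then obtain a b where x: "x = (a, b)" "a \<in> Obj A" "b \<in> Obj B" by auto
      show "(\<lambda>(x, y)\<in>Obj A \<times> Obj B. tensor_arr (\<eta> x) (\<theta> y)) x \<in> Hom vect (on_obj (box_fct A B \<Phi> \<Psi>) x) (on_obj (box_fct A B \<Phi>' \<Psi>') x)"
        using tensor_arr_Hom[OF n1(4)[OF x(2)] n2(4)[OF x(3)]] x by (simp add: box_fct_simps)
    next
      fix q x y assume q: "q \<in> Hom (prod_cat A B) x y"
      obtain f g a b a' b' where e: "q = (f, g)" "x = (a, b)" "y = (a', b')" by (metis surj_pair)
      have f: "f \<in> Hom A a a'" and g: "g \<in> Hom B b b'" using q by (simp_all add: e Hom_prod_cat)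
      note o = F1.A.Hom_Obj[OF f] G1.A.Hom_Obj[OF g]
      show "(\<lambda>(x, y)\<in>Obj A \<times> Obj B. tensor_arr (\<eta> x) (\<theta> y)) y \<cdot>\<^sub>v on_arr (box_fct A B \<Phi> \<Psi>) q =
        on_arr (box_fct A B \<Phi>' \<Psi>') q \<cdot>\<^sub>v (\<lambda>(x, y)\<in>Obj A \<times> Obj B. tensor_arr (\<eta> x) (\<theta> y)) x"
        using tensor_arr_comp[OF F1.arr_maps[OF f] n1(4)[OF o(2)] G1.arr_maps[OF g] n2(4)[OF o(4)]]
          tensor_arr_comp[OF n1(4)[OF o(1)] F2.arr_maps[OF f] n2(4)[OF o(3)] G2.arr_maps[OF g]]
          n1(5)[OF f] n2(5)[OF g] o
        by (simp add: e box_fct_simps HomD(1)[OF f] HomD(1)[OF g])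
    qed simp
    then show "on_arr (box A B) p \<in> Hom (Fun (prod_cat A B)) (on_obj (box A B) x) (on_obj (box A B) y)"
      unfolding bx using fs by (simp add: xy box_simps O Hom_Fun)
    fix q z assume q: "q \<in> Hom (prod_cat (Fun A) (Fun B)) y z"
    obtain \<Phi>'' \<Psi>'' where z: "z = (\<Phi>'', \<Psi>'')" by (cases z)
    obtain f' g' where fg': "q = (f', g')" by (cases q)
    have fH': "f' \<in> Hom (Fun A) \<Phi>' \<Phi>''" and gH': "g' \<in> Hom (Fun B) \<Psi>' \<Psi>''" using q by (simp_all add: xy z fg' Hom_prod_cat)
    then obtain \<eta>' \<theta>' where e': "f' = (\<Phi>', \<Phi>'', \<eta>')" "nat_trans A vect \<Phi>' \<Phi>'' \<eta>'" "g' = (\<Psi>', \<Psi>'', \<theta>')" "nat_trans B vect \<Psi>' \<Psi>'' \<theta>'"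
      unfolding Hom_Fun by blast
    note m1 = nat_transD[OF e'(2)] and m2 = nat_transD[OF e'(4)]
    have a: "(\<Phi>, \<Phi>'', \<lambda>x\<in>Obj A. \<eta>' x \<cdot>\<^sub>v \<eta> x) \<in> Arr (Fun A)"
      using HomD(1)[OF FA.Comp_Hom[OF fH fH']] by (simp add: e e' Comp_Fun)
    have b: "(\<Psi>, \<Psi>'', \<lambda>x\<in>Obj B. \<theta>' x \<cdot>\<^sub>v \<theta> x) \<in> Arr (Fun B)"
      using HomD(1)[OF FB.Comp_Hom[OF gH gH']] by (simp add: e e' Comp_Fun)
    have bx': "on_arr (box A B) q = (box_fct A B \<Phi>' \<Psi>', box_fct A B \<Phi>'' \<Psi>'', \<lambda>(x, y)\<in>Obj A \<times> Obj B. tensor_arr (\<eta>' x) (\<theta>' y))"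
      using HomD(1)[OF fH'] HomD(1)[OF gH'] unfolding fg' e'(1,3) by (rule box_simps(2))
    show "on_arr (box A B) (q \<cdot>\<^bsub>prod_cat (Fun A) (Fun B)\<^esub> p) = on_arr (box A B) q \<cdot>\<^bsub>Fun (prod_cat A B)\<^esub> on_arr (box A B) p"
      unfolding bx bx' Comp_Fun
      by (auto simp: fg fg' e e' Comp_Fun box_simps(2)[OF a b] tensor_arr_comp[OF n1(4) m1(4) n2(4) m2(4)] intro!: restrict_ext)
  qed
qed

end

section \<open>Restriction along a functor with finite fibers on isomorphism classes\<close>

definition pi0_finite :: "('o, 'a) cat \<Rightarrow> ('p, 'b) cat \<Rightarrow> ('o, 'a, 'p, 'b) fct \<Rightarrow> bool" where
  "pi0_finite A B H \<longleftrightarrow> (\<forall>b \<in> Obj B. finite {iso_class A a |a. a \<in> Obj A \<and> on_obj H a \<in> iso_class B b})"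

text \<open>The support of the composite lies over the finitely many classes supporting \<Phi>, and
  each of these has finitely many classes above it.\<close>

lemma fcomp_Obj_Fun:
  assumes H: "cat_functor A B H" and fin: "pi0_finite A B H" and \<Phi>: "\<Phi> \<in> Obj (Fun B)"
  shows "fcomp A \<Phi> H \<in> Obj (Fun A)"
proof -
  interpret cat_functor A B H by fact
  have F: "cat_functor B vect \<Phi>" "finite_support B \<Phi>" using \<Phi> by (simp_all add: Obj_Fun)
  let ?S = "\<lambda>A \<Phi>. {iso_class A x |x. x \<in> Obj A \<and> carrier (on_obj \<Phi> x) \<noteq> {\<zero>\<^bsub>on_obj \<Phi> x\<^esub>}}"
  have "?S A (fcomp A \<Phi> H) \<subseteq> (\<Union>c\<in>?S B \<Phi>. {iso_class A a |a. a \<in> Obj A \<and> on_obj H a \<in> c})"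
  proof
    fix c assume "c \<in> ?S A (fcomp A \<Phi> H)"
    then obtain a where a: "c = iso_class A a" "a \<in> Obj A" "carrier (on_obj (fcomp A \<Phi> H) a) \<noteq> {\<zero>\<^bsub>on_obj (fcomp A \<Phi> H) a\<^esub>}"
      by blast
    note a = a(1,2) a(3)[unfolded fcomp_simps(1)[OF a(2)]]
    have h: "on_obj H a \<in> Obj B" using cat_functorD(3)[OF H a(2)] .
    then have "iso_class B (on_obj H a) \<in> ?S B \<Phi>" using a(3) by blast
    moreover have "c \<in> {iso_class A a' |a'. a' \<in> Obj A \<and> on_obj H a' \<in> iso_class B (on_obj H a)}"
      using a B.iso_class_self[OF h] by blast
    ultimately show "c \<in> (\<Union>c\<in>?S B \<Phi>. {iso_class A a |a. a \<in> Obj A \<and> on_obj H a \<in> c})" by blast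
  qed
  moreover have "finite (\<Union>c\<in>?S B \<Phi>. {iso_class A a |a. a \<in> Obj A \<and> on_obj H a \<in> c})"
    using F(2) fin unfolding finite_support_def pi0_finite_def by (intro finite_UN_I) auto
  ultimately have "finite_support A (fcomp A \<Phi> H)" unfolding finite_support_def by (rule finite_subset)
  then show ?thesis using fcomp_functor[OF H F(1)] by (simp add: Obj_Fun)
qed

lemma pull_functor:
  fixes A :: "('o, 'a) cat" and B :: "('p, 'b) cat"
  assumes H: "cat_functor A B H" and fin: "pi0_finite A B H"
  shows "cat_functor (Fun B :: (('p, 'b, 'v) vfct, _) cat) (Fun A :: (('o, 'a, 'v) vfct, _) cat) (pull A B H)"
proof -
  interpret cat_functor A B H by fact
  interpret FA: category "Fun A :: (('o, 'a, 'v) vfct, _) cat" by (rule category_Fun)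
  interpret FB: category "Fun B :: (('p, 'b, 'v) vfct, _) cat" by (rule category_Fun)
  have o: "\<Phi> \<in> Obj (Fun B) \<Longrightarrow> on_obj (pull A B H) \<Phi> = fcomp A \<Phi> H" for \<Phi> :: "('p, 'b, 'v) vfct"
    by (simp add: pull_def)
  have a: "(\<Phi>, \<Psi>, \<eta>) \<in> Hom (Fun B) \<Phi>' \<Psi>' \<Longrightarrow> on_arr (pull A B H) (\<Phi>, \<Psi>, \<eta>) =
     (fcomp A \<Phi> H, fcomp A \<Psi> H, \<lambda>a\<in>Obj A. \<eta> (on_obj H a))" for \<Phi> \<Psi> \<Phi>' \<Psi>' :: "('p, 'b, 'v) vfct" and \<eta>
    using HomD(1)[of "(\<Phi>, \<Psi>, \<eta>)" "Fun B" \<Phi>' \<Psi>'] by (simp add: pull_def)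
  show ?thesis
  proof
    show "on_obj (pull A B H) \<in> Obj (Fun B) \<rightarrow>\<^sub>E Obj (Fun A :: (('o, 'a, 'v) vfct, _) cat)"
      by (rule PiE_I) (simp_all add: pull_def fcomp_Obj_Fun[OF H fin])
    show "on_arr (pull A B H) \<in> extensional (Arr (Fun B :: (('p, 'b, 'v) vfct, _) cat))" by (simp add: pull_def)
  next
    fix \<Phi> :: "('p, 'b, 'v) vfct" assume \<Phi>: "\<Phi> \<in> Obj (Fun B)"
    show "on_arr (pull A B H) (Ident (Fun B) \<Phi>) = Ident (Fun A) (on_obj (pull A B H) \<Phi>)"
      unfolding Ident_Fun a[OF FB.Ident_Hom[OF \<Phi>, unfolded Ident_Fun]] o[OF \<Phi>]
      by (auto simp: fcomp_simps cat_functorD(3)[OF H] intro!: restrict_ext)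
  next
    fix \<Phi> \<Psi> :: "('p, 'b, 'v) vfct" and f assume f: "f \<in> Hom (Fun B) \<Phi> \<Psi>"
    then obtain \<eta> where e: "f = (\<Phi>, \<Psi>, \<eta>)" "nat_trans B vect \<Phi> \<Psi> \<eta>" unfolding Hom_Fun by blast
    note n = nat_transD[OF e(2)] and O = FB.Hom_Obj[OF f]
    have "nat_trans A vect (fcomp A \<Phi> H) (fcomp A \<Psi> H) (\<lambda>a\<in>Obj A. \<eta> (on_obj H a))"
    proof (rule nat_transI[OF fcomp_functor[OF H n(1)] fcomp_functor[OF H n(2)]])
      fix u x y assume u: "u \<in> Hom A x y"
      show "(\<lambda>a\<in>Obj A. \<eta> (on_obj H a)) y \<cdot>\<^sub>v on_arr (fcomp A \<Phi> H) u = on_arr (fcomp A \<Psi> H) u \<cdot>\<^sub>v (\<lambda>a\<in>Obj A. \<eta> (on_obj H a)) x"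
        using n(5)[OF arr_maps[OF u]] A.Hom_Obj[OF u] by (simp add: fcomp_simps(2)[OF u])
    qed (simp_all add: n(4) cat_functorD(3)[OF H] fcomp_simps(1))
    then show "on_arr (pull A B H) f \<in> Hom (Fun A) (on_obj (pull A B H) \<Phi>) (on_obj (pull A B H) \<Psi>)"
      using fcomp_Obj_Fun[OF H fin O(1)] fcomp_Obj_Fun[OF H fin O(2)]
      unfolding e(1) a[OF f[unfolded e(1)]] o[OF O(1)] o[OF O(2)] by (simp add: Hom_Fun Obj_Fun)
    fix \<Xi> :: "('p, 'b, 'v) vfct" and g assume g: "g \<in> Hom (Fun B) \<Psi> \<Xi>"
    then obtain \<theta> where e': "g = (\<Psi>, \<Xi>, \<theta>)" unfolding Hom_Fun by blast
    show "on_arr (pull A B H) (g \<cdot>\<^bsub>Fun B\<^esub> f) = on_arr (pull A B H) g \<cdot>\<^bsub>Fun A\<^esub> on_arr (pull A B H) f"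
      unfolding e(1) e' a[OF f[unfolded e(1)]] a[OF g[unfolded e']] Comp_Fun a[OF FB.Comp_Hom[OF f g, unfolded e(1) e' Comp_Fun]]
      by (auto simp: cat_functorD(3)[OF H] intro!: restrict_ext)
  qed
qed

text \<open>Serves the case of an empty fiber, where a colimit cocone has no legs that would tell
  anything about its vertex.\<close>

lemma (in complex_universe) vect_nonempty: "\<exists>Z :: 'v vspace. Z \<in> Obj vect"
proof -
  obtain e :: "(nat \<Rightarrow> complex) \<Rightarrow> 'v" where e: "inj_on e (carrier (coord_space []))"
    using coord_space_inj[OF inj_\<iota>] by blast
  show ?thesis using vect_transport[OF coord_space_vect e] by auto
qed

section \<open>Left Kan extensions\<close>

text \<open>Existence of the fiber colimits is assumed here so that \<open>kan_fct\<close> and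
  \<open>push\<close> are treated once for both \<open>F_functor\<close> and \<open>sigma0\<close>;
  \<open>left_kanI\<close> supplies the assumption.\<close>

locale left_kan = complex_universe \<iota> + cat_functor A B H
  for \<iota> :: "complex \<Rightarrow> 'v" and A :: "('o, 'a) cat" and B :: "('p, 'b) cat" and H :: "('o, 'a, 'p, 'b) fct" +
  assumes groupoid_B: "groupoid B"
    and colimit_exists: "\<And>\<Phi> :: ('o, 'a, 'v) vfct. \<And>b. \<Phi> \<in> Obj (Fun A) \<Longrightarrow> b \<in> Obj B \<Longrightarrow>
      \<exists>c \<kappa>. is_colimit (two_fiber A B H b) vect (fcomp (two_fiber A B H b) \<Phi> (fiber_proj A B H b)) c \<kappa>"
begin

abbreviation kan_obj :: "('o, 'a, 'v) vfct \<Rightarrow> 'p \<Rightarrow> 'v vspace" where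
  "kan_obj \<Phi> b \<equiv> fst (kan A B H \<Phi> b)"

abbreviation kan_in :: "('o, 'a, 'v) vfct \<Rightarrow> 'p \<Rightarrow> 'o \<times> 'b \<Rightarrow> 'v lin" where
  "kan_in \<Phi> b \<equiv> snd (kan A B H \<Phi> b)"

abbreviation fib :: "'p \<Rightarrow> ('o \<times> 'b) set" where
  "fib b \<equiv> Obj (two_fiber A B H b)"

lemma isoB: "f \<in> Hom B x y \<Longrightarrow> iso_arr B f"
  using groupoid_B HomD(1)[of f B x y] by (simp add: groupoid_def)

text \<open>Over a groupoid the isomorphism condition in the two-fiber holds automatically.\<close>

lemma in_fib: "(a, \<phi>) \<in> fib b \<longleftrightarrow> a \<in> Obj A \<and> \<phi> \<in> Hom B (on_obj H a) b"
  using isoB by (auto simp: two_fiber_Obj)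

lemma fib_comp: "(a, \<phi>) \<in> fib b \<Longrightarrow> \<beta> \<in> Hom B b b' \<Longrightarrow> (a, \<beta> \<cdot>\<^bsub>B\<^esub> \<phi>) \<in> fib b'"
  using B.Comp_Hom[of \<phi> "on_obj H a" b \<beta> b'] by (simp add: in_fib)

context
  fixes \<Phi> :: "('o, 'a, 'v) vfct" and b
  assumes \<Phi>: "\<Phi> \<in> Obj (Fun A)" and b: "b \<in> Obj B"
begin

lemma kan_colimit: "is_colimit (two_fiber A B H b) vect (fcomp (two_fiber A B H b) \<Phi> (fiber_proj A B H b))
    (kan_obj \<Phi> b) (kan_in \<Phi> b)"
proof -
  have "\<exists>p. case p of (c, \<kappa>) \<Rightarrow> is_colimit (two_fiber A B H b) vect (fcomp (two_fiber A B H b) \<Phi> (fiber_proj A B H b)) c \<kappa>"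
    using colimit_exists[OF \<Phi> b] by auto
  from someI_ex[OF this] show ?thesis
    unfolding kan_def colim_def case_prod_unfold .
qed

lemma fiber_diagram: "cat_functor (two_fiber A B H b) vect (fcomp (two_fiber A B H b) \<Phi> (fiber_proj A B H b))"
  using \<Phi> by (intro fcomp_functor[OF fiber_proj_functor[OF cat_functor_axioms]]) (simp add: Obj_Fun)

lemma fiber_diagram_obj: "(a, \<phi>) \<in> fib b \<Longrightarrow>
    on_obj (fcomp (two_fiber A B H b) \<Phi> (fiber_proj A B H b)) (a, \<phi>) = on_obj \<Phi> a"
  by (simp add: fcomp_simps fiber_proj_def)

lemma fiber_diagram_arr:
  assumes "t \<in> Hom (two_fiber A B H b) p q"
  shows "on_arr (fcomp (two_fiber A B H b) \<Phi> (fiber_proj A B H b)) t = on_arr \<Phi> (snd (snd t))"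
  unfolding fcomp_simps(2)[OF assms] using HomD(1)[OF assms] by (cases t) (simp add: fiber_proj_def)

lemma kan_obj_vect: "kan_obj \<Phi> b \<in> Obj vect"
proof -
  have "nat_trans (two_fiber A B H b) vect (fcomp (two_fiber A B H b) \<Phi> (fiber_proj A B H b))
      (const_fct (two_fiber A B H b) vect (kan_obj \<Phi> b)) (kan_in \<Phi> b)"
    using kan_colimit by (simp add: is_colimit_def)
  note n = nat_transD[OF this]
  interpret c: category "two_fiber A B H b" by (rule two_fiber_category[OF cat_functor_axioms])
  show ?thesis
  proof (cases "fib b = {}")
    case False
    then obtain x where x: "x \<in> fib b" by blast
    show ?thesis using vect_HomD(2)[OF n(4)[OF x]] x by (simp add: const_fct_def)
  next
    case True
    \<comment> \<open>Over an empty diagram every space is the vertex of a cocone; the mediating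
      arrow from the colimit to \<open>Z\<close> shows that its domain lies in
      \<open>vect\<close>.\<close>
    obtain Z :: "'v vspace" where Z: "Z \<in> Obj vect" using vect_nonempty by blast
    have "nat_trans (two_fiber A B H b) vect (fcomp (two_fiber A B H b) \<Phi> (fiber_proj A B H b))
      (const_fct (two_fiber A B H b) vect Z) (\<lambda>_. undefined)"
      by (intro nat_transI fiber_diagram const_fct_functor c.category_axioms vect.category_axioms Z)
        (auto simp: True extensional_def dest: c.Hom_Obj)
    then show ?thesis
      using kan_colimit Z unfolding is_colimit_def by (metis vect_HomD(1))
  qed
qed

lemma kan_in_Hom: "(a, \<phi>) \<in> fib b \<Longrightarrow> kan_in \<Phi> b (a, \<phi>) \<in> Hom vect (on_obj \<Phi> a) (kan_obj \<Phi> b)"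
proof -
  assume p: "(a, \<phi>) \<in> fib b"
  have "nat_trans (two_fiber A B H b) vect (fcomp (two_fiber A B H b) \<Phi> (fiber_proj A B H b))
      (const_fct (two_fiber A B H b) vect (kan_obj \<Phi> b)) (kan_in \<Phi> b)"
    using kan_colimit by (simp add: is_colimit_def)
  from nat_transD(4)[OF this p] show ?thesis using p by (simp add: fiber_diagram_obj const_fct_def)
qed

lemma kan_in_natural:
  assumes u: "u \<in> Hom A a a'" and p: "(a, \<phi>) \<in> fib b" "(a', \<phi>') \<in> fib b" and e: "\<phi>' \<cdot>\<^bsub>B\<^esub> on_arr H u = \<phi>"
  shows "kan_in \<Phi> b (a', \<phi>') \<cdot>\<^sub>v on_arr \<Phi> u = kan_in \<Phi> b (a, \<phi>)"
proof -
  have t: "((a, \<phi>), (a', \<phi>'), u) \<in> Hom (two_fiber A B H b) (a, \<phi>) (a', \<phi>')"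
    using u p e by (simp add: two_fiber_Hom)
  have "nat_trans (two_fiber A B H b) vect (fcomp (two_fiber A B H b) \<Phi> (fiber_proj A B H b))
      (const_fct (two_fiber A B H b) vect (kan_obj \<Phi> b)) (kan_in \<Phi> b)"
    using kan_colimit by (simp add: is_colimit_def)
  from nat_transD(5)[OF this t] show ?thesis
    using HomD(1)[OF t] vect.Ident_left[OF kan_in_Hom[OF p(1)]]
    by (simp add: fiber_diagram_arr[OF t] const_fct_def)
qed

text \<open>The cocone is a curried family defined everywhere; the restriction to the fiber that
  \<open>nat_trans\<close> demands is made inside the proof.\<close>

lemma kan_universal:
  assumes d: "d \<in> Obj vect" and m: "\<And>a \<phi>. (a, \<phi>) \<in> fib b \<Longrightarrow> \<mu> a \<phi> \<in> Hom vect (on_obj \<Phi> a) d"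
    and n: "\<And>u a a' \<phi> \<phi>'. u \<in> Hom A a a' \<Longrightarrow> (a, \<phi>) \<in> fib b \<Longrightarrow> (a', \<phi>') \<in> fib b \<Longrightarrow> \<phi>' \<cdot>\<^bsub>B\<^esub> on_arr H u = \<phi> \<Longrightarrow>
      \<mu> a' \<phi>' \<cdot>\<^sub>v on_arr \<Phi> u = \<mu> a \<phi>"
  shows "\<exists>!m. m \<in> Hom vect (kan_obj \<Phi> b) d \<and> (\<forall>(a, \<phi>) \<in> fib b. m \<cdot>\<^sub>v kan_in \<Phi> b (a, \<phi>) = \<mu> a \<phi>)"
proof -
  let ?\<mu> = "\<lambda>p\<in>fib b. \<mu> (fst p) (snd p)"
  interpret c: category "two_fiber A B H b" by (rule two_fiber_category[OF cat_functor_axioms])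
  have "nat_trans (two_fiber A B H b) vect (fcomp (two_fiber A B H b) \<Phi> (fiber_proj A B H b))
      (const_fct (two_fiber A B H b) vect d) ?\<mu>"
  proof (rule nat_transI[OF fiber_diagram const_fct_functor[OF c.category_axioms vect.category_axioms d]])
    fix x assume x: "x \<in> fib b"
    obtain a \<phi> where e: "x = (a, \<phi>)" by (cases x)
    show "?\<mu> x \<in> Hom vect (on_obj (fcomp (two_fiber A B H b) \<Phi> (fiber_proj A B H b)) x) (on_obj (const_fct (two_fiber A B H b) vect d) x)"
      using x m[of a \<phi>] by (simp add: e fiber_diagram_obj const_fct_def)
  next
    fix t x y assume t: "t \<in> Hom (two_fiber A B H b) x y"
    obtain a \<phi> a' \<phi>' where xy: "x = (a, \<phi>)" "y = (a', \<phi>')" by (metis surj_pair)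
    obtain u where u: "u \<in> Hom A a a'" "t = (x, y, u)" "\<phi>' \<cdot>\<^bsub>B\<^esub> on_arr H u = \<phi>" "(a, \<phi>) \<in> fib b" "(a', \<phi>') \<in> fib b"
      using t unfolding two_fiber_Hom xy by auto
    have arr: "on_arr (fcomp (two_fiber A B H b) \<Phi> (fiber_proj A B H b)) t = on_arr \<Phi> u"
      using fiber_diagram_arr[OF t] u(2) by simp
    show "?\<mu> y \<cdot>\<^sub>v on_arr (fcomp (two_fiber A B H b) \<Phi> (fiber_proj A B H b)) t =
        on_arr (const_fct (two_fiber A B H b) vect d) t \<cdot>\<^sub>v ?\<mu> x"
      using n[OF u(1,4,5,3)] u(4,5) vect.Ident_left[OF m[OF u(4)]] HomD(1)[OF t]
      unfolding arr xy by (simp add: const_fct_def)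
  qed simp
  then have "\<exists>!m. m \<in> Hom vect (kan_obj \<Phi> b) d \<and> (\<forall>p \<in> fib b. m \<cdot>\<^sub>v kan_in \<Phi> b p = ?\<mu> p)"
    using kan_colimit d unfolding is_colimit_def by blast
  moreover have "(\<forall>p \<in> fib b. m \<cdot>\<^sub>v kan_in \<Phi> b p = ?\<mu> p) \<longleftrightarrow>
      (\<forall>(a, \<phi>) \<in> fib b. m \<cdot>\<^sub>v kan_in \<Phi> b (a, \<phi>) = \<mu> a \<phi>)" for m
    by (intro ball_cong) auto
  ultimately show ?thesis by simp
qed

lemma kan_ext:
  assumes m: "m \<in> Hom vect (kan_obj \<Phi> b) d" and n: "n \<in> Hom vect (kan_obj \<Phi> b) d"
    and eq: "\<And>a \<phi>. (a, \<phi>) \<in> fib b \<Longrightarrow> m \<cdot>\<^sub>v kan_in \<Phi> b (a, \<phi>) = n \<cdot>\<^sub>v kan_in \<Phi> b (a, \<phi>)"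
  shows "m = n"
proof -
  have "\<exists>!k. k \<in> Hom vect (kan_obj \<Phi> b) d \<and>
      (\<forall>(a, \<phi>) \<in> fib b. k \<cdot>\<^sub>v kan_in \<Phi> b (a, \<phi>) = m \<cdot>\<^sub>v kan_in \<Phi> b (a, \<phi>))"
  proof (rule kan_universal[OF vect_HomD(2)[OF m]])
    fix a \<phi> assume p: "(a, \<phi>) \<in> fib b"
    show "m \<cdot>\<^sub>v kan_in \<Phi> b (a, \<phi>) \<in> Hom vect (on_obj \<Phi> a) d" by (rule vect.Comp_Hom[OF kan_in_Hom[OF p] m])
  next
    have F: "cat_functor A vect \<Phi>" using \<Phi> by (simp add: Obj_Fun)
    fix u a a' \<phi> \<phi>'
    assume h: "u \<in> Hom A a a'" "(a, \<phi>) \<in> fib b" "(a', \<phi>') \<in> fib b" "\<phi>' \<cdot>\<^bsub>B\<^esub> on_arr H u = \<phi>"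
    show "m \<cdot>\<^sub>v kan_in \<Phi> b (a', \<phi>') \<cdot>\<^sub>v on_arr \<Phi> u = m \<cdot>\<^sub>v kan_in \<Phi> b (a, \<phi>)"
      using kan_in_natural[OF h] vect.Comp_assoc[OF cat_functorD(4)[OF F h(1)] kan_in_Hom[OF h(3)] m] by simp
  qed
  moreover have "\<forall>(a, \<phi>) \<in> fib b. n \<cdot>\<^sub>v kan_in \<Phi> b (a, \<phi>) = m \<cdot>\<^sub>v kan_in \<Phi> b (a, \<phi>)"
    using eq by auto
  moreover have "\<forall>(a, \<phi>) \<in> fib b. m \<cdot>\<^sub>v kan_in \<Phi> b (a, \<phi>) = m \<cdot>\<^sub>v kan_in \<Phi> b (a, \<phi>)"
    by auto
  ultimately show ?thesis using m n by blast
qed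

text \<open>All legs of the colimit are zero, so by \<open>kan_ext\<close> its identity equals the
  zero map. This includes the empty fiber.\<close>

lemma kan_obj_zero:
  assumes "\<And>a \<phi>. (a, \<phi>) \<in> fib b \<Longrightarrow> carrier (on_obj \<Phi> a) = {\<zero>\<^bsub>on_obj \<Phi> a\<^esub>}"
  shows "carrier (kan_obj \<Phi> b) = {\<zero>\<^bsub>kan_obj \<Phi> b\<^esub>}"
proof -
  let ?T = "kan_obj \<Phi> b"
  note T = kan_obj_vect
  have "Ident vect ?T = mk_lin ?T ?T (\<lambda>_. \<zero>\<^bsub>?T\<^esub>)" (is "_ = ?z")
  proof (rule kan_ext)
    show i: "Ident vect ?T \<in> Hom vect ?T ?T" by (rule vect.Ident_Hom[OF T])
    show z: "?z \<in> Hom vect ?T ?T" by (rule mk_lin_Hom[OF T T linmap_zero_map[OF T]])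
    fix a \<phi> assume p: "(a, \<phi>) \<in> fib b"
    note k = kan_in_Hom[OF p]
    show "Ident vect ?T \<cdot>\<^sub>v kan_in \<Phi> b (a, \<phi>) = ?z \<cdot>\<^sub>v kan_in \<Phi> b (a, \<phi>)"
    proof (rule vect_eqI[OF vect.Comp_Hom[OF k i] vect.Comp_Hom[OF k z]])
      fix v assume v: "v \<in> carrier (on_obj \<Phi> a)"
      then have "app (kan_in \<Phi> b (a, \<phi>)) v = \<zero>\<^bsub>?T\<^esub>"
        using assms[OF p] linmap_zero[OF vect_HomD(1)[OF k] T vect_HomD(3)[OF k]] by simp
      then show "app (Ident vect ?T \<cdot>\<^sub>v kan_in \<Phi> b (a, \<phi>)) v = app (?z \<cdot>\<^sub>v kan_in \<Phi> b (a, \<phi>)) v"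
        using T by (simp add: app_comp[OF k v])
    qed
  qed
  then have "v = \<zero>\<^bsub>?T\<^esub>" if "v \<in> carrier ?T" for v
    using app_Ident[OF that] app_mk_lin[OF that, of ?T "\<lambda>_. \<zero>\<^bsub>?T\<^esub>"] by simp
  then show ?thesis using vs_zero[OF T] by blast
qed

end

lemma kan_fct_obj: "b \<in> Obj B \<Longrightarrow> on_obj (kan_fct A B H \<Phi>) b = kan_obj \<Phi> b"
  by (simp add: kan_fct_def)

text \<open>Composition with \<beta> carries the fiber over \<open>b\<close> to the fiber over
  \<open>b'\<close>, and the legs at \<open>b'\<close> restrict to a cocone at \<open>b\<close>; its
  mediating arrow is the \<open>THE\<close> in \<open>kan_fct\<close>.\<close>

lemma kan_fct_arr:
  assumes \<Phi>: "\<Phi> \<in> Obj (Fun A)" and \<beta>: "\<beta> \<in> Hom B b b'"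
  shows "on_arr (kan_fct A B H \<Phi>) \<beta> \<in> Hom vect (kan_obj \<Phi> b) (kan_obj \<Phi> b')"
    and "(a, \<phi>) \<in> fib b \<Longrightarrow> on_arr (kan_fct A B H \<Phi>) \<beta> \<cdot>\<^sub>v kan_in \<Phi> b (a, \<phi>) = kan_in \<Phi> b' (a, \<beta> \<cdot>\<^bsub>B\<^esub> \<phi>)"
proof -
  note b = B.Hom_Obj[OF \<beta>]
  let ?P = "\<lambda>m. m \<in> Hom vect (kan_obj \<Phi> b) (kan_obj \<Phi> b') \<and>
      (\<forall>(a, \<phi>) \<in> fib b. m \<cdot>\<^sub>v kan_in \<Phi> b (a, \<phi>) = kan_in \<Phi> b' (a, \<beta> \<cdot>\<^bsub>B\<^esub> \<phi>))"
  have "\<exists>!m. ?P m"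
  proof (rule kan_universal[OF \<Phi> b(1) kan_obj_vect[OF \<Phi> b(2)]])
    fix a \<phi> assume "(a, \<phi>) \<in> fib b"
    from fib_comp[OF this \<beta>] show "kan_in \<Phi> b' (a, \<beta> \<cdot>\<^bsub>B\<^esub> \<phi>) \<in> Hom vect (on_obj \<Phi> a) (kan_obj \<Phi> b')"
      by (rule kan_in_Hom[OF \<Phi> b(2)])
  next
    fix u a a' \<phi> \<phi>'
    assume h: "u \<in> Hom A a a'" "(a, \<phi>) \<in> fib b" "(a', \<phi>') \<in> fib b" "\<phi>' \<cdot>\<^bsub>B\<^esub> on_arr H u = \<phi>"
    have "\<phi>' \<in> Hom B (on_obj H a') b" using h(3) by (simp add: in_fib)
    from B.Comp_assoc[OF arr_maps[OF h(1)] this \<beta>]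
    have "\<beta> \<cdot>\<^bsub>B\<^esub> \<phi>' \<cdot>\<^bsub>B\<^esub> on_arr H u = \<beta> \<cdot>\<^bsub>B\<^esub> \<phi>" using h(4) by simp
    then show "kan_in \<Phi> b' (a', \<beta> \<cdot>\<^bsub>B\<^esub> \<phi>') \<cdot>\<^sub>v on_arr \<Phi> u = kan_in \<Phi> b' (a, \<beta> \<cdot>\<^bsub>B\<^esub> \<phi>)"
      by (rule kan_in_natural[OF \<Phi> b(2) h(1) fib_comp[OF h(2) \<beta>] fib_comp[OF h(3) \<beta>]])
  qed
  from theI'[OF this] have "?P (on_arr (kan_fct A B H \<Phi>) \<beta>)"
    using HomD[OF \<beta>] by (simp add: kan_fct_def)
  then show "on_arr (kan_fct A B H \<Phi>) \<beta> \<in> Hom vect (kan_obj \<Phi> b) (kan_obj \<Phi> b')"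
    and "(a, \<phi>) \<in> fib b \<Longrightarrow> on_arr (kan_fct A B H \<Phi>) \<beta> \<cdot>\<^sub>v kan_in \<Phi> b (a, \<phi>) = kan_in \<Phi> b' (a, \<beta> \<cdot>\<^bsub>B\<^esub> \<phi>)"
    by blast+
qed

lemma kan_fct_functor:
  fixes \<Phi> :: "('o, 'a, 'v) vfct"
  assumes \<Phi>: "\<Phi> \<in> Obj (Fun A)"
  shows "cat_functor B vect (kan_fct A B H \<Phi>)"
proof
  show "on_obj (kan_fct A B H \<Phi>) \<in> Obj B \<rightarrow>\<^sub>E Obj vect"
    by (rule PiE_I) (simp_all add: kan_fct_def kan_obj_vect[OF \<Phi>])
  show "on_arr (kan_fct A B H \<Phi>) \<in> extensional (Arr B)" by (simp add: kan_fct_def)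
next
  fix x assume x: "x \<in> Obj B"
  note i = B.Ident_Hom[OF x]
  show "on_arr (kan_fct A B H \<Phi>) (Ident B x) = Ident vect (on_obj (kan_fct A B H \<Phi>) x)"
    unfolding kan_fct_obj[OF x]
  proof (rule kan_ext[OF \<Phi> x kan_fct_arr(1)[OF \<Phi> i] vect.Ident_Hom[OF kan_obj_vect[OF \<Phi> x]]])
    fix a \<phi> assume p: "(a, \<phi>) \<in> fib x"
    then have "Ident B x \<cdot>\<^bsub>B\<^esub> \<phi> = \<phi>" using B.Ident_left[of \<phi> "on_obj H a" x] by (simp add: in_fib)
    then show "on_arr (kan_fct A B H \<Phi>) (Ident B x) \<cdot>\<^sub>v kan_in \<Phi> x (a, \<phi>) = Ident vect (kan_obj \<Phi> x) \<cdot>\<^sub>v kan_in \<Phi> x (a, \<phi>)"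
      using kan_fct_arr(2)[OF \<Phi> i p] vect.Ident_left[OF kan_in_Hom[OF \<Phi> x p]] by simp
  qed
next
  fix \<beta> x y assume \<beta>: "\<beta> \<in> Hom B x y"
  note O = B.Hom_Obj[OF \<beta>]
  show "on_arr (kan_fct A B H \<Phi>) \<beta> \<in> Hom vect (on_obj (kan_fct A B H \<Phi>) x) (on_obj (kan_fct A B H \<Phi>) y)"
    using kan_fct_arr(1)[OF \<Phi> \<beta>] O by (simp add: kan_fct_obj)
  fix \<gamma> w assume \<gamma>: "\<gamma> \<in> Hom B y w"
  note c = B.Comp_Hom[OF \<beta> \<gamma>]
  show "on_arr (kan_fct A B H \<Phi>) (\<gamma> \<cdot>\<^bsub>B\<^esub> \<beta>) = on_arr (kan_fct A B H \<Phi>) \<gamma> \<cdot>\<^sub>v on_arr (kan_fct A B H \<Phi>) \<beta>"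
  proof (rule kan_ext[OF \<Phi> O(1) kan_fct_arr(1)[OF \<Phi> c] vect.Comp_Hom[OF kan_fct_arr(1)[OF \<Phi> \<beta>] kan_fct_arr(1)[OF \<Phi> \<gamma>]]])
    fix a \<phi> assume p: "(a, \<phi>) \<in> fib x"
    then have "\<phi> \<in> Hom B (on_obj H a) x" by (simp add: in_fib)
    from B.Comp_assoc[OF this \<beta> \<gamma>]
    show "on_arr (kan_fct A B H \<Phi>) (\<gamma> \<cdot>\<^bsub>B\<^esub> \<beta>) \<cdot>\<^sub>v kan_in \<Phi> x (a, \<phi>) =
      on_arr (kan_fct A B H \<Phi>) \<gamma> \<cdot>\<^sub>v on_arr (kan_fct A B H \<Phi>) \<beta> \<cdot>\<^sub>v kan_in \<Phi> x (a, \<phi>)"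
      using kan_fct_arr(2)[OF \<Phi> c p] kan_fct_arr(2)[OF \<Phi> \<beta> p] kan_fct_arr(2)[OF \<Phi> \<gamma> fib_comp[OF p \<beta>]]
        vect.Comp_assoc[OF kan_in_Hom[OF \<Phi> O(1) p] kan_fct_arr(1)[OF \<Phi> \<beta>] kan_fct_arr(1)[OF \<Phi> \<gamma>]] by simp
  qed
qed

text \<open>A nonzero value at \<open>b\<close> forces a fiber object \<open>(a, \<phi>)\<close>
  with nonzero value at \<open>a\<close>. The class of \<open>b\<close> is then the image of the
  class of \<open>a\<close>, and this image can be computed from any chosen representative.\<close>

lemma kan_fct_Obj:
  fixes \<Phi> :: "('o, 'a, 'v) vfct"
  assumes \<Phi>: "\<Phi> \<in> Obj (Fun A)"
  shows "kan_fct A B H \<Phi> \<in> Obj (Fun B)"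
proof -
  let ?S = "\<lambda>A \<Phi>. {iso_class A x |x. x \<in> Obj A \<and> carrier (on_obj \<Phi> x) \<noteq> {\<zero>\<^bsub>on_obj \<Phi> x\<^esub>}}"
  have "?S B (kan_fct A B H \<Phi>) \<subseteq> (\<lambda>c. iso_class B (on_obj H (SOME a. a \<in> c))) ` ?S A \<Phi>"
  proof
    fix c assume "c \<in> ?S B (kan_fct A B H \<Phi>)"
    then obtain b where b: "c = iso_class B b" "b \<in> Obj B"
      "carrier (on_obj (kan_fct A B H \<Phi>) b) \<noteq> {\<zero>\<^bsub>on_obj (kan_fct A B H \<Phi>) b\<^esub>}" by blast
    then obtain a \<phi> where p: "(a, \<phi>) \<in> fib b" "carrier (on_obj \<Phi> a) \<noteq> {\<zero>\<^bsub>on_obj \<Phi> a\<^esub>}"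
      using kan_obj_zero[OF \<Phi> b(2)] unfolding kan_fct_obj[OF b(2)] by blast
    then have a: "a \<in> Obj A" "\<phi> \<in> Hom B (on_obj H a) b" by (simp_all add: in_fib)
    define a' where "a' = (SOME a'. a' \<in> iso_class A a)"
    have "a' \<in> iso_class A a" unfolding a'_def by (rule someI[of _ a]) (rule A.iso_class_self[OF a(1)])
    then obtain f where f: "f \<in> Hom A a a'" "iso_arr A f" unfolding iso_class_def by blast
    have "iso_class B (on_obj H a') = iso_class B b"
      using B.iso_class_eq[OF arr_maps[OF f(1)] isoB[OF arr_maps[OF f(1)]]] B.iso_class_eq[OF a(2) isoB[OF a(2)]] by simp
    moreover have "iso_class A a \<in> ?S A \<Phi>" using a(1) p(2) by blast
    ultimately show "c \<in> (\<lambda>c. iso_class B (on_obj H (SOME a. a \<in> c))) ` ?S A \<Phi>"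
      unfolding b(1) a'_def by (intro image_eqI) simp_all
  qed
  moreover have "finite (?S A \<Phi>)" using \<Phi> by (simp add: Obj_Fun finite_support_def)
  ultimately have "finite_support B (kan_fct A B H \<Phi>)"
    unfolding finite_support_def by (meson finite_imageI finite_subset)
  then show ?thesis using kan_fct_functor[OF \<Phi>] by (simp add: Obj_Fun)
qed

section \<open>Kan extension of natural transformations\<close>

definition push_map :: "('o, 'a, 'v) vfct \<Rightarrow> ('o, 'a, 'v) vfct \<Rightarrow> ('o \<Rightarrow> 'v lin) \<Rightarrow> 'p \<Rightarrow> 'v lin" where
  "push_map \<Phi> \<Psi> \<eta> b = (THE m. m \<in> Hom vect (kan_obj \<Phi> b) (kan_obj \<Psi> b) \<and>
     (\<forall>(a, \<phi>) \<in> fib b. m \<cdot>\<^sub>v kan_in \<Phi> b (a, \<phi>) = kan_in \<Psi> b (a, \<phi>) \<cdot>\<^sub>v \<eta> a))"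

lemma push_simps:
  "\<Phi> \<in> Obj (Fun A) \<Longrightarrow> on_obj (push A B H) \<Phi> = kan_fct A B H \<Phi>"
  "(\<Phi>, \<Psi>, \<eta>) \<in> Arr (Fun A) \<Longrightarrow> on_arr (push A B H) (\<Phi>, \<Psi>, \<eta>) =
    (kan_fct A B H \<Phi>, kan_fct A B H \<Psi>, \<lambda>b\<in>Obj B. push_map \<Phi> \<Psi> \<eta> b)"
  by (simp_all add: push_def push_map_def)

lemma push_map:
  assumes t: "(\<Phi>, \<Psi>, \<eta>) \<in> Hom (Fun A) \<Phi> \<Psi>" and b: "b \<in> Obj B"
  shows "push_map \<Phi> \<Psi> \<eta> b \<in> Hom vect (kan_obj \<Phi> b) (kan_obj \<Psi> b)"
    and "(a, \<phi>) \<in> fib b \<Longrightarrow> push_map \<Phi> \<Psi> \<eta> b \<cdot>\<^sub>v kan_in \<Phi> b (a, \<phi>) = kan_in \<Psi> b (a, \<phi>) \<cdot>\<^sub>v \<eta> a"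
proof -
  interpret FA: category "Fun A :: (('o, 'a, 'v) vfct, _) cat" by (rule category_Fun)
  note O = FA.Hom_Obj[OF t]
  have nt: "nat_trans A vect \<Phi> \<Psi> \<eta>" using t by (simp add: Hom_Fun)
  note n = nat_transD[OF nt]
  let ?P = "\<lambda>m. m \<in> Hom vect (kan_obj \<Phi> b) (kan_obj \<Psi> b) \<and>
     (\<forall>(a, \<phi>) \<in> fib b. m \<cdot>\<^sub>v kan_in \<Phi> b (a, \<phi>) = kan_in \<Psi> b (a, \<phi>) \<cdot>\<^sub>v \<eta> a)"
  have "\<exists>!m. ?P m"
  proof (rule kan_universal[OF O(1) b kan_obj_vect[OF O(2) b]])
    fix a \<phi> assume p: "(a, \<phi>) \<in> fib b"
    then have "a \<in> Obj A" by (simp add: in_fib)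
    from vect.Comp_Hom[OF n(4)[OF this] kan_in_Hom[OF O(2) b p]]
    show "kan_in \<Psi> b (a, \<phi>) \<cdot>\<^sub>v \<eta> a \<in> Hom vect (on_obj \<Phi> a) (kan_obj \<Psi> b)" .
  next
    fix u a a' \<phi> \<phi>'
    assume h: "u \<in> Hom A a a'" "(a, \<phi>) \<in> fib b" "(a', \<phi>') \<in> fib b" "\<phi>' \<cdot>\<^bsub>B\<^esub> on_arr H u = \<phi>"
    note a = A.Hom_Obj[OF h(1)]
    show "kan_in \<Psi> b (a', \<phi>') \<cdot>\<^sub>v \<eta> a' \<cdot>\<^sub>v on_arr \<Phi> u = kan_in \<Psi> b (a, \<phi>) \<cdot>\<^sub>v \<eta> a"
      using vect.Comp_assoc[OF cat_functorD(4)[OF n(1) h(1)] n(4)[OF a(2)] kan_in_Hom[OF O(2) b h(3)]]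
        vect.Comp_assoc[OF n(4)[OF a(1)] cat_functorD(4)[OF n(2) h(1)] kan_in_Hom[OF O(2) b h(3)]]
        n(5)[OF h(1)] kan_in_natural[OF O(2) b h] by simp
  qed
  from theI'[OF this] have "?P (push_map \<Phi> \<Psi> \<eta> b)" unfolding push_map_def .
  then show "push_map \<Phi> \<Psi> \<eta> b \<in> Hom vect (kan_obj \<Phi> b) (kan_obj \<Psi> b)"
    and "(a, \<phi>) \<in> fib b \<Longrightarrow> push_map \<Phi> \<Psi> \<eta> b \<cdot>\<^sub>v kan_in \<Phi> b (a, \<phi>) = kan_in \<Psi> b (a, \<phi>) \<cdot>\<^sub>v \<eta> a"
    by blast+
qed

lemma push_functor: "cat_functor (Fun A :: (('o, 'a, 'v) vfct, _) cat) (Fun B :: (('p, 'b, 'v) vfct, _) cat) (push A B H)"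
proof -
  interpret FA: category "Fun A :: (('o, 'a, 'v) vfct, _) cat" by (rule category_Fun)
  interpret FB: category "Fun B :: (('p, 'b, 'v) vfct, _) cat" by (rule category_Fun)
  show ?thesis
  proof
    show "on_obj (push A B H) \<in> Obj (Fun A) \<rightarrow>\<^sub>E Obj (Fun B :: (('p, 'b, 'v) vfct, _) cat)"
      by (rule PiE_I) (simp_all add: push_def kan_fct_Obj)
    show "on_arr (push A B H) \<in> extensional (Arr (Fun A :: (('o, 'a, 'v) vfct, _) cat))" by (simp add: push_def)
  next
    fix \<Phi> :: "('o, 'a, 'v) vfct" assume \<Phi>: "\<Phi> \<in> Obj (Fun A)"
    note i = FA.Ident_Hom[OF \<Phi>, unfolded Ident_Fun]
    have "push_map \<Phi> \<Phi> (\<lambda>x\<in>Obj A. Ident vect (on_obj \<Phi> x)) b = Ident vect (kan_obj \<Phi> b)" if b: "b \<in> Obj B" for b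
    proof (rule kan_ext[OF \<Phi> b push_map(1)[OF i b] vect.Ident_Hom[OF kan_obj_vect[OF \<Phi> b]]])
      fix a \<phi> assume p: "(a, \<phi>) \<in> fib b"
      then have "a \<in> Obj A" by (simp add: in_fib)
      then show "push_map \<Phi> \<Phi> (\<lambda>x\<in>Obj A. Ident vect (on_obj \<Phi> x)) b \<cdot>\<^sub>v kan_in \<Phi> b (a, \<phi>) =
        Ident vect (kan_obj \<Phi> b) \<cdot>\<^sub>v kan_in \<Phi> b (a, \<phi>)"
        unfolding push_map(2)[OF i b p]
        using vect.Ident_left[OF kan_in_Hom[OF \<Phi> b p]] vect.Ident_right[OF kan_in_Hom[OF \<Phi> b p]] by simp
    qed
    then show "on_arr (push A B H) (Ident (Fun A) \<Phi>) = Ident (Fun B) (on_obj (push A B H) \<Phi>)"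
      unfolding Ident_Fun push_simps(2)[OF HomD(1)[OF i]] push_simps(1)[OF \<Phi>]
      by (auto simp: kan_fct_obj intro!: restrict_ext)
  next
    fix \<Phi> \<Psi> :: "('o, 'a, 'v) vfct" and f assume f0: "f \<in> Hom (Fun A) \<Phi> \<Psi>"
    then obtain \<eta> where e: "f = (\<Phi>, \<Psi>, \<eta>)" "nat_trans A vect \<Phi> \<Psi> \<eta>" unfolding Hom_Fun by blast
    note f = f0[unfolded e(1)]
    note n = nat_transD[OF e(2)] and O = FA.Hom_Obj[OF f]
    have "nat_trans B vect (kan_fct A B H \<Phi>) (kan_fct A B H \<Psi>) (\<lambda>b\<in>Obj B. push_map \<Phi> \<Psi> \<eta> b)"
    proof (rule nat_transI[OF kan_fct_functor[OF O(1)] kan_fct_functor[OF O(2)]])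
      fix \<beta> b b' assume \<beta>: "\<beta> \<in> Hom B b b'"
      note b = B.Hom_Obj[OF \<beta>]
      note kb = kan_fct_arr[OF O(1) \<beta>] and kb' = kan_fct_arr[OF O(2) \<beta>]
      have "push_map \<Phi> \<Psi> \<eta> b' \<cdot>\<^sub>v on_arr (kan_fct A B H \<Phi>) \<beta> = on_arr (kan_fct A B H \<Psi>) \<beta> \<cdot>\<^sub>v push_map \<Phi> \<Psi> \<eta> b"
      proof (rule kan_ext[OF O(1) b(1) vect.Comp_Hom[OF kb(1) push_map(1)[OF f b(2)]] vect.Comp_Hom[OF push_map(1)[OF f b(1)] kb'(1)]])
        fix a \<phi> assume p: "(a, \<phi>) \<in> fib b"
        then have a: "a \<in> Obj A" by (simp add: in_fib)
        show "push_map \<Phi> \<Psi> \<eta> b' \<cdot>\<^sub>v on_arr (kan_fct A B H \<Phi>) \<beta> \<cdot>\<^sub>v kan_in \<Phi> b (a, \<phi>) =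
          on_arr (kan_fct A B H \<Psi>) \<beta> \<cdot>\<^sub>v push_map \<Phi> \<Psi> \<eta> b \<cdot>\<^sub>v kan_in \<Phi> b (a, \<phi>)"
          using vect.Comp_assoc[OF kan_in_Hom[OF O(1) b(1) p] kb(1) push_map(1)[OF f b(2)]] kb(2)[OF p]
            push_map(2)[OF f b(2) fib_comp[OF p \<beta>]]
            vect.Comp_assoc[OF kan_in_Hom[OF O(1) b(1) p] push_map(1)[OF f b(1)] kb'(1)] push_map(2)[OF f b(1) p]
            vect.Comp_assoc[OF n(4)[OF a] kan_in_Hom[OF O(2) b(1) p] kb'(1)] kb'(2)[OF p] by simp
      qed
      then show "(\<lambda>b\<in>Obj B. push_map \<Phi> \<Psi> \<eta> b) b' \<cdot>\<^sub>v on_arr (kan_fct A B H \<Phi>) \<beta> =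
        on_arr (kan_fct A B H \<Psi>) \<beta> \<cdot>\<^sub>v (\<lambda>b\<in>Obj B. push_map \<Phi> \<Psi> \<eta> b) b" using b by simp
    qed (simp_all add: push_map(1)[OF f] kan_fct_obj)
    then show "on_arr (push A B H) f \<in> Hom (Fun B) (on_obj (push A B H) \<Phi>) (on_obj (push A B H) \<Psi>)"
      using kan_fct_Obj[OF O(1)] kan_fct_Obj[OF O(2)]
      unfolding e(1) push_simps(2)[OF HomD(1)[OF f]] push_simps(1)[OF O(1)] push_simps(1)[OF O(2)]
      by (simp add: Hom_Fun Obj_Fun)
    fix \<Xi> :: "('o, 'a, 'v) vfct" and g assume g0: "g \<in> Hom (Fun A) \<Psi> \<Xi>"
    then obtain \<theta> where e': "g = (\<Psi>, \<Xi>, \<theta>)" "nat_trans A vect \<Psi> \<Xi> \<theta>" unfolding Hom_Fun by blast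
    note g = g0[unfolded e'(1)] and m = nat_transD[OF e'(2)]
    note fg = FA.Comp_Hom[OF f g, unfolded Comp_Fun]
    note O' = FA.Hom_Obj(2)[OF g]
    have "push_map \<Phi> \<Xi> (\<lambda>x\<in>Obj A. \<theta> x \<cdot>\<^sub>v \<eta> x) b = push_map \<Psi> \<Xi> \<theta> b \<cdot>\<^sub>v push_map \<Phi> \<Psi> \<eta> b" if b: "b \<in> Obj B" for b
    proof (rule kan_ext[OF O(1) b push_map(1)[OF fg b] vect.Comp_Hom[OF push_map(1)[OF f b] push_map(1)[OF g b]]])
      fix a \<phi> assume p: "(a, \<phi>) \<in> fib b"
      then have a: "a \<in> Obj A" by (simp add: in_fib)
      show "push_map \<Phi> \<Xi> (\<lambda>x\<in>Obj A. \<theta> x \<cdot>\<^sub>v \<eta> x) b \<cdot>\<^sub>v kan_in \<Phi> b (a, \<phi>) =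
        push_map \<Psi> \<Xi> \<theta> b \<cdot>\<^sub>v push_map \<Phi> \<Psi> \<eta> b \<cdot>\<^sub>v kan_in \<Phi> b (a, \<phi>)"
        using push_map(2)[OF fg b p] push_map(2)[OF f b p] push_map(2)[OF g b p] a
          vect.Comp_assoc[OF n(4)[OF a] m(4)[OF a] kan_in_Hom[OF O' b p]]
          vect.Comp_assoc[OF kan_in_Hom[OF O(1) b p] push_map(1)[OF f b] push_map(1)[OF g b]]
          vect.Comp_assoc[OF n(4)[OF a] kan_in_Hom[OF O(2) b p] push_map(1)[OF g b]] by simp
    qed
    then show "on_arr (push A B H) (g \<cdot>\<^bsub>Fun A\<^esub> f) = on_arr (push A B H) g \<cdot>\<^bsub>Fun B\<^esub> on_arr (push A B H) f"
      unfolding e(1) e'(1) Comp_Fun push_simps(2)[OF HomD(1)[OF f]] push_simps(2)[OF HomD(1)[OF g]] push_simps(2)[OF HomD(1)[OF fg]]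
      by (auto intro!: restrict_ext)
  qed
qed

end

text \<open>Finite support leaves finitely many classes in the source, and each representative has
  finitely many arrows to \<open>b\<close>; these pairs form the finite set \<open>J0\<close>. A
  fiber object with nonzero value maps to the pair obtained by transport to its
  representative.\<close>

lemma left_kanI:
  fixes A :: "('o, 'a) cat" and B :: "('p, 'b) cat"
  assumes \<iota>: "inj (\<iota> :: complex \<Rightarrow> 'v)" and H: "cat_functor A B H" and B: "groupoid B"
    and fin: "\<And>x y. finite (Hom B x y)"
  shows "left_kan \<iota> A B H"
proof -
  interpret cat_functor A B H by fact
  show ?thesis
  proof (intro left_kan.intro complex_universe.intro left_kan_axioms.intro \<iota> H B)
    fix \<Phi> :: "('o, 'a, 'v) vfct" and b
    assume \<Phi>: "\<Phi> \<in> Obj (Fun A)" and b: "b \<in> Obj B"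
    have F: "cat_functor A vect \<Phi>" using \<Phi> by (simp add: Obj_Fun)
    let ?S = "{iso_class A x |x. x \<in> Obj A \<and> carrier (on_obj \<Phi> x) \<noteq> {\<zero>\<^bsub>on_obj \<Phi> x\<^esub>}}"
    have finS: "finite ?S" using \<Phi> by (simp add: Obj_Fun finite_support_def)
    define rep where "rep c = (SOME a. a \<in> c)" for c :: "'o set"
    define J0 where "J0 = Sigma (rep ` ?S) (\<lambda>a. Hom B (on_obj H a) b) \<inter> Obj (two_fiber A B H b)"
    show "\<exists>c \<kappa>. is_colimit (two_fiber A B H b) vect (fcomp (two_fiber A B H b) \<Phi> (fiber_proj A B H b)) c \<kappa>"
    proof (rule vect_colimit_exists[OF \<iota> fcomp_functor[OF fiber_proj_functor[OF H] F], where ?J0.0 = J0])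
      show "finite J0" unfolding J0_def using finS fin by (intro finite_Int disjI1 finite_SigmaI finite_imageI)
      show "J0 \<subseteq> Obj (two_fiber A B H b)" by (simp add: J0_def)
      fix j assume j: "j \<in> Obj (two_fiber A B H b)"
      obtain a \<phi> where e: "j = (a, \<phi>)" by (cases j)
      have a: "a \<in> Obj A" "\<phi> \<in> Hom B (on_obj H a) b" "iso_arr B \<phi>" using j by (simp_all add: e two_fiber_Obj)
      have o: "on_obj (fcomp (two_fiber A B H b) \<Phi> (fiber_proj A B H b)) j = on_obj \<Phi> a"
        using j by (simp add: e fcomp_simps fiber_proj_def)
      show "carrier (on_obj (fcomp (two_fiber A B H b) \<Phi> (fiber_proj A B H b)) j) =
          {\<zero>\<^bsub>on_obj (fcomp (two_fiber A B H b) \<Phi> (fiber_proj A B H b)) j\<^esub>} \<or>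
        (\<exists>j0\<in>J0. \<exists>f. f \<in> Hom (two_fiber A B H b) j j0)"
      proof (cases "carrier (on_obj \<Phi> a) = {\<zero>\<^bsub>on_obj \<Phi> a\<^esub>}")
        case False
        define a' where "a' = rep (iso_class A a)"
        have mem: "a' \<in> rep ` ?S" using False a(1) unfolding a'_def by blast
        have "a' \<in> iso_class A a" unfolding a'_def rep_def by (rule someI[of _ a]) (rule A.iso_class_self[OF a(1)])
        then obtain u where u: "u \<in> Hom A a a'" "iso_arr A u" unfolding iso_class_def by blast
        obtain v where v: "v \<in> Hom A a' a" "v \<cdot>\<^bsub>A\<^esub> u = Ident A a" "u \<cdot>\<^bsub>A\<^esub> v = Ident A a'" "iso_arr A v"
          by (rule A.iso_inverse[OF u])
        \<comment> \<open>The fiber object moved along \<open>u\<close> to the representative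
          \<open>a'\<close>; the arrow to \<open>b\<close> is corrected by the inverse of
          \<open>u\<close>.\<close>
        define \<phi>' where "\<phi>' = \<phi> \<cdot>\<^bsub>B\<^esub> on_arr H v"
        have \<phi>': "\<phi>' \<in> Hom B (on_obj H a') b" "iso_arr B \<phi>'"
          unfolding \<phi>'_def by (rule B.Comp_Hom[OF arr_maps[OF v(1)] a(2)] B.iso_comp[OF arr_maps[OF v(1)] functor_iso[OF H v(1,4)] a(2,3)])+
        have "\<phi>' \<cdot>\<^bsub>B\<^esub> on_arr H u = \<phi> \<cdot>\<^bsub>B\<^esub> on_arr H (v \<cdot>\<^bsub>A\<^esub> u)"
          unfolding \<phi>'_def using B.Comp_assoc[OF arr_maps[OF u(1)] arr_maps[OF v(1)] a(2)] pres_Comp[OF u(1) v(1)] by simp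
        also have "\<dots> = \<phi>" using v(2) pres_Ident[OF a(1)] B.Ident_right[OF a(2)] by simp
        finally have c: "\<phi>' \<cdot>\<^bsub>B\<^esub> on_arr H u = \<phi>" .
        have O: "(a', \<phi>') \<in> Obj (two_fiber A B H b)" using \<phi>' A.Hom_Obj(2)[OF u(1)] by (simp add: two_fiber_Obj)
        have "(j, (a', \<phi>'), u) \<in> Hom (two_fiber A B H b) j (a', \<phi>')"
          using j O u(1) c by (simp add: two_fiber_Hom e)
        moreover have "(a', \<phi>') \<in> J0" using O mem \<phi>'(1) unfolding J0_def by blast
        ultimately show ?thesis by blast
      qed (simp add: o)
    qed
  qed
qed

section \<open>Pushouts and pullbacks\<close>

context category
begin

abbreviation dom where "dom \<equiv> Dom C"
abbreviation cod where "cod \<equiv> Cod C"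
abbreviation hom where "hom \<equiv> Hom C"
abbreviation iso where "iso \<equiv> iso_arr C"

section \<open>Monomorphisms, epimorphisms and universal squares\<close>

lemma monoD: "mono_arr C f \<Longrightarrow> g \<in> hom w (dom f) \<Longrightarrow> h \<in> hom w (dom f) \<Longrightarrow> f \<cdot> g = f \<cdot> h \<Longrightarrow> g = h"
  unfolding mono_arr_def by blast

lemma epiD: "epi_arr C f \<Longrightarrow> g \<in> hom (cod f) w \<Longrightarrow> h \<in> hom (cod f) w \<Longrightarrow> g \<cdot> f = h \<cdot> f \<Longrightarrow> g = h"
  unfolding epi_arr_def by blast

lemma mono_comp:
  assumes f: "f \<in> hom x y" "mono_arr C f" and g: "g \<in> hom y w" "mono_arr C g"
  shows "mono_arr C (g \<cdot> f)"
proof -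
  note gf = HomD[OF Comp_Hom[OF f(1) g(1)]]
  show ?thesis unfolding mono_arr_def gf(2)
  proof (intro conjI allI ballI impI)
    fix v a b assume a: "a \<in> hom v x" and b: "b \<in> hom v x" and e: "g \<cdot> f \<cdot> a = g \<cdot> f \<cdot> b"
    have "f \<cdot> a = f \<cdot> b"
      using monoD[OF g(2), of "f \<cdot> a" v "f \<cdot> b"] e Comp_Hom[OF a f(1)] Comp_Hom[OF b f(1)]
        Comp_assoc[OF a f(1) g(1)] Comp_assoc[OF b f(1) g(1)] HomD(2)[OF g(1)] by simp
    then show "a = b" using monoD[OF f(2), of a v b] a b HomD(2)[OF f(1)] by simp
  qed (rule gf(1))
qed

lemma epi_comp:
  assumes f: "f \<in> hom x y" "epi_arr C f" and g: "g \<in> hom y w" "epi_arr C g"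
  shows "epi_arr C (g \<cdot> f)"
proof -
  note gf = HomD[OF Comp_Hom[OF f(1) g(1)]]
  show ?thesis unfolding epi_arr_def gf(3)
  proof (intro conjI allI ballI impI)
    fix v a b assume a: "a \<in> hom w v" and b: "b \<in> hom w v" and e: "a \<cdot> (g \<cdot> f) = b \<cdot> (g \<cdot> f)"
    have "a \<cdot> g = b \<cdot> g"
      using epiD[OF f(2), of "a \<cdot> g" v "b \<cdot> g"] e Comp_Hom[OF g(1) a] Comp_Hom[OF g(1) b]
        Comp_assoc[OF f(1) g(1) a] Comp_assoc[OF f(1) g(1) b] HomD(3)[OF f(1)] by simp
    then show "a = b" using epiD[OF g(2), of a v b] a b HomD(3)[OF g(1)] by simp
  qed (rule gf(1))
qed

lemma mono_cancel:
  assumes f: "f \<in> hom x y" and g: "g \<in> hom y w" and m: "mono_arr C (g \<cdot> f)"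
  shows "mono_arr C f"
  unfolding mono_arr_def HomD(2)[OF f]
proof (intro conjI allI ballI impI)
  fix v a b assume a: "a \<in> hom v x" and b: "b \<in> hom v x" and e: "f \<cdot> a = f \<cdot> b"
  show "a = b"
    using monoD[OF m, of a v b] a b e HomD(2)[OF Comp_Hom[OF f g]] Comp_assoc[OF a f g] Comp_assoc[OF b f g] by simp
qed (rule HomD(1)[OF f])

lemma epi_cancel:
  assumes f: "f \<in> hom x y" and g: "g \<in> hom y w" and m: "epi_arr C (g \<cdot> f)"
  shows "epi_arr C g"
  unfolding epi_arr_def HomD(3)[OF g]
proof (intro conjI allI ballI impI)
  fix v a b assume a: "a \<in> hom w v" and b: "b \<in> hom w v" and e: "a \<cdot> g = b \<cdot> g"
  show "a = b"
    using epiD[OF m, of a v b] a b e HomD(3)[OF Comp_Hom[OF f g]] Comp_assoc[OF f g a] Comp_assoc[OF f g b] by simp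
qed (rule HomD(1)[OF g])

lemma Ident_mono: "x \<in> Obj C \<Longrightarrow> mono_arr C (Ident C x)"
  unfolding mono_arr_def using Ident_Hom[of x] HomD[OF Ident_Hom[of x]] Ident_left by metis

lemma Ident_epi: "x \<in> Obj C \<Longrightarrow> epi_arr C (Ident C x)"
  unfolding epi_arr_def using Ident_Hom[of x] HomD[OF Ident_Hom[of x]] Ident_right by metis

lemma iso_mono: "f \<in> hom x y \<Longrightarrow> iso f \<Longrightarrow> mono_arr C f"
  by (metis iso_inverse mono_cancel Ident_mono Hom_Obj(1))

lemma iso_epi: "f \<in> hom x y \<Longrightarrow> iso f \<Longrightarrow> epi_arr C f"
  by (metis iso_inverse epi_cancel Ident_epi Hom_Obj(2))

lemma comm_squareI:
  assumes "f \<in> hom a b" "g \<in> hom a c" "h \<in> hom b d" "k \<in> hom c d" "h \<cdot> f = k \<cdot> g"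
  shows "comm_square C f g h k"
  using assms unfolding comm_square_def Hom_def by simp

lemma comm_squareE:
  assumes "comm_square C f g h k"
  obtains a b c d where "f \<in> hom a b" "g \<in> hom a c" "h \<in> hom b d" "k \<in> hom c d" "h \<cdot> f = k \<cdot> g"
  using assms unfolding comm_square_def Hom_def by simp

text \<open>Explicit corners, and existence separated from uniqueness, replace the form of the
  definition, which reads the corners off by \<open>Cod\<close>.\<close>

lemma is_pushoutI:
  assumes "f \<in> hom a b" "g \<in> hom a c" "h \<in> hom b d" "k \<in> hom c d" "h \<cdot> f = k \<cdot> g"
    and "\<And>x h' k'. h' \<in> hom b x \<Longrightarrow> k' \<in> hom c x \<Longrightarrow> h' \<cdot> f = k' \<cdot> g \<Longrightarrow> \<exists>u \<in> hom d x. u \<cdot> h = h' \<and> u \<cdot> k = k'"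
    and "\<And>x u u'. u \<in> hom d x \<Longrightarrow> u' \<in> hom d x \<Longrightarrow> u \<cdot> h = u' \<cdot> h \<Longrightarrow> u \<cdot> k = u' \<cdot> k \<Longrightarrow> u = u'"
  shows "is_pushout C f g h k"
  unfolding is_pushout_def
proof (intro conjI allI impI)
  fix h' k' assume "comm_square C f g h' k'"
  then obtain x where x: "h' \<in> hom b x" "k' \<in> hom c x" "h' \<cdot> f = k' \<cdot> g"
    using HomD[OF assms(1)] HomD[OF assms(2)] unfolding comm_square_def Hom_def by auto
  obtain u where u: "u \<in> hom d x" "u \<cdot> h = h'" "u \<cdot> k = k'" using assms(6)[OF x] by blast
  show "\<exists>!u. u \<in> hom (cod h) (cod h') \<and> u \<cdot> h = h' \<and> u \<cdot> k = k'"
    unfolding HomD(3)[OF assms(3)] HomD(3)[OF x(1)]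
  proof (rule ex1I[of _ u])
    fix u' assume "u' \<in> hom d x \<and> u' \<cdot> h = h' \<and> u' \<cdot> k = k'"
    then show "u' = u" using assms(7)[of u' x u] u by simp
  qed (simp add: u)
qed (rule comm_squareI[OF assms(1-5)])

lemma is_pushoutE:
  assumes "is_pushout C f g h k"
  obtains a b c d where "f \<in> hom a b" "g \<in> hom a c" "h \<in> hom b d" "k \<in> hom c d" "h \<cdot> f = k \<cdot> g"
    and "\<And>x h' k'. h' \<in> hom b x \<Longrightarrow> k' \<in> hom c x \<Longrightarrow> h' \<cdot> f = k' \<cdot> g \<Longrightarrow> \<exists>u \<in> hom d x. u \<cdot> h = h' \<and> u \<cdot> k = k'"
    and "\<And>x u u'. u \<in> hom d x \<Longrightarrow> u' \<in> hom d x \<Longrightarrow> u \<cdot> h = u' \<cdot> h \<Longrightarrow> u \<cdot> k = u' \<cdot> k \<Longrightarrow> u = u'"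
proof -
  obtain a b c d where s: "f \<in> hom a b" "g \<in> hom a c" "h \<in> hom b d" "k \<in> hom c d" "h \<cdot> f = k \<cdot> g"
    using assms unfolding is_pushout_def by (blast elim: comm_squareE)
  have ex1: "\<exists>!u. u \<in> hom d x \<and> u \<cdot> h = h' \<and> u \<cdot> k = k'" if x: "h' \<in> hom b x" "k' \<in> hom c x" "h' \<cdot> f = k' \<cdot> g" for x h' k'
    using assms comm_squareI[OF s(1,2) x] HomD(3)[OF s(3)] HomD(3)[OF x(1)] unfolding is_pushout_def by metis
  show thesis
  proof (rule that[OF s])
    fix x h' k' assume "h' \<in> hom b x" "k' \<in> hom c x" "h' \<cdot> f = k' \<cdot> g"
    from ex1[OF this] show "\<exists>u \<in> hom d x. u \<cdot> h = h' \<and> u \<cdot> k = k'" by blast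
  next
    fix x u u' assume u: "u \<in> hom d x" "u' \<in> hom d x" "u \<cdot> h = u' \<cdot> h" "u \<cdot> k = u' \<cdot> k"
    have "u \<cdot> h \<cdot> f = u \<cdot> k \<cdot> g"
      using Comp_assoc[OF s(1,3) u(1)] Comp_assoc[OF s(2,4) u(1)] s(5) by simp
    from ex1[OF Comp_Hom[OF s(3) u(1)] Comp_Hom[OF s(4) u(1)] this] show "u = u'" using u by metis
  qed
qed

lemma is_pullbackI:
  assumes "f \<in> hom a b" "g \<in> hom a c" "h \<in> hom b d" "k \<in> hom c d" "h \<cdot> f = k \<cdot> g"
    and "\<And>x f' g'. f' \<in> hom x b \<Longrightarrow> g' \<in> hom x c \<Longrightarrow> h \<cdot> f' = k \<cdot> g' \<Longrightarrow> \<exists>u \<in> hom x a. f \<cdot> u = f' \<and> g \<cdot> u = g'"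
    and "\<And>x u u'. u \<in> hom x a \<Longrightarrow> u' \<in> hom x a \<Longrightarrow> f \<cdot> u = f \<cdot> u' \<Longrightarrow> g \<cdot> u = g \<cdot> u' \<Longrightarrow> u = u'"
  shows "is_pullback C f g h k"
  unfolding is_pullback_def
proof (intro conjI allI impI)
  fix f' g' assume "comm_square C f' g' h k"
  then obtain x where x: "f' \<in> hom x b" "g' \<in> hom x c" "h \<cdot> f' = k \<cdot> g'"
    using HomD[OF assms(3)] HomD[OF assms(4)] unfolding comm_square_def Hom_def by auto
  obtain u where u: "u \<in> hom x a" "f \<cdot> u = f'" "g \<cdot> u = g'" using assms(6)[OF x] by blast
  show "\<exists>!u. u \<in> hom (dom f') (dom f) \<and> f \<cdot> u = f' \<and> g \<cdot> u = g'"
    unfolding HomD(2)[OF assms(1)] HomD(2)[OF x(1)]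
  proof (rule ex1I[of _ u])
    fix u' assume "u' \<in> hom x a \<and> f \<cdot> u' = f' \<and> g \<cdot> u' = g'"
    then show "u' = u" using assms(7)[of u' x u] u by simp
  qed (simp add: u)
qed (rule comm_squareI[OF assms(1-5)])

lemma is_pullbackE:
  assumes "is_pullback C f g h k"
  obtains a b c d where "f \<in> hom a b" "g \<in> hom a c" "h \<in> hom b d" "k \<in> hom c d" "h \<cdot> f = k \<cdot> g"
    and "\<And>x f' g'. f' \<in> hom x b \<Longrightarrow> g' \<in> hom x c \<Longrightarrow> h \<cdot> f' = k \<cdot> g' \<Longrightarrow> \<exists>u \<in> hom x a. f \<cdot> u = f' \<and> g \<cdot> u = g'"
    and "\<And>x u u'. u \<in> hom x a \<Longrightarrow> u' \<in> hom x a \<Longrightarrow> f \<cdot> u = f \<cdot> u' \<Longrightarrow> g \<cdot> u = g \<cdot> u' \<Longrightarrow> u = u'"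
proof -
  obtain a b c d where s: "f \<in> hom a b" "g \<in> hom a c" "h \<in> hom b d" "k \<in> hom c d" "h \<cdot> f = k \<cdot> g"
    using assms unfolding is_pullback_def by (blast elim: comm_squareE)
  have ex1: "\<exists>!u. u \<in> hom x a \<and> f \<cdot> u = f' \<and> g \<cdot> u = g'" if x: "f' \<in> hom x b" "g' \<in> hom x c" "h \<cdot> f' = k \<cdot> g'" for x f' g'
    using assms comm_squareI[OF x(1,2) s(3,4) x(3)] HomD(2)[OF s(1)] HomD(2)[OF x(1)] unfolding is_pullback_def by metis
  show thesis
  proof (rule that[OF s])
    fix x f' g' assume "f' \<in> hom x b" "g' \<in> hom x c" "h \<cdot> f' = k \<cdot> g'"
    from ex1[OF this] show "\<exists>u \<in> hom x a. f \<cdot> u = f' \<and> g \<cdot> u = g'" by blast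
  next
    fix x u u' assume u: "u \<in> hom x a" "u' \<in> hom x a" "f \<cdot> u = f \<cdot> u'" "g \<cdot> u = g \<cdot> u'"
    have "h \<cdot> (f \<cdot> u) = k \<cdot> (g \<cdot> u)"
      using Comp_assoc[OF u(1) s(1,3)] Comp_assoc[OF u(1) s(2,4)] s(5) by simp
    from ex1[OF Comp_Hom[OF u(1) s(1)] Comp_Hom[OF u(1) s(2)] this] show "u = u'" using u by metis
  qed
qed

lemma pushout_unique:
  assumes 1: "is_pushout C f g h k" and 2: "is_pushout C f g h' k'"
  obtains c where "c \<in> hom (cod h) (cod h')" "iso c" "c \<cdot> h = h'" "c \<cdot> k = k'"
proof -
  obtain a b d e where s: "f \<in> hom a b" "g \<in> hom a d" "h \<in> hom b e" "k \<in> hom d e" "h \<cdot> f = k \<cdot> g"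
    and ex: "\<And>x h' k'. h' \<in> hom b x \<Longrightarrow> k' \<in> hom d x \<Longrightarrow> h' \<cdot> f = k' \<cdot> g \<Longrightarrow> \<exists>u \<in> hom e x. u \<cdot> h = h' \<and> u \<cdot> k = k'"
    and un: "\<And>x u u'. u \<in> hom e x \<Longrightarrow> u' \<in> hom e x \<Longrightarrow> u \<cdot> h = u' \<cdot> h \<Longrightarrow> u \<cdot> k = u' \<cdot> k \<Longrightarrow> u = u'"
    by (rule is_pushoutE[OF 1]) blast
  obtain a' b' d' e' where s': "f \<in> hom a' b'" "g \<in> hom a' d'" "h' \<in> hom b' e'" "k' \<in> hom d' e'" "h' \<cdot> f = k' \<cdot> g"
    and ex': "\<And>x h k. h \<in> hom b' x \<Longrightarrow> k \<in> hom d' x \<Longrightarrow> h \<cdot> f = k \<cdot> g \<Longrightarrow> \<exists>u \<in> hom e' x. u \<cdot> h' = h \<and> u \<cdot> k' = k"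
    and un': "\<And>x u u'. u \<in> hom e' x \<Longrightarrow> u' \<in> hom e' x \<Longrightarrow> u \<cdot> h' = u' \<cdot> h' \<Longrightarrow> u \<cdot> k' = u' \<cdot> k' \<Longrightarrow> u = u'"
    by (rule is_pushoutE[OF 2]) blast
  have eq: "b' = b" "d' = d" using HomD[OF s(1)] HomD[OF s'(1)] HomD[OF s(2)] HomD[OF s'(2)] by auto
  note s' = s'[unfolded eq]
  obtain c where c: "c \<in> hom e e'" "c \<cdot> h = h'" "c \<cdot> k = k'" using ex[OF s'(3-5)] by blast
  obtain c' where c': "c' \<in> hom e' e" "c' \<cdot> h' = h" "c' \<cdot> k' = k" using ex'[unfolded eq, OF s(3-5)] by blast
  note o = Hom_Obj(2)[OF s(3)] Hom_Obj(2)[OF s'(3)]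
  have "c' \<cdot> c = Ident C e"
    by (rule un[OF Comp_Hom[OF c(1) c'(1)] Ident_Hom[OF o(1)]])
       (simp_all add: Comp_assoc[OF s(3) c(1) c'(1), symmetric] Comp_assoc[OF s(4) c(1) c'(1), symmetric]
          c c' Ident_left[OF s(3)] Ident_left[OF s(4)])
  moreover have "c \<cdot> c' = Ident C e'"
    by (rule un'[OF Comp_Hom[OF c'(1) c(1)] Ident_Hom[OF o(2)]])
       (simp_all add: Comp_assoc[OF s'(3) c'(1) c(1), symmetric] Comp_assoc[OF s'(4) c'(1) c(1), symmetric]
          c c' Ident_left[OF s'(3)] Ident_left[OF s'(4)])
  ultimately have "iso c" by (rule isoI[OF c(1) c'(1)])
  then show thesis using that c HomD(3)[OF s(3)] HomD(3)[OF s'(3)] by simp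
qed

lemma pullback_unique:
  assumes 1: "is_pullback C f g h k" and 2: "is_pullback C f' g' h k"
  obtains c where "c \<in> hom (dom f) (dom f')" "iso c" "f' \<cdot> c = f" "g' \<cdot> c = g"
proof -
  obtain a b d e where s: "f \<in> hom a b" "g \<in> hom a d" "h \<in> hom b e" "k \<in> hom d e" "h \<cdot> f = k \<cdot> g"
    and ex: "\<And>x f' g'. f' \<in> hom x b \<Longrightarrow> g' \<in> hom x d \<Longrightarrow> h \<cdot> f' = k \<cdot> g' \<Longrightarrow> \<exists>u \<in> hom x a. f \<cdot> u = f' \<and> g \<cdot> u = g'"
    and un: "\<And>x u u'. u \<in> hom x a \<Longrightarrow> u' \<in> hom x a \<Longrightarrow> f \<cdot> u = f \<cdot> u' \<Longrightarrow> g \<cdot> u = g \<cdot> u' \<Longrightarrow> u = u'"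
    by (rule is_pullbackE[OF 1]) blast
  obtain a' b' d' e' where s': "f' \<in> hom a' b'" "g' \<in> hom a' d'" "h \<in> hom b' e'" "k \<in> hom d' e'" "h \<cdot> f' = k \<cdot> g'"
    and ex': "\<And>x f g. f \<in> hom x b' \<Longrightarrow> g \<in> hom x d' \<Longrightarrow> h \<cdot> f = k \<cdot> g \<Longrightarrow> \<exists>u \<in> hom x a'. f' \<cdot> u = f \<and> g' \<cdot> u = g"
    and un': "\<And>x u u'. u \<in> hom x a' \<Longrightarrow> u' \<in> hom x a' \<Longrightarrow> f' \<cdot> u = f' \<cdot> u' \<Longrightarrow> g' \<cdot> u = g' \<cdot> u' \<Longrightarrow> u = u'"
    by (rule is_pullbackE[OF 2]) blast
  have eq: "b' = b" "d' = d" using HomD[OF s(3)] HomD[OF s'(3)] HomD[OF s(4)] HomD[OF s'(4)] by auto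
  note s' = s'[unfolded eq]
  obtain c where c: "c \<in> hom a a'" "f' \<cdot> c = f" "g' \<cdot> c = g" using ex'[unfolded eq, OF s(1,2,5)] by blast
  obtain c' where c': "c' \<in> hom a' a" "f \<cdot> c' = f'" "g \<cdot> c' = g'" using ex[OF s'(1,2,5)] by blast
  note o = Hom_Obj(1)[OF s(1)] Hom_Obj(1)[OF s'(1)]
  have "c' \<cdot> c = Ident C a"
    by (rule un[OF Comp_Hom[OF c(1) c'(1)] Ident_Hom[OF o(1)]])
       (simp_all add: Comp_assoc[OF c(1) c'(1) s(1)] Comp_assoc[OF c(1) c'(1) s(2)]
          c c' Ident_right[OF s(1)] Ident_right[OF s(2)])
  moreover have "c \<cdot> c' = Ident C a'"
    by (rule un'[OF Comp_Hom[OF c'(1) c(1)] Ident_Hom[OF o(2)]])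
       (simp_all add: Comp_assoc[OF c'(1) c(1) s'(1)] Comp_assoc[OF c'(1) c(1) s'(2)]
          c c' Ident_right[OF s'(1)] Ident_right[OF s'(2)])
  ultimately have "iso c" by (rule isoI[OF c(1) c'(1)])
  then show thesis using that c HomD(2)[OF s(1)] HomD(2)[OF s'(1)] by simp
qed

section \<open>Pasting and cancelling squares\<close>

lemma pushout_hpaste:
  assumes 1: "is_pushout C f g h k" and 2: "is_pushout C f' h h' k'"
  shows "is_pushout C (f' \<cdot> f) g h' (k' \<cdot> k)"
proof -
  obtain a b d e where s: "f \<in> hom a b" "g \<in> hom a d" "h \<in> hom b e" "k \<in> hom d e" "h \<cdot> f = k \<cdot> g"
    and ex: "\<And>x h' k'. h' \<in> hom b x \<Longrightarrow> k' \<in> hom d x \<Longrightarrow> h' \<cdot> f = k' \<cdot> g \<Longrightarrow> \<exists>u \<in> hom e x. u \<cdot> h = h' \<and> u \<cdot> k = k'"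
    and un: "\<And>x u u'. u \<in> hom e x \<Longrightarrow> u' \<in> hom e x \<Longrightarrow> u \<cdot> h = u' \<cdot> h \<Longrightarrow> u \<cdot> k = u' \<cdot> k \<Longrightarrow> u = u'"
    by (rule is_pushoutE[OF 1]) blast
  obtain a' b' d' e' where s': "f' \<in> hom a' b'" "h \<in> hom a' d'" "h' \<in> hom b' e'" "k' \<in> hom d' e'" "h' \<cdot> f' = k' \<cdot> h"
    and ex': "\<And>x p q. p \<in> hom b' x \<Longrightarrow> q \<in> hom d' x \<Longrightarrow> p \<cdot> f' = q \<cdot> h \<Longrightarrow> \<exists>u \<in> hom e' x. u \<cdot> h' = p \<and> u \<cdot> k' = q"
    and un': "\<And>x u u'. u \<in> hom e' x \<Longrightarrow> u' \<in> hom e' x \<Longrightarrow> u \<cdot> h' = u' \<cdot> h' \<Longrightarrow> u \<cdot> k' = u' \<cdot> k' \<Longrightarrow> u = u'"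
    by (rule is_pushoutE[OF 2]) blast
  have eq: "a' = b" "d' = e" using HomD[OF s(3)] HomD[OF s'(2)] by auto
  note s' = s'[unfolded eq] and ex' = ex'[unfolded eq]
  show ?thesis
  proof (rule is_pushoutI[OF Comp_Hom[OF s(1) s'(1)] s(2) s'(3) Comp_Hom[OF s(4) s'(4)]])
    show "h' \<cdot> (f' \<cdot> f) = k' \<cdot> k \<cdot> g"
      using Comp_assoc[OF s(1) s'(1,3)] Comp_assoc[OF s(1,3) s'(4)] Comp_assoc[OF s(2,4) s'(4)] s(5) s'(5) by simp
  next
    fix x p q assume p: "p \<in> hom b' x" and q: "q \<in> hom d x" and e: "p \<cdot> (f' \<cdot> f) = q \<cdot> g"
    have "p \<cdot> f' \<cdot> f = q \<cdot> g" using Comp_assoc[OF s(1) s'(1) p] e by simp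
    then obtain u where u: "u \<in> hom e x" "u \<cdot> h = p \<cdot> f'" "u \<cdot> k = q" using ex[OF Comp_Hom[OF s'(1) p] q] by blast
    then obtain v where v: "v \<in> hom e' x" "v \<cdot> h' = p" "v \<cdot> k' = u" using ex'[OF p u(1)] by metis
    show "\<exists>u\<in>hom e' x. u \<cdot> h' = p \<and> u \<cdot> (k' \<cdot> k) = q"
      using v u Comp_assoc[OF s(4) s'(4) v(1)] by (intro bexI[of _ v]) simp_all
  next
    fix x u u' assume u: "u \<in> hom e' x" "u' \<in> hom e' x" "u \<cdot> h' = u' \<cdot> h'" "u \<cdot> (k' \<cdot> k) = u' \<cdot> (k' \<cdot> k)"
    have "u \<cdot> k' = u' \<cdot> k'"
    proof (rule un[OF Comp_Hom[OF s'(4) u(1)] Comp_Hom[OF s'(4) u(2)]])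
      show "u \<cdot> k' \<cdot> h = u' \<cdot> k' \<cdot> h"
        using Comp_assoc[OF s'(2,4) u(1)] Comp_assoc[OF s'(2,4) u(2)] Comp_assoc[OF s'(1,3) u(1)] Comp_assoc[OF s'(1,3) u(2)] s'(5) u(3) by simp
      show "u \<cdot> k' \<cdot> k = u' \<cdot> k' \<cdot> k"
        using Comp_assoc[OF s(4) s'(4) u(1)] Comp_assoc[OF s(4) s'(4) u(2)] u(4) by simp
    qed
    then show "u = u'" by (rule un'[OF u(1-3)])
  qed
qed

lemma pushout_swap: "is_pushout C f g h k \<Longrightarrow> is_pushout C g f k h"
proof -
  assume 1: "is_pushout C f g h k"
  obtain a b d e where s: "f \<in> hom a b" "g \<in> hom a d" "h \<in> hom b e" "k \<in> hom d e" "h \<cdot> f = k \<cdot> g"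
    and ex: "\<And>x h' k'. h' \<in> hom b x \<Longrightarrow> k' \<in> hom d x \<Longrightarrow> h' \<cdot> f = k' \<cdot> g \<Longrightarrow> \<exists>u \<in> hom e x. u \<cdot> h = h' \<and> u \<cdot> k = k'"
    and un: "\<And>x u u'. u \<in> hom e x \<Longrightarrow> u' \<in> hom e x \<Longrightarrow> u \<cdot> h = u' \<cdot> h \<Longrightarrow> u \<cdot> k = u' \<cdot> k \<Longrightarrow> u = u'"
    by (rule is_pushoutE[OF 1]) blast
  show ?thesis
  proof (rule is_pushoutI[OF s(2,1,4,3) s(5)[symmetric]])
    fix x p q assume "p \<in> hom d x" "q \<in> hom b x" "p \<cdot> g = q \<cdot> f"
    then show "\<exists>u\<in>hom e x. u \<cdot> k = p \<and> u \<cdot> h = q" using ex[of q x p] by auto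
  qed (rule un)
qed

lemma pushout_vpaste:
  assumes "is_pushout C f g h k" and "is_pushout C k g' h' k'"
  shows "is_pushout C f (g' \<cdot> g) (h' \<cdot> h) k'"
  using pushout_hpaste[OF pushout_swap[OF assms(1)] pushout_swap[OF assms(2)]] by (rule pushout_swap)

text \<open>The mediating arrow of the outer rectangle also serves the second square, because the
  legs of the first pushout are jointly epic. It yields the exact sequence of a quotient in
  \<open>flag3_left\<close>.\<close>

lemma pushout_vcancel:
  assumes 1: "is_pushout C f g h k" and 2: "is_pushout C f (g' \<cdot> g) (h' \<cdot> h) k'"
    and c: "g' \<in> hom d d'" "k \<in> hom d e" "h' \<in> hom e e'" "k' \<in> hom d' e'" "h' \<cdot> k = k' \<cdot> g'"
  shows "is_pushout C k g' h' k'"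
proof -
  obtain a b d0 e0 where s: "f \<in> hom a b" "g \<in> hom a d0" "h \<in> hom b e0" "k \<in> hom d0 e0" "h \<cdot> f = k \<cdot> g"
    and ex: "\<And>x h' k'. h' \<in> hom b x \<Longrightarrow> k' \<in> hom d0 x \<Longrightarrow> h' \<cdot> f = k' \<cdot> g \<Longrightarrow> \<exists>u \<in> hom e0 x. u \<cdot> h = h' \<and> u \<cdot> k = k'"
    and un: "\<And>x u u'. u \<in> hom e0 x \<Longrightarrow> u' \<in> hom e0 x \<Longrightarrow> u \<cdot> h = u' \<cdot> h \<Longrightarrow> u \<cdot> k = u' \<cdot> k \<Longrightarrow> u = u'"
    by (rule is_pushoutE[OF 1]) blast
  have eq: "d0 = d" "e0 = e" using HomD[OF s(4)] HomD[OF c(2)] by auto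
  note s = s[unfolded eq] and ex = ex[unfolded eq] and un = un[unfolded eq]
  obtain a1 b1 d1 e1 where s': "f \<in> hom a1 b1" "g' \<cdot> g \<in> hom a1 d1" "h' \<cdot> h \<in> hom b1 e1" "k' \<in> hom d1 e1"
    and ex': "\<And>x p q. p \<in> hom b1 x \<Longrightarrow> q \<in> hom d1 x \<Longrightarrow> p \<cdot> f = q \<cdot> (g' \<cdot> g) \<Longrightarrow> \<exists>u \<in> hom e1 x. u \<cdot> (h' \<cdot> h) = p \<and> u \<cdot> k' = q"
    and un': "\<And>x u u'. u \<in> hom e1 x \<Longrightarrow> u' \<in> hom e1 x \<Longrightarrow> u \<cdot> (h' \<cdot> h) = u' \<cdot> (h' \<cdot> h) \<Longrightarrow> u \<cdot> k' = u' \<cdot> k' \<Longrightarrow> u = u'"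
    by (rule is_pushoutE[OF 2]) blast
  have eq': "b1 = b" "d1 = d'" "e1 = e'" using HomD[OF s(1)] HomD[OF s'(1)] HomD[OF s'(4)] HomD[OF c(4)] by auto
  note ex' = ex'[unfolded eq'] and un' = un'[unfolded eq']
  show ?thesis
  proof (rule is_pushoutI[OF c(2,1,3,4,5)])
    fix x p q assume p: "p \<in> hom e x" and q: "q \<in> hom d' x" and e: "p \<cdot> k = q \<cdot> g'"
    have "p \<cdot> h \<cdot> f = q \<cdot> (g' \<cdot> g)"
      using Comp_assoc[OF s(1,3) p] Comp_assoc[OF s(2,4) p] Comp_assoc[OF s(2) c(1) q] e s(5) by simp
    then obtain u where u: "u \<in> hom e' x" "u \<cdot> (h' \<cdot> h) = p \<cdot> h" "u \<cdot> k' = q" using ex'[OF Comp_Hom[OF s(3) p] q] by blast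
    have "u \<cdot> h' = p"
    proof (rule un[OF Comp_Hom[OF c(3) u(1)] p])
      show "u \<cdot> h' \<cdot> h = p \<cdot> h" using Comp_assoc[OF s(3) c(3) u(1)] u(2) by simp
      show "u \<cdot> h' \<cdot> k = p \<cdot> k" using Comp_assoc[OF c(2,3) u(1)] Comp_assoc[OF c(1,4) u(1)] c(5) u(3) e by simp
    qed
    then show "\<exists>u\<in>hom e' x. u \<cdot> h' = p \<and> u \<cdot> k' = q" using u by blast
  next
    fix x u u' assume u: "u \<in> hom e' x" "u' \<in> hom e' x" "u \<cdot> h' = u' \<cdot> h'" "u \<cdot> k' = u' \<cdot> k'"
    show "u = u'"
      by (rule un'[OF u(1,2) _ u(4)])
         (use Comp_assoc[OF s(3) c(3) u(1)] Comp_assoc[OF s(3) c(3) u(2)] u(3) in simp)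
  qed
qed

text \<open>The pullback counterpart of \<open>pushout_vcancel\<close>: here joint monicity of the
  legs of the given pullback is what identifies the mediating arrow. It is used in
  \<open>flag3_right\<close>.\<close>

lemma pullback_hcancel:
  assumes 1: "is_pullback C f' h h' k'" and 2: "is_pullback C (f' \<cdot> f) g h' (k' \<cdot> k)"
    and c: "f \<in> hom a b" "h \<in> hom b e" "k \<in> hom d e" "g \<in> hom a d" "h \<cdot> f = k \<cdot> g"
  shows "is_pullback C f g h k"
proof -
  obtain b0 b' e0 e' where s: "f' \<in> hom b0 b'" "h \<in> hom b0 e0" "h' \<in> hom b' e'" "k' \<in> hom e0 e'" "h' \<cdot> f' = k' \<cdot> h"
    and ex: "\<And>x p q. p \<in> hom x b' \<Longrightarrow> q \<in> hom x e0 \<Longrightarrow> h' \<cdot> p = k' \<cdot> q \<Longrightarrow> \<exists>u \<in> hom x b0. f' \<cdot> u = p \<and> h \<cdot> u = q"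
    and un: "\<And>x u u'. u \<in> hom x b0 \<Longrightarrow> u' \<in> hom x b0 \<Longrightarrow> f' \<cdot> u = f' \<cdot> u' \<Longrightarrow> h \<cdot> u = h \<cdot> u' \<Longrightarrow> u = u'"
    by (rule is_pullbackE[OF 1]) blast
  have eq: "b0 = b" "e0 = e" using HomD[OF s(2)] HomD[OF c(2)] by auto
  note s = s[unfolded eq] and ex = ex[unfolded eq] and un = un[unfolded eq]
  obtain a1 b1 d1 e1 where s': "f' \<cdot> f \<in> hom a1 b1" "g \<in> hom a1 d1" "h' \<in> hom b1 e1"
    and ex': "\<And>x p q. p \<in> hom x b1 \<Longrightarrow> q \<in> hom x d1 \<Longrightarrow> h' \<cdot> p = k' \<cdot> k \<cdot> q \<Longrightarrow> \<exists>u \<in> hom x a1. f' \<cdot> f \<cdot> u = p \<and> g \<cdot> u = q"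
    and un': "\<And>x u u'. u \<in> hom x a1 \<Longrightarrow> u' \<in> hom x a1 \<Longrightarrow> f' \<cdot> f \<cdot> u = f' \<cdot> f \<cdot> u' \<Longrightarrow> g \<cdot> u = g \<cdot> u' \<Longrightarrow> u = u'"
    by (rule is_pullbackE[OF 2]) blast
  have eq': "b1 = b'" "d1 = d" "a1 = a" using HomD[OF s(3)] HomD[OF s'(3)] HomD[OF s'(2)] HomD[OF c(4)] by auto
  note ex' = ex'[unfolded eq'] and un' = un'[unfolded eq']
  show ?thesis
  proof (rule is_pullbackI[OF c(1,4,2,3,5)])
    fix x p q assume p: "p \<in> hom x b" and q: "q \<in> hom x d" and e: "h \<cdot> p = k \<cdot> q"
    have "h' \<cdot> (f' \<cdot> p) = k' \<cdot> k \<cdot> q"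
      using Comp_assoc[OF p s(1,3)] Comp_assoc[OF p s(2,4)] Comp_assoc[OF q c(3) s(4)] e s(5) by simp
    then obtain u where u: "u \<in> hom x a" "f' \<cdot> f \<cdot> u = f' \<cdot> p" "g \<cdot> u = q" using ex'[OF Comp_Hom[OF p s(1)] q] by blast
    have "f \<cdot> u = p"
    proof (rule un[OF Comp_Hom[OF u(1) c(1)] p])
      show "f' \<cdot> (f \<cdot> u) = f' \<cdot> p" using Comp_assoc[OF u(1) c(1) s(1)] u(2) by simp
      show "h \<cdot> (f \<cdot> u) = h \<cdot> p" using Comp_assoc[OF u(1) c(1,2)] Comp_assoc[OF u(1) c(4,3)] c(5) u(3) e by simp
    qed
    then show "\<exists>u\<in>hom x a. f \<cdot> u = p \<and> g \<cdot> u = q" using u by blast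
  next
    fix x u u' assume u: "u \<in> hom x a" "u' \<in> hom x a" "f \<cdot> u = f \<cdot> u'" "g \<cdot> u = g \<cdot> u'"
    show "u = u'"
      by (rule un'[OF u(1,2) _ u(4)])
         (use Comp_assoc[OF u(1) c(1) s(1)] Comp_assoc[OF u(2) c(1) s(1)] u(3) in simp)
  qed
qed

text \<open>Inverses as a function, so that transported sequences can be written as terms.\<close>

definition inverse_arr :: "'a \<Rightarrow> 'a" where
  "inverse_arr f = (SOME g. g \<in> hom (cod f) (dom f) \<and> g \<cdot> f = Ident C (dom f) \<and> f \<cdot> g = Ident C (cod f))"

lemma inverse_arr:
  assumes "f \<in> hom x y" "iso f"
  shows "inverse_arr f \<in> hom y x" "inverse_arr f \<cdot> f = Ident C x" "f \<cdot> inverse_arr f = Ident C y" "iso (inverse_arr f)"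
proof -
  have "\<exists>g. g \<in> hom (cod f) (dom f) \<and> g \<cdot> f = Ident C (dom f) \<and> f \<cdot> g = Ident C (cod f)"
    using assms(2) unfolding iso_arr_def by blast
  from someI_ex[OF this] show i: "inverse_arr f \<in> hom y x" "inverse_arr f \<cdot> f = Ident C x" "f \<cdot> inverse_arr f = Ident C y"
    unfolding inverse_arr_def HomD[OF assms(1)] by blast+
  show "iso (inverse_arr f)" by (rule isoI[OF i(1) assms(1) i(3,2)])
qed

lemma inverse_arr_unique:
  assumes f: "f \<in> hom x y" and g: "g \<in> hom y x" and gf: "g \<cdot> f = Ident C x" and fg: "f \<cdot> g = Ident C y"
  shows "inverse_arr f = g"
proof -
  note i = inverse_arr[OF f isoI[OF f g gf fg]]
  have "inverse_arr f = inverse_arr f \<cdot> (f \<cdot> g)" using fg Ident_right[OF i(1)] by simp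
  also have "\<dots> = g" using Comp_assoc[OF g f i(1)] i(2) Ident_left[OF g] by simp
  finally show ?thesis .
qed

lemma inverse_arr_comp:
  assumes f: "f \<in> hom x y" "iso f" and g: "g \<in> hom y w" "iso g"
  shows "inverse_arr (g \<cdot> f) = inverse_arr f \<cdot> inverse_arr g"
proof -
  note i = inverse_arr[OF f] and j = inverse_arr[OF g]
  have "inverse_arr f \<cdot> inverse_arr g \<cdot> (g \<cdot> f) = inverse_arr f \<cdot> (inverse_arr g \<cdot> g \<cdot> f)"
    using Comp_assoc[OF Comp_Hom[OF f(1) g(1)] j(1) i(1)] Comp_assoc[OF f(1) g(1) j(1)] by simp
  then have 1: "inverse_arr f \<cdot> inverse_arr g \<cdot> (g \<cdot> f) = Ident C x" using i(2) j(2) Ident_left[OF f(1)] by simp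
  have "g \<cdot> f \<cdot> (inverse_arr f \<cdot> inverse_arr g) = g \<cdot> (f \<cdot> inverse_arr f \<cdot> inverse_arr g)"
    using Comp_assoc[OF Comp_Hom[OF j(1) i(1)] f(1) g(1)] Comp_assoc[OF j(1) i(1) f(1)] by simp
  then have 2: "g \<cdot> f \<cdot> (inverse_arr f \<cdot> inverse_arr g) = Ident C w" using i(3) j(3) Ident_left[OF j(1)] by simp
  show ?thesis by (rule inverse_arr_unique[OF Comp_Hom[OF f(1) g(1)] Comp_Hom[OF j(1) i(1)] 1 2])
qed

lemma inverse_arr_Ident: "x \<in> Obj C \<Longrightarrow> inverse_arr (Ident C x) = Ident C x"
  by (rule inverse_arr_unique[OF Ident_Hom Ident_Hom]) (simp_all add: Ident_left[OF Ident_Hom])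

text \<open>Pasting with such a square replaces a corner of a pushout by an isomorphic object. The
  next three lemmas do this for the initial corner, the final corner and one side corner.\<close>

lemma pushout_parallel_isos:
  assumes k: "k \<in> hom x y" and m: "m \<in> hom x' y'" and c: "c \<in> hom x x'" "iso c"
    and d: "d \<in> hom y y'" "iso d" and eq: "d \<cdot> k = m \<cdot> c"
  shows "is_pushout C k c d m"
proof (rule is_pushoutI[OF k c(1) d(1) m eq])
  note j = inverse_arr[OF d]
  fix w p q assume p: "p \<in> hom y w" and q: "q \<in> hom x' w" and pq: "p \<cdot> k = q \<cdot> c"
  let ?u = "p \<cdot> inverse_arr d"
  have u: "?u \<in> hom y' w" "?u \<cdot> d = p"
    using Comp_Hom[OF j(1) p] Comp_assoc[OF d(1) j(1) p] j(2) Ident_right[OF p] by simp_all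
  have "?u \<cdot> m \<cdot> c = q \<cdot> c"
    using Comp_assoc[OF c(1) m u(1)] Comp_assoc[OF k d(1) u(1)] u(2) eq pq by simp
  then have "?u \<cdot> m = q"
    using epiD[OF iso_epi[OF c], of "?u \<cdot> m" w q] Comp_Hom[OF m u(1)] q HomD(3)[OF c(1)] by simp
  with u show "\<exists>u\<in>hom y' w. u \<cdot> d = p \<and> u \<cdot> m = q" by blast
next
  fix w u u' assume "u \<in> hom y' w" "u' \<in> hom y' w" "u \<cdot> d = u' \<cdot> d"
  then show "u = u'" using epiD[OF iso_epi[OF d], of u w u'] HomD(3)[OF d(1)] by simp
qed

context
  fixes f g h k
  assumes po: "is_pushout C f g h k"
begin

lemma pushout_span_iso:
  assumes i: "i \<in> hom w (dom f)" "iso i"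
  shows "is_pushout C (f \<cdot> i) (g \<cdot> i) h k"
proof -
  obtain a b d e where s: "f \<in> hom a b" "g \<in> hom a d" "k \<in> hom d e" by (rule is_pushoutE[OF po])
  have i': "i \<in> hom w a" using i(1) HomD(2)[OF s(1)] by simp
  note gi = Comp_Hom[OF i' s(2)] and o = Hom_Obj(2)[OF s(2)]
  have "is_pushout C i (g \<cdot> i) g (Ident C d)"
    by (rule pushout_swap[OF pushout_parallel_isos[OF gi s(2) i' i(2) Ident_Hom[OF o] iso_Ident[OF o] Ident_left[OF gi]]])
  from pushout_hpaste[OF this po] show ?thesis unfolding Ident_right[OF s(3)] .
qed

lemma pushout_cod_iso:
  assumes i: "i \<in> hom (cod h) w" "iso i"
  shows "is_pushout C f g (i \<cdot> h) (i \<cdot> k)"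
proof -
  obtain a b d e where s: "g \<in> hom a d" "h \<in> hom b e" "k \<in> hom d e" by (rule is_pushoutE[OF po])
  have i': "i \<in> hom e w" using i(1) HomD(3)[OF s(2)] by simp
  note ik = Comp_Hom[OF s(3) i'] and o = Hom_Obj(2)[OF s(1)]
  have "is_pushout C k (Ident C d) i (i \<cdot> k)"
    by (rule pushout_parallel_isos[OF s(3) ik Ident_Hom[OF o] iso_Ident[OF o] i' i(2) Ident_right[OF ik, symmetric]])
  from pushout_vpaste[OF po this] show ?thesis unfolding Ident_left[OF s(1)] .
qed

lemma pushout_leg_iso:
  assumes i: "i \<in> hom (cod g) w" "iso i"
  shows "is_pushout C f (i \<cdot> g) h (k \<cdot> inverse_arr i)"
proof -
  obtain a b d e where s: "g \<in> hom a d" "h \<in> hom b e" "k \<in> hom d e" by (rule is_pushoutE[OF po])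
  have i': "i \<in> hom d w" using i(1) HomD(3)[OF s(1)] by simp
  note j = inverse_arr[OF i' i(2)] and o = Hom_Obj(2)[OF s(2)]
  have eq: "Ident C e \<cdot> k = k \<cdot> inverse_arr i \<cdot> i"
    using Comp_assoc[OF i' j(1) s(3)] j(2) Ident_left[OF s(3)] Ident_right[OF s(3)] by simp
  have "is_pushout C k i (Ident C e) (k \<cdot> inverse_arr i)"
    by (rule pushout_parallel_isos[OF s(3) Comp_Hom[OF j(1) s(3)] i' i(2) Ident_Hom[OF o] iso_Ident[OF o] eq])
  from pushout_vpaste[OF po this] show ?thesis unfolding Ident_left[OF s(2)] .
qed

end

end

section \<open>Exact sequences and three-step flags\<close>

locale pointed_proto_abelian = proto_abelian C for C :: "('o, 'a) cat" (structure) +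
  fixes z :: 'o
  assumes zero_z: "zero_object C z"
begin

section \<open>The zero object and zero maps\<close>

lemma z_Obj: "z \<in> Obj C"
  using zero_z by (simp add: zero_object_def)

lemma zero_object_unique:
  assumes "zero_object C w"
  shows "f \<in> hom w x \<Longrightarrow> g \<in> hom w x \<Longrightarrow> f = g" "f \<in> hom x w \<Longrightarrow> g \<in> hom x w \<Longrightarrow> f = g"
  using assms Hom_Obj(2)[of f w x] Hom_Obj(1)[of f x w] unfolding zero_object_def by blast+

lemma from_zero: "x \<in> Obj C \<Longrightarrow> from_zero C z x \<in> hom z x"
  using zero_z theI'[of "\<lambda>f. f \<in> hom z x"] unfolding zero_object_def from_zero_def by blast

lemma to_zero: "x \<in> Obj C \<Longrightarrow> to_zero C z x \<in> hom x z"
  using zero_z theI'[of "\<lambda>f. f \<in> hom x z"] unfolding zero_object_def to_zero_def by blast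

lemma from_zero_eq: "f \<in> hom z x \<Longrightarrow> f = from_zero C z x"
  by (rule zero_object_unique(1)[OF zero_z _ from_zero[OF Hom_Obj(2)]])

lemma to_zero_eq: "f \<in> hom x z \<Longrightarrow> f = to_zero C z x"
  by (rule zero_object_unique(2)[OF zero_z _ to_zero[OF Hom_Obj(1)]])

lemma from_zero_mono: "x \<in> Obj C \<Longrightarrow> mono_arr C (from_zero C z x)"
  unfolding mono_arr_def HomD(2)[OF from_zero]
  using HomD(1)[OF from_zero] zero_object_unique(2)[OF zero_z] by blast

lemma to_zero_epi: "x \<in> Obj C \<Longrightarrow> epi_arr C (to_zero C z x)"
  unfolding epi_arr_def HomD(3)[OF to_zero]
  using HomD(1)[OF to_zero] zero_object_unique(1)[OF zero_z] by blast

definition zero_map :: "'o \<Rightarrow> 'o \<Rightarrow> 'a" where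
  "zero_map x y = from_zero C z y \<cdot> to_zero C z x"

lemma zero_map_Hom: "x \<in> Obj C \<Longrightarrow> y \<in> Obj C \<Longrightarrow> zero_map x y \<in> hom x y"
  unfolding zero_map_def by (rule Comp_Hom[OF to_zero from_zero])

lemma zero_map_comp_left:
  assumes f: "f \<in> hom y w" and x: "x \<in> Obj C"
  shows "f \<cdot> zero_map x y = zero_map x w"
proof -
  note o = Hom_Obj[OF f]
  have "f \<cdot> from_zero C z y = from_zero C z w" by (rule from_zero_eq[OF Comp_Hom[OF from_zero[OF o(1)] f]])
  then show ?thesis unfolding zero_map_def using Comp_assoc[OF to_zero[OF x] from_zero[OF o(1)] f] by simp
qed

lemma zero_map_comp_right:
  assumes f: "f \<in> hom x y" and w: "w \<in> Obj C"
  shows "zero_map y w \<cdot> f = zero_map x w"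
proof -
  note o = Hom_Obj[OF f]
  have "to_zero C z y \<cdot> f = to_zero C z x" by (rule to_zero_eq[OF Comp_Hom[OF f to_zero[OF o(2)]]])
  then show ?thesis unfolding zero_map_def using Comp_assoc[OF f to_zero[OF o(2)] from_zero[OF w]] by simp
qed

lemma zero_object_map:
  assumes "zero_object C w"
  shows "f \<in> hom w x \<Longrightarrow> f = zero_map w x" "f \<in> hom x w \<Longrightarrow> f = zero_map x w"
  using zero_object_unique[OF assms] zero_map_Hom Hom_Obj by metis+

text \<open>The extension square of a short exact sequence. Its two arrows at the corner
  \<open>z\<close> are determined by the end terms, so the pair \<open>(f, g)\<close> carries all
  the data.\<close>

definition exact :: "'a \<Rightarrow> 'a \<Rightarrow> bool" where
  "exact f g \<longleftrightarrow> bicartesian C f (to_zero C z (dom f)) g (from_zero C z (cod g))"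

text \<open>With sides that are mono and epi as required, the third axiom makes either universal
  property imply the other.\<close>

lemma bicartesianI:
  assumes "is_pushout C f g h k \<or> is_pullback C f g h k" "mono_arr C f" "epi_arr C g" "epi_arr C h" "mono_arr C k"
  shows "bicartesian C f g h k"
proof -
  have "comm_square C f g h k" using assms(1) by (auto simp: is_pushout_def is_pullback_def)
  from pushout_iff_pullback[OF this assms(2-)] show ?thesis using assms by (auto simp: bicartesian_def)
qed

text \<open>The last two conclusions are the working form: \<open>g\<close> is a cokernel of
  \<open>f\<close> and \<open>f\<close> is a kernel of \<open>g\<close>, with uniqueness left to
  \<open>epi_arr\<close> and \<open>mono_arr\<close>.\<close>

lemma exactE:
  assumes "exact f g"
  obtains a b c where "f \<in> hom a b" "g \<in> hom b c" "mono_arr C f" "epi_arr C g" "g \<cdot> f = zero_map a c"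
    "is_pushout C f (to_zero C z a) g (from_zero C z c)" "is_pullback C f (to_zero C z a) g (from_zero C z c)"
    "\<And>x h. h \<in> hom b x \<Longrightarrow> h \<cdot> f = zero_map a x \<Longrightarrow> \<exists>u\<in>hom c x. u \<cdot> g = h"
    "\<And>x h. h \<in> hom x b \<Longrightarrow> g \<cdot> h = zero_map x c \<Longrightarrow> \<exists>u\<in>hom x a. f \<cdot> u = h"
proof -
  have e: "mono_arr C f" "epi_arr C g" "is_pushout C f (to_zero C z (dom f)) g (from_zero C z (cod g))"
    "is_pullback C f (to_zero C z (dom f)) g (from_zero C z (cod g))"
    using assms by (simp_all add: exact_def bicartesian_def)
  obtain a b c d where s: "f \<in> hom a b" "to_zero C z (dom f) \<in> hom a d" "g \<in> hom b c" "from_zero C z (cod g) \<in> hom d c"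
    and c: "g \<cdot> f = from_zero C z (cod g) \<cdot> to_zero C z (dom f)"
    and ex: "\<And>x h' k'. h' \<in> hom b x \<Longrightarrow> k' \<in> hom d x \<Longrightarrow> h' \<cdot> f = k' \<cdot> to_zero C z (dom f) \<Longrightarrow> \<exists>u \<in> hom c x. u \<cdot> g = h' \<and> u \<cdot> from_zero C z (cod g) = k'"
    by (rule is_pushoutE[OF e(3)]) blast
  obtain a' b' c' d' where s': "f \<in> hom a' b'" "to_zero C z (dom f) \<in> hom a' d'" "g \<in> hom b' c'" "from_zero C z (cod g) \<in> hom d' c'"
    and ex': "\<And>x p q. p \<in> hom x b' \<Longrightarrow> q \<in> hom x d' \<Longrightarrow> g \<cdot> p = from_zero C z (cod g) \<cdot> q \<Longrightarrow> \<exists>u \<in> hom x a'. f \<cdot> u = p \<and> to_zero C z (dom f) \<cdot> u = q"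
    by (rule is_pullbackE[OF e(4)]) blast
  have dc: "dom f = a" "cod g = c" using s by (simp_all add: HomD)
  have d: "d = z" using HomD(3)[OF to_zero[OF Hom_Obj(1)[OF s(1)]]] HomD(3)[OF s(2)] dc by simp
  have eq: "a' = a" "b' = b" "c' = c" "d' = z" using HomD[OF s(1)] HomD[OF s'(1)] HomD[OF s(3)] HomD[OF s'(3)] HomD(3)[OF s(2)] HomD(3)[OF s'(2)] d by auto
  note ex' = ex'[unfolded eq dc] and ex = ex[unfolded d dc]
  show thesis
  proof (rule that[OF s(1,3) e(1,2)])
    show "g \<cdot> f = zero_map a c" using c by (simp add: dc zero_map_def)
    show "is_pushout C f (to_zero C z a) g (from_zero C z c)" "is_pullback C f (to_zero C z a) g (from_zero C z c)"
      using e(3,4) by (simp_all add: dc)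
  next
    fix x h assume h: "h \<in> hom b x" "h \<cdot> f = zero_map a x"
    then show "\<exists>u\<in>hom c x. u \<cdot> g = h" using ex[OF h(1) from_zero[OF Hom_Obj(2)[OF h(1)]]] by (auto simp: zero_map_def)
  next
    fix x h assume h: "h \<in> hom x b" "g \<cdot> h = zero_map x c"
    then show "\<exists>u\<in>hom x a. f \<cdot> u = h" using ex'[OF h(1) to_zero[OF Hom_Obj(1)[OF h(1)]]] by (auto simp: zero_map_def)
  qed
qed

lemma exact_pushoutI:
  assumes f: "f \<in> hom a b" "mono_arr C f" and g: "g \<in> hom b c" "epi_arr C g"
    and p: "is_pushout C f (to_zero C z a) g (from_zero C z c) \<or> is_pullback C f (to_zero C z a) g (from_zero C z c)"
  shows "exact f g"
  unfolding exact_def HomD(2)[OF f(1)] HomD(3)[OF g(1)]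
  by (rule bicartesianI[OF p f(2) to_zero_epi[OF Hom_Obj(1)[OF f(1)]] g(2) from_zero_mono[OF Hom_Obj(2)[OF g(1)]]])

text \<open>The cokernel property gives a pushout square, uniqueness being cancellation of the
  epimorphism \<open>g\<close>; the pullback half then comes from the third axiom.\<close>

lemma exactI:
  assumes f: "f \<in> hom a b" "mono_arr C f" and g: "g \<in> hom b c" "epi_arr C g" and gf: "g \<cdot> f = zero_map a c"
    and ex: "\<And>x h. h \<in> hom b x \<Longrightarrow> h \<cdot> f = zero_map a x \<Longrightarrow> \<exists>u\<in>hom c x. u \<cdot> g = h"
  shows "exact f g"
proof (rule exact_pushoutI[OF f g disjI1])
  note o = Hom_Obj(1)[OF f(1)] Hom_Obj(2)[OF g(1)]
  show "is_pushout C f (to_zero C z a) g (from_zero C z c)"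
  proof (rule is_pushoutI[OF f(1) to_zero[OF o(1)] g(1) from_zero[OF o(2)]])
    show "g \<cdot> f = from_zero C z c \<cdot> to_zero C z a" using gf by (simp add: zero_map_def)
  next
    fix x p q assume p: "p \<in> hom b x" and q: "q \<in> hom z x" and e: "p \<cdot> f = q \<cdot> to_zero C z a"
    have "p \<cdot> f = zero_map a x" using e from_zero_eq[OF q] by (simp add: zero_map_def)
    then obtain u where u: "u \<in> hom c x" "u \<cdot> g = p" using ex[OF p] by blast
    moreover have "u \<cdot> from_zero C z c = q" by (rule zero_object_unique(1)[OF zero_z Comp_Hom[OF from_zero[OF o(2)] u(1)] q])
    ultimately show "\<exists>u\<in>hom c x. u \<cdot> g = p \<and> u \<cdot> from_zero C z c = q" by blast
  next
    fix x u u' assume "u \<in> hom c x" "u' \<in> hom c x" "u \<cdot> g = u' \<cdot> g"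
    then show "u = u'" using epiD[OF g(2), of u x u'] HomD(3)[OF g(1)] by simp
  qed
qed

context
  fixes f g
  assumes e: "exact f g"
begin

lemma exact_mono_epi: "mono_arr C f" "epi_arr C g"
  using e by (simp_all add: exact_def bicartesian_def)

lemma exact_Hom: "f \<in> hom (dom f) (cod f)" "g \<in> hom (cod f) (cod g)"
  by (rule exactE[OF e], simp add: HomD)+

lemma exact_Obj: "dom f \<in> Obj C" "cod f \<in> Obj C" "cod g \<in> Obj C"
  using Hom_Obj[OF exact_Hom(1)] Hom_Obj[OF exact_Hom(2)] by simp_all

lemma exact_pushout: "is_pushout C f (to_zero C z (dom f)) g (from_zero C z (cod g))"
  using e by (simp add: exact_def bicartesian_def)

lemma exact_iso_left:
  assumes a: "a \<in> hom x (dom f)" "iso a"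
  shows "exact (f \<cdot> a) g"
  using pushout_span_iso[OF exact_pushout a] to_zero_eq[OF Comp_Hom[OF a(1) to_zero[OF exact_Obj(1)]]]
  by (intro exact_pushoutI[OF Comp_Hom[OF a(1) exact_Hom(1)] mono_comp[OF a(1) iso_mono[OF a] exact_Hom(1) exact_mono_epi(1)]
        exact_Hom(2) exact_mono_epi(2)]) simp

lemma exact_iso_right:
  assumes i: "i \<in> hom (cod g) x" "iso i"
  shows "exact f (i \<cdot> g)"
  using pushout_cod_iso[OF exact_pushout i] from_zero_eq[OF Comp_Hom[OF from_zero[OF exact_Obj(3)] i(1)]]
  by (intro exact_pushoutI[OF exact_Hom(1) exact_mono_epi(1) Comp_Hom[OF exact_Hom(2) i(1)]
        epi_comp[OF exact_Hom(2) exact_mono_epi(2) i(1) iso_epi[OF i]]]) simp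

lemma exact_iso_middle:
  assumes h: "h \<in> hom (cod f) x" "h' \<in> hom x (cod f)" "h' \<cdot> h = Ident C (cod f)" "h \<cdot> h' = Ident C x"
  shows "exact (h \<cdot> f) (g \<cdot> h')"
proof -
  have ih: "iso h" "iso h'" by (rule isoI[OF h(1,2,3,4)] isoI[OF h(2,1,4,3)])+
  have "is_pushout C (h \<cdot> f) (to_zero C z (dom f)) (g \<cdot> h') (from_zero C z (cod g))"
    using pushout_swap[OF pushout_leg_iso[OF pushout_swap[OF exact_pushout] h(1) ih(1)]] inverse_arr_unique[OF h] by simp
  then show ?thesis
    by (intro exact_pushoutI[OF Comp_Hom[OF exact_Hom(1) h(1)] mono_comp[OF exact_Hom(1) exact_mono_epi(1) h(1) iso_mono[OF h(1) ih(1)]]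
          Comp_Hom[OF h(2) exact_Hom(2)] epi_comp[OF h(2) iso_epi[OF h(2) ih(2)] exact_Hom(2) exact_mono_epi(2)]]) simp
qed

end

lemma exact_zero_left:
  assumes "x \<in> Obj C"
  shows "exact (from_zero C z x) (Ident C x)"
proof (rule exactI[OF from_zero[OF assms] from_zero_mono[OF assms] Ident_Hom[OF assms] Ident_epi[OF assms]])
  show "Ident C x \<cdot> from_zero C z x = zero_map z x"
    by (rule zero_object_map(1)[OF zero_z Comp_Hom[OF from_zero[OF assms] Ident_Hom[OF assms]]])
  fix y h assume h: "h \<in> hom x y"
  then show "\<exists>u\<in>hom x y. u \<cdot> Ident C x = h" using Ident_right[OF h] by blast
qed

lemma exact_zero_right:
  assumes "x \<in> Obj C"
  shows "exact (Ident C x) (to_zero C z x)"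
proof (rule exactI[OF Ident_Hom[OF assms] Ident_mono[OF assms] to_zero[OF assms] to_zero_epi[OF assms]])
  show "to_zero C z x \<cdot> Ident C x = zero_map x z"
    by (rule zero_object_map(2)[OF zero_z Comp_Hom[OF Ident_Hom[OF assms] to_zero[OF assms]]])
  fix y h assume h: "h \<in> hom x y" "h \<cdot> Ident C x = zero_map x y"
  then show "\<exists>u\<in>hom z y. u \<cdot> to_zero C z x = h" using Ident_right[OF h(1)] from_zero[OF Hom_Obj(2)[OF h(1)]] by (auto simp: zero_map_def)
qed

text \<open>Since the left term is zero, the identity of the middle term kills \<open>f\<close> and
  hence factors through the cokernel \<open>g\<close>; cancelling the epimorphism \<open>g\<close>
  shows that the factor is a two-sided inverse.\<close>

lemma exact_zero_left_iso:
  assumes e: "exact f g" and w: "zero_object C (dom f)"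
  shows "iso g"
proof -
  obtain a b c where s: "f \<in> hom a b" "g \<in> hom b c" "epi_arr C g"
    and ex: "\<And>x h. h \<in> hom b x \<Longrightarrow> h \<cdot> f = zero_map a x \<Longrightarrow> \<exists>u\<in>hom c x. u \<cdot> g = h"
    by (rule exactE[OF e]) blast
  note o = Hom_Obj[OF s(2)]
  have "Ident C b \<cdot> f = zero_map a b"
    using zero_object_map(1)[OF w[unfolded HomD(2)[OF s(1)]] Comp_Hom[OF s(1) Ident_Hom[OF o(1)]]] .
  then obtain u where u: "u \<in> hom c b" "u \<cdot> g = Ident C b" using ex[OF Ident_Hom[OF o(1)]] by blast
  have "g \<cdot> u = Ident C c"
    using epiD[OF s(3), of "g \<cdot> u" c "Ident C c"] Comp_Hom[OF u(1) s(2)] Ident_Hom[OF o(2)] HomD(3)[OF s(2)]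
      Comp_assoc[OF s(2) u(1) s(2)] u(2) Ident_left[OF s(2)] Ident_right[OF s(2)] by simp
  then show ?thesis by (rule isoI[OF s(2) u])
qed

text \<open>Dual argument: the identity of the middle term factors through the kernel
  \<open>f\<close>.\<close>

lemma exact_zero_right_iso:
  assumes e: "exact f g" and w: "zero_object C (cod g)"
  shows "iso f"
proof -
  obtain a b c where s: "f \<in> hom a b" "g \<in> hom b c" "mono_arr C f"
    and ex: "\<And>x h. h \<in> hom x b \<Longrightarrow> g \<cdot> h = zero_map x c \<Longrightarrow> \<exists>u\<in>hom x a. f \<cdot> u = h"
    by (rule exactE[OF e]) blast
  note o = Hom_Obj[OF s(1)]
  have "g \<cdot> Ident C b = zero_map b c"
    using zero_object_map(2)[OF w[unfolded HomD(3)[OF s(2)]] Comp_Hom[OF Ident_Hom[OF o(2)] s(2)]] .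
  then obtain u where u: "u \<in> hom b a" "f \<cdot> u = Ident C b" using ex[OF Ident_Hom[OF o(2)]] by blast
  have "u \<cdot> f = Ident C a"
    using monoD[OF s(3), of "u \<cdot> f" a "Ident C a"] Comp_Hom[OF s(1) u(1)] Ident_Hom[OF o(1)] HomD(2)[OF s(1)]
      Comp_assoc[OF s(1) u(1) s(1)] u(2) Ident_left[OF s(1)] Ident_right[OF s(1)] by simp
  then show ?thesis by (rule isoI[OF s(1) u(1) _ u(2)])
qed

text \<open>A flag \<open>A\<^sub>0\<^sub>1 \<hookrightarrow> A\<^sub>0\<^sub>2 \<hookrightarrow> A\<^sub>0\<^sub>3\<close> with all its subquotients: \<open>f' : A\<^sub>0\<^sub>1 \<rightarrow> A\<^sub>0\<^sub>2\<close>, \<open>f : A\<^sub>0\<^sub>2 \<rightarrow> A\<^sub>0\<^sub>3\<close>,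
  \<open>g' : A\<^sub>0\<^sub>2 \<rightarrow> A\<^sub>1\<^sub>2\<close>, \<open>q : A\<^sub>0\<^sub>3 \<rightarrow> A\<^sub>1\<^sub>3\<close>, \<open>f'' : A\<^sub>1\<^sub>2 \<rightarrow> A\<^sub>1\<^sub>3\<close>, \<open>g : A\<^sub>0\<^sub>3 \<rightarrow> A\<^sub>2\<^sub>3\<close>, \<open>g'' : A\<^sub>1\<^sub>3 \<rightarrow> A\<^sub>2\<^sub>3\<close>.\<close>

definition flag3 :: "'a \<Rightarrow> 'a \<Rightarrow> 'a \<Rightarrow> 'a \<Rightarrow> 'a \<Rightarrow> 'a \<Rightarrow> 'a \<Rightarrow> bool" where
  "flag3 f g f' g' q f'' g'' \<longleftrightarrow> exact f g \<and> exact f' g' \<and> cod f' = dom f \<and>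
     exact (f \<cdot> f') q \<and> exact f'' g'' \<and> bicartesian C f g' q f'' \<and> g'' \<cdot> q = g"

text \<open>\<open>q\<close> and \<open>f''\<close> come from the pushout of \<open>f\<close> along
  \<open>g'\<close>, and \<open>g''\<close> is induced by \<open>g\<close> and the zero map. The two
  new exact sequences follow by pasting this pushout with the extension square of
  \<open>(f', g')\<close> and by cancelling it from that of \<open>(f, g)\<close>.\<close>

lemma flag3_left:
  assumes e: "exact f g" and e': "exact f' g'" and c: "cod f' = dom f"
  obtains q f'' g'' where "flag3 f g f' g' q f'' g''"
proof -
  obtain a3 a2 a23 where s: "f \<in> hom a2 a3" "g \<in> hom a3 a23" "mono_arr C f" "epi_arr C g" "g \<cdot> f = zero_map a2 a23"
    "is_pushout C f (to_zero C z a2) g (from_zero C z a23)"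
    by (rule exactE[OF e]) blast
  obtain a1 a2' a12 where s': "f' \<in> hom a1 a2'" "g' \<in> hom a2' a12" "mono_arr C f'" "epi_arr C g'" "g' \<cdot> f' = zero_map a1 a12"
    "is_pushout C f' (to_zero C z a1) g' (from_zero C z a12)"
    by (rule exactE[OF e']) blast
  have "a2' = a2" using HomD(3)[OF s'(1)] HomD(2)[OF s(1)] c by simp
  note s' = s'[unfolded this]
  obtain q f'' where q: "epi_arr C q" "mono_arr C f''" "is_pushout C f g' q f''"
    using completes_to_pushout[OF s(3) s'(4)] HomD(2)[OF s(1)] HomD(2)[OF s'(2)] by auto
  obtain a13 where t: "q \<in> hom a3 a13" "f'' \<in> hom a12 a13" "q \<cdot> f = f'' \<cdot> g'"
    and ex: "\<And>x h' k'. h' \<in> hom a3 x \<Longrightarrow> k' \<in> hom a12 x \<Longrightarrow> h' \<cdot> f = k' \<cdot> g' \<Longrightarrow> \<exists>u \<in> hom a13 x. u \<cdot> q = h' \<and> u \<cdot> f'' = k'"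
  proof (rule is_pushoutE[OF q(3)])
    fix a b c d assume 1: "f \<in> hom a b" "g' \<in> hom a c" "q \<in> hom b d" "f'' \<in> hom c d" "q \<cdot> f = f'' \<cdot> g'"
    and 2: "\<And>x h' k'. h' \<in> hom b x \<Longrightarrow> k' \<in> hom c x \<Longrightarrow> h' \<cdot> f = k' \<cdot> g' \<Longrightarrow> \<exists>u \<in> hom d x. u \<cdot> q = h' \<and> u \<cdot> f'' = k'"
    have "b = a3" "c = a12" using HomD[OF 1(1)] HomD[OF s(1)] HomD[OF 1(2)] HomD[OF s'(2)] by auto
    then show thesis using that[of d] 1(3-5) 2 by blast
  qed
  have o: "a1 \<in> Obj C" "a2 \<in> Obj C" "a3 \<in> Obj C" "a12 \<in> Obj C" "a13 \<in> Obj C" "a23 \<in> Obj C"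
    using Hom_Obj s(1,2) s'(1,2) t(1) by blast+
  have "g \<cdot> f = zero_map a12 a23 \<cdot> g'" using s(5) zero_map_comp_right[OF s'(2) o(6)] by simp
  then obtain g'' where g'': "g'' \<in> hom a13 a23" "g'' \<cdot> q = g" "g'' \<cdot> f'' = zero_map a12 a23"
    using ex[OF s(2) zero_map_Hom[OF o(4,6)]] by blast
  have epi: "epi_arr C g''" by (rule epi_cancel[OF t(1) g''(1)]) (simp add: g''(2) s(4))
  have tz: "to_zero C z a12 \<cdot> g' = to_zero C z a2" by (rule to_zero_eq[OF Comp_Hom[OF s'(2) to_zero[OF o(4)]]])
  have "is_pushout C f'' (to_zero C z a12) g'' (from_zero C z a23)"
    by (rule pushout_vcancel[OF q(3), of "to_zero C z a12" g'' "from_zero C z a23" a12 z a13 a23])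
       (use s(6) g'' tz t(2) to_zero[OF o(4)] from_zero[OF o(6)] in \<open>simp_all add: zero_map_def\<close>)
  then have 2: "exact f'' g''" by (intro exact_pushoutI[OF t(2) q(2) g''(1) epi]) simp
  have fz: "f'' \<cdot> from_zero C z a12 = from_zero C z a13" by (rule from_zero_eq[OF Comp_Hom[OF from_zero[OF o(4)] t(2)]])
  have "is_pushout C (f \<cdot> f') (to_zero C z a1) q (from_zero C z a13)"
    using pushout_hpaste[OF s'(6) q(3)] fz by simp
  then have 1: "exact (f \<cdot> f') q" by (intro exact_pushoutI[OF Comp_Hom[OF s'(1) s(1)] mono_comp[OF s'(1,3) s(1,3)] t(1) q(1)]) simp
  have "bicartesian C f g' q f''" by (rule bicartesianI) (use q s(3) s'(4) in simp_all)
  with 1 2 e e' c g''(2) have "flag3 f g f' g' q f'' g''" by (simp add: flag3_def)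
  then show thesis by (rule that)
qed

text \<open>Dual to \<open>flag3_left\<close>: \<open>f\<close> and \<open>g'\<close> come from the
  pullback of \<open>q\<close> along \<open>f''\<close>, and \<open>f'\<close> is induced by
  \<open>p\<close> and the zero map. Cancelling pullbacks gives exactness of
  \<open>(f', g')\<close>, pasting pushouts that of \<open>(f, g'' \<cdot> q)\<close>.\<close>

lemma flag3_right:
  assumes e: "exact p q" and e'': "exact f'' g''" and c: "cod q = cod f''"
  obtains f g f' g' where "flag3 f g f' g' q f'' g''" "f \<cdot> f' = p" "g = g'' \<cdot> q"
proof -
  obtain a1 a3 a13 where s: "p \<in> hom a1 a3" "q \<in> hom a3 a13" "mono_arr C p" "epi_arr C q" "q \<cdot> p = zero_map a1 a13"
    "is_pullback C p (to_zero C z a1) q (from_zero C z a13)"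
    by (rule exactE[OF e]) blast
  obtain a12 a13' a23 where s'': "f'' \<in> hom a12 a13'" "g'' \<in> hom a13' a23" "mono_arr C f''" "epi_arr C g''" "g'' \<cdot> f'' = zero_map a12 a23"
    "is_pushout C f'' (to_zero C z a12) g'' (from_zero C z a23)"
    by (rule exactE[OF e'']) blast
  have "a13' = a13" using HomD(3)[OF s''(1)] HomD(3)[OF s(2)] c by simp
  note s'' = s''[unfolded this]
  obtain f g' where q: "mono_arr C f" "epi_arr C g'" "is_pullback C f g' q f''"
    using completes_to_pullback[OF s''(3) s(4)] c by auto
  obtain a2 where t: "f \<in> hom a2 a3" "g' \<in> hom a2 a12" "q \<cdot> f = f'' \<cdot> g'"
    and ex: "\<And>x p r. p \<in> hom x a3 \<Longrightarrow> r \<in> hom x a12 \<Longrightarrow> q \<cdot> p = f'' \<cdot> r \<Longrightarrow> \<exists>u \<in> hom x a2. f \<cdot> u = p \<and> g' \<cdot> u = r"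
  proof (rule is_pullbackE[OF q(3)])
    fix a b c d assume 1: "f \<in> hom a b" "g' \<in> hom a c" "q \<in> hom b d" "f'' \<in> hom c d" "q \<cdot> f = f'' \<cdot> g'"
    and 2: "\<And>x p r. p \<in> hom x b \<Longrightarrow> r \<in> hom x c \<Longrightarrow> q \<cdot> p = f'' \<cdot> r \<Longrightarrow> \<exists>u \<in> hom x a. f \<cdot> u = p \<and> g' \<cdot> u = r"
    have "b = a3" "c = a12" using HomD[OF 1(3)] HomD[OF s(2)] HomD[OF 1(4)] HomD[OF s''(1)] by auto
    then show thesis using that[of a] 1(1,2,5) 2 by blast
  qed
  have o: "a1 \<in> Obj C" "a2 \<in> Obj C" "a3 \<in> Obj C" "a12 \<in> Obj C" "a13 \<in> Obj C" "a23 \<in> Obj C"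
    using Hom_Obj s(1,2) s''(1,2) t(1) by blast+
  have "q \<cdot> p = f'' \<cdot> zero_map a1 a12" using s(5) zero_map_comp_left[OF s''(1) o(1)] by simp
  then obtain f' where f': "f' \<in> hom a1 a2" "f \<cdot> f' = p" "g' \<cdot> f' = zero_map a1 a12"
    using ex[OF s(1) zero_map_Hom[OF o(1,4)]] by blast
  have mono: "mono_arr C f'" by (rule mono_cancel[OF f'(1) t(1)]) (simp add: f'(2) s(3))
  have bi: "bicartesian C f g' q f''" by (rule bicartesianI) (use q s(4) s''(3) in simp_all)
  then have po: "is_pushout C f g' q f''" by (simp add: bicartesian_def)
  have fz: "f'' \<cdot> from_zero C z a12 = from_zero C z a13" by (rule from_zero_eq[OF Comp_Hom[OF from_zero[OF o(4)] s''(1)]])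
  have "is_pullback C f' (to_zero C z a1) g' (from_zero C z a12)"
    by (rule pullback_hcancel[OF q(3), of f' "to_zero C z a1" "from_zero C z a12" a1 a2 a12 z])
       (use s(6) f' fz t(2) to_zero[OF o(1)] from_zero[OF o(4)] in \<open>simp_all add: zero_map_def\<close>)
  then have 1: "exact f' g'" by (intro exact_pushoutI[OF f'(1) mono t(2) q(2)]) simp
  have tz: "to_zero C z a12 \<cdot> g' = to_zero C z a2" by (rule to_zero_eq[OF Comp_Hom[OF t(2) to_zero[OF o(4)]]])
  have "is_pushout C f (to_zero C z a2) (g'' \<cdot> q) (from_zero C z a23)"
    using pushout_vpaste[OF po s''(6)] tz by simp
  then have 2: "exact f (g'' \<cdot> q)" by (intro exact_pushoutI[OF t(1) q(1) Comp_Hom[OF s(2) s''(2)] epi_comp[OF s(2,4) s''(2,4)]]) simp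
  have "flag3 f (g'' \<cdot> q) f' g' q f'' g''"
    using 1 2 e e'' bi HomD(3)[OF f'(1)] HomD(2)[OF t(1)] f'(2) by (simp add: flag3_def)
  then show thesis using that f'(2) by blast
qed

lemma flag3D:
  assumes "flag3 f g f' g' q f'' g''"
  shows "exact f g" "exact f' g'" "cod f' = dom f" "exact (f \<cdot> f') q" "exact f'' g''" "bicartesian C f g' q f''" "g'' \<cdot> q = g"
    "is_pushout C f g' q f''" "is_pullback C f g' q f''" "q \<cdot> f = f'' \<cdot> g'"
proof -
  show b: "bicartesian C f g' q f''" using assms unfolding flag3_def by blast
  then show p: "is_pushout C f g' q f''" "is_pullback C f g' q f''" by (simp_all add: bicartesian_def)
  then show "q \<cdot> f = f'' \<cdot> g'" by (simp add: is_pushout_def comm_square_def)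
qed (use assms in \<open>simp_all add: flag3_def\<close>)

lemma flag3_Hom:
  assumes fl: "flag3 f g f' g' q f'' g''"
  obtains a1 a2 a3 a12 a13 a23 where "f' \<in> hom a1 a2" "f \<in> hom a2 a3" "g' \<in> hom a2 a12" "q \<in> hom a3 a13"
    "f'' \<in> hom a12 a13" "g'' \<in> hom a13 a23" "g \<in> hom a3 a23"
proof -
  note D = flag3D[OF fl]
  obtain a b c d where s: "f \<in> hom a b" "g' \<in> hom a c" "q \<in> hom b d" "f'' \<in> hom c d"
    by (rule is_pushoutE[OF D(8)])
  show thesis
    using exact_Hom[OF D(1)] exact_Hom[OF D(2)] exact_Hom[OF D(5)] s D(3) that[of "dom f'" a b c d "cod g''"]
      HomD[OF s(1)] HomD[OF s(2)] HomD[OF s(3)] HomD[OF s(4)] HomD(3)[OF Comp_Hom[OF s(3), of g'']] D(7) by metis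
qed

lemma flag3_ends:
  assumes "flag3 f g f' g' q f'' g''"
  shows "dom (f \<cdot> f') = dom f'" "cod (f \<cdot> f') = cod f" "cod q = cod f''" "cod g'' = cod g" "dom f'' = cod g'" "cod f' = dom f"
proof -
  obtain a1 a2 a3 a12 a13 a23 where s: "f' \<in> hom a1 a2" "f \<in> hom a2 a3" "g' \<in> hom a2 a12" "q \<in> hom a3 a13"
    "f'' \<in> hom a12 a13" "g'' \<in> hom a13 a23" "g \<in> hom a3 a23" by (rule flag3_Hom[OF assms])
  show "dom (f \<cdot> f') = dom f'" "cod (f \<cdot> f') = cod f" using HomD[OF Comp_Hom[OF s(1,2)]] HomD[OF s(1)] HomD[OF s(2)] by simp_all
  show "cod q = cod f''" "cod g'' = cod g" "dom f'' = cod g'" "cod f' = dom f"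
    using HomD[OF s(1)] HomD[OF s(2)] HomD[OF s(3)] HomD[OF s(4)] HomD[OF s(5)] HomD[OF s(6)] HomD[OF s(7)] by simp_all
qed

text \<open>Both completions are pushouts of the same span; compatibility with the last arrows is
  checked after composing with the epimorphism \<open>q\<close>.\<close>

lemma flag3_unique_left:
  assumes 1: "flag3 f g f' g' q f'' g''" and 2: "flag3 f g f' g' r h k"
  obtains c where "c \<in> hom (cod q) (cod r)" "iso c" "c \<cdot> q = r" "c \<cdot> f'' = h" "k \<cdot> c = g''"
proof -
  obtain c where c: "c \<in> hom (cod q) (cod r)" "iso c" "c \<cdot> q = r" "c \<cdot> f'' = h"
    by (rule pushout_unique[OF flag3D(8)[OF 1] flag3D(8)[OF 2]])
  obtain a1 a2 a3 a12 a13 a23 where s: "q \<in> hom a3 a13" "g'' \<in> hom a13 a23" "g \<in> hom a3 a23"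
    by (rule flag3_Hom[OF 1]) blast
  obtain b1 b2 b3 b12 b13 b23 where t: "r \<in> hom b3 b13" "k \<in> hom b13 b23" "g \<in> hom b3 b23"
    by (rule flag3_Hom[OF 2]) blast
  have eq: "b23 = a23" using HomD[OF s(3)] HomD[OF t(3)] by simp
  note c' = c(1)[unfolded HomD(3)[OF s(1)] HomD(3)[OF t(1)]]
  have eq_q: "epi_arr C q" using flag3D(6)[OF 1] by (simp add: bicartesian_def)
  have "k \<cdot> c \<cdot> q = g'' \<cdot> q" using Comp_assoc[OF s(1) c' t(2)] c(3) flag3D(7)[OF 1] flag3D(7)[OF 2] by simp
  then have "k \<cdot> c = g''" using epiD[OF eq_q, of "k \<cdot> c" a23 g''] Comp_Hom[OF c' t(2)] s(2) eq HomD(3)[OF s(1)] by simp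
  then show thesis using that c by blast
qed

text \<open>Both completions are pullbacks of the same cospan; compatibility with \<open>f'\<close>
  and \<open>h'\<close> is checked after composing with the monomorphism \<open>h\<close>.\<close>

lemma flag3_unique_right:
  assumes 1: "flag3 f g f' g' q f'' g''" and 2: "flag3 h k h' k' q f'' g''" and e: "f \<cdot> f' = h \<cdot> h'"
  obtains c where "c \<in> hom (dom f) (dom h)" "iso c" "h \<cdot> c = f" "k' \<cdot> c = g'" "c \<cdot> f' = h'" "k = g"
proof -
  obtain c where c: "c \<in> hom (dom f) (dom h)" "iso c" "h \<cdot> c = f" "k' \<cdot> c = g'"
    by (rule pullback_unique[OF flag3D(9)[OF 1] flag3D(9)[OF 2]])
  obtain a1 a2 a3 where s: "f' \<in> hom a1 a2" "f \<in> hom a2 a3"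
    by (rule flag3_Hom[OF 1]) blast
  obtain b1 b2 b3 where t: "h' \<in> hom b1 b2" "h \<in> hom b2 b3"
    by (rule flag3_Hom[OF 2]) blast
  note c' = c(1)[unfolded HomD(2)[OF s(2)] HomD(2)[OF t(2)]]
  have eq: "b1 = a1" using HomD(2)[OF Comp_Hom[OF s]] HomD(2)[OF Comp_Hom[OF t]] e by simp
  have m: "mono_arr C h" using flag3D(6)[OF 2] by (simp add: bicartesian_def)
  have "h \<cdot> (c \<cdot> f') = h \<cdot> h'" using Comp_assoc[OF s(1) c' t(2)] c(3) e by simp
  then have "c \<cdot> f' = h'" using monoD[OF m, of "c \<cdot> f'" a1 h'] Comp_Hom[OF s(1) c'] t(1) eq HomD(2)[OF t(2)] by simp
  then show thesis using that c flag3D(7)[OF 1] flag3D(7)[OF 2] by simp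
qed

end

section \<open>The groupoids of flags\<close>

lemma tri_mem [simp]: "(i, j) \<in> tri n \<longleftrightarrow> i \<le> j \<and> j \<le> n"
  by (simp add: tri_def)

lemma tri_1: "p \<in> tri 1 \<longleftrightarrow> p = (0, 0) \<or> p = (0, 1) \<or> p = (1, 1)"
  by (cases p) (auto simp: tri_def)

context pointed_proto_abelian
begin

section \<open>Morphisms of flags\<close>

definition flag_map :: "nat \<Rightarrow> ('o, 'a) flag \<Rightarrow> ('o, 'a) flag \<Rightarrow> (nat \<times> nat \<Rightarrow> 'a) \<Rightarrow> bool" where
  "flag_map n A B u \<longleftrightarrow> u \<in> extensional (tri n) \<and>
     (\<forall>i j. i \<le> j \<and> j \<le> n \<longrightarrow> u (i, j) \<in> hom (vertex A (i, j)) (vertex B (i, j))) \<and>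
     (\<forall>i j. i \<le> j \<and> j < n \<longrightarrow> hor B (i, j) \<cdot> u (i, j) = u (i, j + 1) \<cdot> hor A (i, j)) \<and>
     (\<forall>i j. i < j \<and> j \<le> n \<longrightarrow> ver B (i, j) \<cdot> u (i, j) = u (i + 1, j) \<cdot> ver A (i, j))"

lemma flag_cat_Hom: "t \<in> Hom (flag_cat C z n) A B \<longleftrightarrow>
    A \<in> flags C z n \<and> B \<in> flags C z n \<and> (\<exists>u. t = (A, B, u) \<and> flag_map n A B u)"
  by (cases t) (auto simp: flag_cat_def Hom_def flag_map_def tri_def)

lemma flag_cat_simps:
  "Obj (flag_cat C z n) = flags C z n"
  "Ident (flag_cat C z n) A = (A, A, \<lambda>p\<in>tri n. Ident C (vertex A p))"
  "(B, D, v) \<cdot>\<^bsub>flag_cat C z n\<^esub> (A, B', u) = (A, D, \<lambda>p\<in>tri n. v p \<cdot> u p)"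
  "Dom (flag_cat C z n) (A, B, u) = A" "Cod (flag_cat C z n) (A, B, u) = B"
  by (simp_all add: flag_cat_def)

lemma flags_hor: "A \<in> flags C z n \<Longrightarrow> i \<le> j \<Longrightarrow> j < n \<Longrightarrow> hor A (i, j) \<in> hom (vertex A (i, j)) (vertex A (i, j + 1))"
  and flags_ver: "A \<in> flags C z n \<Longrightarrow> i < j \<Longrightarrow> j \<le> n \<Longrightarrow> ver A (i, j) \<in> hom (vertex A (i, j)) (vertex A (i + 1, j))"
  and flags_diag: "A \<in> flags C z n \<Longrightarrow> i \<le> n \<Longrightarrow> vertex A (i, i) = z"
  by (simp_all add: flags_def)

lemma flags_vertex: "A \<in> flags C z n \<Longrightarrow> i \<le> j \<Longrightarrow> j \<le> n \<Longrightarrow> vertex A (i, j) \<in> Obj C"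
proof -
  assume "A \<in> flags C z n" "i \<le> j" "j \<le> n"
  then have "vertex A \<in> tri n \<rightarrow>\<^sub>E Obj C" "(i, j) \<in> tri n" by (simp_all add: flags_def)
  then show ?thesis by (rule PiE_mem)
qed

lemma flag_mapD:
  assumes "flag_map n A B u"
  shows "u \<in> extensional (tri n)"
    "i \<le> j \<Longrightarrow> j \<le> n \<Longrightarrow> u (i, j) \<in> hom (vertex A (i, j)) (vertex B (i, j))"
    "i \<le> j \<Longrightarrow> j < n \<Longrightarrow> hor B (i, j) \<cdot> u (i, j) = u (i, j + 1) \<cdot> hor A (i, j)"
    "i < j \<Longrightarrow> j \<le> n \<Longrightarrow> ver B (i, j) \<cdot> u (i, j) = u (i + 1, j) \<cdot> ver A (i, j)"
  using assms by (simp_all add: flag_map_def)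

lemma flag_cat_category: "category (flag_cat C z n)"
proof
  fix t assume "t \<in> Arr (flag_cat C z n)"
  then have "t \<in> Hom (flag_cat C z n) (Dom (flag_cat C z n) t) (Cod (flag_cat C z n) t)" by (rule HomI)
  then show "Dom (flag_cat C z n) t \<in> Obj (flag_cat C z n)" "Cod (flag_cat C z n) t \<in> Obj (flag_cat C z n)"
    by (simp_all add: flag_cat_Hom flag_cat_simps)
next
  fix A assume "A \<in> Obj (flag_cat C z n)"
  then have A: "A \<in> flags C z n" by (simp add: flag_cat_simps)
  have "flag_map n A A (\<lambda>p\<in>tri n. Ident C (vertex A p))"
    unfolding flag_map_def
    using Ident_left[OF flags_hor[OF A]] Ident_right[OF flags_hor[OF A]] Ident_left[OF flags_ver[OF A]] Ident_right[OF flags_ver[OF A]]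
    by (simp add: Ident_Hom flags_vertex[OF A])
  then show "Ident (flag_cat C z n) A \<in> Hom (flag_cat C z n) A A" using A by (simp add: flag_cat_Hom flag_cat_simps)
next
  fix A B t assume "t \<in> Hom (flag_cat C z n) A B"
  then obtain u where t: "t = (A, B, u)" "flag_map n A B u" and AB: "A \<in> flags C z n" "B \<in> flags C z n" by (auto simp: flag_cat_Hom)
  note U = flag_mapD[OF t(2)]
  have "(\<lambda>p\<in>tri n. (\<lambda>p\<in>tri n. Ident C (vertex B p)) p \<cdot> u p) = u" "(\<lambda>p\<in>tri n. u p \<cdot> (\<lambda>p\<in>tri n. Ident C (vertex A p)) p) = u"
    by (rule extensionalityI[OF restrict_extensional U(1)], auto simp: Ident_left[OF U(2)] Ident_right[OF U(2)])+
  then show "Ident (flag_cat C z n) B \<cdot>\<^bsub>flag_cat C z n\<^esub> t = t" "t \<cdot>\<^bsub>flag_cat C z n\<^esub> Ident (flag_cat C z n) A = t"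
    by (simp_all add: t flag_cat_simps)
  fix D s assume "s \<in> Hom (flag_cat C z n) B D"
  then obtain v where s: "s = (B, D, v)" "flag_map n B D v" and D: "D \<in> flags C z n" by (auto simp: flag_cat_Hom)
  note V = flag_mapD[OF s(2)]
  have "flag_map n A D (\<lambda>p\<in>tri n. v p \<cdot> u p)"
    unfolding flag_map_def
  proof (intro conjI allI impI)
    fix i j assume ij: "i \<le> j \<and> j \<le> n"
    then show "(\<lambda>p\<in>tri n. v p \<cdot> u p) (i, j) \<in> hom (vertex A (i, j)) (vertex D (i, j))"
      using Comp_Hom[OF U(2) V(2)] by simp
  next
    fix i j assume ij: "i \<le> j \<and> j < n"
    then have ij': "i \<le> j" "j < n" "j \<le> n" "i \<le> j + 1" "j + 1 \<le> n" by auto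
    note h = flags_hor[OF AB(1) ij'(1,2)] flags_hor[OF AB(2) ij'(1,2)] flags_hor[OF D ij'(1,2)]
    note u1 = U(2)[OF ij'(1,3)] U(2)[OF ij'(4,5)] and v1 = V(2)[OF ij'(1,3)] V(2)[OF ij'(4,5)]
    have "hor D (i, j) \<cdot> (v (i, j) \<cdot> u (i, j)) = v (i, j + 1) \<cdot> u (i, j + 1) \<cdot> hor A (i, j)"
      using Comp_assoc[OF u1(1) v1(1) h(3)] V(3)[OF ij'(1,2)] Comp_assoc[OF u1(1) h(2) v1(2)] U(3)[OF ij'(1,2)]
        Comp_assoc[OF h(1) u1(2) v1(2)] by simp
    then show "hor D (i, j) \<cdot> (\<lambda>p\<in>tri n. v p \<cdot> u p) (i, j) = (\<lambda>p\<in>tri n. v p \<cdot> u p) (i, j + 1) \<cdot> hor A (i, j)"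
      using ij' by simp
  next
    fix i j assume ij: "i < j \<and> j \<le> n"
    then have ij': "i < j" "j \<le> n" "i \<le> j" "i + 1 \<le> j" by auto
    note h = flags_ver[OF AB(1) ij'(1,2)] flags_ver[OF AB(2) ij'(1,2)] flags_ver[OF D ij'(1,2)]
    note u1 = U(2)[OF ij'(3,2)] U(2)[OF ij'(4,2)] and v1 = V(2)[OF ij'(3,2)] V(2)[OF ij'(4,2)]
    have "ver D (i, j) \<cdot> (v (i, j) \<cdot> u (i, j)) = v (i + 1, j) \<cdot> u (i + 1, j) \<cdot> ver A (i, j)"
      using Comp_assoc[OF u1(1) v1(1) h(3)] V(4)[OF ij'(1,2)] Comp_assoc[OF u1(1) h(2) v1(2)] U(4)[OF ij'(1,2)]
        Comp_assoc[OF h(1) u1(2) v1(2)] by simp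
    then show "ver D (i, j) \<cdot> (\<lambda>p\<in>tri n. v p \<cdot> u p) (i, j) = (\<lambda>p\<in>tri n. v p \<cdot> u p) (i + 1, j) \<cdot> ver A (i, j)"
      using ij' by simp
  qed simp
  then show "s \<cdot>\<^bsub>flag_cat C z n\<^esub> t \<in> Hom (flag_cat C z n) A D"
    using AB D by (simp add: s t flag_cat_simps flag_cat_Hom)
  fix E r assume "r \<in> Hom (flag_cat C z n) D E"
  then obtain w where r: "r = (D, E, w)" "flag_map n D E w" by (auto simp: flag_cat_Hom)
  note W = flag_mapD[OF r(2)]
  show "r \<cdot>\<^bsub>flag_cat C z n\<^esub> (s \<cdot>\<^bsub>flag_cat C z n\<^esub> t) = r \<cdot>\<^bsub>flag_cat C z n\<^esub> s \<cdot>\<^bsub>flag_cat C z n\<^esub> t"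
    by (auto simp: r s t flag_cat_simps Comp_assoc[OF U(2) V(2) W(2)] intro!: restrict_ext)
qed

text \<open>Componentwise inverses commute with the structure arrows by themselves, so they assemble
  to an inverse of the morphism of flags.\<close>

lemma flag_iso_iff:
  assumes t: "(A, B, u) \<in> Hom (flag_cat C z n) A B"
  shows "iso_arr (flag_cat C z n) (A, B, u) \<longleftrightarrow> (\<forall>p \<in> tri n. iso (u p))"
proof
  interpret fc: category "flag_cat C z n" by (rule flag_cat_category)
  have u: "flag_map n A B u" and AB: "A \<in> flags C z n" "B \<in> flags C z n" using t by (simp_all add: flag_cat_Hom)
  note U = flag_mapD[OF u]
  show "\<forall>p \<in> tri n. iso (u p)" if i: "iso_arr (flag_cat C z n) (A, B, u)"
  proof
    fix p assume p: "p \<in> tri n"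
    obtain s where s: "s \<in> Hom (flag_cat C z n) B A" "s \<cdot>\<^bsub>flag_cat C z n\<^esub> (A, B, u) = Ident (flag_cat C z n) A"
      "(A, B, u) \<cdot>\<^bsub>flag_cat C z n\<^esub> s = Ident (flag_cat C z n) B"
      by (rule fc.iso_inverse[OF t i])
    obtain v where v: "s = (B, A, v)" "flag_map n B A v" using s(1) by (auto simp: flag_cat_Hom)
    have e: "(\<lambda>p\<in>tri n. v p \<cdot> u p) = (\<lambda>p\<in>tri n. Ident C (vertex A p))" "(\<lambda>p\<in>tri n. u p \<cdot> v p) = (\<lambda>p\<in>tri n. Ident C (vertex B p))"
      using s(2,3) by (simp_all add: v flag_cat_simps)
    obtain i j where ij: "p = (i, j)" "i \<le> j" "j \<le> n" using p by (cases p) auto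
    show "iso (u p)"
      using isoI[OF U(2)[OF ij(2,3)] flag_mapD(2)[OF v(2) ij(2,3)]] fun_cong[OF e(1), of p] fun_cong[OF e(2), of p] p ij(1) by simp
  qed
  show "iso_arr (flag_cat C z n) (A, B, u)" if i: "\<forall>p \<in> tri n. iso (u p)"
  proof -
    have "\<exists>g. i \<le> j \<longrightarrow> j \<le> n \<longrightarrow> g \<in> hom (vertex B (i, j)) (vertex A (i, j)) \<and> g \<cdot> u (i, j) = Ident C (vertex A (i, j)) \<and>
       u (i, j) \<cdot> g = Ident C (vertex B (i, j))" for i j
      using iso_inverse[OF U(2)] i by (metis tri_mem)
    then obtain w where w: "\<And>i j. i \<le> j \<Longrightarrow> j \<le> n \<Longrightarrow> w i j \<in> hom (vertex B (i, j)) (vertex A (i, j)) \<and> w i j \<cdot> u (i, j) = Ident C (vertex A (i, j)) \<and>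
       u (i, j) \<cdot> w i j = Ident C (vertex B (i, j))" by metis
    define v where "v = (\<lambda>p\<in>tri n. w (fst p) (snd p))"
    have v: "v (i, j) \<in> hom (vertex B (i, j)) (vertex A (i, j))" "v (i, j) \<cdot> u (i, j) = Ident C (vertex A (i, j))"
       "u (i, j) \<cdot> v (i, j) = Ident C (vertex B (i, j))" if "i \<le> j" "j \<le> n" for i j
      using w[OF that] that by (simp_all add: v_def)
    \<comment> \<open>Inverting two opposite sides of a commuting square gives a commuting square in
      the other direction.\<close>
    have inv_sq: "k \<cdot> b = d \<cdot> h" if h: "h \<in> hom x' y'" and k: "k \<in> hom x y" and a: "a \<in> hom x x'" and b: "b \<in> hom x' x" and c: "c \<in> hom y y'" and d: "d \<in> hom y' y"
      and 1: "a \<cdot> b = Ident C x'" and 2: "d \<cdot> c = Ident C y" and sq: "h \<cdot> a = c \<cdot> k" for h k a b c d x x' y y'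
    proof -
      have "k \<cdot> b = d \<cdot> c \<cdot> (k \<cdot> b)" using 2 Ident_left[OF Comp_Hom[OF b k]] by simp
      also have "\<dots> = d \<cdot> (c \<cdot> k \<cdot> b)" using Comp_assoc[OF Comp_Hom[OF b k] c d] Comp_assoc[OF b k c] by simp
      also have "\<dots> = d \<cdot> (h \<cdot> (a \<cdot> b))" using sq Comp_assoc[OF b a h] by simp
      also have "\<dots> = d \<cdot> h" using 1 Ident_right[OF h] by simp
      finally show ?thesis .
    qed
    have "flag_map n B A v" unfolding flag_map_def
    proof (intro conjI allI impI)
      show "v \<in> extensional (tri n)" by (simp add: v_def)
      fix i j assume "i \<le> j \<and> j < n"
      then have ij: "i \<le> j" "j < n" "j \<le> n" "i \<le> j + 1" "j + 1 \<le> n" by auto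
      show "hor A (i, j) \<cdot> v (i, j) = v (i, j + 1) \<cdot> hor B (i, j)"
        by (rule inv_sq[OF flags_hor[OF AB(2) ij(1,2)] flags_hor[OF AB(1) ij(1,2)] U(2)[OF ij(1,3)] v(1)[OF ij(1,3)] U(2)[OF ij(4,5)] v(1)[OF ij(4,5)]
           v(3)[OF ij(1,3)] v(2)[OF ij(4,5)] U(3)[OF ij(1,2)]])
    next
      fix i j assume "i < j \<and> j \<le> n"
      then have ij: "i < j" "j \<le> n" "i \<le> j" "i + 1 \<le> j" by auto
      show "ver A (i, j) \<cdot> v (i, j) = v (i + 1, j) \<cdot> ver B (i, j)"
        by (rule inv_sq[OF flags_ver[OF AB(2) ij(1,2)] flags_ver[OF AB(1) ij(1,2)] U(2)[OF ij(3,2)] v(1)[OF ij(3,2)] U(2)[OF ij(4,2)] v(1)[OF ij(4,2)]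
           v(3)[OF ij(3,2)] v(2)[OF ij(4,2)] U(4)[OF ij(1,2)]])
    qed (use v(1) in simp)
    then have s: "(B, A, v) \<in> Hom (flag_cat C z n) B A" using AB by (simp add: flag_cat_Hom)
    have "(B, A, v) \<cdot>\<^bsub>flag_cat C z n\<^esub> (A, B, u) = Ident (flag_cat C z n) A" "(A, B, u) \<cdot>\<^bsub>flag_cat C z n\<^esub> (B, A, v) = Ident (flag_cat C z n) B"
      using v by (auto simp: flag_cat_simps intro!: restrict_ext)
    then show ?thesis by (rule fc.isoI[OF t s])
  qed
qed

lemma S_groupoid: "groupoid (S C z n)"
  unfolding S_def by (rule core_groupoid[OF flag_cat_category])

lemma S_simps:
  "Obj (S C z n) = flags C z n"
  "Ident (S C z n) A = (A, A, \<lambda>p\<in>tri n. Ident C (vertex A p))"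
  "(B, D, v) \<cdot>\<^bsub>S C z n\<^esub> (A, B', u) = (A, D, \<lambda>p\<in>tri n. v p \<cdot> u p)"
  "Dom (S C z n) (A, B, u) = A" "Cod (S C z n) (A, B, u) = B"
  unfolding S_def core_simps by (simp_all add: flag_cat_simps)

lemma S_Hom: "t \<in> Hom (S C z n) A B \<longleftrightarrow>
    A \<in> flags C z n \<and> B \<in> flags C z n \<and> (\<exists>u. t = (A, B, u) \<and> flag_map n A B u \<and> (\<forall>p \<in> tri n. iso (u p)))"
proof -
  have "t \<in> Hom (S C z n) A B \<longleftrightarrow> t \<in> Hom (flag_cat C z n) A B \<and> iso_arr (flag_cat C z n) t"
    unfolding S_def by (rule Hom_core)
  also have "\<dots> \<longleftrightarrow> (\<exists>u. t = (A, B, u) \<and> (A, B, u) \<in> Hom (flag_cat C z n) A B \<and> (\<forall>p \<in> tri n. iso (u p)))"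
    using flag_iso_iff[of A B _ n] by (auto simp: flag_cat_Hom)
  finally show ?thesis by (auto simp: flag_cat_Hom)
qed

section \<open>The groupoid of one-step flags as the core of \<open>C\<close>\<close>

abbreviation fl :: "'o \<Rightarrow> ('o, 'a) flag" where
  "fl X \<equiv> flag1 C z X"

lemma flag1_vertex [simp]: "vertex (fl X) (0, Suc 0) = X" "vertex (fl X) (0, 0) = z" "vertex (fl X) (Suc 0, Suc 0) = z"
  by (simp_all add: flag1_def)

lemma flag1_flags: "X \<in> Obj C \<Longrightarrow> fl X \<in> flags C z 1"
proof -
  assume X: "X \<in> Obj C"
  have 1: "i \<le> j \<and> j < 1 \<longleftrightarrow> i = 0 \<and> j = 0" "i < j \<and> j \<le> 1 \<longleftrightarrow> i = 0 \<and> j = 1" for i j :: nat by auto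
  have 2: "\<not> (i < j \<and> j < 1)" for i j :: nat by auto
  show ?thesis unfolding flags_def mem_Collect_eq 1
  proof (intro conjI allI impI)
    show "vertex (fl X) \<in> tri 1 \<rightarrow>\<^sub>E Obj C" using X z_Obj by (auto simp: flag1_def)
    show "hor (fl X) \<in> extensional {(i, j). i = 0 \<and> j = 0}" by (auto simp: flag1_def extensional_def)
    show "ver (fl X) \<in> extensional {(i, j). i = 0 \<and> j = 1}" by (auto simp: flag1_def extensional_def)
    fix i :: nat assume "i \<le> 1"
    then have "i = 0 \<or> i = 1" by auto
    then show "vertex (fl X) (i, i) = z" by auto
  qed (use 2 X from_zero[OF X] to_zero[OF X] from_zero_mono[OF X] to_zero_epi[OF X] in \<open>auto simp: flag1_def\<close>)
qed

text \<open>Equality of records holds on the nose: diagonal vertices are \<open>z\<close>, arrows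
  from and to \<open>z\<close> are unique, and all fields are extensional. Thus objects of
  \<open>S C z 1\<close> and objects of \<open>C\<close> correspond bijectively.\<close>

lemma flags1_eq:
  assumes A: "A \<in> flags C z 1"
  shows "A = fl (vertex A (0, 1))" "vertex A (0, 1) \<in> Obj C"
proof -
  show X: "vertex A (0, 1) \<in> Obj C" by (rule flags_vertex[OF A]) auto
  have v: "vertex A (0, 0) = z" "vertex A (1, 1) = z" by (rule flags_diag[OF A]; simp)+
  have e: "vertex A \<in> extensional (tri 1)" "hor A \<in> extensional {(i, j). i \<le> j \<and> j < 1}" "ver A \<in> extensional {(i, j). i < j \<and> j \<le> 1}"
    using A by (auto simp: flags_def PiE_def)
  have 1: "{(i, j). i \<le> j \<and> j < (1 :: nat)} = {(0, 0)}" "{(i, j). i < j \<and> j \<le> (1 :: nat)} = {(0, 1)}" by auto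
  have h: "hor A (0, 0) = from_zero C z (vertex A (0, 1))"
    using flags_hor[OF A, of 0 0] v by (intro from_zero_eq) simp
  have w: "ver A (0, 1) = to_zero C z (vertex A (0, 1))"
    using flags_ver[OF A, of 0 1] v by (intro to_zero_eq) simp
  show "A = fl (vertex A (0, 1))"
  proof (rule flag.equality)
    show "vertex A = vertex (fl (vertex A (0, 1)))"
    proof (rule extensionalityI[OF e(1)])
      fix p assume "p \<in> tri 1"
      then show "vertex A p = vertex (fl (vertex A (0, 1))) p" using v unfolding tri_1 by (elim disjE) simp_all
    qed (simp add: flag1_def)
    show "hor A = hor (fl (vertex A (0, 1)))"
      by (rule extensionalityI[OF e(2)[unfolded 1]]) (use h in \<open>auto simp: flag1_def\<close>)
    show "ver A = ver (fl (vertex A (0, 1)))"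
      by (rule extensionalityI[OF e(3)[unfolded 1]]) (use w in \<open>auto simp: flag1_def\<close>)
  qed simp
qed

lemma S1_Obj: "A \<in> Obj (S C z 1) \<longleftrightarrow> (\<exists>X \<in> Obj C. A = fl X)"
  unfolding S_simps using flags1_eq flag1_flags by blast

lemma fl_Obj [simp]: "X \<in> Obj C \<Longrightarrow> fl X \<in> Obj (S C z 1)"
  unfolding S_simps by (rule flag1_flags)

lemma flag1_arr_map:
  assumes f: "f \<in> hom X Y"
  shows "flag_map 1 (fl X) (fl Y) (\<lambda>p\<in>tri 1. if p = (0, 1) then f else Ident C z)"
proof -
  note o = Hom_Obj[OF f]
  have 1: "i \<le> j \<and> j < 1 \<longleftrightarrow> i = 0 \<and> j = 0" "i < j \<and> j \<le> 1 \<longleftrightarrow> i = 0 \<and> j = 1"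
    "i \<le> j \<and> j \<le> 1 \<longleftrightarrow> (i = 0 \<and> j = 0) \<or> (i = 0 \<and> j = 1) \<or> (i = 1 \<and> j = 1)" for i j :: nat by auto
  have 2: "f \<cdot> from_zero C z X = from_zero C z Y" by (rule from_zero_eq[OF Comp_Hom[OF from_zero[OF o(1)] f]])
  have 3: "to_zero C z Y \<cdot> f = to_zero C z X" by (rule to_zero_eq[OF Comp_Hom[OF f to_zero[OF o(2)]]])
  show ?thesis unfolding flag_map_def 1
    using f 2 3 Ident_Hom[OF z_Obj] Ident_right[OF from_zero[OF o(2)]] Ident_left[OF to_zero[OF o(1)]]
    by (auto simp: flag1_def)
qed

lemma flag1_arr_Hom:
  assumes f: "f \<in> hom X Y" "iso f"
  shows "flag1_arr C z f \<in> Hom (S C z 1) (fl X) (fl Y)"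
  using flag1_flags[OF Hom_Obj(1)[OF f(1)]] flag1_flags[OF Hom_Obj(2)[OF f(1)]] flag1_arr_map[OF f(1)] f(2) iso_Ident[OF z_Obj]
  unfolding S_Hom by (auto simp: flag1_arr_def HomD[OF f(1)])

text \<open>The components at \<open>(0, 0)\<close> and \<open>(1, 1)\<close> are endomorphisms of
  \<open>z\<close>, hence identities, so the component at \<open>(0, 1)\<close> is the whole
  datum.\<close>

lemma S1_HomE:
  assumes "t \<in> Hom (S C z 1) (fl X) (fl Y)"
  obtains f where "f \<in> hom X Y" "iso f" "t = flag1_arr C z f"
proof -
  obtain u where u: "t = (fl X, fl Y, u)" "flag_map 1 (fl X) (fl Y) u" "\<forall>p \<in> tri 1. iso (u p)"
    using assms unfolding S_Hom by blast
  note U = flag_mapD[OF u(2)]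
  have f: "u (0, 1) \<in> hom X Y" using U(2)[of 0 1] by simp
  have z: "u (0, 0) = Ident C z" "u (1, 1) = Ident C z"
    using zero_object_unique(1)[OF zero_z _ Ident_Hom[OF z_Obj], of "u (0, 0)"]
      zero_object_unique(1)[OF zero_z _ Ident_Hom[OF z_Obj], of "u (1, 1)"] U(2)[of 0 0] U(2)[of 1 1] by simp_all
  have "u = (\<lambda>p\<in>tri 1. if p = (0, 1) then u (0, 1) else Ident C z)"
  proof (rule extensionalityI[OF U(1)])
    fix p assume "p \<in> tri 1"
    then show "u p = (\<lambda>p\<in>tri 1. if p = (0, 1) then u (0, 1) else Ident C z) p" using z unfolding tri_1 by auto
  qed simp
  then have "t = flag1_arr C z (u (0, 1))" unfolding u(1) flag1_arr_def HomD[OF f] by blast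
  moreover have "iso (u (0, 1))" using u(3) by simp
  ultimately show thesis using f that by blast
qed

text \<open>The \<open>undefined\<close> branch records what the composition formula produces at
  indices of \<open>tri n\<close> outside \<open>tri 1\<close>; for \<open>n = 1\<close>, used
  below, it disappears.\<close>

lemma flag1_arr_comp:
  assumes "f \<in> hom X Y" "g \<in> hom Y W"
  shows "flag1_arr C z g \<cdot>\<^bsub>S C z n\<^esub> flag1_arr C z f = (fl X, fl W, \<lambda>p\<in>tri n. (if p \<in> tri 1 then (if p = (0, 1) then g \<cdot> f else Ident C z) else undefined \<cdot> undefined))"
  by (auto simp: flag1_arr_def S_simps HomD[OF assms(1)] HomD[OF assms(2)] Ident_left[OF Ident_Hom[OF z_Obj]] intro!: restrict_ext)

lemma S1_comp:
  assumes "f \<in> hom X Y" "g \<in> hom Y W"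
  shows "flag1_arr C z g \<cdot>\<^bsub>S C z 1\<^esub> flag1_arr C z f = flag1_arr C z (g \<cdot> f)"
  unfolding flag1_arr_comp[OF assms]
  by (auto simp: flag1_arr_def HomD[OF Comp_Hom[OF assms]] intro!: restrict_ext)

lemma S1_Ident: "X \<in> Obj C \<Longrightarrow> Ident (S C z 1) (fl X) = flag1_arr C z (Ident C X)"
proof -
  assume X: "X \<in> Obj C"
  have "(\<lambda>p\<in>tri 1. Ident C (vertex (fl X) p)) = (\<lambda>p\<in>tri 1. if p = (0, 1) then Ident C X else Ident C z)"
  proof (rule restrict_ext)
    fix p assume "p \<in> tri 1"
    then show "Ident C (vertex (fl X) p) = (if p = (0, 1) then Ident C X else Ident C z)" unfolding tri_1 by auto
  qed
  then show ?thesis by (simp add: S_simps flag1_arr_def HomD[OF Ident_Hom[OF X]])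
qed

lemma flag1_arr_inj: "f \<in> hom X Y \<Longrightarrow> flag1_arr C z f = flag1_arr C z g \<Longrightarrow> f = g"
proof -
  assume "flag1_arr C z f = flag1_arr C z g"
  then have "(snd (snd (flag1_arr C z f))) (0, 1) = (snd (snd (flag1_arr C z g))) (0, 1)" by simp
  then show ?thesis by (simp add: flag1_arr_def)
qed

section \<open>The groupoid of two-step flags as short exact sequences\<close>

definition flag2 :: "'a \<Rightarrow> 'a \<Rightarrow> ('o, 'a) flag" where
  "flag2 f g = \<lparr>
     vertex = (\<lambda>p\<in>tri 2. if p = (0, 1) then dom f else if p = (0, 2) then cod f else if p = (1, 2) then cod g else z),
     hor = (\<lambda>p\<in>{(0, 0), (0, 1), (1, 1)}. if p = (0, 0) then from_zero C z (dom f) else if p = (0, 1) then f else from_zero C z (cod g)),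
     ver = (\<lambda>p\<in>{(0, 1), (0, 2), (1, 2)}. if p = (0, 1) then to_zero C z (dom f) else if p = (0, 2) then g else to_zero C z (cod g))\<rparr>"

lemma flag2_simps [simp]: "vertex (flag2 f g) (0, Suc 0) = dom f" "vertex (flag2 f g) (0, 2) = cod f" "vertex (flag2 f g) (Suc 0, 2) = cod g"
  "vertex (flag2 f g) (0, 0) = z" "vertex (flag2 f g) (Suc 0, Suc 0) = z" "vertex (flag2 f g) (2, 2) = z"
  "hor (flag2 f g) (0, Suc 0) = f" "ver (flag2 f g) (0, 2) = g"
  by (simp_all add: flag2_def)

lemma index_2:
  "i \<le> j \<and> j < 2 \<longleftrightarrow> (i = 0 \<and> j = 0) \<or> (i = 0 \<and> j = 1) \<or> (i = 1 \<and> j = 1)"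
  "i < j \<and> j \<le> 2 \<longleftrightarrow> (i = 0 \<and> j = 1) \<or> (i = 0 \<and> j = 2) \<or> (i = 1 \<and> j = 2)"
  "i \<le> j \<and> j \<le> 2 \<longleftrightarrow> (i = 0 \<and> j = 0) \<or> (i = 0 \<and> j = 1) \<or> (i = 0 \<and> j = 2) \<or> (i = 1 \<and> j = 1) \<or> (i = 1 \<and> j = 2) \<or> (i = 2 \<and> j = 2)"
  "i < j \<and> j < 2 \<longleftrightarrow> i = 0 \<and> j = 1"
  for i j :: nat
  by auto

lemma flag2_flags:
  assumes e: "exact f g"
  shows "flag2 f g \<in> flags C z 2"
proof -
  note h = exact_Hom[OF e]
  have o: "dom f \<in> Obj C" "cod f \<in> Obj C" "cod g \<in> Obj C" using Hom_Obj[OF h(1)] Hom_Obj[OF h(2)] by simp_all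
  have b: "bicartesian C f (to_zero C z (dom f)) g (from_zero C z (cod g))" using e by (simp add: exact_def)
  then have m: "mono_arr C f" "epi_arr C g" by (simp_all add: bicartesian_def)
  show ?thesis unfolding flags_def mem_Collect_eq index_2
  proof (intro conjI allI impI)
    show "vertex (flag2 f g) \<in> tri 2 \<rightarrow>\<^sub>E Obj C" using o z_Obj by (auto simp: flag2_def)
    show "hor (flag2 f g) \<in> extensional {(i, j). i = 0 \<and> j = 0 \<or> i = 0 \<and> j = 1 \<or> i = 1 \<and> j = 1}" by (auto simp: flag2_def extensional_def)
    show "ver (flag2 f g) \<in> extensional {(i, j). i = 0 \<and> j = 1 \<or> i = 0 \<and> j = 2 \<or> i = 1 \<and> j = 2}" by (auto simp: flag2_def extensional_def)
    fix i :: nat assume "i \<le> 2"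
    then have "i = 0 \<or> i = 1 \<or> i = 2" by auto
    then show "vertex (flag2 f g) (i, i) = z" by auto
  next
    fix i j :: nat assume "i = 0 \<and> j = 0 \<or> i = 0 \<and> j = 1 \<or> i = 1 \<and> j = 1"
    then show "hor (flag2 f g) (i, j) \<in> hom (vertex (flag2 f g) (i, j)) (vertex (flag2 f g) (i, j + 1))" "mono_arr C (hor (flag2 f g) (i, j))"
      using h(1) m from_zero[OF o(1)] from_zero[OF o(3)] from_zero_mono[OF o(1)] from_zero_mono[OF o(3)] by (auto simp: flag2_def)
  next
    fix i j :: nat assume "i = 0 \<and> j = 1 \<or> i = 0 \<and> j = 2 \<or> i = 1 \<and> j = 2"
    then show "ver (flag2 f g) (i, j) \<in> hom (vertex (flag2 f g) (i, j)) (vertex (flag2 f g) (i + 1, j))" "epi_arr C (ver (flag2 f g) (i, j))"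
      using h(2) m to_zero[OF o(1)] to_zero[OF o(3)] to_zero_epi[OF o(1)] to_zero_epi[OF o(3)] by (auto simp: flag2_def)
  next
    fix i j :: nat assume "i = 0 \<and> j = 1"
    then show "bicartesian C (hor (flag2 f g) (i, j)) (ver (flag2 f g) (i, j)) (ver (flag2 f g) (i, j + 1)) (hor (flag2 f g) (i + 1, j))"
      using b by (auto simp: flag2_def)
  qed
qed

lemma flags2_exact:
  assumes A: "A \<in> flags C z 2"
  shows "exact (hor A (0, 1)) (ver A (0, 2))"
    "hor A (0, 1) \<in> hom (vertex A (0, 1)) (vertex A (0, 2))"
    "ver A (0, 2) \<in> hom (vertex A (0, 2)) (vertex A (1, 2))"
proof -
  show h: "hor A (0, 1) \<in> hom (vertex A (0, 1)) (vertex A (0, 2))" using flags_hor[OF A, of 0 1] by (simp add: numeral_2_eq_2)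
  show v: "ver A (0, 2) \<in> hom (vertex A (0, 2)) (vertex A (1, 2))" using flags_ver[OF A, of 0 2] by simp
  have d: "vertex A (1, 1) = z" by (rule flags_diag[OF A]) simp
  have "bicartesian C (hor A (0, 1)) (ver A (0, 1)) (ver A (0, 1 + 1)) (hor A (0 + 1, 1))"
    using A unfolding flags_def mem_Collect_eq by (metis less_one one_less_numeral_iff semiring_norm(76))
  moreover have "ver A (0, 1) = to_zero C z (vertex A (0, 1))" using flags_ver[OF A, of 0 1] d by (intro to_zero_eq) simp
  moreover have "hor A (1, 1) = from_zero C z (vertex A (1, 2))" using flags_hor[OF A, of 1 1] d by (intro from_zero_eq) (simp add: numeral_2_eq_2)
  ultimately show "exact (hor A (0, 1)) (ver A (0, 2))"
    using HomD[OF h] HomD[OF v] by (simp add: exact_def numeral_2_eq_2)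
qed

text \<open>Three isomorphisms commuting with the two arrows of the sequences suffice: each
  remaining square has a zero object as its source or its target and commutes by uniqueness.\<close>

lemma S2_Hom:
  assumes A: "A \<in> flags C z 2" and B: "B \<in> flags C z 2"
    and a: "a \<in> hom (vertex A (0, 1)) (vertex B (0, 1))" "iso a"
    and h: "h \<in> hom (vertex A (0, 2)) (vertex B (0, 2))" "iso h"
    and c: "c \<in> hom (vertex A (1, 2)) (vertex B (1, 2))" "iso c"
    and 1: "hor B (0, 1) \<cdot> a = h \<cdot> hor A (0, 1)" and 2: "ver B (0, 2) \<cdot> h = c \<cdot> ver A (0, 2)"
  obtains u where "(A, B, u) \<in> Hom (S C z 2) A B" "u (0, 1) = a" "u (0, 2) = h" "u (1, 2) = c"
proof -
  define u where "u = (\<lambda>p\<in>tri 2. if p = (0, 1) then a else if p = (0, 2) then h else if p = (1, 2) then c else Ident C z)"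
  have v: "u (0, 1) = a" "u (0, 2) = h" "u (1, 2) = c" "u (0, 0) = Ident C z" "u (1, 1) = Ident C z" "u (2, 2) = Ident C z"
    by (simp_all add: u_def)
  have d: "vertex A (0, 0) = z" "vertex A (1, 1) = z" "vertex A (2, 2) = z" "vertex B (0, 0) = z" "vertex B (1, 1) = z" "vertex B (2, 2) = z"
    by (rule flags_diag[OF A] flags_diag[OF B]; simp)+
  have uH: "u (i, j) \<in> hom (vertex A (i, j)) (vertex B (i, j))" if "i \<le> j \<and> j \<le> 2" for i j
    using that a(1) h(1) c(1) Ident_Hom[OF z_Obj] v d unfolding index_2 by auto
  have "flag_map 2 A B u" unfolding flag_map_def
  proof (intro conjI allI impI)
    show "u \<in> extensional (tri 2)" by (simp add: u_def)
    fix i j :: nat assume ij: "i \<le> j \<and> j < 2"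
    then have l: "i \<le> j" "j < 2" "i \<le> j \<and> j \<le> 2" "i \<le> j + 1 \<and> j + 1 \<le> 2" by auto
    note hh = Comp_Hom[OF uH[OF l(3)] flags_hor[OF B l(1,2)]] Comp_Hom[OF flags_hor[OF A l(1,2)] uH[OF l(4)]]
    from ij have "i = j \<or> (i = 0 \<and> j = 1)" by auto
    then show "hor B (i, j) \<cdot> u (i, j) = u (i, j + 1) \<cdot> hor A (i, j)"
    proof
      assume e: "i = j"
      have "vertex A (i, j) = z" using flags_diag[OF A, of j] l e by simp
      then show ?thesis using zero_object_unique(1)[OF zero_z] hh by simp
    next
      assume "i = 0 \<and> j = 1"
      then show ?thesis using 1 v by (simp add: numeral_2_eq_2)
    qed
  next
    fix i j :: nat assume ij: "i < j \<and> j \<le> 2"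
    then have l: "i < j" "j \<le> 2" "i \<le> j \<and> j \<le> 2" "i + 1 \<le> j \<and> j \<le> 2" by auto
    note hh = Comp_Hom[OF uH[OF l(3)] flags_ver[OF B l(1,2)]] Comp_Hom[OF flags_ver[OF A l(1,2)] uH[OF l(4)]]
    from ij have "i + 1 = j \<or> (i = 0 \<and> j = 2)" by auto
    then show "ver B (i, j) \<cdot> u (i, j) = u (i + 1, j) \<cdot> ver A (i, j)"
    proof
      assume e: "i + 1 = j"
      have "vertex B (i + 1, j) = z" using flags_diag[OF B, of j] l e by simp
      then show ?thesis using zero_object_unique(2)[OF zero_z] hh by simp
    next
      assume "i = 0 \<and> j = 2"
      then show ?thesis using 2 v by simp
    qed
  qed (use uH in blast)
  moreover have "\<forall>p\<in>tri 2. iso (u p)" using a(2) h(2) c(2) iso_Ident[OF z_Obj] by (auto simp: u_def)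
  ultimately have "(A, B, u) \<in> Hom (S C z 2) A B" using A B by (simp add: S_Hom)
  then show thesis using that v by blast
qed

lemma S2_HomD:
  assumes "(A, B, u) \<in> Hom (S C z 2) A B"
  shows "u (0, 1) \<in> hom (vertex A (0, 1)) (vertex B (0, 1))" "iso (u (0, 1))"
    "u (0, 2) \<in> hom (vertex A (0, 2)) (vertex B (0, 2))" "iso (u (0, 2))"
    "u (1, 2) \<in> hom (vertex A (1, 2)) (vertex B (1, 2))" "iso (u (1, 2))"
    "hor B (0, 1) \<cdot> u (0, 1) = u (0, 2) \<cdot> hor A (0, 1)" "ver B (0, 2) \<cdot> u (0, 2) = u (1, 2) \<cdot> ver A (0, 2)"
proof -
  have u: "flag_map 2 A B u" "\<forall>p\<in>tri 2. iso (u p)" using assms by (auto simp: S_Hom)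
  note U = flag_mapD[OF u(1)]
  show "u (0, 1) \<in> hom (vertex A (0, 1)) (vertex B (0, 1))"
    "u (0, 2) \<in> hom (vertex A (0, 2)) (vertex B (0, 2))"
    "u (1, 2) \<in> hom (vertex A (1, 2)) (vertex B (1, 2))" by (rule U(2); simp)+
  show "iso (u (0, 1))" "iso (u (0, 2))" "iso (u (1, 2))" using u(2) by simp_all
  show "hor B (0, 1) \<cdot> u (0, 1) = u (0, 2) \<cdot> hor A (0, 1)" using U(3)[of 0 1] by (simp add: numeral_2_eq_2)
  show "ver B (0, 2) \<cdot> u (0, 2) = u (1, 2) \<cdot> ver A (0, 2)" using U(4)[of 0 2] by simp
qed

section \<open>The functors from short exact sequences to their middle and end terms\<close>

lemma F_simps:
  "A \<in> flags C z 2 \<Longrightarrow> on_obj (F_functor C z) A = fl (vertex A (0, 2))"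
  "(A, B, u) \<in> Hom (S C z 2) A' B' \<Longrightarrow> on_arr (F_functor C z) (A, B, u) = flag1_arr C z (u (0, 2))"
  using HomD(1)[of "(A, B, u)" "S C z 2" A' B'] by (simp_all add: F_functor_def S_simps)

lemma G_simps:
  "A \<in> flags C z 2 \<Longrightarrow> on_obj (G_functor C z) A = (fl (vertex A (0, 1)), fl (vertex A (1, 2)))"
  "(A, B, u) \<in> Hom (S C z 2) A' B' \<Longrightarrow> on_arr (G_functor C z) (A, B, u) = (flag1_arr C z (u (0, 1)), flag1_arr C z (u (1, 2)))"
  using HomD(1)[of "(A, B, u)" "S C z 2" A' B'] by (simp_all add: G_functor_def S_simps)

lemma S_category: "category (S C z n)"
  using S_groupoid by (simp add: groupoid_def)

lemma S_iso: "t \<in> Hom (S C z n) A B \<Longrightarrow> iso_arr (S C z n) t"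
  using S_groupoid HomD(1)[of t "S C z n" A B] by (simp add: groupoid_def)

lemma F_is_functor: "cat_functor (S C z 2) (S C z 1) (F_functor C z)"
proof -
  interpret S2: category "S C z 2" by (rule S_category)
  interpret S1: category "S C z 1" by (rule S_category)
  show ?thesis
  proof
    show "on_obj (F_functor C z) \<in> Obj (S C z 2) \<rightarrow>\<^sub>E Obj (S C z 1)"
      by (rule PiE_I) (simp_all add: F_functor_def S_simps flag1_flags[unfolded One_nat_def] flags_vertex)
    show "on_arr (F_functor C z) \<in> extensional (Arr (S C z 2))" by (simp add: F_functor_def)
  next
    fix A assume A: "A \<in> Obj (S C z 2)"
    then have A': "A \<in> flags C z 2" by (simp add: S_simps)
    show "on_arr (F_functor C z) (Ident (S C z 2) A) = Ident (S C z 1) (on_obj (F_functor C z) A)"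
      using F_simps(2)[OF S2.Ident_Hom[OF A, unfolded S_simps(2)]] S1_Ident[OF flags_vertex[OF A', of 0 2]]
      by (simp add: S_simps(2)[of 2] F_simps(1)[OF A'])
  next
    fix t A B assume t: "t \<in> Hom (S C z 2) A B"
    then obtain u where e: "t = (A, B, u)" and AB: "A \<in> flags C z 2" "B \<in> flags C z 2" unfolding S_Hom by blast
    note h = t[unfolded e] and d = S2_HomD[OF t[unfolded e]]
    show "on_arr (F_functor C z) t \<in> Hom (S C z 1) (on_obj (F_functor C z) A) (on_obj (F_functor C z) B)"
      unfolding e F_simps(2)[OF h] F_simps(1)[OF AB(1)] F_simps(1)[OF AB(2)] by (rule flag1_arr_Hom[OF d(3,4)])
    fix s D assume s: "s \<in> Hom (S C z 2) B D"
    then obtain v where e': "s = (B, D, v)" unfolding S_Hom by blast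
    note h' = s[unfolded e'] and d' = S2_HomD[OF s[unfolded e']]
    show "on_arr (F_functor C z) (s \<cdot>\<^bsub>S C z 2\<^esub> t) = on_arr (F_functor C z) s \<cdot>\<^bsub>S C z 1\<^esub> on_arr (F_functor C z) t"
      unfolding e e' S_simps(3)[of 2] F_simps(2)[OF h] F_simps(2)[OF h'] F_simps(2)[OF S2.Comp_Hom[OF h h', unfolded S_simps(3)]] S1_comp[OF d(3) d'(3)]
      by simp
  qed
qed

lemma G_is_functor: "cat_functor (S C z 2) (prod_cat (S C z 1) (S C z 1)) (G_functor C z)"
proof -
  interpret S2: category "S C z 2" by (rule S_category)
  interpret S1: category "prod_cat (S C z 1) (S C z 1)" by (rule prod_category[OF S_category S_category])
  show ?thesis
  proof
    show "on_obj (G_functor C z) \<in> Obj (S C z 2) \<rightarrow>\<^sub>E Obj (prod_cat (S C z 1) (S C z 1))"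
      by (rule PiE_I) (simp_all add: G_functor_def S_simps flag1_flags[unfolded One_nat_def] flags_vertex)
    show "on_arr (G_functor C z) \<in> extensional (Arr (S C z 2))" by (simp add: G_functor_def)
  next
    fix A assume A: "A \<in> Obj (S C z 2)"
    then have A': "A \<in> flags C z 2" by (simp add: S_simps)
    show "on_arr (G_functor C z) (Ident (S C z 2) A) = Ident (prod_cat (S C z 1) (S C z 1)) (on_obj (G_functor C z) A)"
      using G_simps(2)[OF S2.Ident_Hom[OF A, unfolded S_simps(2)]] S1_Ident[OF flags_vertex[OF A', of 0 1]] S1_Ident[OF flags_vertex[OF A', of 1 2]]
      by (simp add: S_simps(2)[of 2] G_simps(1)[OF A'])
  next
    fix t A B assume t: "t \<in> Hom (S C z 2) A B"
    then obtain u where e: "t = (A, B, u)" and AB: "A \<in> flags C z 2" "B \<in> flags C z 2" unfolding S_Hom by blast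
    note h = t[unfolded e] and d = S2_HomD[OF t[unfolded e]]
    show "on_arr (G_functor C z) t \<in> Hom (prod_cat (S C z 1) (S C z 1)) (on_obj (G_functor C z) A) (on_obj (G_functor C z) B)"
      unfolding e G_simps(2)[OF h] G_simps(1)[OF AB(1)] G_simps(1)[OF AB(2)] Hom_prod_cat
      using flag1_arr_Hom[OF d(1,2)] flag1_arr_Hom[OF d(5,6)] by simp
    fix s D assume s: "s \<in> Hom (S C z 2) B D"
    then obtain v where e': "s = (B, D, v)" unfolding S_Hom by blast
    note h' = s[unfolded e'] and d' = S2_HomD[OF s[unfolded e']]
    show "on_arr (G_functor C z) (s \<cdot>\<^bsub>S C z 2\<^esub> t) = on_arr (G_functor C z) s \<cdot>\<^bsub>prod_cat (S C z 1) (S C z 1)\<^esub> on_arr (G_functor C z) t"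
      unfolding e e' S_simps(3)[of 2] G_simps(2)[OF h] G_simps(2)[OF h'] G_simps(2)[OF S2.Comp_Hom[OF h h', unfolded S_simps(3)]]
        prod_cat_simps S1_comp[OF d(1) d'(1)] S1_comp[OF d(5) d'(5)]
      by simp
  qed
qed

end

locale hall = pointed_proto_abelian C z + complex_universe \<iota>
  for C :: "('o, 'a) cat" (structure) and z :: 'o and \<iota> :: "complex \<Rightarrow> 'v" +
  assumes finitary_C: "finitary C z"
begin

lemma finite_Hom: "finite (hom x y)"
proof (cases "x \<in> Obj C \<and> y \<in> Obj C")
  case True
  then show ?thesis using finitary_C by (simp add: finitary_def)
next
  case False
  then have "hom x y = {}" using Hom_Obj by blast
  then show ?thesis by simp
qed

text \<open>The form in which local finiteness of \<open>F_functor\<close> and \<open>sigma0\<close>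
  enters \<open>left_kanI\<close>.\<close>

lemma finite_Hom_S1: "finite (Hom (S C z 1) A B)"
proof (cases "A \<in> Obj (S C z 1) \<and> B \<in> Obj (S C z 1)")
  case True
  then obtain X Y where e: "A = fl X" "B = fl Y" unfolding S1_Obj by blast
  have "Hom (S C z 1) A B \<subseteq> flag1_arr C z ` hom X Y" unfolding e by (blast elim: S1_HomE)
  then show ?thesis using finite_Hom finite_surj by blast
next
  case False
  then have "Hom (S C z 1) A B = {}" using category.Hom_Obj[OF S_category] by blast
  then show ?thesis by simp
qed

sublocale F: left_kan \<iota> "S C z 2" "S C z 1" "F_functor C z"
  by (rule left_kanI[OF inj_\<iota> F_is_functor S_groupoid finite_Hom_S1])

lemma sigma0_functor: "cat_functor (S C z 0) (S C z 1) (sigma0 C z)"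
  unfolding sigma0_def by (rule const_fct_functor[OF S_category S_category fl_Obj[OF z_Obj]])

sublocale U: left_kan \<iota> "S C z 0" "S C z 1" "sigma0 C z"
  by (rule left_kanI[OF inj_\<iota> sigma0_functor S_groupoid finite_Hom_S1])

text \<open>Identities on both ends complete the isomorphism of middle terms to an arrow of
  \<open>S C z 2\<close>.\<close>

lemma ext_equiv_iso:
  assumes "((f, g), (f', g')) \<in> ext_equiv C z Y X"
  shows "iso_class (S C z 2) (flag2 f g) = iso_class (S C z 2) (flag2 f' g')"
proof -
  obtain u where u: "u \<in> hom (cod f) (cod f')" "iso u" "u \<cdot> f = f'" "g' \<cdot> u = g"
    and x: "(f, g) \<in> extensions C z Y X" "(f', g') \<in> extensions C z Y X"
    using assms by (auto simp: ext_equiv_def)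
  have e: "exact f g" "exact f' g'" "dom f = X" "dom f' = X" "cod g = Y" "cod g' = Y"
    using x by (auto simp: extensions_def exact_def)
  note h = exact_Hom[OF e(1)] exact_Hom[OF e(2)]
  have o: "X \<in> Obj C" "Y \<in> Obj C" using Hom_Obj[OF h(1)] Hom_Obj[OF h(2)] e by auto
  obtain v where v: "(flag2 f g, flag2 f' g', v) \<in> Hom (S C z 2) (flag2 f g) (flag2 f' g')"
    by (rule S2_Hom[OF flag2_flags[OF e(1)] flag2_flags[OF e(2)], of "Ident C X" u "Ident C Y"])
       (use u e o h Ident_Hom[OF o(1)] Ident_Hom[OF o(2)] iso_Ident[OF o(1)] iso_Ident[OF o(2)] Ident_right[OF h(3)] Ident_left[OF h(2)] in simp_all)
  show ?thesis by (rule category.iso_class_eq[OF S_category v S_iso[OF v]])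
qed

lemma extensions_iff: "(f, g) \<in> extensions C z Y X \<longleftrightarrow> exact f g \<and> dom f = X \<and> cod g = Y"
  by (auto simp: extensions_def exact_def)

lemma iso_class_S1:
  assumes "fl X \<in> iso_class (S C z 1) (fl Y)"
  obtains f where "f \<in> hom Y X" "iso f"
  using assms unfolding iso_class_def by (blast elim: S1_HomE)

text \<open>A sequence whose ends are isomorphic to \<open>X\<close> and \<open>Y\<close> becomes,
  after transport of both ends, an extension of \<open>Y\<close> by \<open>X\<close> isomorphic to
  it. So the isomorphism classes over \<open>(X, Y)\<close> are covered by the finite set
  \<open>Ext\<close>.\<close>

lemma G_pi0_finite: "pi0_finite (S C z 2) (prod_cat (S C z 1) (S C z 1)) (G_functor C z)"
  unfolding pi0_finite_def
proof
  fix b assume "b \<in> Obj (prod_cat (S C z 1) (S C z 1))"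
  then have "fst b \<in> Obj (S C z 1)" "snd b \<in> Obj (S C z 1)" by auto
  then obtain X Y where XY: "X \<in> Obj C" "Y \<in> Obj C" "b = (fl X, fl Y)" unfolding S1_Obj by (metis prod.collapse)
  \<comment> \<open>An element of \<open>Ext\<close> is a set of equivalent extensions; by
    \<open>ext_equiv_iso\<close> any member of it gives the same isomorphism class.\<close>
  define rep where "rep E = (SOME p. p \<in> E)" for E :: "('a \<times> 'a) set"
  have "{iso_class (S C z 2) A |A. A \<in> Obj (S C z 2) \<and> on_obj (G_functor C z) A \<in> iso_class (prod_cat (S C z 1) (S C z 1)) b}
     \<subseteq> (\<lambda>E. iso_class (S C z 2) (flag2 (fst (rep E)) (snd (rep E)))) ` Ext C z Y X"
  proof
    fix c assume "c \<in> {iso_class (S C z 2) A |A. A \<in> Obj (S C z 2) \<and> on_obj (G_functor C z) A \<in> iso_class (prod_cat (S C z 1) (S C z 1)) b}"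
    then obtain A where A: "c = iso_class (S C z 2) A" "A \<in> flags C z 2" "on_obj (G_functor C z) A \<in> iso_class (prod_cat (S C z 1) (S C z 1)) b"
      unfolding S_simps by blast
    have "fl (vertex A (0, 1)) \<in> iso_class (S C z 1) (fl X)" "fl (vertex A (1, 2)) \<in> iso_class (S C z 1) (fl Y)"
      using A(3) unfolding G_simps(1)[OF A(2)] XY(3) iso_class_prod_eq by simp_all
    obtain a where a: "a \<in> hom X (vertex A (0, 1))" "iso a"
      by (rule iso_class_S1[OF \<open>fl (vertex A (0, 1)) \<in> iso_class (S C z 1) (fl X)\<close>])
    obtain d where d: "d \<in> hom Y (vertex A (1, 2))" "iso d"
      by (rule iso_class_S1[OF \<open>fl (vertex A (1, 2)) \<in> iso_class (S C z 1) (fl Y)\<close>])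
    obtain d' where d': "d' \<in> hom (vertex A (1, 2)) Y" "d' \<cdot> d = Ident C Y" "d \<cdot> d' = Ident C (vertex A (1, 2))" "iso d'"
      by (rule iso_inverse[OF d])
    note e = flags2_exact[OF A(2)]
    \<comment> \<open>Both ends of \<open>A\<close> are moved to exactly \<open>X\<close> and
      \<open>Y\<close>, while the middle term stays the same.\<close>
    define f where "f = hor A (0, 1) \<cdot> a"
    define g where "g = d' \<cdot> ver A (0, 2)"
    have f: "f \<in> hom X (vertex A (0, 2))" and g: "g \<in> hom (vertex A (0, 2)) Y"
      unfolding f_def g_def by (rule Comp_Hom[OF a(1) e(2)] Comp_Hom[OF e(3) d'(1)])+
    have "exact (hor A (0, 1)) g" unfolding g_def using exact_iso_right[OF e(1)] d'(1,4) HomD(3)[OF e(3)] by simp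
    then have ex: "exact f g" unfolding f_def using exact_iso_left a HomD(2)[OF e(2)] by simp
    then have ext: "(f, g) \<in> extensions C z Y X" using HomD[OF f] HomD[OF g] by (simp add: extensions_iff)
    have dg: "d \<cdot> g = ver A (0, 2)"
      unfolding g_def using Comp_assoc[OF e(3) d'(1) d(1)] d'(3) Ident_left[OF e(3)] by simp
    have o: "vertex A (0, 2) \<in> Obj C" by (rule flags_vertex[OF A(2)]) auto
    obtain u where u: "(flag2 f g, A, u) \<in> Hom (S C z 2) (flag2 f g) A"
    proof (rule S2_Hom[OF flag2_flags[OF ex] A(2), of a "Ident C (vertex A (0, 2))" d])
      show "a \<in> hom (vertex (flag2 f g) (0, 1)) (vertex A (0, 1))" using a(1) HomD[OF f] by simp
      show "Ident C (vertex A (0, 2)) \<in> hom (vertex (flag2 f g) (0, 2)) (vertex A (0, 2))" using Ident_Hom[OF o] HomD[OF f] by simp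
      show "d \<in> hom (vertex (flag2 f g) (1, 2)) (vertex A (1, 2))" using d(1) HomD[OF g] by simp
      show "hor A (0, 1) \<cdot> a = Ident C (vertex A (0, 2)) \<cdot> hor (flag2 f g) (0, 1)" using Ident_left[OF f] by (simp add: f_def)
      show "ver A (0, 2) \<cdot> Ident C (vertex A (0, 2)) = d \<cdot> ver (flag2 f g) (0, 2)" using Ident_right[OF e(3)] dg by simp
    qed (use a d iso_Ident[OF o] in blast)+
    have c1: "iso_class (S C z 2) (flag2 f g) = c"
      unfolding A(1) by (rule category.iso_class_eq[OF S_category u S_iso[OF u]])
    define E where "E = ext_equiv C z Y X `` {(f, g)}"
    have E: "E \<in> Ext C z Y X" unfolding E_def Ext_def using ext by (rule quotientI)
    have "(f, g) \<in> E" unfolding E_def ext_equiv_def using ext HomD[OF f] Ident_Hom[OF o] iso_Ident[OF o] Ident_left[OF f] Ident_right[OF g]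
      by auto
    then have "rep E \<in> E" unfolding rep_def by (rule someI)
    then have "((f, g), (fst (rep E), snd (rep E))) \<in> ext_equiv C z Y X" unfolding E_def by simp
    from ext_equiv_iso[OF this] show "c \<in> (\<lambda>E. iso_class (S C z 2) (flag2 (fst (rep E)) (snd (rep E)))) ` Ext C z Y X"
      using E c1 by blast
  qed
  moreover have "finite (Ext C z Y X)" using finitary_C XY by (simp add: finitary_def)
  ultimately show "finite {iso_class (S C z 2) A |A. A \<in> Obj (S C z 2) \<and> on_obj (G_functor C z) A \<in> iso_class (prod_cat (S C z 1) (S C z 1)) b}"
    by (meson finite_imageI finite_subset)
qed

lemma hall_tensor_functor:
  "cat_functor (prod_cat (Fun (S C z 1)) (Fun (S C z 1))) (Fun (S C z 1) :: ((('o, 'a) flag, ('o, 'a) flag_arr, 'v) vfct, _) cat) (hall_tensor C z)"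
  unfolding hall_tensor_def Let_def
  by (rule fcomp_functor[OF fcomp_functor[OF box_functor pull_functor[OF G_is_functor G_pi0_finite]] F.push_functor])

end

section \<open>The complex line inside the universe type\<close>

context complex_universe
begin

lemma complex_line_simps [simp]:
  "carrier (complex_line \<iota>) = range \<iota>" "\<zero>\<^bsub>complex_line \<iota>\<^esub> = \<iota> 0"
  "\<iota> a \<oplus>\<^bsub>complex_line \<iota>\<^esub> \<iota> b = \<iota> (a + b)" "c \<odot>\<^bsub>complex_line \<iota>\<^esub> \<iota> a = \<iota> (c * a)"
  by (simp_all add: complex_line_def the_inv_f_f[OF inj_\<iota>])

lemma complex_line_vect: "complex_line \<iota> \<in> Obj vect"
proof (rule vect_ObjI[where B = "{\<iota> 1}"])
  fix v assume "v \<in> carrier (complex_line \<iota>)"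
  then obtain c where "v = \<iota> c" by auto
  then show "\<exists>r. snd ` set r \<subseteq> {\<iota> 1} \<and> v = lc (complex_line \<iota>) (\<lambda>i. i) r"
    by (intro exI[of _ "[(c, \<iota> 1)]"]) simp
qed (auto simp: algebra_simps)

lemma complex_line_linear:
  assumes U: "U \<in> Obj vect" and u: "u \<in> carrier U"
  shows "linmap (complex_line \<iota>) U (\<lambda>v. the_inv \<iota> v \<odot>\<^bsub>U\<^esub> u)"
  by (rule linmapI) (use U u in \<open>auto simp: the_inv_f_f[OF inj_\<iota>] vs_smult_add_left vs_smult_smult\<close>)

lemma complex_line_ext:
  assumes "linmap (complex_line \<iota>) U m" "linmap (complex_line \<iota>) U n" "m (\<iota> 1) = n (\<iota> 1)" "v \<in> carrier (complex_line \<iota>)"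
  shows "m v = n v"
proof -
  obtain c where v: "v = c \<odot>\<^bsub>complex_line \<iota>\<^esub> \<iota> 1" using assms(4) by auto
  have 1: "\<iota> 1 \<in> carrier (complex_line \<iota>)" by simp
  show ?thesis unfolding v linmap_smult[OF assms(1) 1] linmap_smult[OF assms(2) 1] assms(3) ..
qed

end

context pointed_proto_abelian
begin

lemma zero_object_iso:
  assumes "zero_object C X"
  shows "iso (from_zero C z X)"
proof -
  have X: "X \<in> Obj C" using assms by (simp add: zero_object_def)
  note h = from_zero[OF X] to_zero[OF X]
  show ?thesis
    by (rule isoI[OF h]; rule zero_object_unique(1)[OF zero_z Comp_Hom[OF h] Ident_Hom[OF z_Obj]]
          zero_object_unique(1)[OF assms Comp_Hom[OF h(2,1)] Ident_Hom[OF X]])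
qed

lemma iso_zero_object:
  assumes f: "f \<in> hom X Y" "iso f" and X: "zero_object C X"
  shows "zero_object C Y"
proof -
  note i = inverse_arr[OF f]
  have Y: "Y \<in> Obj C" using Hom_Obj(2)[OF f(1)] .
  have "\<exists>!g. g \<in> hom Y W" if W: "W \<in> Obj C" for W
  proof (rule ex1I)
    have XW: "zero_map X W \<in> hom X W" using zero_map_Hom[OF Hom_Obj(1)[OF f(1)] W] .
    show "zero_map X W \<cdot> inverse_arr f \<in> hom Y W" by (rule Comp_Hom[OF i(1) XW])
    fix g assume g: "g \<in> hom Y W"
    have "g = g \<cdot> f \<cdot> inverse_arr f" using Comp_assoc[OF i(1) f(1) g] i(3) Ident_right[OF g] by simp
    also have "g \<cdot> f = zero_map X W" by (rule zero_object_unique(1)[OF X Comp_Hom[OF f(1) g] XW])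
    finally show "g = zero_map X W \<cdot> inverse_arr f" .
  qed
  moreover have "\<exists>!g. g \<in> hom W Y" if W: "W \<in> Obj C" for W
  proof (rule ex1I)
    have XW: "zero_map W X \<in> hom W X" using zero_map_Hom[OF W Hom_Obj(1)[OF f(1)]] .
    show "f \<cdot> zero_map W X \<in> hom W Y" by (rule Comp_Hom[OF XW f(1)])
    fix g assume g: "g \<in> hom W Y"
    have "g = f \<cdot> (inverse_arr f \<cdot> g)" using Comp_assoc[OF g i(1) f(1)] i(3) Ident_left[OF g] by simp
    also have "inverse_arr f \<cdot> g = zero_map W X" by (rule zero_object_unique(2)[OF X Comp_Hom[OF g i(1)] XW])
    finally show "g = f \<cdot> zero_map W X" .
  qed
  ultimately show ?thesis using Y unfolding zero_object_def by blast
qed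

text \<open>Restriction to the empty set makes \<open>hor\<close> and \<open>ver\<close> undefined
  everywhere, as extensionality over empty index sets demands.\<close>

definition flag0 :: "('o, 'a) flag" where
  "flag0 = \<lparr>vertex = (\<lambda>p\<in>tri 0. z), hor = (\<lambda>p\<in>{}. undefined), ver = (\<lambda>p\<in>{}. undefined)\<rparr>"

lemma flags_0: "flags C z 0 = {flag0}"
proof -
  have t: "tri 0 = {(0, 0)}" "{(i, j). i < j \<and> j \<le> (0 :: nat)} = {}" by (auto simp: tri_def)
  show ?thesis
  proof (intro equalityI subsetI)
    fix A assume A: "A \<in> flags C z 0"
    have "ver A \<in> extensional {(i, j). i < j \<and> j \<le> 0}" using A unfolding flags_def by blast
    then have e: "vertex A \<in> extensional (tri 0)" "hor A \<in> extensional {}" "ver A \<in> extensional {}"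
      using A unfolding t(2) by (auto simp: flags_def PiE_def)
    have "vertex A (0, 0) = z" by (rule flags_diag[OF A]) simp
    then have "vertex A = vertex flag0" by (intro extensionalityI[OF e(1)]) (auto simp: flag0_def t)
    moreover have "hor A = hor flag0" by (rule extensionalityI[OF e(2)]) (auto simp: flag0_def)
    moreover have "ver A = ver flag0" by (rule extensionalityI[OF e(3)]) (auto simp: flag0_def)
    ultimately show "A \<in> {flag0}" by (simp add: flag.equality)
  next
    fix A assume "A \<in> {flag0}"
    then show "A \<in> flags C z 0" using z_Obj by (auto simp: flags_def flag0_def t extensional_def)
  qed
qed

text \<open>The mono and epi sides of the square come from the exact pairs, so the pushout property
  alone yields \<open>bicartesian\<close>.\<close>

lemma flag3I:
  assumes "exact f g" "exact f' g'" "cod f' = dom f" "exact (f \<cdot> f') q" "exact f'' g''" "is_pushout C f g' q f''" "g'' \<cdot> q = g"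
  shows "flag3 f g f' g' q f'' g''"
  using assms bicartesianI[OF disjI1[OF assms(6)] exact_mono_epi(1)[OF assms(1)] exact_mono_epi(2)[OF assms(2)]
      exact_mono_epi(2)[OF assms(4)] exact_mono_epi(1)[OF assms(5)]] by (simp add: flag3_def)

section \<open>Replacing one vertex of a three-step flag by an isomorphic object\<close>

context
  fixes f g f' g' q f'' g''
  assumes fl3: "flag3 f g f' g' q f'' g''"
begin

lemmas fl3D = flag3D[OF fl3]

text \<open>In this group of lemmas the suffix names the vertex that moves: \<open>sub\<close>,
  \<open>mid\<close> and \<open>quot\<close> are the graded pieces with indices 01, 12 and 23, and
  digits give the indices directly. They match the balancing relations of the two triple tensor
  products.\<close>

lemma flag3_iso_sub:
  assumes a: "a \<in> hom A (dom f')" "iso a"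
  shows "flag3 f g (f' \<cdot> a) g' q f'' g''"
proof -
  obtain a1 a2 a3 where s: "f' \<in> hom a1 a2" "f \<in> hom a2 a3" by (rule flag3_Hom[OF fl3])
  have a': "a \<in> hom A a1" using a(1) HomD(2)[OF s(1)] by simp
  show ?thesis
  proof (rule flag3I[OF fl3D(1) exact_iso_left[OF fl3D(2) a] _ _ fl3D(5,8,7)])
    show "cod (f' \<cdot> a) = dom f" using HomD(3)[OF Comp_Hom[OF a' s(1)]] HomD(2)[OF s(2)] by simp
    show "exact (f \<cdot> (f' \<cdot> a)) q"
      unfolding Comp_assoc[OF a' s] by (rule exact_iso_left[OF fl3D(4) _ a(2)]) (use a' HomD(2)[OF Comp_Hom[OF s]] in simp)
  qed
qed

lemma flag3_iso_mid:
  assumes c: "c \<in> hom (cod g') D" "iso c"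
  shows "flag3 f g f' (c \<cdot> g') q (f'' \<cdot> inverse_arr c) g''"
proof -
  obtain a1 a2 a3 a12 a13 a23 where s: "g' \<in> hom a2 a12" "f'' \<in> hom a12 a13" by (rule flag3_Hom[OF fl3])
  have "cod g' = dom f''" using HomD(3)[OF s(1)] HomD(2)[OF s(2)] by simp
  then have i: "inverse_arr c \<in> hom D (dom f'')" using inverse_arr(1)[OF c] by simp
  show ?thesis
    by (rule flag3I[OF fl3D(1) exact_iso_right[OF fl3D(2) c] fl3D(3,4) exact_iso_left[OF fl3D(5) i inverse_arr(4)[OF c]] pushout_leg_iso[OF fl3D(8) c] fl3D(7)])
qed

lemma flag3_iso_quot:
  assumes c: "c \<in> hom (cod g) D" "iso c"
  shows "flag3 f (c \<cdot> g) f' g' q f'' (c \<cdot> g'')"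
proof -
  obtain a1 a2 a3 a12 a13 a23 where s: "q \<in> hom a3 a13" "g'' \<in> hom a13 a23" "g \<in> hom a3 a23" by (rule flag3_Hom[OF fl3])
  have c': "c \<in> hom a23 D" using c(1) HomD(3)[OF s(3)] by simp
  then have "c \<in> hom (cod g'') D" using HomD(3)[OF s(2)] by simp
  moreover have "c \<cdot> g'' \<cdot> q = c \<cdot> g" using Comp_assoc[OF s(1,2) c'] fl3D(7) by simp
  ultimately show ?thesis
    by (intro flag3I[OF exact_iso_right[OF fl3D(1) c] fl3D(2,3,4) exact_iso_right[OF fl3D(5) _ c(2)] fl3D(8)])
qed

lemma flag3_iso_13:
  assumes c: "c \<in> hom (cod q) D" "iso c"
  shows "flag3 f g f' g' (c \<cdot> q) (c \<cdot> f'') (g'' \<cdot> inverse_arr c)"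
proof -
  obtain a1 a2 a3 a12 a13 a23 where s: "q \<in> hom a3 a13" "f'' \<in> hom a12 a13" "g'' \<in> hom a13 a23" by (rule flag3_Hom[OF fl3])
  have c': "c \<in> hom a13 D" using c(1) HomD(3)[OF s(1)] by simp
  note j = inverse_arr[OF c' c(2)]
  have "g'' \<cdot> inverse_arr c \<cdot> (c \<cdot> q) = g'' \<cdot> (inverse_arr c \<cdot> c \<cdot> q)"
    using Comp_assoc[OF Comp_Hom[OF s(1) c'] j(1) s(3)] Comp_assoc[OF s(1) c' j(1)] by simp
  then have "g'' \<cdot> inverse_arr c \<cdot> (c \<cdot> q) = g" using j(2) Ident_left[OF s(1)] fl3D(7) by simp
  moreover have "exact (c \<cdot> f'') (g'' \<cdot> inverse_arr c)"
    by (rule exact_iso_middle[OF fl3D(5)]) (use c' j HomD(3)[OF s(2)] in simp_all)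
  ultimately show ?thesis
    by (intro flag3I[OF fl3D(1,2,3) exact_iso_right[OF fl3D(4) c] _ pushout_cod_iso[OF fl3D(8) c]])
qed

end

text \<open>The isomorphism is stripped off \<open>f\<close> instead of added to it, because the
  outer balancing relation starts from a flag over \<open>f \<cdot> a\<close>.\<close>

lemma flag3_iso_02:
  assumes fl3: "flag3 (f \<cdot> a) g f' g' q f'' g''" and f: "f \<in> hom X Y" and a: "a \<in> hom A X" "iso a"
  shows "flag3 f g (a \<cdot> f') (g' \<cdot> inverse_arr a) q f'' g''"
proof -
  note D = flag3D[OF fl3]
  obtain a1 a2 a3 a12 where s: "f' \<in> hom a1 a2" "f \<cdot> a \<in> hom a2 a3" "g' \<in> hom a2 a12" by (rule flag3_Hom[OF fl3])
  have eq: "a2 = A" using HomD(2)[OF s(2)] HomD(2)[OF Comp_Hom[OF a(1) f]] by simp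
  note s = s[unfolded eq] and j = inverse_arr[OF a]
  have f2: "f \<cdot> a \<cdot> inverse_arr a = f" using Comp_assoc[OF j(1) a(1) f] j(3) Ident_right[OF f] by simp
  have j': "inverse_arr a \<in> hom X (dom (f \<cdot> a))" using j(1) HomD(2)[OF s(2)] by simp
  show ?thesis
  proof (rule flag3I)
    show "exact f g" using exact_iso_left[OF D(1) j' j(4)] unfolding f2 .
    show "exact (a \<cdot> f') (g' \<cdot> inverse_arr a)"
      by (rule exact_iso_middle[OF D(2)]) (use a j HomD(3)[OF s(1)] in simp_all)
    show "cod (a \<cdot> f') = dom f" using HomD(3)[OF Comp_Hom[OF s(1) a(1)]] HomD(2)[OF f] by simp
    show "exact (f \<cdot> (a \<cdot> f')) q" using D(4) unfolding Comp_assoc[OF s(1) a(1) f] .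
    show "is_pushout C f (g' \<cdot> inverse_arr a) q f''" using pushout_span_iso[OF D(8) j' j(4)] unfolding f2 .
  qed (rule D)+
qed

lemma flag3_iso_03:
  assumes fl3: "flag3 f g f' g' q f'' g''" and h: "h \<in> hom (cod f) Y" "iso h"
  shows "flag3 (h \<cdot> f) (g \<cdot> inverse_arr h) f' g' (q \<cdot> inverse_arr h) f'' g''"
proof -
  note D = flag3D[OF fl3]
  obtain a1 a2 a3 a12 a13 a23 where s: "f' \<in> hom a1 a2" "f \<in> hom a2 a3" "g' \<in> hom a2 a12" "q \<in> hom a3 a13"
    "f'' \<in> hom a12 a13" "g'' \<in> hom a13 a23" "g \<in> hom a3 a23" by (rule flag3_Hom[OF fl3])
  have h': "h \<in> hom a3 Y" using h(1) HomD(3)[OF s(2)] by simp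
  note j = inverse_arr[OF h' h(2)]
  show ?thesis
  proof (rule flag3I)
    show "exact (h \<cdot> f) (g \<cdot> inverse_arr h)"
      by (rule exact_iso_middle[OF D(1)]) (use h' j HomD(3)[OF s(2)] in simp_all)
    show "cod f' = dom (h \<cdot> f)" using HomD(3)[OF s(1)] HomD(2)[OF Comp_Hom[OF s(2) h']] by simp
    show "exact (h \<cdot> f \<cdot> f') (q \<cdot> inverse_arr h)"
      unfolding Comp_assoc[OF s(1,2) h', symmetric]
      by (rule exact_iso_middle[OF D(4)]) (use h' j HomD(3)[OF Comp_Hom[OF s(1,2)]] in simp_all)
    show "is_pushout C (h \<cdot> f) g' (q \<cdot> inverse_arr h) f''"
    proof -
      have "is_pushout C g' (h \<cdot> f) f'' (q \<cdot> inverse_arr h)"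
        by (rule pushout_leg_iso[OF pushout_swap[OF D(8)] _ h(2)]) (use h' HomD(3)[OF s(2)] in simp)
      then show ?thesis by (rule pushout_swap)
    qed
    show "g'' \<cdot> (q \<cdot> inverse_arr h) = g \<cdot> inverse_arr h" using Comp_assoc[OF j(1) s(4,6)] D(7) by simp
  qed (rule D)+
qed

text \<open>The filtration whose first two steps coincide, with zero middle subquotient. Its
  bicartesian square is the extension square of \<open>(f, g)\<close> itself. It is the flag behind
  the triangle identity.\<close>

lemma flag3_unit:
  assumes e: "exact f g"
  shows "flag3 f g (Ident C (dom f)) (to_zero C z (dom f)) g (from_zero C z (cod g)) (Ident C (cod g))"
proof -
  note H = exact_Hom[OF e]
  note o = Hom_Obj(1)[OF H(1)] Hom_Obj(2)[OF H(2)]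
  have "is_pushout C f (to_zero C z (dom f)) g (from_zero C z (cod g))"
    using e by (simp add: exact_def bicartesian_def)
  then show ?thesis
    using e exact_zero_right[OF o(1)] exact_zero_left[OF o(2)] HomD(3)[OF Ident_Hom[OF o(1)]] Ident_right[OF H(1)] Ident_left[OF H(2)]
    by (intro flag3I) simp_all
qed

text \<open>The hypotheses describe a filtration \<open>A\<^sub>1 \<hookrightarrow> A\<^sub>2 \<hookrightarrow> A\<^sub>3 \<hookrightarrow> X\<close> by \<open>f3\<close>, \<open>f2\<close>, \<open>f1\<close>; the conclusions are its subflags
  \<open>A\<^sub>2 \<hookrightarrow> A\<^sub>3 \<hookrightarrow> X\<close> and \<open>A\<^sub>1 \<hookrightarrow> A\<^sub>2 \<hookrightarrow> X\<close>.\<close>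

lemma flag3_refine:
  assumes 1: "flag3 f2 g2 f3 g3 p h k" and 2: "flag3 f1 g1 (f2 \<cdot> f3) p p' h' k'" and 3: "flag3 h' k' h k s m n"
  shows "flag3 f1 g1 f2 g2 (s \<cdot> p') m n" "flag3 (f1 \<cdot> f2) (s \<cdot> p') f3 g3 p' (h' \<cdot> h) s"
proof -
  note D1 = flag3D[OF 1] and D2 = flag3D[OF 2] and D3 = flag3D[OF 3]
  obtain a1 a2 a3 b where H: "f3 \<in> hom a1 a2" "f2 \<in> hom a2 a3" by (rule flag3_Hom[OF 1])
  obtain b1 b2 b3 b12 b13 b23 where "f2 \<cdot> f3 \<in> hom b1 b2" "f1 \<in> hom b2 b3" and P: "p' \<in> hom b3 b13" "k' \<in> hom b13 b23"
    by (rule flag3_Hom[OF 2])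
  then have f1: "f1 \<in> hom a3 b3" using HomD(3)[OF Comp_Hom[OF H]] HomD(3) by metis
  obtain c1 c2 c3 c13 c23 where S: "s \<in> hom c1 c2" "n \<in> hom c2 c3" by (rule flag3_Hom[OF 3])
  have "c1 = b13" using HomD(2,3) P S D3(7) Comp_Hom[OF S] by metis
  note S = S[unfolded this]
  have cd: "cod f2 = dom f1" using HomD(3)[OF H(2)] HomD(2)[OF f1] by simp
  \<comment> \<open>Two stacked pushouts, the side \<open>g2\<close> being \<open>k\<close> after
    \<open>p\<close>.\<close>
  have po: "is_pushout C f1 g2 (s \<cdot> p') m" using pushout_vpaste[OF D2(8) D3(8)] D1(7) by simp
  \<comment> \<open>This auxiliary flag agrees with the wanted one up to the isomorphism
    \<open>c\<close> of pushouts, and it supplies the exactness of \<open>f1 \<cdot> f2\<close>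
    followed by \<open>s \<cdot> p'\<close>.\<close>
  obtain q f0 g0 where fl: "flag3 f1 g1 f2 g2 q f0 g0" by (rule flag3_left[OF D2(1) D1(1) cd])
  obtain c where c: "c \<in> hom (cod q) (cod (s \<cdot> p'))" "iso c" "c \<cdot> q = s \<cdot> p'" by (rule pushout_unique[OF flag3D(8)[OF fl] po])
  have e: "exact (f1 \<cdot> f2) (s \<cdot> p')" using exact_iso_right[OF flag3D(4)[OF fl] c(1,2)] c(3) by simp
  show "flag3 f1 g1 f2 g2 (s \<cdot> p') m n"
    by (rule flag3I[OF D2(1) D1(1) cd e D3(5) po]) (use Comp_assoc[OF P(1) S] D3(7) D2(7) in simp)
  show "flag3 (f1 \<cdot> f2) (s \<cdot> p') f3 g3 p' (h' \<cdot> h) s"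
  proof (rule flag3I[OF e D1(2)])
    show "cod f3 = dom (f1 \<cdot> f2)" using HomD(3)[OF H(1)] HomD(2)[OF Comp_Hom[OF H(2) f1]] by simp
    show "exact (f1 \<cdot> f2 \<cdot> f3) p'" using D2(4) Comp_assoc[OF H f1] by simp
    show "exact (h' \<cdot> h) s" by (rule D3(4))
    show "is_pushout C (f1 \<cdot> f2) g3 p' (h' \<cdot> h)" by (rule pushout_hpaste[OF D1(8) D2(8)])
  qed simp
qed

end

section \<open>The Hall tensor product\<close>

context hall
begin

abbreviation K where
  "K \<equiv> (Fun (S C z 1) :: ((('o, 'a) flag, ('o, 'a) flag_arr, 'v) vfct, _) cat)"

interpretation K: category K
  by (rule category_Fun)

section \<open>Functors on one-step flags, read at objects and isomorphisms of
  \<open>C\<close>\<close>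

abbreviation sp where
  "sp F X \<equiv> on_obj (F :: (('o, 'a) flag, ('o, 'a) flag_arr, 'v) vfct) (fl X)"

abbreviation el where
  "el F X \<equiv> carrier (sp F X)"

text \<open>The action of isomorphisms of \<open>C\<close> on elements. Together with
  \<open>sp\<close> it removes one-step flags from the later computations.\<close>

definition ac where
  "ac (F :: (('o, 'a) flag, ('o, 'a) flag_arr, 'v) vfct) f = app (on_arr F (flag1_arr C z f))"

definition cmp where
  "cmp (t :: (('o, 'a) flag, ('o, 'a) flag_arr, 'v) vntrans) X = app (snd (snd t) (fl X))"

context
  fixes F
  assumes F: "F \<in> Obj K"
begin

lemma fun_functor: "cat_functor (S C z 1) vect F"
  using F by (simp add: Obj_Fun)

lemma sp_vect: "X \<in> Obj C \<Longrightarrow> sp F X \<in> Obj vect"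
  by (rule cat_functorD(3)[OF fun_functor fl_Obj])

lemma on_arr_Hom: "f \<in> hom X Y \<Longrightarrow> iso f \<Longrightarrow> on_arr F (flag1_arr C z f) \<in> Hom vect (sp F X) (sp F Y)"
  by (rule cat_functorD(4)[OF fun_functor flag1_arr_Hom])

lemma ac_linear: "f \<in> hom X Y \<Longrightarrow> iso f \<Longrightarrow> linmap (sp F X) (sp F Y) (ac F f)"
  unfolding ac_def by (rule vect_HomD(3)[OF on_arr_Hom])

lemma ac_closed: "f \<in> hom X Y \<Longrightarrow> iso f \<Longrightarrow> v \<in> el F X \<Longrightarrow> ac F f v \<in> el F Y"
  by (rule linmap_closed[OF ac_linear])

lemma ac_comp:
  assumes f: "f \<in> hom X Y" "iso f" and g: "g \<in> hom Y W" "iso g" and v: "v \<in> el F X"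
  shows "ac F (g \<cdot> f) v = ac F g (ac F f v)"
  unfolding ac_def S1_comp[OF f(1) g(1), symmetric]
    cat_functor.pres_Comp[OF fun_functor flag1_arr_Hom[OF f] flag1_arr_Hom[OF g]] by (rule app_comp[OF on_arr_Hom[OF f] v])

lemma ac_Ident: "X \<in> Obj C \<Longrightarrow> v \<in> el F X \<Longrightarrow> ac F (Ident C X) v = v"
  unfolding ac_def S1_Ident[symmetric] cat_functor.pres_Ident[OF fun_functor fl_Obj] by (rule app_Ident)

lemma ac_inverse:
  assumes f: "f \<in> hom X Y" "iso f"
  shows "v \<in> el F X \<Longrightarrow> ac F (inverse_arr f) (ac F f v) = v"
    "v \<in> el F Y \<Longrightarrow> ac F f (ac F (inverse_arr f) v) = v"
  using ac_comp[OF f inverse_arr(1,4)[OF f], of v] ac_comp[OF inverse_arr(1,4)[OF f] f, of v]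
    ac_Ident[OF Hom_Obj(1)[OF f(1)], of v] ac_Ident[OF Hom_Obj(2)[OF f(1)], of v] inverse_arr(2,3)[OF f] by simp_all

end

lemma K_HomE:
  assumes "t \<in> Hom K F G"
  obtains \<eta> where "t = (F, G, \<eta>)" "nat_trans (S C z 1) vect F G \<eta>" "F \<in> Obj K" "G \<in> Obj K"
  using assms K.Hom_Obj[OF assms] unfolding Hom_Fun by blast

lemma cmp_Hom: "t \<in> Hom K F G \<Longrightarrow> X \<in> Obj C \<Longrightarrow> snd (snd t) (fl X) \<in> Hom vect (sp F X) (sp G X)"
  by (erule K_HomE) (use nat_transD(4) fl_Obj in fastforce)

lemma cmp_linear: "t \<in> Hom K F G \<Longrightarrow> X \<in> Obj C \<Longrightarrow> linmap (sp F X) (sp G X) (cmp t X)"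
  unfolding cmp_def by (rule vect_HomD(3)[OF cmp_Hom])

lemma cmp_closed: "t \<in> Hom K F G \<Longrightarrow> X \<in> Obj C \<Longrightarrow> v \<in> el F X \<Longrightarrow> cmp t X v \<in> el G X"
  by (rule linmap_closed[OF cmp_linear])

lemma cmp_comp:
  assumes t: "t \<in> Hom K F G" and s: "s \<in> Hom K G H" and X: "X \<in> Obj C" and v: "v \<in> el F X"
  shows "cmp (s \<cdot>\<^bsub>K\<^esub> t) X v = cmp s X (cmp t X v)"
proof -
  obtain \<eta> where e: "t = (F, G, \<eta>)" and n: "nat_trans (S C z 1) vect F G \<eta>" by (rule K_HomE[OF t])
  obtain \<theta> where e': "s = (G, H, \<theta>)" by (rule K_HomE[OF s])
  show ?thesis using app_comp[OF nat_transD(4)[OF n fl_Obj[OF X]] v] X by (simp add: e e' cmp_def Comp_Fun fl_Obj[unfolded One_nat_def])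
qed

lemma cmp_Ident: "F \<in> Obj K \<Longrightarrow> X \<in> Obj C \<Longrightarrow> v \<in> el F X \<Longrightarrow> cmp (Ident K F) X v = v"
  by (simp add: cmp_def Ident_Fun fl_Obj[unfolded One_nat_def])

text \<open>Components and linear maps are extensional, so arrows of \<open>K\<close> can be
  compared as functions on elements.\<close>

lemma K_eqI:
  assumes t: "t \<in> Hom K F G" and s: "s \<in> Hom K F G" and eq: "\<And>X v. X \<in> Obj C \<Longrightarrow> v \<in> el F X \<Longrightarrow> cmp t X v = cmp s X v"
  shows "t = s"
proof -
  obtain \<eta> where e: "t = (F, G, \<eta>)" and n: "nat_trans (S C z 1) vect F G \<eta>" by (rule K_HomE[OF t])
  obtain \<theta> where e': "s = (F, G, \<theta>)" and n': "nat_trans (S C z 1) vect F G \<theta>" by (rule K_HomE[OF s])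
  have "\<eta> = \<theta>"
  proof (rule extensionalityI[OF nat_transD(3)[OF n] nat_transD(3)[OF n']])
    fix A assume "A \<in> Obj (S C z 1)"
    then obtain X where X: "X \<in> Obj C" "A = fl X" unfolding S1_Obj by blast
    show "\<eta> A = \<theta> A" unfolding X(2)
      by (rule vect_eqI[OF nat_transD(4)[OF n fl_Obj[OF X(1)]] nat_transD(4)[OF n' fl_Obj[OF X(1)]]])
         (use eq[OF X(1)] in \<open>simp add: cmp_def e e'\<close>)
  qed
  then show ?thesis by (simp add: e e')
qed

text \<open>\<open>vertex A (0, 1)\<close> recovers \<open>X\<close> from \<open>fl X\<close>, so a
  family indexed by objects of \<open>C\<close> gives a component at every one-step flag.\<close>

definition mk_nt where
  "mk_nt F G h = (F :: (('o, 'a) flag, ('o, 'a) flag_arr, 'v) vfct, G :: (('o, 'a) flag, ('o, 'a) flag_arr, 'v) vfct,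
     \<lambda>A\<in>Obj (S C z 1). mk_lin (on_obj F A) (on_obj G A) (h (vertex A (0, 1))))"

lemma cmp_mk_nt: "X \<in> Obj C \<Longrightarrow> v \<in> el F X \<Longrightarrow> cmp (mk_nt F G h) X v = h X v"
  by (simp add: cmp_def mk_nt_def fl_Obj[unfolded One_nat_def])

lemma mk_nt_Hom:
  assumes O: "F \<in> Obj K" "G \<in> Obj K"
    and lin: "\<And>X. X \<in> Obj C \<Longrightarrow> linmap (sp F X) (sp G X) (h X)"
    and nat: "\<And>X Y f v. f \<in> hom X Y \<Longrightarrow> iso f \<Longrightarrow> v \<in> el F X \<Longrightarrow> h Y (ac F f v) = ac G f (h X v)"
  shows "mk_nt F G h \<in> Hom K F G"
proof -
  let ?\<eta> = "\<lambda>A\<in>Obj (S C z 1). mk_lin (on_obj F A) (on_obj G A) (h (vertex A (0, 1)))"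
  have e: "?\<eta> (fl X) = mk_lin (sp F X) (sp G X) (h X)" if "X \<in> Obj C" for X using fl_Obj[OF that] by simp
  have eH: "mk_lin (sp F X) (sp G X) (h X) \<in> Hom vect (sp F X) (sp G X)" if "X \<in> Obj C" for X
    by (rule mk_lin_Hom[OF sp_vect[OF O(1) that] sp_vect[OF O(2) that] lin[OF that]])
  have "nat_trans (S C z 1) vect F G ?\<eta>"
  proof (rule nat_transI[OF fun_functor[OF O(1)] fun_functor[OF O(2)]])
    fix A assume "A \<in> Obj (S C z 1)"
    then obtain X where X: "X \<in> Obj C" "A = fl X" unfolding S1_Obj by blast
    show "?\<eta> A \<in> Hom vect (on_obj F A) (on_obj G A)" unfolding X(2) e[OF X(1)] by (rule eH[OF X(1)])
  next
    fix t A B assume t: "t \<in> Hom (S C z 1) A B"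
    note AB = category.Hom_Obj[OF S_category t]
    then obtain X Y where e0: "A = fl X" "B = fl Y" "X \<in> Obj C" "Y \<in> Obj C" unfolding S1_Obj by blast
    obtain f where f: "f \<in> hom X Y" "iso f" "t = flag1_arr C z f" by (rule S1_HomE[OF t[unfolded e0]])
    note o1 = on_arr_Hom[OF O(1) f(1,2)] and o2 = on_arr_Hom[OF O(2) f(1,2)]
    show "?\<eta> B \<cdot>\<^sub>v on_arr F t = on_arr G t \<cdot>\<^sub>v ?\<eta> A"
      unfolding e0(1,2) e[OF e0(3)] e[OF e0(4)] f(3)
    proof (rule vect_eqI[OF vect.Comp_Hom[OF o1 eH[OF e0(4)]] vect.Comp_Hom[OF eH[OF e0(3)] o2]])
      fix v assume v: "v \<in> el F X"
      show "app (mk_lin (sp F Y) (sp G Y) (h Y) \<cdot>\<^sub>v on_arr F (flag1_arr C z f)) v =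
          app (on_arr G (flag1_arr C z f) \<cdot>\<^sub>v mk_lin (sp F X) (sp G X) (h X)) v"
        unfolding app_comp[OF o1 v] app_comp[OF eH[OF e0(3)] v]
        using nat[OF f(1,2) v] v ac_closed[OF O(1) f(1,2) v] by (simp add: ac_def)
    qed
  qed simp
  then show ?thesis using O by (simp add: Hom_Fun mk_nt_def Obj_Fun)
qed

lemma K_isoI:
  assumes t: "t \<in> Hom K F G" and s: "s \<in> Hom K G F"
    and 1: "\<And>X v. X \<in> Obj C \<Longrightarrow> v \<in> el F X \<Longrightarrow> cmp s X (cmp t X v) = v"
    and 2: "\<And>X v. X \<in> Obj C \<Longrightarrow> v \<in> el G X \<Longrightarrow> cmp t X (cmp s X v) = v"
  shows "iso_arr K t"
proof (rule K.isoI[OF t s])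
  note O = K.Hom_Obj[OF t]
  show "s \<cdot>\<^bsub>K\<^esub> t = Ident K F"
  proof (rule K_eqI[OF K.Comp_Hom[OF t s] K.Ident_Hom[OF O(1)]])
    fix X v assume X: "X \<in> Obj C" and v: "v \<in> el F X"
    show "cmp (s \<cdot>\<^bsub>K\<^esub> t) X v = cmp (Ident K F) X v" unfolding cmp_comp[OF t s X v] cmp_Ident[OF O(1) X v] by (rule 1[OF X v])
  qed
  show "t \<cdot>\<^bsub>K\<^esub> s = Ident K G"
  proof (rule K_eqI[OF K.Comp_Hom[OF s t] K.Ident_Hom[OF O(2)]])
    fix X v assume X: "X \<in> Obj C" and v: "v \<in> el G X"
    show "cmp (t \<cdot>\<^bsub>K\<^esub> s) X v = cmp (Ident K G) X v" unfolding cmp_comp[OF s t X v] cmp_Ident[OF O(2) X v] by (rule 2[OF X v])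
  qed
qed

section \<open>Symbols in the tensor product and their universal property\<close>

abbreviation T where
  "T F G \<equiv> on_obj (hall_tensor C z) (F, G :: (('o, 'a) flag, ('o, 'a) flag_arr, 'v) vfct)"

text \<open>The pullback along \<open>G_functor\<close> of the external product; the Kan extension
  of this functor along \<open>F_functor\<close> is the tensor product.\<close>

definition diag where
  "diag F G = fcomp (S C z 2) (box_fct (S C z 1) (S C z 1) F (G :: (('o, 'a) flag, ('o, 'a) flag_arr, 'v) vfct)) (G_functor C z)"

text \<open>\<open>inn F G f g x y\<close> is the image of \<open>x \<otimes> y\<close> in the colimit defining \<open>(F \<otimes> G) (cod f)\<close>; it is meaningful only
  if \<open>f\<close> and \<open>g\<close> form an exact sequence.\<close>

definition inn where
  "inn F G f g x y = app (F.kan_in (diag F G) (fl (cod f)) (flag2 f g, flag1_arr C z (Ident C (cod f))))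
     (tensor_vec (sp F (dom f)) (sp G (cod g)) x y)"

lemma T_Obj: "F \<in> Obj K \<Longrightarrow> G \<in> Obj K \<Longrightarrow> T F G \<in> Obj K"
  by (rule cat_functorD(3)[OF hall_tensor_functor]) simp

lemma flag1_fib: "(A, \<phi>) \<in> F.fib (fl X) \<Longrightarrow>
    \<exists>h. A \<in> flags C z 2 \<and> h \<in> hom (vertex A (0, 2)) X \<and> iso h \<and> \<phi> = flag1_arr C z h"
proof -
  assume "(A, \<phi>) \<in> F.fib (fl X)"
  then have A: "A \<in> flags C z 2" and p: "\<phi> \<in> Hom (S C z 1) (on_obj (F_functor C z) A) (fl X)" unfolding F.in_fib S_simps by blast+
  obtain h where "h \<in> hom (vertex A (0, 2)) X" "iso h" "\<phi> = flag1_arr C z h" by (rule S1_HomE[OF p[unfolded F_simps(1)[OF A]]])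
  with A show ?thesis by blast
qed

lemma fib_flag1:
  assumes "A \<in> flags C z 2" "h \<in> hom (vertex A (0, 2)) X" "iso h"
  shows "(A, flag1_arr C z h) \<in> F.fib (fl X)"
  unfolding F.in_fib S_simps(1) F_simps(1)[OF assms(1)] using assms(1) flag1_arr_Hom[OF assms(2,3)] by blast

context
  fixes F G
  assumes F: "F \<in> Obj K" and G: "G \<in> Obj K"
begin

lemma diag_Obj: "diag F G \<in> Obj (Fun (S C z 2))"
  unfolding diag_def by (rule fcomp_Obj_Fun[OF G_is_functor G_pi0_finite box_fct_Obj[OF F G]])

lemma T_eq: "T F G = kan_fct (S C z 2) (S C z 1) (F_functor C z) (diag F G)"
proof -
  have P: "(F, G) \<in> Obj (prod_cat K K)" using F G by simp
  show ?thesis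
    unfolding hall_tensor_def Let_def fcomp_simps(1)[OF P] box_simps(1)[OF F G]
    using F.push_simps(1)[OF diag_Obj] box_fct_Obj[OF F G] by (simp add: pull_def diag_def)
qed

lemma diag_obj: "A \<in> flags C z 2 \<Longrightarrow> on_obj (diag F G) A = tensor_obj (sp F (vertex A (0, 1))) (sp G (vertex A (1, 2)))"
  unfolding diag_def by (subst fcomp_simps(1)) (simp_all add: S_simps(1) G_simps(1) box_fct_simps fl_Obj[unfolded One_nat_def S_simps(1)] flags_vertex)

lemma diag_arr:
  assumes "(A, B, u) \<in> Hom (S C z 2) A B"
  shows "on_arr (diag F G) (A, B, u) = tensor_arr (on_arr F (flag1_arr C z (u (0, 1)))) (on_arr G (flag1_arr C z (u (1, 2))))"
  unfolding diag_def fcomp_simps(2)[OF assms] G_simps(2)[OF assms]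
  using HomD(1)[OF flag1_arr_Hom[OF S2_HomD(1,2)[OF assms]]] HomD(1)[OF flag1_arr_Hom[OF S2_HomD(5,6)[OF assms]]]
  by (rule box_fct_simps(2))

lemma sp_T: "X \<in> Obj C \<Longrightarrow> sp (T F G) X = F.kan_obj (diag F G) (fl X)"
  unfolding T_eq by (rule F.kan_fct_obj[OF fl_Obj])

context
  fixes f g
  assumes e: "exact f g"
begin

lemma flag2_fib: "(flag2 f g, flag1_arr C z (Ident C (cod f))) \<in> F.fib (fl (cod f))"
  using Ident_Hom[OF exact_Obj(2)[OF e]] iso_Ident[OF exact_Obj(2)[OF e]] by (intro fib_flag1[OF flag2_flags[OF e]]) simp_all

lemma inn_Hom: "F.kan_in (diag F G) (fl (cod f)) (flag2 f g, flag1_arr C z (Ident C (cod f))) \<in>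
   Hom vect (tensor_obj (sp F (dom f)) (sp G (cod g))) (sp (T F G) (cod f))"
  using F.kan_in_Hom[OF diag_Obj fl_Obj[OF exact_Obj(2)[OF e]] flag2_fib]
  unfolding diag_obj[OF flag2_flags[OF e]] sp_T[OF exact_Obj(2)[OF e]] by simp

lemma inn_linear_left: "y \<in> el G (cod g) \<Longrightarrow> linmap (sp F (dom f)) (sp (T F G) (cod f)) (\<lambda>x. inn F G f g x y)"
  unfolding inn_def
  by (rule linmap_comp[OF tensor_vec_linear_left[OF sp_vect[OF F exact_Obj(1)[OF e]] sp_vect[OF G exact_Obj(3)[OF e]]] vect_HomD(3)[OF inn_Hom]])

lemma inn_linear_right: "x \<in> el F (dom f) \<Longrightarrow> linmap (sp G (cod g)) (sp (T F G) (cod f)) (inn F G f g x)"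
  unfolding inn_def
  by (rule linmap_comp[OF tensor_vec_linear_right[OF sp_vect[OF F exact_Obj(1)[OF e]] sp_vect[OF G exact_Obj(3)[OF e]]] vect_HomD(3)[OF inn_Hom]])

lemma inn_closed: "x \<in> el F (dom f) \<Longrightarrow> y \<in> el G (cod g) \<Longrightarrow> inn F G f g x y \<in> el (T F G) (cod f)"
  by (rule linmap_closed[OF inn_linear_right])

end

text \<open>Normal form of a fiber object: a sequence \<open>A\<close> with an isomorphism
  \<open>h\<close> from its middle term to \<open>X\<close> is isomorphic, in the fiber, to a
  sequence with middle term exactly \<open>X\<close> and the identity of \<open>X\<close>. Hence the
  symbols \<open>inn\<close> account for all legs of the colimit.\<close>

lemma kan_in_inn:
  assumes A: "A \<in> flags C z 2" and h: "h \<in> hom (vertex A (0, 2)) X" "iso h"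
    and x: "x \<in> el F (vertex A (0, 1))" and y: "y \<in> el G (vertex A (1, 2))"
  shows "exact (h \<cdot> hor A (0, 1)) (ver A (0, 2) \<cdot> inverse_arr h)"
    and "app (F.kan_in (diag F G) (fl X) (A, flag1_arr C z h)) (tensor_vec (sp F (vertex A (0, 1))) (sp G (vertex A (1, 2))) x y) =
      inn F G (h \<cdot> hor A (0, 1)) (ver A (0, 2) \<cdot> inverse_arr h) x y"
proof -
  note e = flags2_exact[OF A] and i = inverse_arr[OF h]
  let ?f = "h \<cdot> hor A (0, 1)" and ?g = "ver A (0, 2) \<cdot> inverse_arr h"
  show ex: "exact ?f ?g"
    by (rule exact_iso_middle[OF e(1)]) (use h i HomD[OF e(2)] in simp_all)
  have f: "?f \<in> hom (vertex A (0, 1)) X" and g: "?g \<in> hom X (vertex A (1, 2))" by (rule Comp_Hom[OF e(2) h(1)] Comp_Hom[OF i(1) e(3)])+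
  have o: "vertex A (0, 1) \<in> Obj C" "X \<in> Obj C" "vertex A (1, 2) \<in> Obj C" using Hom_Obj[OF f] Hom_Obj[OF g] by simp_all
  \<comment> \<open>The arrow of the fiber has components identity, \<open>h\<close> and
    identity.\<close>
  obtain u where u: "(A, flag2 ?f ?g, u) \<in> Hom (S C z 2) A (flag2 ?f ?g)" "u (0, 1) = Ident C (vertex A (0, 1))" "u (0, 2) = h" "u (1, 2) = Ident C (vertex A (1, 2))"
  proof (rule S2_Hom[OF A flag2_flags[OF ex], of "Ident C (vertex A (0, 1))" h "Ident C (vertex A (1, 2))"])
    show "Ident C (vertex A (0, 1)) \<in> hom (vertex A (0, 1)) (vertex (flag2 ?f ?g) (0, 1))" using Ident_Hom[OF o(1)] HomD[OF f] by simp
    show "Ident C (vertex A (1, 2)) \<in> hom (vertex A (1, 2)) (vertex (flag2 ?f ?g) (1, 2))" using Ident_Hom[OF o(3)] HomD[OF g] by simp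
    show "h \<in> hom (vertex A (0, 2)) (vertex (flag2 ?f ?g) (0, 2))" using h(1) HomD[OF f] by simp
    show "hor (flag2 ?f ?g) (0, 1) \<cdot> Ident C (vertex A (0, 1)) = h \<cdot> hor A (0, 1)" using Ident_right[OF f] by simp
    show "ver (flag2 ?f ?g) (0, 2) \<cdot> h = Ident C (vertex A (1, 2)) \<cdot> ver A (0, 2)"
      using Comp_assoc[OF h(1) i(1) e(3)] i(2) Ident_right[OF e(3)] Ident_left[OF e(3)] by simp
  qed (use h(2) iso_Ident[OF o(1)] iso_Ident[OF o(3)] in blast)+
  have X: "cod ?f = X" "dom ?f = vertex A (0, 1)" "cod ?g = vertex A (1, 2)" by (rule HomD[OF f] HomD[OF g])+
  note p1 = fib_flag1[OF A h] and p2 = flag2_fib[OF ex, unfolded X]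
  have "flag1_arr C z (Ident C X) \<cdot>\<^bsub>S C z 1\<^esub> on_arr (F_functor C z) (A, flag2 ?f ?g, u) = flag1_arr C z h"
    unfolding F_simps(2)[OF u(1)] u(3) S1_comp[OF h(1) Ident_Hom[OF o(2)]] Ident_left[OF h(1)] ..
  note n = F.kan_in_natural[OF diag_Obj fl_Obj[OF o(2)] u(1) p1 p2 this, symmetric]
  note V = sp_vect[OF F o(1)] sp_vect[OF G o(3)]
  note i1 = Ident_Hom[OF o(1)] iso_Ident[OF o(1)] and i3 = Ident_Hom[OF o(3)] iso_Ident[OF o(3)]
  have da: "on_arr (diag F G) (A, flag2 ?f ?g, u) = Ident vect (tensor_obj (sp F (vertex A (0, 1))) (sp G (vertex A (1, 2))))"
    unfolding diag_arr[OF u(1)] u(2,4) S1_Ident[OF o(1), symmetric] S1_Ident[OF o(3), symmetric]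
      cat_functor.pres_Ident[OF fun_functor[OF F] fl_Obj[OF o(1)]] cat_functor.pres_Ident[OF fun_functor[OF G] fl_Obj[OF o(3)]]
    by (rule tensor_arr_Ident[OF V])
  note tv = tensor_vec_closed[OF V x y]
  show "app (F.kan_in (diag F G) (fl X) (A, flag1_arr C z h)) (tensor_vec (sp F (vertex A (0, 1))) (sp G (vertex A (1, 2))) x y) = inn F G ?f ?g x y"
    unfolding inn_def X n da app_comp[OF vect.Ident_Hom[OF tensor_obj_vect[OF V]] tv] app_Ident[OF tv] ..
qed

text \<open>\<open>kan_fct\<close> composes the fiber arrow with \<open>h\<close>;
  \<open>kan_in_inn\<close> brings the result back to normal form.\<close>

lemma inn_action:
  assumes e: "exact f g" and h: "h \<in> hom (cod f) X" "iso h"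
    and x: "x \<in> el F (dom f)" and y: "y \<in> el G (cod g)"
  shows "ac (T F G) h (inn F G f g x y) = inn F G (h \<cdot> f) (g \<cdot> inverse_arr h) x y"
proof -
  note o = exact_Obj[OF e] and p = flag2_fib[OF e]
  note V = sp_vect[OF F o(1)] sp_vect[OF G o(3)]
  note tv = tensor_vec_closed[OF V x y]
  have h': "h \<in> hom (vertex (flag2 f g) (0, 2)) X" using h(1) by simp
  have "on_arr (T F G) (flag1_arr C z h) \<cdot>\<^sub>v F.kan_in (diag F G) (fl (cod f)) (flag2 f g, flag1_arr C z (Ident C (cod f))) =
     F.kan_in (diag F G) (fl X) (flag2 f g, flag1_arr C z h)"
    unfolding T_eq F.kan_fct_arr(2)[OF diag_Obj flag1_arr_Hom[OF h] p] S1_comp[OF Ident_Hom[OF o(2)] h(1)] Ident_right[OF h(1)] ..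
  then have "ac (T F G) h (inn F G f g x y) = app (F.kan_in (diag F G) (fl X) (flag2 f g, flag1_arr C z h)) (tensor_vec (sp F (dom f)) (sp G (cod g)) x y)"
    unfolding ac_def inn_def app_comp[OF inn_Hom[OF e] tv, symmetric] by simp
  then show ?thesis using kan_in_inn(2)[OF flag2_flags[OF e] h' h(2), of x y] x y by simp
qed

text \<open>Naturality of the legs along the arrow of sequences with components \<open>a\<close>,
  identity and \<open>c\<close>. Putting \<open>a\<close> on one side and \<open>c\<close> on the
  other keeps inverses out of the relation.\<close>

lemma inn_shift:
  assumes e: "exact f g" and a: "a \<in> hom A (dom f)" "iso a" and c: "c \<in> hom (cod g) D" "iso c"
    and x: "x \<in> el F A" and y: "y \<in> el G (cod g)"
  shows "inn F G (f \<cdot> a) g x y = inn F G f (c \<cdot> g) (ac F a x) (ac G c y)"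
proof -
  note o = exact_Obj[OF e] and H = exact_Hom[OF e]
  note e1 = exact_iso_left[OF e a] and e2 = exact_iso_right[OF e c]
  note H1 = HomD[OF Comp_Hom[OF a(1) H(1)]] and H2 = HomD[OF Comp_Hom[OF H(2) c(1)]]
  obtain u where u: "(flag2 (f \<cdot> a) g, flag2 f (c \<cdot> g), u) \<in> Hom (S C z 2) (flag2 (f \<cdot> a) g) (flag2 f (c \<cdot> g))"
     "u (0, 1) = a" "u (0, 2) = Ident C (cod f)" "u (1, 2) = c"
    by (rule S2_Hom[OF flag2_flags[OF e1] flag2_flags[OF e2], of a "Ident C (cod f)" c])
       (use a c H1 H2 Ident_Hom[OF o(2)] iso_Ident[OF o(2)] Ident_left[OF Comp_Hom[OF a(1) H(1)]] Ident_right[OF Comp_Hom[OF H(2) c(1)]] in simp_all)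
  note p1 = flag2_fib[OF e1, unfolded H1] and p2 = flag2_fib[OF e2]
  have "flag1_arr C z (Ident C (cod f)) \<cdot>\<^bsub>S C z 1\<^esub> on_arr (F_functor C z) (flag2 (f \<cdot> a) g, flag2 f (c \<cdot> g), u) = flag1_arr C z (Ident C (cod f))"
    unfolding F_simps(2)[OF u(1)] u(3) S1_comp[OF Ident_Hom[OF o(2)] Ident_Hom[OF o(2)]] Ident_left[OF Ident_Hom[OF o(2)]] ..
  note n = F.kan_in_natural[OF diag_Obj fl_Obj[OF o(2)] u(1) p1 p2 this]
  have V: "sp F A \<in> Obj vect" "sp G (cod g) \<in> Obj vect" by (rule sp_vect[OF F Hom_Obj(1)[OF a(1)]] sp_vect[OF G o(3)])+
  note tv = tensor_vec_closed[OF V x y]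
  have da: "on_arr (diag F G) (flag2 (f \<cdot> a) g, flag2 f (c \<cdot> g), u) = tensor_arr (on_arr F (flag1_arr C z a)) (on_arr G (flag1_arr C z c))"
    unfolding diag_arr[OF u(1)] u(2,4) ..
  note oa = on_arr_Hom[OF F a] and oc = on_arr_Hom[OF G c]
  show ?thesis
    unfolding inn_def H1 H2 n[symmetric] da app_comp[OF tensor_arr_Hom[OF oa oc] tv] app_tensor_arr[OF oa oc x y]
    by (simp add: ac_def)
qed

text \<open>The data for a linear map out of the tensor product at \<open>X\<close>: a bilinear map
  for every exact sequence through \<open>X\<close>, subject to the relation satisfied by
  \<open>inn\<close> in \<open>inn_shift\<close>.\<close>

definition hall_family where
  "hall_family X (U :: 'v vspace) \<beta> \<longleftrightarrow> U \<in> Obj vect \<and>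
     (\<forall>f g. exact f g \<and> cod f = X \<longrightarrow> bilinear_map (sp F (dom f)) (sp G (cod g)) U (\<beta> f g)) \<and>
     (\<forall>f g a c A D x y. exact f g \<and> cod f = X \<and> a \<in> hom A (dom f) \<and> iso a \<and> c \<in> hom (cod g) D \<and> iso c \<and>
       x \<in> el F A \<and> y \<in> el G (cod g) \<longrightarrow>
       \<beta> (f \<cdot> a) g x y = \<beta> f (c \<cdot> g) (ac F a x) (ac G c y))"

text \<open>A family given on sequences with middle term exactly \<open>X\<close> is extended to all
  fiber objects by the normal form of \<open>kan_in_inn\<close>; the balancing condition is what
  makes the result a cocone.\<close>

lemma inn_universal:
  assumes X: "X \<in> Obj C" and fam: "hall_family X U \<beta>"
  obtains m where "linmap (sp (T F G) X) U m"
    "\<And>f g x y. exact f g \<Longrightarrow> cod f = X \<Longrightarrow> x \<in> el F (dom f) \<Longrightarrow> y \<in> el G (cod g) \<Longrightarrow> m (inn F G f g x y) = \<beta> f g x y"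
proof -
  have U: "U \<in> Obj vect"
    and bil: "\<And>f g. exact f g \<Longrightarrow> cod f = X \<Longrightarrow> bilinear_map (sp F (dom f)) (sp G (cod g)) U (\<beta> f g)"
    and sh: "\<And>f g a c A D x y. exact f g \<Longrightarrow> cod f = X \<Longrightarrow> a \<in> hom A (dom f) \<Longrightarrow> iso a \<Longrightarrow> c \<in> hom (cod g) D \<Longrightarrow> iso c \<Longrightarrow>
       x \<in> el F A \<Longrightarrow> y \<in> el G (cod g) \<Longrightarrow> \<beta> (f \<cdot> a) g x y = \<beta> f (c \<cdot> g) (ac F a x) (ac G c y)"
    using fam unfolding hall_family_def by blast+
  \<comment> \<open>The leg at the fiber object \<open>(A, h)\<close> is prescribed on pure tensors
    by the value of \<beta> at the normal form.\<close>
  define P where "P A h m \<longleftrightarrow> m \<in> Hom vect (tensor_obj (sp F (vertex A (0, 1))) (sp G (vertex A (1, 2)))) U \<and>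
     (\<forall>x \<in> el F (vertex A (0, 1)). \<forall>y \<in> el G (vertex A (1, 2)).
        app m (tensor_vec (sp F (vertex A (0, 1))) (sp G (vertex A (1, 2))) x y) = \<beta> (h \<cdot> hor A (0, 1)) (ver A (0, 2) \<cdot> inverse_arr h) x y)" for A :: "('o, 'a) flag" and h m
  have V: "sp F (vertex A (0, 1)) \<in> Obj vect" "sp G (vertex A (1, 2)) \<in> Obj vect" if "A \<in> flags C z 2" for A
    by (rule sp_vect[OF F] sp_vect[OF G]; rule flags_vertex[OF that]; simp)+
  have exP: "\<exists>m. P A h m" if A: "A \<in> flags C z 2" and h: "h \<in> hom (vertex A (0, 2)) X" "iso h" for A h
  proof -
    note fe = flags2_exact[OF A] and i = inverse_arr[OF h]
    have e: "exact (h \<cdot> hor A (0, 1)) (ver A (0, 2) \<cdot> inverse_arr h)"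
      by (rule exact_iso_middle[OF fe(1)]) (use h i HomD[OF fe(2)] in simp_all)
    have b: "bilinear_map (sp F (vertex A (0, 1))) (sp G (vertex A (1, 2))) U (\<beta> (h \<cdot> hor A (0, 1)) (ver A (0, 2) \<cdot> inverse_arr h))"
      using bil[OF e] HomD[OF Comp_Hom[OF fe(2) h(1)]] HomD[OF Comp_Hom[OF i(1) fe(3)]] by simp
    show ?thesis using tensor_universal[OF V[OF A] U b] unfolding P_def by metis
  qed
  define \<mu>0 where "\<mu>0 A h = (SOME m. P A h m)" for A h
  have \<mu>0: "P A h (\<mu>0 A h)" if "A \<in> flags C z 2" "h \<in> hom (vertex A (0, 2)) X" "iso h" for A h
    unfolding \<mu>0_def by (rule someI_ex[OF exP[OF that]])
  \<comment> \<open>A fiber object carries an arrow of \<open>S C z 1\<close>; its component at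
    \<open>(0, 1)\<close> is the isomorphism \<open>h\<close> of \<open>C\<close>.\<close>
  define \<mu> where "\<mu> A \<phi> = \<mu>0 A (snd (snd \<phi>) (0, 1))" for A :: "('o, 'a) flag" and \<phi> :: "('o, 'a) flag_arr"
  have \<mu>: "\<mu> A (flag1_arr C z h) = \<mu>0 A h" for A h by (simp add: \<mu>_def flag1_arr_def)
  have "\<exists>!m. m \<in> Hom vect (F.kan_obj (diag F G) (fl X)) U \<and>
     (\<forall>(A, \<phi>) \<in> F.fib (fl X). m \<cdot>\<^sub>v F.kan_in (diag F G) (fl X) (A, \<phi>) = \<mu> A \<phi>)"
  proof (rule F.kan_universal[OF diag_Obj fl_Obj[OF X] U])
    fix A \<phi> assume "(A, \<phi>) \<in> F.fib (fl X)"
    from flag1_fib[OF this] obtain h where h: "A \<in> flags C z 2" "h \<in> hom (vertex A (0, 2)) X" "iso h" "\<phi> = flag1_arr C z h" by blast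
    show "\<mu> A \<phi> \<in> Hom vect (on_obj (diag F G) A) U" using \<mu>0[OF h(1-3)] unfolding h(4) \<mu> diag_obj[OF h(1)] P_def by blast
  next
    fix t A A' \<phi> \<phi>'
    assume t: "t \<in> Hom (S C z 2) A A'" and p: "(A, \<phi>) \<in> F.fib (fl X)" "(A', \<phi>') \<in> F.fib (fl X)" and eq: "\<phi>' \<cdot>\<^bsub>S C z 1\<^esub> on_arr (F_functor C z) t = \<phi>"
    obtain h where h: "A \<in> flags C z 2" "h \<in> hom (vertex A (0, 2)) X" "iso h" "\<phi> = flag1_arr C z h" using flag1_fib[OF p(1)] by blast
    obtain h' where h': "A' \<in> flags C z 2" "h' \<in> hom (vertex A' (0, 2)) X" "iso h'" "\<phi>' = flag1_arr C z h'" using flag1_fib[OF p(2)] by blast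
    obtain u where u: "t = (A, A', u)" using t unfolding S_Hom by blast
    note t' = t[unfolded u] and d = S2_HomD[OF t[unfolded u]]
    have hu: "h' \<cdot> u (0, 2) = h"
      using eq unfolding u F_simps(2)[OF t'] h(4) h'(4) S1_comp[OF d(3) h'(2)] by (rule flag1_arr_inj[OF Comp_Hom[OF d(3) h'(2)]])
    note fe = flags2_exact[OF h(1)] and fe' = flags2_exact[OF h'(1)]
    note i = inverse_arr[OF h(2,3)] and i' = inverse_arr[OF h'(2,3)]
    let ?f' = "h' \<cdot> hor A' (0, 1)" and ?g = "ver A (0, 2) \<cdot> inverse_arr h" and ?g' = "ver A' (0, 2) \<cdot> inverse_arr h'"
    have f': "?f' \<in> hom (vertex A' (0, 1)) X" and g: "?g \<in> hom X (vertex A (1, 2))" and g': "?g' \<in> hom X (vertex A' (1, 2))"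
      by (rule Comp_Hom[OF fe'(2) h'(2)] Comp_Hom[OF i(1) fe(3)] Comp_Hom[OF i'(1) fe'(3)])+
    have e': "exact ?f' ?g'" by (rule exact_iso_middle[OF fe'(1)]) (use h' i' HomD[OF fe'(2)] in simp_all)
    have f: "?f' \<cdot> u (0, 1) = h \<cdot> hor A (0, 1)"
      using Comp_assoc[OF d(1) fe'(2) h'(2)] d(7) Comp_assoc[OF fe(2) d(3) h'(2)] hu by simp
    have "u (1, 2) \<cdot> ?g = ver A' (0, 2) \<cdot> (u (0, 2) \<cdot> inverse_arr h)"
      using Comp_assoc[OF i(1) fe(3) d(5)] d(8) Comp_assoc[OF i(1) d(3) fe'(3)] by simp
    also have "u (0, 2) \<cdot> inverse_arr h = inverse_arr h'"
    proof -
      have "inverse_arr h' = inverse_arr h' \<cdot> (h' \<cdot> u (0, 2) \<cdot> inverse_arr h)" using hu i(3) Ident_right[OF i'(1)] by simp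
      also have "\<dots> = inverse_arr h' \<cdot> h' \<cdot> (u (0, 2) \<cdot> inverse_arr h)"
        using Comp_assoc[OF i(1) d(3) h'(2)] Comp_assoc[OF Comp_Hom[OF i(1) d(3)] h'(2) i'(1)] by simp
      also have "\<dots> = u (0, 2) \<cdot> inverse_arr h" using i'(2) Ident_left[OF Comp_Hom[OF i(1) d(3)]] by simp
      finally show ?thesis ..
    qed
    finally have gg: "u (1, 2) \<cdot> ?g = ?g'" .
    \<comment> \<open>The balancing relation is applied to a mixed sequence, with subobject taken
      from \<open>A'\<close> and quotient from \<open>A\<close>; its exactness is obtained
      next.\<close>
    note j = inverse_arr[OF d(5,6)]
    have "inverse_arr (u (1, 2)) \<cdot> ?g' = ?g" unfolding gg[symmetric] using Comp_assoc[OF g d(5) j(1)] j(2) Ident_left[OF g] by simp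
    moreover have "exact ?f' (inverse_arr (u (1, 2)) \<cdot> ?g')" using exact_iso_right[OF e'] j(1,4) HomD(3)[OF g'] by simp
    ultimately have e: "exact ?f' ?g" by simp
    note oa = on_arr_Hom[OF F d(1,2)] and oc = on_arr_Hom[OF G d(5,6)]
    have m: "P A h (\<mu>0 A h)" "P A' h' (\<mu>0 A' h')" by (rule \<mu>0[OF h(1-3)] \<mu>0[OF h'(1-3)])+
    then have mH: "\<mu>0 A h \<in> Hom vect (tensor_obj (sp F (vertex A (0, 1))) (sp G (vertex A (1, 2)))) U"
      "\<mu>0 A' h' \<in> Hom vect (tensor_obj (sp F (vertex A' (0, 1))) (sp G (vertex A' (1, 2)))) U" unfolding P_def by blast+
    show "\<mu> A' \<phi>' \<cdot>\<^sub>v on_arr (diag F G) t = \<mu> A \<phi>"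
      unfolding h(4) h'(4) \<mu> u diag_arr[OF t']
    proof (rule tensor_ext[OF V[OF h(1)] vect.Comp_Hom[OF tensor_arr_Hom[OF oa oc] mH(2)] mH(1)])
      fix x y assume x: "x \<in> el F (vertex A (0, 1))" and y: "y \<in> el G (vertex A (1, 2))"
      note cl = vect_app_closed[OF oa x] vect_app_closed[OF oc y]
      have 1: "\<beta> (?f' \<cdot> u (0, 1)) ?g x y = \<beta> ?f' (u (1, 2) \<cdot> ?g) (ac F (u (0, 1)) x) (ac G (u (1, 2)) y)"
        by (rule sh[OF e]) (use x y d HomD[OF f'] HomD[OF g] in simp_all)
      have 2: "app (\<mu>0 A' h') (tensor_vec (sp F (vertex A' (0, 1))) (sp G (vertex A' (1, 2))) (app (on_arr F (flag1_arr C z (u (0, 1)))) x) (app (on_arr G (flag1_arr C z (u (1, 2)))) y)) =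
         \<beta> ?f' ?g' (app (on_arr F (flag1_arr C z (u (0, 1)))) x) (app (on_arr G (flag1_arr C z (u (1, 2)))) y)"
        using m(2) cl unfolding P_def by blast
      have 3: "app (\<mu>0 A h) (tensor_vec (sp F (vertex A (0, 1))) (sp G (vertex A (1, 2))) x y) = \<beta> (h \<cdot> hor A (0, 1)) ?g x y"
        using m(1) x y unfolding P_def by blast
      show "app (\<mu>0 A' h' \<cdot>\<^sub>v tensor_arr (on_arr F (flag1_arr C z (u (0, 1)))) (on_arr G (flag1_arr C z (u (1, 2)))))
          (tensor_vec (sp F (vertex A (0, 1))) (sp G (vertex A (1, 2))) x y) = app (\<mu>0 A h) (tensor_vec (sp F (vertex A (0, 1))) (sp G (vertex A (1, 2))) x y)"
        unfolding app_comp[OF tensor_arr_Hom[OF oa oc] tensor_vec_closed[OF V[OF h(1)] x y]] app_tensor_arr[OF oa oc x y] 2 3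
        using 1 unfolding f gg by (simp add: ac_def)
    qed
  qed
  then obtain m where m: "m \<in> Hom vect (F.kan_obj (diag F G) (fl X)) U"
    "\<And>A \<phi>. (A, \<phi>) \<in> F.fib (fl X) \<Longrightarrow> m \<cdot>\<^sub>v F.kan_in (diag F G) (fl X) (A, \<phi>) = \<mu> A \<phi>" by blast
  show thesis
  proof (rule that[of "app m"])
    show "linmap (sp (T F G) X) U (app m)" unfolding sp_T[OF X] by (rule vect_HomD(3)[OF m(1)])
    fix f g x y assume e: "exact f g" and c: "cod f = X" and x: "x \<in> el F (dom f)" and y: "y \<in> el G (cod g)"
    note o = exact_Obj[OF e, unfolded c] and p = flag2_fib[OF e, unfolded c]
    note tv = tensor_vec_closed[OF sp_vect[OF F o(1)] sp_vect[OF G o(3)] x y]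
    have iX: "Ident C X \<in> hom (vertex (flag2 f g) (0, 2)) X" using Ident_Hom[OF o(2)] c by simp
    have "app m (inn F G f g x y) = app (m \<cdot>\<^sub>v F.kan_in (diag F G) (fl X) (flag2 f g, flag1_arr C z (Ident C X))) (tensor_vec (sp F (dom f)) (sp G (cod g)) x y)"
      unfolding inn_def c app_comp[OF inn_Hom[OF e, unfolded c] tv] ..
    also have "\<dots> = app (\<mu>0 (flag2 f g) (Ident C X)) (tensor_vec (sp F (dom f)) (sp G (cod g)) x y)"
      unfolding m(2)[OF p] \<mu> ..
    also have "\<dots> = \<beta> (Ident C X \<cdot> f) (g \<cdot> inverse_arr (Ident C X)) x y"
      using \<mu>0[OF flag2_flags[OF e] iX iso_Ident[OF o(2)]] x y unfolding P_def by simp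
    finally show "app m (inn F G f g x y) = \<beta> f g x y"
      using Ident_left[of f "dom f" X] Ident_right[of g X "cod g"] exact_Hom[OF e] c inverse_arr_Ident[OF o(2)] by simp
  qed
qed

text \<open>Legs generate the colimit, pure tensors generate the source of each leg, and
  \<open>kan_in_inn\<close> identifies their images with symbols.\<close>

lemma inn_ext:
  fixes U :: "'v vspace"
  assumes X: "X \<in> Obj C" and U: "U \<in> Obj vect" and m: "linmap (sp (T F G) X) U m" and n: "linmap (sp (T F G) X) U n"
    and eq: "\<And>f g x y. exact f g \<Longrightarrow> cod f = X \<Longrightarrow> x \<in> el F (dom f) \<Longrightarrow> y \<in> el G (cod g) \<Longrightarrow>
       m (inn F G f g x y) = n (inn F G f g x y)"
    and v: "v \<in> el (T F G) X"
  shows "m v = n v"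
proof -
  let ?T = "sp (T F G) X"
  have TV: "?T \<in> Obj vect" by (rule sp_vect[OF T_Obj[OF F G] X])
  have "mk_lin ?T U m = mk_lin ?T U n"
  proof (rule F.kan_ext[OF diag_Obj fl_Obj[OF X]])
    show mH: "mk_lin ?T U m \<in> Hom vect (F.kan_obj (diag F G) (fl X)) U" using mk_lin_Hom[OF TV U m] unfolding sp_T[OF X] .
    show nH: "mk_lin ?T U n \<in> Hom vect (F.kan_obj (diag F G) (fl X)) U" using mk_lin_Hom[OF TV U n] unfolding sp_T[OF X] .
    fix A \<phi> assume p: "(A, \<phi>) \<in> F.fib (fl X)"
    then obtain h where h: "A \<in> flags C z 2" "h \<in> hom (vertex A (0, 2)) X" "iso h" "\<phi> = flag1_arr C z h" using flag1_fib by blast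
    note k = F.kan_in_Hom[OF diag_Obj fl_Obj[OF X] p, unfolded diag_obj[OF h(1)]]
    have V: "sp F (vertex A (0, 1)) \<in> Obj vect" "sp G (vertex A (1, 2)) \<in> Obj vect"
      by (rule sp_vect[OF F] sp_vect[OF G]; rule flags_vertex[OF h(1)]; simp)+
    show "mk_lin ?T U m \<cdot>\<^sub>v F.kan_in (diag F G) (fl X) (A, \<phi>) = mk_lin ?T U n \<cdot>\<^sub>v F.kan_in (diag F G) (fl X) (A, \<phi>)"
    proof (rule tensor_ext[OF V vect.Comp_Hom[OF k mH] vect.Comp_Hom[OF k nH]])
      fix x y assume x: "x \<in> el F (vertex A (0, 1))" and y: "y \<in> el G (vertex A (1, 2))"
      note tv = tensor_vec_closed[OF V x y] and ki = kan_in_inn[OF h(1-3) x y]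
      note fe = flags2_exact[OF h(1)]
      note dF = HomD[OF Comp_Hom[OF fe(2) h(2)]] and dG = HomD[OF Comp_Hom[OF inverse_arr(1)[OF h(2,3)] fe(3)]]
      have "inn F G (h \<cdot> hor A (0, 1)) (ver A (0, 2) \<cdot> inverse_arr h) x y \<in> carrier ?T"
        using inn_closed[OF ki(1)] dF dG x y by simp
      then show "app (mk_lin ?T U m \<cdot>\<^sub>v F.kan_in (diag F G) (fl X) (A, \<phi>)) (tensor_vec (sp F (vertex A (0, 1))) (sp G (vertex A (1, 2))) x y) =
        app (mk_lin ?T U n \<cdot>\<^sub>v F.kan_in (diag F G) (fl X) (A, \<phi>)) (tensor_vec (sp F (vertex A (0, 1))) (sp G (vertex A (1, 2))) x y)"
        unfolding app_comp[OF k tv] unfolding h(4) ki(2) using eq[OF ki(1)] dF dG x y by simp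
    qed
  qed
  then have "app (mk_lin ?T U m) v = app (mk_lin ?T U n) v" by simp
  then show ?thesis using v by simp
qed

text \<open>Later the maps \<open>M w\<close> are picked separately for each \<open>w\<close>, so
  their dependence on \<open>w\<close> is not visibly linear. Both sides of additivity and
  homogeneity are linear in \<open>u\<close>, hence it suffices to compare them on symbols.\<close>

lemma inn_pointwise_linear:
  fixes U V :: "'v vspace"
  assumes X: "X \<in> Obj C" and V: "V \<in> Obj vect" and U: "U \<in> Obj vect"
    and M: "\<And>w. w \<in> carrier V \<Longrightarrow> linmap (sp (T F G) X) U (M w)"
    and gen: "\<And>f g x y. exact f g \<Longrightarrow> cod f = X \<Longrightarrow> x \<in> el F (dom f) \<Longrightarrow> y \<in> el G (cod g) \<Longrightarrow>
       linmap V U (\<lambda>w. M w (inn F G f g x y))"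
    and u: "u \<in> el (T F G) X"
  shows "linmap V U (\<lambda>w. M w u)"
proof (rule linmapI)
  fix w assume w: "w \<in> carrier V"
  show "M w u \<in> carrier U" by (rule linmap_closed[OF M[OF w] u])
next
  fix v w assume w: "v \<in> carrier V" "w \<in> carrier V"
  show "M (v \<oplus>\<^bsub>V\<^esub> w) u = M v u \<oplus>\<^bsub>U\<^esub> M w u"
    by (rule inn_ext[OF X U M[OF vs_add[OF V w]] linmap_sum[OF U M[OF w(1)] M[OF w(2)]] linmap_add[OF gen w] u])
next
  fix c w assume w: "w \<in> carrier V"
  show "M (c \<odot>\<^bsub>V\<^esub> w) u = c \<odot>\<^bsub>U\<^esub> M w u"
    by (rule inn_ext[OF X U M[OF vs_smult[OF V w]] linmap_scale[OF U M[OF w]] linmap_smult[OF gen w] u])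
qed

end

lemma T_arr_Hom: "s \<in> Hom K F F' \<Longrightarrow> t \<in> Hom K G G' \<Longrightarrow> on_arr (hall_tensor C z) (s, t) \<in> Hom K (T F G) (T F' G')"
  by (rule cat_functorD(4)[OF hall_tensor_functor]) (simp add: Hom_prod_cat)

lemma T_arr_inn:
  assumes s: "s \<in> Hom K F F'" and t: "t \<in> Hom K G G'" and e: "exact f g"
    and x: "x \<in> el F (dom f)" and y: "y \<in> el G (cod g)"
  shows "cmp (on_arr (hall_tensor C z) (s, t)) (cod f) (inn F G f g x y) = inn F' G' f g (cmp s (dom f) x) (cmp t (cod g) y)"
proof -
  obtain \<eta> where es: "s = (F, F', \<eta>)" and n: "nat_trans (S C z 1) vect F F' \<eta>" and O: "F \<in> Obj K" "F' \<in> Obj K" by (rule K_HomE[OF s])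
  obtain \<theta> where et: "t = (G, G', \<theta>)" and n': "nat_trans (S C z 1) vect G G' \<theta>" and O': "G \<in> Obj K" "G' \<in> Obj K" by (rule K_HomE[OF t])
  let ?S = "S C z 1" and ?S2 = "S C z 2" and ?G = "G_functor C z"
  let ?P = "prod_cat ?S ?S"
  let ?b = "on_arr (box ?S ?S) (s, t)" and ?pl = "pull ?S2 ?P ?G"
  \<comment> \<open>The transformation on two-step flags to which the Kan extension is applied:
    \<open>s\<close> acts on the subobject and \<open>t\<close> on the quotient.\<close>
  define \<zeta> where "\<zeta> = (\<lambda>A\<in>Obj ?S2. (\<lambda>(x, y)\<in>Obj ?S \<times> Obj ?S. tensor_arr (\<eta> x) (\<theta> y)) (on_obj ?G A))"
  have st: "(s, t) \<in> Hom (prod_cat K K) (F, G) (F', G')" using s t by (simp add: Hom_prod_cat)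
  have b: "?b = (box_fct ?S ?S F G, box_fct ?S ?S F' G', \<lambda>(x, y)\<in>Obj ?S \<times> Obj ?S. tensor_arr (\<eta> x) (\<theta> y))"
    using HomD(1)[OF s] HomD(1)[OF t] unfolding es et by (rule box_simps(2))
  have bH: "?b \<in> Arr (Fun ?P)" by (rule HomD(1)[OF cat_functorD(4)[OF box_functor st]])
  have bH': "?b \<in> Hom (Fun ?P) (on_obj (box ?S ?S) (F, G)) (on_obj (box ?S ?S) (F', G'))" by (rule cat_functorD(4)[OF box_functor st])
  have pb: "on_arr ?pl ?b = (diag F G, diag F' G', \<zeta>)"
    using bH unfolding b by (simp add: pull_def diag_def \<zeta>_def)
  have "on_arr ?pl ?b \<in> Arr (Fun ?S2)"
    by (rule HomD(1)[OF cat_functorD(4)[OF pull_functor[OF G_is_functor G_pi0_finite] bH']])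
  then have pA: "(diag F G, diag F' G', \<zeta>) \<in> Arr (Fun ?S2)" unfolding pb .
  then have pH: "(diag F G, diag F' G', \<zeta>) \<in> Hom (Fun ?S2) (diag F G) (diag F' G')" by (simp add: Hom_def)
  have "on_arr (hall_tensor C z) (s, t) = on_arr (push ?S2 ?S (F_functor C z)) (on_arr ?pl ?b)"
    unfolding hall_tensor_def Let_def fcomp_simps(2)[OF st] ..
  then have T: "on_arr (hall_tensor C z) (s, t) = (kan_fct ?S2 ?S (F_functor C z) (diag F G), kan_fct ?S2 ?S (F_functor C z) (diag F' G'),
     \<lambda>b\<in>Obj ?S. F.push_map (diag F G) (diag F' G') \<zeta> b)"
    unfolding pb F.push_simps(2)[OF pA] .
  note o = exact_Obj[OF e]
  have X: "fl (cod f) \<in> Obj ?S" by (rule fl_Obj[OF o(2)])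
  have cm: "cmp (on_arr (hall_tensor C z) (s, t)) (cod f) = app (F.push_map (diag F G) (diag F' G') \<zeta> (fl (cod f)))"
    unfolding cmp_def T using X by simp
  note fA = flag2_flags[OF e]
  have dG: "on_obj ?G (flag2 f g) = (fl (dom f), fl (cod g))" unfolding G_simps(1)[OF fA] by simp
  have z: "\<zeta> (flag2 f g) = tensor_arr (\<eta> (fl (dom f))) (\<theta> (fl (cod g)))"
    unfolding \<zeta>_def using fA fl_Obj[OF o(1)] fl_Obj[OF o(3)] by (simp add: dG S_simps(1))
  note V = sp_vect[OF O(1) o(1)] sp_vect[OF O'(1) o(3)]
  note tv = tensor_vec_closed[OF V x y]
  note e1 = nat_transD(4)[OF n fl_Obj[OF o(1)]] and e2 = nat_transD(4)[OF n' fl_Obj[OF o(3)]]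
  note p = flag2_fib[OF O(1) O'(1) e]
  have "app (F.push_map (diag F G) (diag F' G') \<zeta> (fl (cod f))) (inn F G f g x y) =
     app (F.kan_in (diag F' G') (fl (cod f)) (flag2 f g, flag1_arr C z (Ident C (cod f))) \<cdot>\<^sub>v \<zeta> (flag2 f g)) (tensor_vec (sp F (dom f)) (sp G (cod g)) x y)"
    unfolding inn_def app_comp[OF inn_Hom[OF O(1) O'(1) e] tv, symmetric] F.push_map(2)[OF pH X p] ..
  also have "\<dots> = inn F' G' f g (app (\<eta> (fl (dom f))) x) (app (\<theta> (fl (cod g))) y)"
    unfolding z app_comp[OF tensor_arr_Hom[OF e1 e2] tv] app_tensor_arr[OF e1 e2 x y] inn_def ..
  finally show ?thesis unfolding cm by (simp add: cmp_def es et)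
qed

section \<open>The unit object and its generator\<close>

abbreviation one_fct where
  "one_fct \<equiv> hall_unit C z \<iota>"

definition line_fct :: "(('o, 'a) flag, ('o, 'a) flag_arr, 'v) vfct" where
  "line_fct = const_fct (S C z 0) vect (complex_line \<iota>)"

text \<open>The image of the number 1 in the colimit. It is meaningful when \<open>X\<close> is a
  zero object, for then the displayed pair lies in the fiber.\<close>

definition one :: "'o \<Rightarrow> 'v" where
  "one X = app (U.kan_in line_fct (fl X) (flag0, flag1_arr C z (from_zero C z X))) (\<iota> 1)"

lemma line_fct_Obj: "line_fct \<in> Obj (Fun (S C z 0))"
proof -
  have "cat_functor (S C z 0) vect line_fct"
    unfolding line_fct_def by (rule const_fct_functor[OF S_category vect.category_axioms complex_line_vect])
  moreover have "{iso_class (S C z 0) x |x. x \<in> Obj (S C z 0) \<and> carrier (on_obj line_fct x) \<noteq> {\<zero>\<^bsub>on_obj line_fct x\<^esub>}}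
     \<subseteq> {iso_class (S C z 0) flag0}" unfolding S_simps(1) flags_0 by blast
  then have "finite_support (S C z 0) line_fct" unfolding finite_support_def by (rule finite_subset) simp
  ultimately show ?thesis by (simp add: Obj_Fun)
qed

lemma one_fct_eq: "one_fct = kan_fct (S C z 0) (S C z 1) (sigma0 C z) line_fct"
  unfolding hall_unit_def using U.push_simps(1)[OF line_fct_Obj] by (simp add: line_fct_def)

lemma one_fct_Obj: "one_fct \<in> Obj K"
  unfolding one_fct_eq by (rule U.kan_fct_Obj[OF line_fct_Obj])

lemma sp_one: "X \<in> Obj C \<Longrightarrow> sp one_fct X = U.kan_obj line_fct (fl X)"
  unfolding one_fct_eq by (rule U.kan_fct_obj[OF fl_Obj])

lemma line_fct_obj: "on_obj line_fct flag0 = complex_line \<iota>"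
  unfolding line_fct_def const_fct_def by (simp add: S_simps(1) flags_0)

lemma line_fct_arr: "t \<in> Hom (S C z 0) A B \<Longrightarrow> on_arr line_fct t = Ident vect (complex_line \<iota>)"
  unfolding line_fct_def const_fct_def by (simp add: HomD(1))

lemma sigma0_obj: "on_obj (sigma0 C z) flag0 = fl z"
  unfolding sigma0_def const_fct_def by (simp add: S_simps(1) flags_0)

text \<open>There is one flag of length 0, and at most one arrow from \<open>z\<close> to
  \<open>X\<close>, which is an isomorphism exactly when \<open>X\<close> is a zero object.\<close>

lemma unit_fib: "(A, \<phi>) \<in> U.fib (fl X) \<longleftrightarrow> A = flag0 \<and> zero_object C X \<and> \<phi> = flag1_arr C z (from_zero C z X)"
proof
  assume "(A, \<phi>) \<in> U.fib (fl X)"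
  then have A: "A = flag0" and p: "\<phi> \<in> Hom (S C z 1) (on_obj (sigma0 C z) A) (fl X)"
    unfolding U.in_fib S_simps(1) flags_0 by blast+
  obtain h where h: "h \<in> hom z X" "iso h" "\<phi> = flag1_arr C z h" by (rule S1_HomE[OF p[unfolded A sigma0_obj]])
  show "A = flag0 \<and> zero_object C X \<and> \<phi> = flag1_arr C z (from_zero C z X)"
    using A h(3) iso_zero_object[OF h(1,2) zero_z] from_zero_eq[OF h(1)] by simp
next
  assume h: "A = flag0 \<and> zero_object C X \<and> \<phi> = flag1_arr C z (from_zero C z X)"
  then have X: "X \<in> Obj C" by (simp add: zero_object_def)
  have "\<phi> \<in> Hom (S C z 1) (fl z) (fl X)" using flag1_arr_Hom[OF from_zero[OF X] zero_object_iso] h by simp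
  then show "(A, \<phi>) \<in> U.fib (fl X)" unfolding U.in_fib S_simps(1) flags_0 using h sigma0_obj by simp
qed

context
  fixes X
  assumes X: "zero_object C X"
begin

lemma zero_Obj: "X \<in> Obj C"
  using X by (simp add: zero_object_def)

lemma one_in_fib: "(flag0, flag1_arr C z (from_zero C z X)) \<in> U.fib (fl X)"
  unfolding unit_fib using X by blast

lemma one_in_Hom: "U.kan_in line_fct (fl X) (flag0, flag1_arr C z (from_zero C z X)) \<in> Hom vect (complex_line \<iota>) (sp one_fct X)"
  using U.kan_in_Hom[OF line_fct_Obj fl_Obj[OF zero_Obj] one_in_fib] unfolding line_fct_obj sp_one[OF zero_Obj] .

lemma one_closed: "one X \<in> el one_fct X"
  unfolding one_def by (rule vect_app_closed[OF one_in_Hom]) simp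

lemma one_universal:
  fixes U :: "'v vspace"
  assumes U: "U \<in> Obj vect" and u: "u \<in> carrier U"
  obtains m where "linmap (sp one_fct X) U m" "m (one X) = u"
proof -
  let ?l = "mk_lin (complex_line \<iota>) U (\<lambda>v. the_inv \<iota> v \<odot>\<^bsub>U\<^esub> u)"
  have l: "?l \<in> Hom vect (complex_line \<iota>) U" by (rule mk_lin_Hom[OF complex_line_vect U complex_line_linear[OF U u]])
  have "\<exists>!m. m \<in> Hom vect (U.kan_obj line_fct (fl X)) U \<and>
     (\<forall>(A, \<phi>) \<in> U.fib (fl X). m \<cdot>\<^sub>v U.kan_in line_fct (fl X) (A, \<phi>) = ?l)"
  proof (rule U.kan_universal[OF line_fct_Obj fl_Obj[OF zero_Obj] U])
    fix A \<phi> assume "(A, \<phi>) \<in> U.fib (fl X)"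
    then have A: "A = flag0" unfolding unit_fib by blast
    show "?l \<in> Hom vect (on_obj line_fct A) U" using l unfolding A line_fct_obj .
  next
    fix t A A' \<phi> \<phi>' assume t: "t \<in> Hom (S C z 0) A A'"
    show "?l \<cdot>\<^sub>v on_arr line_fct t = ?l" unfolding line_fct_arr[OF t] by (rule vect.Ident_right[OF l])
  qed
  then obtain m where m: "m \<in> Hom vect (U.kan_obj line_fct (fl X)) U"
    "m \<cdot>\<^sub>v U.kan_in line_fct (fl X) (flag0, flag1_arr C z (from_zero C z X)) = ?l"
    using one_in_fib by blast
  have i1: "\<iota> 1 \<in> carrier (complex_line \<iota>)" by simp
  have "app m (one X) = app ?l (\<iota> 1)" unfolding one_def m(2)[symmetric] app_comp[OF one_in_Hom i1] ..
  also have "\<dots> = u" using u U by (simp add: the_inv_f_f[OF inj_\<iota>])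
  finally show thesis using that[of "app m"] vect_HomD(3)[OF m(1)] unfolding sp_one[OF zero_Obj] by blast
qed

lemma one_ext:
  fixes U :: "'v vspace"
  assumes U: "U \<in> Obj vect" and m: "linmap (sp one_fct X) U m" and n: "linmap (sp one_fct X) U n" and eq: "m (one X) = n (one X)"
    and v: "v \<in> el one_fct X"
  shows "m v = n v"
proof -
  let ?T = "sp one_fct X"
  have TV: "?T \<in> Obj vect" by (rule sp_vect[OF one_fct_Obj zero_Obj])
  note k = one_in_Hom
  have "mk_lin ?T U m = mk_lin ?T U n"
  proof (rule U.kan_ext[OF line_fct_Obj fl_Obj[OF zero_Obj]])
    show "mk_lin ?T U m \<in> Hom vect (U.kan_obj line_fct (fl X)) U" using mk_lin_Hom[OF TV U m] unfolding sp_one[OF zero_Obj] .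
    show "mk_lin ?T U n \<in> Hom vect (U.kan_obj line_fct (fl X)) U" using mk_lin_Hom[OF TV U n] unfolding sp_one[OF zero_Obj] .
    fix A \<phi> assume "(A, \<phi>) \<in> U.fib (fl X)"
    then have e: "A = flag0" "\<phi> = flag1_arr C z (from_zero C z X)" unfolding unit_fib by blast+
    show "mk_lin ?T U m \<cdot>\<^sub>v U.kan_in line_fct (fl X) (A, \<phi>) = mk_lin ?T U n \<cdot>\<^sub>v U.kan_in line_fct (fl X) (A, \<phi>)"
      unfolding e
    proof (rule vect_eqI[OF vect.Comp_Hom[OF k mk_lin_Hom[OF TV U m]] vect.Comp_Hom[OF k mk_lin_Hom[OF TV U n]]])
      fix v assume v: "v \<in> carrier (complex_line \<iota>)"
      note kv = vect_app_closed[OF k v]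
      have "m (app (U.kan_in line_fct (fl X) (flag0, flag1_arr C z (from_zero C z X))) v) = n (app (U.kan_in line_fct (fl X) (flag0, flag1_arr C z (from_zero C z X))) v)"
        by (rule complex_line_ext[OF linmap_comp[OF vect_HomD(3)[OF k] m] linmap_comp[OF vect_HomD(3)[OF k] n] _ v])
           (use eq in \<open>simp add: one_def\<close>)
      then show "app (mk_lin ?T U m \<cdot>\<^sub>v U.kan_in line_fct (fl X) (flag0, flag1_arr C z (from_zero C z X))) v =
         app (mk_lin ?T U n \<cdot>\<^sub>v U.kan_in line_fct (fl X) (flag0, flag1_arr C z (from_zero C z X))) v"
        unfolding app_comp[OF k v] app_mk_lin[OF kv] .
    qed
  qed
  then have "app (mk_lin ?T U m) v = app (mk_lin ?T U n) v" by simp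
  then show ?thesis using v by simp
qed

lemma ac_one:
  assumes f: "f \<in> hom X Y" "iso f"
  shows "ac one_fct f (one X) = one Y"
proof -
  have i1: "\<iota> 1 \<in> carrier (complex_line \<iota>)" by simp
  note fz = from_zero[OF zero_Obj]
  have "f \<cdot> from_zero C z X = from_zero C z Y" by (rule from_zero_eq[OF Comp_Hom[OF fz f(1)]])
  then have "on_arr one_fct (flag1_arr C z f) \<cdot>\<^sub>v U.kan_in line_fct (fl X) (flag0, flag1_arr C z (from_zero C z X)) =
     U.kan_in line_fct (fl Y) (flag0, flag1_arr C z (from_zero C z Y))"
    unfolding one_fct_eq U.kan_fct_arr(2)[OF line_fct_Obj flag1_arr_Hom[OF f] one_in_fib] S1_comp[OF fz f(1)] by simp
  then show ?thesis unfolding ac_def one_def app_comp[OF one_in_Hom i1, symmetric] by simp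
qed

end

lemma sp_one_zero:
  assumes "X \<in> Obj C" "\<not> zero_object C X"
  shows "el one_fct X = {\<zero>\<^bsub>sp one_fct X\<^esub>}"
  unfolding sp_one[OF assms(1)]
  by (rule U.kan_obj_zero[OF line_fct_Obj fl_Obj[OF assms(1)]]) (use assms(2) unit_fib in blast)

lemma hall_familyI:
  fixes U :: "'v vspace"
  assumes "U \<in> Obj vect"
    and "\<And>f g y. exact f g \<Longrightarrow> cod f = X \<Longrightarrow> y \<in> el G (cod g) \<Longrightarrow> linmap (sp F (dom f)) U (\<lambda>x. \<beta> f g x y)"
    and "\<And>f g x. exact f g \<Longrightarrow> cod f = X \<Longrightarrow> x \<in> el F (dom f) \<Longrightarrow> linmap (sp G (cod g)) U (\<lambda>y. \<beta> f g x y)"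
    and "\<And>f g a c A D x y. exact f g \<Longrightarrow> cod f = X \<Longrightarrow> a \<in> hom A (dom f) \<Longrightarrow> iso a \<Longrightarrow> c \<in> hom (cod g) D \<Longrightarrow> iso c \<Longrightarrow>
       x \<in> el F A \<Longrightarrow> y \<in> el G (cod g) \<Longrightarrow> \<beta> (f \<cdot> a) g x y = \<beta> f (c \<cdot> g) (ac F a x) (ac G c y)"
  shows "F \<in> Obj K \<Longrightarrow> G \<in> Obj K \<Longrightarrow> hall_family F G X U \<beta>"
  unfolding hall_family_def bilinear_map_iff using assms by blast

text \<open>Naturality is required of \<open>h\<close> alone; for the inverse family it follows by
  applying \<open>k\<close> to the naturality of \<open>h\<close>.\<close>

lemma K_iso_mk_nt:
  assumes O: "F \<in> Obj K" "G \<in> Obj K"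
    and h: "\<And>X. X \<in> Obj C \<Longrightarrow> linmap (sp F X) (sp G X) (h X)"
    and k: "\<And>X. X \<in> Obj C \<Longrightarrow> linmap (sp G X) (sp F X) (k X)"
    and nat: "\<And>X Y f v. f \<in> hom X Y \<Longrightarrow> iso f \<Longrightarrow> v \<in> el F X \<Longrightarrow> h Y (ac F f v) = ac G f (h X v)"
    and kh: "\<And>X v. X \<in> Obj C \<Longrightarrow> v \<in> el F X \<Longrightarrow> k X (h X v) = v"
    and hk: "\<And>X v. X \<in> Obj C \<Longrightarrow> v \<in> el G X \<Longrightarrow> h X (k X v) = v"
  shows "mk_nt F G h \<in> Hom K F G" "iso_arr K (mk_nt F G h)"
proof -
  show t: "mk_nt F G h \<in> Hom K F G" by (rule mk_nt_Hom[OF O h nat])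
  have s: "mk_nt G F k \<in> Hom K G F"
  proof (rule mk_nt_Hom[OF O(2,1) k])
    fix X Y f v assume f: "f \<in> hom X Y" "iso f" and v: "v \<in> el G X"
    note o = Hom_Obj[OF f(1)]
    note kv = linmap_closed[OF k[OF o(1)] v]
    show "k Y (ac G f v) = ac F f (k X v)"
      using nat[OF f kv] hk[OF o(1) v] kh[OF o(2) ac_closed[OF O(1) f kv]] by simp
  qed
  show "iso_arr K (mk_nt F G h)"
    by (rule K_isoI[OF t s]) (simp_all add: cmp_mk_nt kh hk linmap_closed[OF h] linmap_closed[OF k])
qed

lemma inn_shift_left:
  assumes O: "F \<in> Obj K" "G \<in> Obj K" and e: "exact f g" and a: "a \<in> hom A (dom f)" "iso a"
    and x: "x \<in> el F A" and y: "y \<in> el G (cod g)"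
  shows "inn F G (f \<cdot> a) g x y = inn F G f g (ac F a x) y"
proof -
  have o: "cod g \<in> Obj C" by (rule exact_Obj(3)[OF e])
  show ?thesis
    using inn_shift[OF O e a Ident_Hom[OF o] iso_Ident[OF o] x y] ac_Ident[OF O(2) o y] Ident_left[OF exact_Hom(2)[OF e]] by simp
qed

lemma inn_shift_right:
  assumes O: "F \<in> Obj K" "G \<in> Obj K" and e: "exact f g" and c: "c \<in> hom (cod g) D" "iso c"
    and x: "x \<in> el F (dom f)" and y: "y \<in> el G (cod g)"
  shows "inn F G f g x y = inn F G f (c \<cdot> g) x (ac G c y)"
proof -
  have o: "dom f \<in> Obj C" by (rule exact_Obj(1)[OF e])
  show ?thesis
    using inn_shift[OF O e Ident_Hom[OF o] iso_Ident[OF o] c x y] ac_Ident[OF O(1) o x] Ident_right[OF exact_Hom(1)[OF e]] by simp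
qed

section \<open>The associator\<close>

context
  fixes F G H
  assumes F: "F \<in> Obj K" and G: "G \<in> Obj K" and H: "H \<in> Obj K"
begin

abbreviation TL where "TL \<equiv> T (T F G) H"
abbreviation TR where "TR \<equiv> T F (T G H)"

lemma T2_Obj: "T F G \<in> Obj K" "T G H \<in> Obj K" "TL \<in> Obj K" "TR \<in> Obj K"
  by (intro T_Obj F G H)+

text \<open>Letters follow \<open>flag3\<close>: in \<open>inl\<close> the primed pair decomposes
  the subobject of the outer sequence, and in \<open>inr\<close> the doubly primed pair decomposes
  the quotient.\<close>

definition inl where
  "inl f g f' g' x y w = inn (T F G) H f g (inn F G f' g' x y) w"

definition inr where
  "inr p q f'' g'' x y w = inn F (T G H) p q x (inn G H f'' g'' y w)"

lemma inl_ext: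
  fixes U :: "'v vspace"
  assumes X: "X \<in> Obj C" and U: "U \<in> Obj vect"
    and m: "linmap (sp TL X) U m" and n: "linmap (sp TL X) U n"
    and eq: "\<And>f g f' g' x y w. exact f g \<Longrightarrow> cod f = X \<Longrightarrow> exact f' g' \<Longrightarrow> cod f' = dom f \<Longrightarrow>
       x \<in> el F (dom f') \<Longrightarrow> y \<in> el G (cod g') \<Longrightarrow> w \<in> el H (cod g) \<Longrightarrow>
       m (inl f g f' g' x y w) = n (inl f g f' g' x y w)"
    and v: "v \<in> el TL X"
  shows "m v = n v"
proof (rule inn_ext[OF T2_Obj(1) H X U m n _ v])
  fix f g u w assume e: "exact f g" "cod f = X" and u: "u \<in> el (T F G) (dom f)" and w: "w \<in> el H (cod g)"
  note l = inn_linear_left[OF T2_Obj(1) H e(1) w, unfolded e(2)]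
  show "m (inn (T F G) H f g u w) = n (inn (T F G) H f g u w)"
    by (rule inn_ext[OF F G exact_Obj(1)[OF e(1)] U linmap_comp[OF l m] linmap_comp[OF l n] _ u])
       (use eq[OF e] w in \<open>simp add: inl_def\<close>)
qed

lemma inr_ext:
  fixes U :: "'v vspace"
  assumes X: "X \<in> Obj C" and U: "U \<in> Obj vect"
    and m: "linmap (sp TR X) U m" and n: "linmap (sp TR X) U n"
    and eq: "\<And>p q f'' g'' x y w. exact p q \<Longrightarrow> cod p = X \<Longrightarrow> exact f'' g'' \<Longrightarrow> cod q = cod f'' \<Longrightarrow>
       x \<in> el F (dom p) \<Longrightarrow> y \<in> el G (dom f'') \<Longrightarrow> w \<in> el H (cod g'') \<Longrightarrow>
       m (inr p q f'' g'' x y w) = n (inr p q f'' g'' x y w)"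
    and v: "v \<in> el TR X"
  shows "m v = n v"
proof (rule inn_ext[OF F T2_Obj(2) X U m n _ v])
  fix p q x u assume e: "exact p q" "cod p = X" and x: "x \<in> el F (dom p)" and u: "u \<in> el (T G H) (cod q)"
  note l = inn_linear_right[OF F T2_Obj(2) e(1) x, unfolded e(2)]
  show "m (inn F (T G H) p q x u) = n (inn F (T G H) p q x u)"
    by (rule inn_ext[OF G H exact_Obj(3)[OF e(1)] U linmap_comp[OF l m] linmap_comp[OF l n] _ u])
       (use eq[OF e] x in \<open>simp add: inr_def\<close>)
qed

lemma inr_linear:
  assumes fl: "flag3 f g f' g' q f'' g''"
  shows "y \<in> el G (cod g') \<Longrightarrow> w \<in> el H (cod g) \<Longrightarrow>
      linmap (sp F (dom f')) (sp TR (cod f)) (\<lambda>x. inr (f \<cdot> f') q f'' g'' x y w)"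
    "x \<in> el F (dom f') \<Longrightarrow> w \<in> el H (cod g) \<Longrightarrow>
      linmap (sp G (cod g')) (sp TR (cod f)) (\<lambda>y. inr (f \<cdot> f') q f'' g'' x y w)"
    "x \<in> el F (dom f') \<Longrightarrow> y \<in> el G (cod g') \<Longrightarrow>
      linmap (sp H (cod g)) (sp TR (cod f)) (\<lambda>w. inr (f \<cdot> f') q f'' g'' x y w)"
proof -
  note D = flag3D[OF fl] and E = flag3_ends[OF fl]
  note l = inn_linear_left[OF F T2_Obj(2) D(4), unfolded E] and r = inn_linear_right[OF F T2_Obj(2) D(4), unfolded E]
  note l' = inn_linear_left[OF G H D(5), unfolded E] and r' = inn_linear_right[OF G H D(5), unfolded E]
  note c' = inn_closed[OF G H D(5), unfolded E]
  show "y \<in> el G (cod g') \<Longrightarrow> w \<in> el H (cod g) \<Longrightarrow>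
      linmap (sp F (dom f')) (sp TR (cod f)) (\<lambda>x. inr (f \<cdot> f') q f'' g'' x y w)"
    unfolding inr_def by (rule l[OF c'])
  show "x \<in> el F (dom f') \<Longrightarrow> w \<in> el H (cod g) \<Longrightarrow>
      linmap (sp G (cod g')) (sp TR (cod f)) (\<lambda>y. inr (f \<cdot> f') q f'' g'' x y w)"
    unfolding inr_def by (rule linmap_comp[OF l' r])
  show "x \<in> el F (dom f') \<Longrightarrow> y \<in> el G (cod g') \<Longrightarrow>
      linmap (sp H (cod g)) (sp TR (cod f)) (\<lambda>w. inr (f \<cdot> f') q f'' g'' x y w)"
    unfolding inr_def by (rule linmap_comp[OF r' r])
qed

lemma inl_linear:
  assumes fl: "flag3 f g f' g' q f'' g''"
  shows "y \<in> el G (cod g') \<Longrightarrow> w \<in> el H (cod g) \<Longrightarrow>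
      linmap (sp F (dom f')) (sp TL (cod f)) (\<lambda>x. inl f g f' g' x y w)"
    "x \<in> el F (dom f') \<Longrightarrow> w \<in> el H (cod g) \<Longrightarrow>
      linmap (sp G (cod g')) (sp TL (cod f)) (\<lambda>y. inl f g f' g' x y w)"
    "x \<in> el F (dom f') \<Longrightarrow> y \<in> el G (cod g') \<Longrightarrow>
      linmap (sp H (cod g)) (sp TL (cod f)) (\<lambda>w. inl f g f' g' x y w)"
proof -
  note D = flag3D[OF fl] and E = flag3_ends[OF fl]
  note l = inn_linear_left[OF T2_Obj(1) H D(1)] and r = inn_linear_right[OF T2_Obj(1) H D(1)]
  note l' = inn_linear_left[OF F G D(2), unfolded E] and r' = inn_linear_right[OF F G D(2), unfolded E]
  note c' = inn_closed[OF F G D(2), unfolded E]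
  show "y \<in> el G (cod g') \<Longrightarrow> w \<in> el H (cod g) \<Longrightarrow>
      linmap (sp F (dom f')) (sp TL (cod f)) (\<lambda>x. inl f g f' g' x y w)"
    unfolding inl_def by (rule linmap_comp[OF l' l])
  show "x \<in> el F (dom f') \<Longrightarrow> w \<in> el H (cod g) \<Longrightarrow>
      linmap (sp G (cod g')) (sp TL (cod f)) (\<lambda>y. inl f g f' g' x y w)"
    unfolding inl_def by (rule linmap_comp[OF r' l])
  show "x \<in> el F (dom f') \<Longrightarrow> y \<in> el G (cod g') \<Longrightarrow>
      linmap (sp H (cod g)) (sp TL (cod f)) (\<lambda>w. inl f g f' g' x y w)"
    unfolding inl_def by (rule r[OF c'])
qed

text \<open>Two completions differ by an isomorphism \<open>c\<close> of the vertex 13. Shifting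
  \<open>c\<close> across the outer symbol makes it act on the inner one, and
  \<open>inn_action\<close> turns one completion into the other.\<close>

lemma inr_unique:
  assumes 1: "flag3 f g f' g' q f'' g''" and 2: "flag3 f g f' g' r h k"
    and x: "x \<in> el F (dom f')" and y: "y \<in> el G (cod g')" and w: "w \<in> el H (cod g)"
  shows "inr (f \<cdot> f') r h k x y w = inr (f \<cdot> f') q f'' g'' x y w"
proof -
  note D = flag3D[OF 1] and E = flag3_ends[OF 1] and E2 = flag3_ends[OF 2]
  obtain c where c: "c \<in> hom (cod q) (cod r)" "iso c" "c \<cdot> q = r" "c \<cdot> f'' = h" "k \<cdot> c = g''"
    by (rule flag3_unique_left[OF 1 2])
  have c': "c \<in> hom (cod f'') (cod h)" using c(1) E(3) E2(3) by simp
  have k: "k \<in> hom (cod h) (cod k)" using exact_Hom(2)[OF flag3D(5)[OF 2]] .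
  have kc: "k = g'' \<cdot> inverse_arr c"
    unfolding c(5)[symmetric] using Comp_assoc[OF inverse_arr(1)[OF c' c(2)] c' k] inverse_arr(3)[OF c' c(2)] Ident_right[OF k] by simp
  note cl = inn_closed[OF G H D(5), unfolded E, OF y w]
  have "inr (f \<cdot> f') q f'' g'' x y w = inn F (T G H) (f \<cdot> f') (c \<cdot> q) x (ac (T G H) c (inn G H f'' g'' y w))"
    unfolding inr_def using c(1,2) x cl E by (intro inn_shift_right[OF F T2_Obj(2) D(4)]) simp_all
  also have "ac (T G H) c (inn G H f'' g'' y w) = inn G H (c \<cdot> f'') (g'' \<cdot> inverse_arr c) y w"
    using y w E by (intro inn_action[OF G H D(5) c' c(2)]) simp_all
  finally show ?thesis unfolding inr_def c(3,4) kc[symmetric] ..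
qed

text \<open>Mirror image of \<open>inr_unique\<close>, with the isomorphism at the vertex
  02.\<close>

lemma inl_unique:
  assumes 1: "flag3 f g f' g' q f'' g''" and 2: "flag3 h k h' k' q f'' g''" and e: "f \<cdot> f' = h \<cdot> h'"
    and x: "x \<in> el F (dom f')" and y: "y \<in> el G (cod g')" and w: "w \<in> el H (cod g)"
  shows "inl h k h' k' x y w = inl f g f' g' x y w"
proof -
  note D = flag3D[OF 1] and E = flag3_ends[OF 1] and E2 = flag3_ends[OF 2] and D2 = flag3D[OF 2]
  obtain c where c: "c \<in> hom (dom f) (dom h)" "iso c" "h \<cdot> c = f" "k' \<cdot> c = g'" "c \<cdot> f' = h'" "k = g"
    by (rule flag3_unique_right[OF 1 2 e])
  have c': "c \<in> hom (cod f') (dom h)" using c(1) E(6) by simp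
  have k: "k' \<in> hom (dom h) (cod k')" using exact_Hom(2)[OF D2(2)] E2(6) by simp
  have kc: "k' = g' \<cdot> inverse_arr c"
    unfolding c(4)[symmetric] using Comp_assoc[OF inverse_arr(1)[OF c' c(2)] c' k] inverse_arr(3)[OF c' c(2)] Ident_right[OF k] by simp
  note cl = inn_closed[OF F G D(2), unfolded E, OF x y]
  have "inl f g f' g' x y w = inn (T F G) H h k (ac (T F G) c (inn F G f' g' x y)) w"
    unfolding inl_def c(3)[symmetric] c(6)[symmetric] using c(1,2,6) cl w by (intro inn_shift_left[OF T2_Obj(1) H D2(1)]) simp_all
  also have "ac (T F G) c (inn F G f' g' x y) = inn F G (c \<cdot> f') (g' \<cdot> inverse_arr c) x y"
    using x y by (intro inn_action[OF F G D(2) c' c(2)])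
  finally show ?thesis unfolding inl_def c(5) kc[symmetric] ..
qed

text \<open>The outer sequence and its third vector are held fixed, and the associator is built on
  the inner tensor product. A completion of the flag is picked for each inner sequence;
  \<open>inr_unique\<close> makes the value independent of the pick, and balance follows by
  transporting the flag.\<close>

lemma assoc_inner:
  assumes e: "exact f g" and w: "w \<in> el H (cod g)"
  shows "\<exists>M. linmap (sp (T F G) (dom f)) (sp TR (cod f)) M \<and>
    (\<forall>f' g' q f'' g'' x y. flag3 f g f' g' q f'' g'' \<longrightarrow> x \<in> el F (dom f') \<longrightarrow> y \<in> el G (cod g') \<longrightarrow>
       M (inn F G f' g' x y) = inr (f \<cdot> f') q f'' g'' x y w)"
proof -
  \<comment> \<open>A chosen completion \<open>(q, f'', g'')\<close>, whose existence comes from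
    \<open>flag3_left\<close>.\<close>
  define t where "t f' g' = (SOME t. flag3 f g f' g' (fst t) (fst (snd t)) (snd (snd t)))" for f' g'
  define val where "val f' g' x y = inr (f \<cdot> f') (fst (t f' g')) (fst (snd (t f' g'))) (snd (snd (t f' g'))) x y w" for f' g' x y
  have t: "flag3 f g f' g' (fst (t f' g')) (fst (snd (t f' g'))) (snd (snd (t f' g')))" if fl: "flag3 f g f' g' q f'' g''" for f' g' q f'' g''
    unfolding t_def by (rule someI[of _ "(q, f'', g'')"]) (use fl in simp)
  have val: "val f' g' x y = inr (f \<cdot> f') q f'' g'' x y w"
    if fl: "flag3 f g f' g' q f'' g''" and x: "x \<in> el F (dom f')" and y: "y \<in> el G (cod g')" for f' g' q f'' g'' x y
    unfolding val_def by (rule inr_unique[OF fl t[OF fl] x y w])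
  have o: "dom f \<in> Obj C" "cod f \<in> Obj C" by (rule exact_Obj[OF e])+
  have "hall_family F G (dom f) (sp TR (cod f)) val"
  proof (rule hall_familyI[OF sp_vect[OF T2_Obj(4) o(2)] _ _ _ F G])
    fix f' g' y assume e': "exact f' g'" "cod f' = dom f" and y: "y \<in> el G (cod g')"
    obtain q f'' g'' where fl: "flag3 f g f' g' q f'' g''" by (rule flag3_left[OF e e'])
    show "linmap (sp F (dom f')) (sp TR (cod f)) (\<lambda>x. val f' g' x y)"
      unfolding val_def by (rule inr_linear(1)[OF t[OF fl] y w])
  next
    fix f' g' x assume e': "exact f' g'" "cod f' = dom f" and x: "x \<in> el F (dom f')"
    obtain q f'' g'' where fl: "flag3 f g f' g' q f'' g''" by (rule flag3_left[OF e e'])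
    show "linmap (sp G (cod g')) (sp TR (cod f)) (\<lambda>y. val f' g' x y)"
      unfolding val_def by (rule inr_linear(2)[OF t[OF fl] x w])
  next
    fix f' g' a c A D x y
    assume e': "exact f' g'" "cod f' = dom f" and a: "a \<in> hom A (dom f')" "iso a"
      and c: "c \<in> hom (cod g') D" "iso c" and x: "x \<in> el F A" and y: "y \<in> el G (cod g')"
    obtain q f'' g'' where fl: "flag3 f g f' g' q f'' g''" by (rule flag3_left[OF e e'])
    note D = flag3D[OF fl] and E = flag3_ends[OF fl]
    note ia = ac_closed[OF F a x] and ic = ac_closed[OF G c y] and j = inverse_arr[OF c]
    have fa: "f \<cdot> (f' \<cdot> a) = f \<cdot> f' \<cdot> a"
      using Comp_assoc[OF a(1) exact_Hom(1)[OF e'(1)], of f "cod f"] exact_Hom(1)[OF e] e'(2) by simp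
    have da: "dom (f' \<cdot> a) = A" using HomD(2)[OF Comp_Hom[OF a(1) exact_Hom(1)[OF e'(1)]]] .
    have dc: "cod (c \<cdot> g') = D" using HomD(3)[OF Comp_Hom[OF exact_Hom(2)[OF e'(1)] c(1)]] .
    have a2: "a \<in> hom A (dom (f \<cdot> f'))" using a(1) E by simp
    have j2: "inverse_arr c \<in> hom D (dom f'')" using j(1) E by simp
    have w2: "w \<in> el H (cod g'')" using w E by simp
    have cl: "inn G H f'' g'' y w \<in> el (T G H) (cod q)"
      using inn_closed[OF G H D(5), of y w] y w2 E by simp
    \<comment> \<open>The isomorphism \<open>a\<close> of the first graded piece moves across the
      outer symbol, while \<open>c\<close> on the middle piece moves across the inner one.\<close>
    have "val (f' \<cdot> a) g' x y = inn F (T G H) (f \<cdot> f' \<cdot> a) q x (inn G H f'' g'' y w)"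
      using val[OF flag3_iso_sub[OF fl a], of x y] x y by (simp add: da fa inr_def)
    also have "\<dots> = inn F (T G H) (f \<cdot> f') q (ac F a x) (inn G H f'' g'' y w)"
      by (rule inn_shift_left[OF F T2_Obj(2) D(4) a2 a(2) x cl])
    also have "inn G H f'' g'' y w = inn G H (f'' \<cdot> inverse_arr c) g'' (ac G c y) w"
      unfolding inn_shift_left[OF G H D(5) j2 j(4) ic w2] ac_inverse(1)[OF G c y] ..
    also have "inn F (T G H) (f \<cdot> f') q (ac F a x) (inn G H (f'' \<cdot> inverse_arr c) g'' (ac G c y) w) = val f' (c \<cdot> g') (ac F a x) (ac G c y)"
      using val[OF flag3_iso_mid[OF fl c] ia, of "ac G c y"] ic by (simp add: dc inr_def)
    finally show "val (f' \<cdot> a) g' x y = val f' (c \<cdot> g') (ac F a x) (ac G c y)" .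
  qed
  from inn_universal[OF F G o(1) this] obtain M where M: "linmap (sp (T F G) (dom f)) (sp TR (cod f)) M"
    "\<And>f' g' x y. exact f' g' \<Longrightarrow> cod f' = dom f \<Longrightarrow> x \<in> el F (dom f') \<Longrightarrow> y \<in> el G (cod g') \<Longrightarrow> M (inn F G f' g' x y) = val f' g' x y"
    by blast
  have "M (inn F G f' g' x y) = inr (f \<cdot> f') q f'' g'' x y w" if fl: "flag3 f g f' g' q f'' g''" and x: "x \<in> el F (dom f')" and y: "y \<in> el G (cod g')" for f' g' q f'' g'' x y
    using M(2)[OF flag3D(2,3)[OF fl] x y] val[OF fl x y] by simp
  with M(1) show ?thesis by blast
qed

text \<open>The inner maps, one for each outer sequence and third vector, form a balanced family.
  They were picked separately, so linearity in the third vector needs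
  \<open>inn_pointwise_linear\<close>.\<close>

lemma assoc_exists:
  assumes X: "X \<in> Obj C"
  shows "\<exists>m. linmap (sp TL X) (sp TR X) m \<and>
    (\<forall>f g f' g' q f'' g'' x y w. flag3 f g f' g' q f'' g'' \<longrightarrow> cod f = X \<longrightarrow> x \<in> el F (dom f') \<longrightarrow> y \<in> el G (cod g') \<longrightarrow>
       w \<in> el H (cod g) \<longrightarrow> m (inl f g f' g' x y w) = inr (f \<cdot> f') q f'' g'' x y w)"
proof -
  define P where "P f g w M \<longleftrightarrow> linmap (sp (T F G) (dom f)) (sp TR (cod f)) M \<and>
    (\<forall>f' g' q f'' g'' x y. flag3 f g f' g' q f'' g'' \<longrightarrow> x \<in> el F (dom f') \<longrightarrow> y \<in> el G (cod g') \<longrightarrow>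
       M (inn F G f' g' x y) = inr (f \<cdot> f') q f'' g'' x y w)" for f g w M
  define M where "M f g w = (SOME M. P f g w M)" for f g w
  have PM: "P f g w (M f g w)" if "exact f g" "w \<in> el H (cod g)" for f g w
  proof -
    have "\<exists>M. P f g w M" unfolding P_def by (rule assoc_inner[OF that])
    then show ?thesis unfolding M_def by (rule someI_ex)
  qed
  then have M1: "linmap (sp (T F G) (dom f)) (sp TR (cod f)) (M f g w)" if "exact f g" "w \<in> el H (cod g)" for f g w
    using that unfolding P_def by blast
  have M2: "M f g w (inn F G f' g' x y) = inr (f \<cdot> f') q f'' g'' x y w"
    if fl: "flag3 f g f' g' q f'' g''" and v: "x \<in> el F (dom f')" "y \<in> el G (cod g')" "w \<in> el H (cod g)" for f g w f' g' q f'' g'' x y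
    using PM[OF flag3D(1)[OF fl] v(3)] fl v(1,2) unfolding P_def by blast
  have "hall_family (T F G) H X (sp TR X) (\<lambda>f g u w. M f g w u)"
  proof (rule hall_familyI[OF sp_vect[OF T2_Obj(4) X] _ _ _ T2_Obj(1) H])
    fix f g w assume e: "exact f g" "cod f = X" and w: "w \<in> el H (cod g)"
    show "linmap (sp (T F G) (dom f)) (sp TR X) (\<lambda>u. M f g w u)" using M1[OF e(1) w] e(2) by simp
  next
    fix f g u assume e: "exact f g" "cod f = X" and u: "u \<in> el (T F G) (dom f)"
    have o: "dom f \<in> Obj C" "cod g \<in> Obj C" by (rule exact_Obj[OF e(1)])+
    note V = sp_vect[OF H o(2)] and TV = sp_vect[OF T2_Obj(4) X]
    note M1' = M1[OF e(1), unfolded e(2)]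
    have lin: "linmap (sp H (cod g)) (sp TR X) (\<lambda>w. inr (f \<cdot> f') q f'' g'' x y w)"
      if "flag3 f g f' g' q f'' g''" "x \<in> el F (dom f')" "y \<in> el G (cod g')" for f' g' q f'' g'' x y
      using inr_linear(3)[OF that] e(2) by simp
    show "linmap (sp H (cod g)) (sp TR X) (\<lambda>w. M f g w u)"
    proof (rule inn_pointwise_linear[OF F G o(1) V TV M1' _ u])
      fix f' g' x y assume e': "exact f' g'" "cod f' = dom f" and v: "x \<in> el F (dom f')" "y \<in> el G (cod g')"
      obtain q f'' g'' where fl: "flag3 f g f' g' q f'' g''" by (rule flag3_left[OF e(1) e'])
      show "linmap (sp H (cod g)) (sp TR X) (\<lambda>w. M f g w (inn F G f' g' x y))"
        by (rule iffD2[OF linmap_cong[OF V] lin[OF fl v]]) (rule M2[OF fl v])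
    qed
  next
    fix f g a c A D u w
    assume e: "exact f g" "cod f = X" and a: "a \<in> hom A (dom f)" "iso a" and c: "c \<in> hom (cod g) D" "iso c"
      and u: "u \<in> el (T F G) A" and w: "w \<in> el H (cod g)"
    note e1 = exact_iso_left[OF e(1) a] and e2 = exact_iso_right[OF e(1) c]
    note fa = HomD[OF Comp_Hom[OF a(1) exact_Hom(1)[OF e(1)]]] and cg = HomD[OF Comp_Hom[OF exact_Hom(2)[OF e(1)] c(1)]]
    have A: "A \<in> Obj C" using Hom_Obj(1)[OF a(1)] .
    have w': "ac H c w \<in> el H D" "ac H c w \<in> el H (cod (c \<cdot> g))" using ac_closed[OF H c w] cg by simp_all
    have l1: "linmap (sp (T F G) A) (sp TR X) (M (f \<cdot> a) g w)" using M1[OF e1 w] fa e(2) by simp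
    have l2: "linmap (sp (T F G) (dom f)) (sp TR X) (M f (c \<cdot> g) (ac H c w))" using M1[OF e2 w'(2)] e(2) by simp
    show "M (f \<cdot> a) g w u = M f (c \<cdot> g) (ac H c w) (ac (T F G) a u)"
    proof (rule inn_ext[OF F G A sp_vect[OF T2_Obj(4) X] l1 linmap_comp[OF ac_linear[OF T2_Obj(1) a] l2] _ u])
      fix f' g' x y assume e': "exact f' g'" "cod f' = A" and v: "x \<in> el F (dom f')" "y \<in> el G (cod g')"
      obtain q f'' g'' where fl: "flag3 (f \<cdot> a) g f' g' q f'' g''" by (rule flag3_left[OF e1 e'(1)]) (use e' fa in simp)
      note D = flag3D[OF fl] and E = flag3_ends[OF fl]
      \<comment> \<open>The flag over \<open>f \<cdot> a\<close> is rewritten as one over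
        \<open>f\<close>, and then its last quotient is moved along \<open>c\<close>; these are the
        two sides of the outer balancing relation.\<close>
      note fl2 = flag3_iso_02[OF fl exact_Hom(1)[OF e(1)] a]
      note fl3 = flag3_iso_quot[OF fl2 c]
      have f': "f' \<in> hom (dom f') A" and g': "g' \<in> hom A (cod g')" using exact_Hom[OF e'(1)] e'(2) by simp_all
      note j = inverse_arr[OF a]
      have dm: "dom (a \<cdot> f') = dom f'" "cod (g' \<cdot> inverse_arr a) = cod g'"
        using HomD[OF Comp_Hom[OF f' a(1)]] HomD[OF Comp_Hom[OF j(1) g']] by simp_all
      have act: "ac (T F G) a (inn F G f' g' x y) = inn F G (a \<cdot> f') (g' \<cdot> inverse_arr a) x y"
        using a e'(2) by (intro inn_action[OF F G e'(1) _ a(2) v]) simp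
      have fa': "f \<cdot> (a \<cdot> f') = f \<cdot> a \<cdot> f'" using Comp_assoc[OF f' a(1) exact_Hom(1)[OF e(1)]] .
      have sh: "inn G H f'' g'' y w = inn G H f'' (c \<cdot> g'') y (ac H c w)"
        by (rule inn_shift_right[OF G H D(5) _ c(2)]) (use c(1) v w E in simp_all)
      have "M f (c \<cdot> g) (ac H c w) (inn F G (a \<cdot> f') (g' \<cdot> inverse_arr a) x y) = inr (f \<cdot> (a \<cdot> f')) q f'' (c \<cdot> g'') x y (ac H c w)"
        by (rule M2[OF fl3]) (use v w' dm in simp_all)
      then show "M (f \<cdot> a) g w (inn F G f' g' x y) = M f (c \<cdot> g) (ac H c w) (ac (T F G) a (inn F G f' g' x y))"
        unfolding act M2[OF fl v w] fa' by (simp add: inr_def sh)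
    qed
  qed
  from inn_universal[OF T2_Obj(1) H X this] obtain m where m: "linmap (sp TL X) (sp TR X) m"
    "\<And>f g u w. exact f g \<Longrightarrow> cod f = X \<Longrightarrow> u \<in> el (T F G) (dom f) \<Longrightarrow> w \<in> el H (cod g) \<Longrightarrow> m (inn (T F G) H f g u w) = M f g w u"
    by blast
  have "m (inl f g f' g' x y w) = inr (f \<cdot> f') q f'' g'' x y w"
    if fl: "flag3 f g f' g' q f'' g''" and c: "cod f = X" and v: "x \<in> el F (dom f')" "y \<in> el G (cod g')" "w \<in> el H (cod g)"
    for f g f' g' q f'' g'' x y w
  proof -
    note D = flag3D[OF fl]
    have "inn F G f' g' x y \<in> el (T F G) (dom f)" using inn_closed[OF F G D(2) v(1,2)] D(3) by simp
    from m(2)[OF D(1) c this v(3)] show ?thesis unfolding inl_def M2[OF fl v] .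
  qed
  with m(1) show ?thesis by blast
qed

section \<open>The inverse of the associator\<close>

lemma coassoc_inner:
  assumes e: "exact p q" and x: "x \<in> el F (dom p)"
  shows "\<exists>N. linmap (sp (T G H) (cod q)) (sp TL (cod p)) N \<and>
    (\<forall>f g f' g' f'' g'' y w. flag3 f g f' g' q f'' g'' \<longrightarrow> f \<cdot> f' = p \<longrightarrow> y \<in> el G (cod g') \<longrightarrow> w \<in> el H (cod g) \<longrightarrow>
       N (inn G H f'' g'' y w) = inl f g f' g' x y w)"
proof -
  \<comment> \<open>A chosen completion \<open>(f, g, f', g')\<close> restricted to
    \<open>f \<cdot> f' = p\<close>; the quotient datum \<open>q\<close> alone would fix the first
    step only up to isomorphism.\<close>
  define t where "t f'' g'' = (SOME t. case t of (f, g, f', g') \<Rightarrow> flag3 f g f' g' q f'' g'' \<and> f \<cdot> f' = p)" for f'' g''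
  define val where "val f'' g'' y w = (case t f'' g'' of (f, g, f', g') \<Rightarrow> inl f g f' g' x y w)" for f'' g'' y w
  have t: "\<exists>h k h' k'. t f'' g'' = (h, k, h', k') \<and> flag3 h k h' k' q f'' g'' \<and> h \<cdot> h' = p"
    if fl: "flag3 f g f' g' q f'' g''" "f \<cdot> f' = p" for f g f' g' f'' g''
    using someI[of "\<lambda>t. case t of (f, g, f', g') \<Rightarrow> flag3 f g f' g' q f'' g'' \<and> f \<cdot> f' = p" "(f, g, f', g')"] fl unfolding t_def
    by (cases "SOME t. case t of (f, g, f', g') \<Rightarrow> flag3 f g f' g' q f'' g'' \<and> f \<cdot> f' = p") simp
  have dx: "dom f' = dom p" "cod f = cod p" if fl: "flag3 f g f' g' q f'' g''" "f \<cdot> f' = p" for f g f' g' f'' g''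
    using flag3_ends(1,2)[OF fl(1)] fl(2) by simp_all
  have val: "val f'' g'' y w = inl f g f' g' x y w"
    if fl: "flag3 f g f' g' q f'' g''" "f \<cdot> f' = p" and y: "y \<in> el G (cod g')" and w: "w \<in> el H (cod g)" for f g f' g' f'' g'' y w
  proof -
    obtain h k h' k' where h: "t f'' g'' = (h, k, h', k')" "flag3 h k h' k' q f'' g''" "h \<cdot> h' = p" using t[OF fl] by blast
    have x': "x \<in> el F (dom f')" using x dx[OF fl] by simp
    show ?thesis unfolding val_def h(1) prod.case
      by (rule inl_unique[OF fl(1) h(2) _ x' y w]) (simp add: fl h)
  qed
  have o: "cod q \<in> Obj C" "cod p \<in> Obj C" by (rule exact_Obj[OF e])+
  have "hall_family G H (cod q) (sp TL (cod p)) val"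
  proof (rule hall_familyI[OF sp_vect[OF T2_Obj(3) o(2)] _ _ _ G H])
    fix f'' g'' w assume e'': "exact f'' g''" "cod f'' = cod q" and w: "w \<in> el H (cod g'')"
    obtain f0 g0 f0' g0' where "flag3 f0 g0 f0' g0' q f'' g''" "f0 \<cdot> f0' = p" by (rule flag3_right[OF e e''(1) e''(2)[symmetric]])
    then obtain f g f' g' where fl: "t f'' g'' = (f, g, f', g')" "flag3 f g f' g' q f'' g''" "f \<cdot> f' = p" using t by blast
    note E = flag3_ends[OF fl(2)] and d = dx[OF fl(2,3)]
    show "linmap (sp G (dom f'')) (sp TL (cod p)) (\<lambda>y. val f'' g'' y w)"
      unfolding val_def fl(1) prod.case using inl_linear(2)[OF fl(2), of x w] x w E d by simp
  next
    fix f'' g'' y assume e'': "exact f'' g''" "cod f'' = cod q" and y: "y \<in> el G (dom f'')"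
    obtain f0 g0 f0' g0' where "flag3 f0 g0 f0' g0' q f'' g''" "f0 \<cdot> f0' = p" by (rule flag3_right[OF e e''(1) e''(2)[symmetric]])
    then obtain f g f' g' where fl: "t f'' g'' = (f, g, f', g')" "flag3 f g f' g' q f'' g''" "f \<cdot> f' = p" using t by blast
    note E = flag3_ends[OF fl(2)] and d = dx[OF fl(2,3)]
    show "linmap (sp H (cod g'')) (sp TL (cod p)) (\<lambda>w. val f'' g'' y w)"
      unfolding val_def fl(1) prod.case using inl_linear(3)[OF fl(2), of x y] x y E d by simp
  next
    fix f'' g'' a c A D y w
    assume e'': "exact f'' g''" "cod f'' = cod q" and a: "a \<in> hom A (dom f'')" "iso a"
      and c: "c \<in> hom (cod g'') D" "iso c" and y: "y \<in> el G A" and w: "w \<in> el H (cod g'')"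
    obtain f g f' g' where fl: "flag3 f g f' g' q f'' g''" "f \<cdot> f' = p" by (rule flag3_right[OF e e''(1) e''(2)[symmetric]])
    note D = flag3D[OF fl(1)] and E = flag3_ends[OF fl(1)] and d = dx[OF fl]
    note j = inverse_arr[OF a]
    have j2: "inverse_arr a \<in> hom (cod g') A" using j(1) E by simp
    \<comment> \<open>\<open>flag3_iso_mid\<close> produces an inverse on the side of
      \<open>f''\<close>; applied to the inverse of \<open>a\<close> it gives
      \<open>f'' \<cdot> a\<close>.\<close>
    have jj: "inverse_arr (inverse_arr a) = a" by (rule inverse_arr_unique[OF j(1) a(1) j(3,2)])
    have c2: "c \<in> hom (cod g) D" using c(1) E by simp
    note fl1 = flag3_iso_mid[OF fl(1) j2 j(4), unfolded jj] and fl2 = flag3_iso_quot[OF fl(1) c2 c(2)]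
    have ag: "cod (inverse_arr a \<cdot> g') = A" using HomD(3)[OF Comp_Hom[OF exact_Hom(2)[OF D(2)] j2]] .
    have cg: "cod (c \<cdot> g) = D" using HomD(3)[OF Comp_Hom[OF exact_Hom(2)[OF D(1)] c2]] .
    have x': "x \<in> el F (dom f')" using x d by simp
    have w': "w \<in> el H (cod g)" using w E by simp
    have ya: "ac G a y \<in> el G (cod g')" using ac_closed[OF G a y] E by simp
    have wc: "ac H c w \<in> el H D" using ac_closed[OF H c w] .
    have cl: "inn F G f' g' x (ac G a y) \<in> el (T F G) (dom f)" using inn_closed[OF F G D(2) x' ya] E by simp
    have "val (f'' \<cdot> a) g'' y w = inl f g f' (inverse_arr a \<cdot> g') x y w"
      by (rule val[OF fl1 fl(2)]) (use y w' ag in simp_all)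
    also have "\<dots> = inn (T F G) H f g (inn F G f' g' x (ac G a y)) w"
      using inn_shift_right[OF F G D(2) j2 j(4) x' ya] ac_inverse(1)[OF G a y] by (simp add: inl_def)
    also have "\<dots> = inl f (c \<cdot> g) f' g' x (ac G a y) (ac H c w)"
      unfolding inl_def by (rule inn_shift_right[OF T2_Obj(1) H D(1) c2 c(2) cl w'])
    also have "\<dots> = val f'' (c \<cdot> g'') (ac G a y) (ac H c w)"
      by (rule val[OF fl2 fl(2), symmetric]) (use ya wc cg in simp_all)
    finally show "val (f'' \<cdot> a) g'' y w = val f'' (c \<cdot> g'') (ac G a y) (ac H c w)" .
  qed
  from inn_universal[OF G H o(1) this] obtain N where N: "linmap (sp (T G H) (cod q)) (sp TL (cod p)) N"
    "\<And>f'' g'' y w. exact f'' g'' \<Longrightarrow> cod f'' = cod q \<Longrightarrow> y \<in> el G (dom f'') \<Longrightarrow> w \<in> el H (cod g'') \<Longrightarrow> N (inn G H f'' g'' y w) = val f'' g'' y w"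
    by blast
  have "N (inn G H f'' g'' y w) = inl f g f' g' x y w"
    if fl: "flag3 f g f' g' q f'' g''" "f \<cdot> f' = p" and y: "y \<in> el G (cod g')" and w: "w \<in> el H (cod g)" for f g f' g' f'' g'' y w
    using N(2)[OF flag3D(5)[OF fl(1)], of y w] val[OF fl y w] y w flag3_ends[OF fl(1)] by simp
  with N(1) show ?thesis by blast
qed

text \<open>Same scheme as \<open>assoc_exists\<close> with the roles exchanged: the first vector is
  the parameter, and linearity in it comes from \<open>inn_pointwise_linear\<close>.\<close>

lemma coassoc_exists:
  assumes X: "X \<in> Obj C"
  shows "\<exists>m. linmap (sp TR X) (sp TL X) m \<and>
    (\<forall>f g f' g' q f'' g'' x y w. flag3 f g f' g' q f'' g'' \<longrightarrow> cod f = X \<longrightarrow> x \<in> el F (dom f') \<longrightarrow> y \<in> el G (cod g') \<longrightarrow>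
       w \<in> el H (cod g) \<longrightarrow> m (inr (f \<cdot> f') q f'' g'' x y w) = inl f g f' g' x y w)"
proof -
  define P where "P p q x N \<longleftrightarrow> linmap (sp (T G H) (cod q)) (sp TL (cod p)) N \<and>
    (\<forall>f g f' g' f'' g'' y w. flag3 f g f' g' q f'' g'' \<longrightarrow> f \<cdot> f' = p \<longrightarrow> y \<in> el G (cod g') \<longrightarrow> w \<in> el H (cod g) \<longrightarrow>
       N (inn G H f'' g'' y w) = inl f g f' g' x y w)" for p q x N
  define N where "N p q x = (SOME N. P p q x N)" for p q x
  have PN: "P p q x (N p q x)" if "exact p q" "x \<in> el F (dom p)" for p q x
  proof -
    have "\<exists>N. P p q x N" unfolding P_def by (rule coassoc_inner[OF that])
    then show ?thesis unfolding N_def by (rule someI_ex)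
  qed
  then have N1: "linmap (sp (T G H) (cod q)) (sp TL (cod p)) (N p q x)" if "exact p q" "x \<in> el F (dom p)" for p q x
    using that unfolding P_def by blast
  have N2: "N p q x (inn G H f'' g'' y w) = inl f g f' g' x y w"
    if fl: "flag3 f g f' g' q f'' g''" "f \<cdot> f' = p" and v: "x \<in> el F (dom p)" "y \<in> el G (cod g')" "w \<in> el H (cod g)" for p q f g w f' g' f'' g'' x y
  proof -
    have "exact p q" using flag3D(4)[OF fl(1)] fl(2) by simp
    from PN[OF this v(1)] fl v(2,3) show ?thesis unfolding P_def by blast
  qed
  have "hall_family F (T G H) X (sp TL X) N"
  proof (rule hall_familyI[OF sp_vect[OF T2_Obj(3) X] _ _ _ F T2_Obj(2)])
    fix p q x assume e: "exact p q" "cod p = X" and x: "x \<in> el F (dom p)"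
    show "linmap (sp (T G H) (cod q)) (sp TL X) (\<lambda>u. N p q x u)" using N1[OF e(1) x] e(2) by simp
  next
    fix p q u assume e: "exact p q" "cod p = X" and u: "u \<in> el (T G H) (cod q)"
    have o: "dom p \<in> Obj C" "cod q \<in> Obj C" by (rule exact_Obj[OF e(1)])+
    note V = sp_vect[OF F o(1)] and TV = sp_vect[OF T2_Obj(3) X]
    note N1' = N1[OF e(1), unfolded e(2)]
    have lin: "linmap (sp F (dom p)) (sp TL X) (\<lambda>x. inl f g f' g' x y w)"
      if fl: "flag3 f g f' g' q f'' g''" "f \<cdot> f' = p" and v: "y \<in> el G (cod g')" "w \<in> el H (cod g)" for f g f' g' f'' g'' y w
      using inl_linear(1)[OF fl(1) v] e(2) flag3_ends(1,2)[OF fl(1)] fl(2) by simp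
    have ex: "\<exists>f g f' g'. flag3 f g f' g' q f'' g'' \<and> f \<cdot> f' = p \<and> y \<in> el G (cod g') \<and> w \<in> el H (cod g)"
      if e'': "exact f'' g''" "cod f'' = cod q" and v: "y \<in> el G (dom f'')" "w \<in> el H (cod g'')" for f'' g'' y w
    proof -
      obtain f g f' g' where fl: "flag3 f g f' g' q f'' g''" "f \<cdot> f' = p" by (rule flag3_right[OF e(1) e''(1) e''(2)[symmetric]])
      then show ?thesis using v flag3_ends[OF fl(1)] by fastforce
    qed
    show "linmap (sp F (dom p)) (sp TL X) (\<lambda>x. N p q x u)"
    proof (rule inn_pointwise_linear[OF G H o(2) V TV N1' _ u])
      fix f'' g'' y w assume "exact f'' g''" "cod f'' = cod q" "y \<in> el G (dom f'')" "w \<in> el H (cod g'')"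
      from ex[OF this] obtain f g f' g' where fl: "flag3 f g f' g' q f'' g''" "f \<cdot> f' = p" and v: "y \<in> el G (cod g')" "w \<in> el H (cod g)" by blast
      show "linmap (sp F (dom p)) (sp TL X) (\<lambda>x. N p q x (inn G H f'' g'' y w))"
        by (rule iffD2[OF linmap_cong[OF V] lin[OF fl v]]) (rule N2[OF fl _ v])
    qed
  next
    fix p q a c A D x u
    assume e: "exact p q" "cod p = X" and a: "a \<in> hom A (dom p)" "iso a" and c: "c \<in> hom (cod q) D" "iso c"
      and x: "x \<in> el F A" and u: "u \<in> el (T G H) (cod q)"
    note e1 = exact_iso_left[OF e(1) a] and e2 = exact_iso_right[OF e(1) c]
    note pa = HomD[OF Comp_Hom[OF a(1) exact_Hom(1)[OF e(1)]]] and cq = HomD[OF Comp_Hom[OF exact_Hom(2)[OF e(1)] c(1)]]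
    have B: "cod q \<in> Obj C" using Hom_Obj(1)[OF c(1)] .
    have x1: "x \<in> el F (dom (p \<cdot> a))" using x pa by simp
    have x2: "ac F a x \<in> el F (dom p)" using ac_closed[OF F a x] .
    have l1: "linmap (sp (T G H) (cod q)) (sp TL X) (N (p \<cdot> a) q x)" using N1[OF e1 x1] pa e(2) by simp
    have l2: "linmap (sp (T G H) D) (sp TL X) (N p (c \<cdot> q) (ac F a x))" using N1[OF e2 x2] cq e(2) by simp
    show "N (p \<cdot> a) q x u = N p (c \<cdot> q) (ac F a x) (ac (T G H) c u)"
    proof (rule inn_ext[OF G H B sp_vect[OF T2_Obj(3) X] l1 linmap_comp[OF ac_linear[OF T2_Obj(2) c] l2] _ u])
      fix f'' g'' y w assume e'': "exact f'' g''" "cod f'' = cod q" and yw: "y \<in> el G (dom f'')" "w \<in> el H (cod g'')"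
      obtain f g f' g' where fl: "flag3 f g f' g' q f'' g''" "f \<cdot> f' = p" by (rule flag3_right[OF e(1) e''(1) e''(2)[symmetric]])
      note D = flag3D[OF fl(1)] and E = flag3_ends[OF fl(1)]
      have a2: "a \<in> hom A (dom f')" using a(1) E(1) fl(2) by simp
      note fl1 = flag3_iso_sub[OF fl(1) a2 a(2)] and fl2 = flag3_iso_13[OF fl(1) c]
      have v: "y \<in> el G (cod g')" "w \<in> el H (cod g)" using yw E by simp_all
      have c2: "c \<in> hom (cod f'') D" using c(1) e''(2) by simp
      have act: "ac (T G H) c (inn G H f'' g'' y w) = inn G H (c \<cdot> f'') (g'' \<cdot> inverse_arr c) y w"
        by (rule inn_action[OF G H e''(1) c2 c(2) yw])
      have f: "f \<in> hom (cod f') (cod f)" using exact_Hom(1)[OF D(1)] E(6) by simp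
      have pa': "f \<cdot> (f' \<cdot> a) = p \<cdot> a" using Comp_assoc[OF a2 exact_Hom(1)[OF D(2)] f] fl(2) by simp
      have sh: "inn F G (f' \<cdot> a) g' x y = inn F G f' g' (ac F a x) y" by (rule inn_shift_left[OF F G D(2) a2 a(2) x v(1)])
      show "N (p \<cdot> a) q x (inn G H f'' g'' y w) = N p (c \<cdot> q) (ac F a x) (ac (T G H) c (inn G H f'' g'' y w))"
        unfolding act N2[OF fl1 pa' x1 v] N2[OF fl2 fl(2) x2 v] by (simp add: inl_def sh)
    qed
  qed
  from inn_universal[OF F T2_Obj(2) X this] obtain m where m: "linmap (sp TR X) (sp TL X) m"
    "\<And>p q x u. exact p q \<Longrightarrow> cod p = X \<Longrightarrow> x \<in> el F (dom p) \<Longrightarrow> u \<in> el (T G H) (cod q) \<Longrightarrow> m (inn F (T G H) p q x u) = N p q x u"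
    by blast
  have "m (inr (f \<cdot> f') q f'' g'' x y w) = inl f g f' g' x y w"
    if fl: "flag3 f g f' g' q f'' g''" and c: "cod f = X" and v: "x \<in> el F (dom f')" "y \<in> el G (cod g')" "w \<in> el H (cod g)"
    for f g f' g' q f'' g'' x y w
  proof -
    note D = flag3D[OF fl] and E = flag3_ends[OF fl]
    have cl: "inn G H f'' g'' y w \<in> el (T G H) (cod q)" using inn_closed[OF G H D(5), of y w] v E by simp
    have x: "x \<in> el F (dom (f \<cdot> f'))" "cod (f \<cdot> f') = X" using v c E by simp_all
    from m(2)[OF D(4) x(2,1) cl] show ?thesis unfolding inr_def N2[OF fl refl x(1) v(2,3)] .
  qed
  with m(1) show ?thesis by blast
qed

text \<open>On symbols of one flag the two constructed families exchange \<open>inl\<close> and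
  \<open>inr\<close>, so they are mutually inverse. Naturality on isomorphisms of \<open>X\<close>
  is transport of the whole flag by \<open>flag3_iso_03\<close>.\<close>

lemma associator_exists:
  "\<exists>a. a \<in> Hom K TL TR \<and> iso_arr K a \<and>
    (\<forall>f g f' g' q f'' g'' x y w. flag3 f g f' g' q f'' g'' \<longrightarrow> x \<in> el F (dom f') \<longrightarrow> y \<in> el G (cod g') \<longrightarrow>
       w \<in> el H (cod g) \<longrightarrow> cmp a (cod f) (inl f g f' g' x y w) = inr (f \<cdot> f') q f'' g'' x y w)"
proof -
  obtain h where "\<forall>X\<in>Obj C. linmap (sp TL X) (sp TR X) (h X) \<and>
    (\<forall>f g f' g' q f'' g'' x y w. flag3 f g f' g' q f'' g'' \<longrightarrow> cod f = X \<longrightarrow> x \<in> el F (dom f') \<longrightarrow> y \<in> el G (cod g') \<longrightarrow>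
       w \<in> el H (cod g) \<longrightarrow> h X (inl f g f' g' x y w) = inr (f \<cdot> f') q f'' g'' x y w)"
    using bchoice[OF ballI[OF assoc_exists]] ..
  note h = conjunct1[OF bspec[OF this]] conjunct2[OF bspec[OF this], rule_format]
  obtain k where "\<forall>X\<in>Obj C. linmap (sp TR X) (sp TL X) (k X) \<and>
    (\<forall>f g f' g' q f'' g'' x y w. flag3 f g f' g' q f'' g'' \<longrightarrow> cod f = X \<longrightarrow> x \<in> el F (dom f') \<longrightarrow> y \<in> el G (cod g') \<longrightarrow>
       w \<in> el H (cod g) \<longrightarrow> k X (inr (f \<cdot> f') q f'' g'' x y w) = inl f g f' g' x y w)"
    using bchoice[OF ballI[OF coassoc_exists]] ..
  note k = conjunct1[OF bspec[OF this]] conjunct2[OF bspec[OF this], rule_format]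
  have nat: "h Y (ac TL i v) = ac TR i (h X v)"
    if i: "i \<in> hom X Y" "iso i" and v: "v \<in> el TL X" for X Y i v
  proof (rule inl_ext[OF Hom_Obj(1)[OF i(1)] sp_vect[OF T2_Obj(4) Hom_Obj(2)[OF i(1)]]
        linmap_comp[OF ac_linear[OF T2_Obj(3) i] h(1)[OF Hom_Obj(2)[OF i(1)]]] linmap_comp[OF h(1)[OF Hom_Obj(1)[OF i(1)]] ac_linear[OF T2_Obj(4) i]] _ v])
    fix f g f' g' x y w assume e: "exact f g" "cod f = X" and e': "exact f' g'" "cod f' = dom f"
      and p: "x \<in> el F (dom f')" "y \<in> el G (cod g')" "w \<in> el H (cod g)"
    obtain q f'' g'' where fl: "flag3 f g f' g' q f'' g''" by (rule flag3_left[OF e(1) e'])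
    note D = flag3D[OF fl] and E = flag3_ends[OF fl] and o = Hom_Obj[OF i(1)]
    have i': "i \<in> hom (cod f) Y" "i \<in> hom (cod (f \<cdot> f')) Y" using i(1) e(2) E by simp_all
    note fl' = flag3_iso_03[OF fl i'(1) i(2)]
    have f: "f \<in> hom (dom f) X" "f' \<in> hom (dom f') (dom f)" using exact_Hom(1)[OF e(1)] exact_Hom(1)[OF e'(1)] e(2) e'(2) by simp_all
    have cd: "cod (i \<cdot> f) = Y" "cod (g \<cdot> inverse_arr i) = cod g"
      using HomD(3)[OF Comp_Hom[OF f(1) i(1)]] HomD(3)[OF Comp_Hom[OF inverse_arr(1)[OF i'(1) i(2)] exact_Hom(2)[OF e(1)]]] by simp_all
    have u: "inn F G f' g' x y \<in> el (T F G) (dom f)" using inn_closed[OF F G e'(1) p(1,2)] e'(2) by simp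
    have u': "inn G H f'' g'' y w \<in> el (T G H) (cod q)" "x \<in> el F (dom (f \<cdot> f'))"
      using inn_closed[OF G H D(5), of y w] p E by simp_all
    have "h Y (ac TL i (inl f g f' g' x y w)) = h Y (inl (i \<cdot> f) (g \<cdot> inverse_arr i) f' g' x y w)"
      unfolding inl_def inn_action[OF T2_Obj(1) H e(1) i'(1) i(2) u p(3)] ..
    also have "\<dots> = inr (i \<cdot> f \<cdot> f') (q \<cdot> inverse_arr i) f'' g'' x y w"
      by (rule h(2)[OF o(2) fl' cd(1) p(1,2)]) (simp add: cd p)
    also have "\<dots> = ac TR i (inr (f \<cdot> f') q f'' g'' x y w)"
      unfolding inr_def inn_action[OF F T2_Obj(2) D(4) i'(2) i(2) u'(2,1)] Comp_assoc[OF f(2,1) i(1)] ..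
    also have "inr (f \<cdot> f') q f'' g'' x y w = h X (inl f g f' g' x y w)"
      by (rule h(2)[OF o(1) fl e(2) p, symmetric])
    finally show "h Y (ac TL i (inl f g f' g' x y w)) = ac TR i (h X (inl f g f' g' x y w))" .
  qed
  have kh: "k X (h X v) = v" if X: "X \<in> Obj C" and v: "v \<in> el TL X" for X v
  proof (rule inl_ext[OF X sp_vect[OF T2_Obj(3) X] linmap_comp[OF h(1)[OF X] k(1)[OF X]] linmap_id _ v])
    fix f g f' g' x y w assume e: "exact f g" "cod f = X" and e': "exact f' g'" "cod f' = dom f"
      and p: "x \<in> el F (dom f')" "y \<in> el G (cod g')" "w \<in> el H (cod g)"
    obtain q f'' g'' where fl: "flag3 f g f' g' q f'' g''" by (rule flag3_left[OF e(1) e'])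
    show "k X (h X (inl f g f' g' x y w)) = inl f g f' g' x y w"
      unfolding h(2)[OF X fl e(2) p] by (rule k(2)[OF X fl e(2) p])
  qed
  have hk: "h X (k X v) = v" if X: "X \<in> Obj C" and v: "v \<in> el TR X" for X v
  proof (rule inr_ext[OF X sp_vect[OF T2_Obj(4) X] linmap_comp[OF k(1)[OF X] h(1)[OF X]] linmap_id _ v])
    fix p q f'' g'' x y w assume e: "exact p q" "cod p = X" and e'': "exact f'' g''" "cod q = cod f''"
      and v: "x \<in> el F (dom p)" "y \<in> el G (dom f'')" "w \<in> el H (cod g'')"
    obtain f g f' g' where fl: "flag3 f g f' g' q f'' g''" "f \<cdot> f' = p" by (rule flag3_right[OF e(1) e''])
    note E = flag3_ends[OF fl(1)]
    have p: "cod f = X" "x \<in> el F (dom f')" "y \<in> el G (cod g')" "w \<in> el H (cod g)"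
      using v e(2) E fl(2) by simp_all
    show "h X (k X (inr p q f'' g'' x y w)) = inr p q f'' g'' x y w"
      unfolding fl(2)[symmetric] k(2)[OF X fl(1) p] by (rule h(2)[OF X fl(1) p])
  qed
  note I = K_iso_mk_nt[OF T2_Obj(3,4) h(1) k(1) nat kh hk]
  have "cmp (mk_nt TL TR h) (cod f) (inl f g f' g' x y w) = inr (f \<cdot> f') q f'' g'' x y w"
    if fl: "flag3 f g f' g' q f'' g''" and p: "x \<in> el F (dom f')" "y \<in> el G (cod g')" "w \<in> el H (cod g)"
    for f g f' g' q f'' g'' x y w
  proof -
    have X: "cod f \<in> Obj C" by (rule exact_Obj(2)[OF flag3D(1)[OF fl]])
    have "inl f g f' g' x y w \<in> el TL (cod f)"
      by (rule linmap_closed[OF inl_linear(1)[OF fl p(2,3)] p(1)])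
    then show ?thesis using h(2)[OF X fl refl p] cmp_mk_nt[OF X] by simp
  qed
  then show ?thesis using I by blast
qed

text \<open>Since the symbols \<open>inl\<close> generate and each of them extends to a flag, the
  listed properties determine the arrow.\<close>

definition associator where
  "associator = (SOME a. a \<in> Hom K TL TR \<and> iso_arr K a \<and>
    (\<forall>f g f' g' q f'' g'' x y w. flag3 f g f' g' q f'' g'' \<longrightarrow> x \<in> el F (dom f') \<longrightarrow> y \<in> el G (cod g') \<longrightarrow>
       w \<in> el H (cod g) \<longrightarrow> cmp a (cod f) (inl f g f' g' x y w) = inr (f \<cdot> f') q f'' g'' x y w))"

lemma associator:
  shows "associator \<in> Hom K TL TR" "iso_arr K associator"
    "flag3 f g f' g' q f'' g'' \<Longrightarrow> x \<in> el F (dom f') \<Longrightarrow> y \<in> el G (cod g') \<Longrightarrow> w \<in> el H (cod g) \<Longrightarrow>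
      cmp associator (cod f) (inn (T F G) H f g (inn F G f' g' x y) w) = inn F (T G H) (f \<cdot> f') q x (inn G H f'' g'' y w)"
  using someI_ex[OF associator_exists, folded associator_def] unfolding inl_def inr_def by blast+

end

text \<open>On a symbol, \<open>s\<close>, \<open>t\<close> and \<open>u\<close> act on the three
  vectors and leave the flag alone, while the associator changes only the bracketing of the
  flag.\<close>

lemma associator_natural:
  assumes s: "s \<in> Hom K F F'" and t: "t \<in> Hom K G G'" and u: "u \<in> Hom K H H'"
  shows "associator F' G' H' \<cdot>\<^bsub>K\<^esub> on_arr (hall_tensor C z) (on_arr (hall_tensor C z) (s, t), u) =
    on_arr (hall_tensor C z) (s, on_arr (hall_tensor C z) (t, u)) \<cdot>\<^bsub>K\<^esub> associator F G H"
proof -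
  note O = K.Hom_Obj(1)[OF s] K.Hom_Obj(1)[OF t] K.Hom_Obj(1)[OF u] and O' = K.Hom_Obj(2)[OF s] K.Hom_Obj(2)[OF t] K.Hom_Obj(2)[OF u]
  note st = T_arr_Hom[OF s t] and tu = T_arr_Hom[OF t u]
  note st_u = T_arr_Hom[OF st u] and s_tu = T_arr_Hom[OF s tu]
  note a = associator[OF O] and a' = associator[OF O']
  note L = K.Comp_Hom[OF st_u a'(1)] and R = K.Comp_Hom[OF a(1) s_tu]
  show ?thesis
  proof (rule K_eqI[OF L R])
    fix X v assume X: "X \<in> Obj C" and v: "v \<in> el (TL F G H) X"
    show "cmp (associator F' G' H' \<cdot>\<^bsub>K\<^esub> on_arr (hall_tensor C z) (on_arr (hall_tensor C z) (s, t), u)) X v =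
      cmp (on_arr (hall_tensor C z) (s, on_arr (hall_tensor C z) (t, u)) \<cdot>\<^bsub>K\<^esub> associator F G H) X v"
    proof (rule inl_ext[OF O X sp_vect[OF T2_Obj(4)[OF O'] X] cmp_linear[OF L X] cmp_linear[OF R X] _ v])
      fix f g f' g' x y w assume e: "exact f g" "cod f = X" and e': "exact f' g'" "cod f' = dom f"
        and p: "x \<in> el F (dom f')" "y \<in> el G (cod g')" "w \<in> el H (cod g)"
      obtain q f'' g'' where fl: "flag3 f g f' g' q f'' g''" by (rule flag3_left[OF e(1) e'])
      note D = flag3D[OF fl] and E = flag3_ends[OF fl]
      have u0: "inn F G f' g' x y \<in> el (T F G) (dom f)" using inn_closed[OF O(1,2) e'(1) p(1,2)] e'(2) by simp
      have p': "x \<in> el F (dom (f \<cdot> f'))" "y \<in> el G (dom f'')" "w \<in> el H (cod g'')" using p E by simp_all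
      have u1: "inn G H f'' g'' y w \<in> el (T G H) (cod q)" using inn_closed[OF O(2,3) D(5) p'(2,3)] E by simp
      have l: "inl F G H f g f' g' x y w \<in> el (TL F G H) X"
        using linmap_closed[OF inl_linear(1)[OF O fl p(2,3)] p(1)] e(2) by simp
      note 1 = T_arr_inn[OF st u e(1) u0 p(3), unfolded T_arr_inn[OF s t e'(1) p(1,2), unfolded e'(2)]]
      note 2 = T_arr_inn[OF s tu D(4) p'(1) u1] and 3 = T_arr_inn[OF t u D(5) p'(2,3)]
      note d = exact_Obj[OF e(1)] exact_Obj[OF e'(1)]
      note c = cmp_closed[OF s d(4) p(1)] cmp_closed[OF t d(6) p(2)] cmp_closed[OF u d(3) p(3)]
      show "cmp (associator F' G' H' \<cdot>\<^bsub>K\<^esub> on_arr (hall_tensor C z) (on_arr (hall_tensor C z) (s, t), u)) X (inl F G H f g f' g' x y w) =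
        cmp (on_arr (hall_tensor C z) (s, on_arr (hall_tensor C z) (t, u)) \<cdot>\<^bsub>K\<^esub> associator F G H) X (inl F G H f g f' g' x y w)"
        unfolding cmp_comp[OF st_u a'(1) X l] cmp_comp[OF a(1) s_tu X l]
        unfolding inl_def[OF O] e(2)[symmetric] a(3)[OF fl p] 1 a'(3)[OF fl c] 2[unfolded E 3[unfolded E]] ..
    qed
  qed
qed

section \<open>The unitors\<close>

text \<open>Makes the universal property uniform in \<open>A\<close>, without a case split at each
  use: away from zero objects the zero map serves.\<close>

lemma one_universal_total:
  fixes U :: "'v vspace"
  assumes A: "A \<in> Obj C" and U: "U \<in> Obj vect" and u: "u \<in> carrier U"
  shows "\<exists>m. linmap (sp one_fct A) U m \<and> (zero_object C A \<longrightarrow> m (one A) = u)"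
proof (cases "zero_object C A")
  case True
  then show ?thesis using one_universal[OF True U u] by blast
next
  case False
  then show ?thesis using linmap_zero_map[OF U] by blast
qed

lemma one_ext_total:
  fixes U :: "'v vspace"
  assumes A: "A \<in> Obj C" and U: "U \<in> Obj vect" and m: "linmap (sp one_fct A) U m" and n: "linmap (sp one_fct A) U n"
    and eq: "zero_object C A \<Longrightarrow> m (one A) = n (one A)" and v: "v \<in> el one_fct A"
  shows "m v = n v"
proof (cases "zero_object C A")
  case True
  then show ?thesis using one_ext[OF True U m n eq v] by blast
next
  case False
  have V: "sp one_fct A \<in> Obj vect" by (rule sp_vect[OF one_fct_Obj A])
  have "v = \<zero>\<^bsub>sp one_fct A\<^esub>" using v sp_one_zero[OF A False] by simp
  then show ?thesis using linmap_zero[OF V U m] linmap_zero[OF V U n] by simp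
qed

text \<open>The unit object is one-dimensional or zero at \<open>A\<close>, and \<open>scale A U u\<close> is the linear map to \<open>U\<close> with \<open>one A \<mapsto> u\<close>;
  on objects that are not zero objects it is the zero map.\<close>

definition scale :: "'o \<Rightarrow> 'v vspace \<Rightarrow> 'v \<Rightarrow> 'v \<Rightarrow> 'v" where
  "scale A U u = (SOME m. linmap (sp one_fct A) U m \<and> (zero_object C A \<longrightarrow> m (one A) = u))"

context
  fixes A and U :: "'v vspace"
  assumes A: "A \<in> Obj C" and U: "U \<in> Obj vect"
begin

lemma scale:
  assumes "u \<in> carrier U"
  shows "linmap (sp one_fct A) U (scale A U u)" "zero_object C A \<Longrightarrow> scale A U u (one A) = u"
  using someI_ex[OF one_universal_total[OF A U assms]] unfolding scale_def by blast+

text \<open>For each \<open>u\<close> the map \<open>scale A U u\<close> is picked separately; its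
  dependence on \<open>u\<close> is found to be linear by comparison at \<open>one A\<close>,
  through \<open>one_ext_total\<close>.\<close>

lemma scale_linear:
  assumes V: "V \<in> Obj vect" and h: "linmap V U h" and i: "i \<in> el one_fct A"
  shows "linmap V U (\<lambda>y. scale A U (h y) i)"
proof (rule linmapI)
  fix y assume y: "y \<in> carrier V"
  show "scale A U (h y) i \<in> carrier U" by (rule linmap_closed[OF scale(1)[OF linmap_closed[OF h y]] i])
next
  fix y y' assume y: "y \<in> carrier V" "y' \<in> carrier V"
  note c = linmap_closed[OF h y(1)] linmap_closed[OF h y(2)] vs_add[OF U linmap_closed[OF h y(1)] linmap_closed[OF h y(2)]]
  show "scale A U (h (y \<oplus>\<^bsub>V\<^esub> y')) i = scale A U (h y) i \<oplus>\<^bsub>U\<^esub> scale A U (h y') i"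
    unfolding linmap_add[OF h y]
    by (rule one_ext_total[OF A U scale(1)[OF c(3)] linmap_sum[OF U scale(1)[OF c(1)] scale(1)[OF c(2)]] _ i])
       (simp add: scale(2)[OF c(1)] scale(2)[OF c(2)] scale(2)[OF c(3)])
next
  fix b y assume y: "y \<in> carrier V"
  note c = linmap_closed[OF h y] vs_smult[OF U linmap_closed[OF h y], of b]
  show "scale A U (h (b \<odot>\<^bsub>V\<^esub> y)) i = b \<odot>\<^bsub>U\<^esub> scale A U (h y) i"
    unfolding linmap_smult[OF h y]
    by (rule one_ext_total[OF A U scale(1)[OF c(2)] linmap_scale[OF U scale(1)[OF c(1)]] _ i])
       (simp add: scale(2)[OF c(1)] scale(2)[OF c(2)])
qed

end

text \<open>Both sides are linear in \<open>i\<close>, and an isomorphism takes \<open>one A\<close>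
  to \<open>one B\<close>.\<close>

lemma scale_ac:
  fixes U :: "'v vspace"
  assumes U: "U \<in> Obj vect" and u: "u \<in> carrier U" and a: "a \<in> hom A B" "iso a" and i: "i \<in> el one_fct A"
  shows "scale B U u (ac one_fct a i) = scale A U u i"
proof (rule one_ext_total[OF Hom_Obj(1)[OF a(1)] U linmap_comp[OF ac_linear[OF one_fct_Obj a] scale(1)[OF Hom_Obj(2)[OF a(1)] U u]]
      scale(1)[OF Hom_Obj(1)[OF a(1)] U u] _ i])
  assume A: "zero_object C A"
  show "scale B U u (ac one_fct a (one A)) = scale A U u (one A)"
    unfolding ac_one[OF A a] scale(2)[OF Hom_Obj(1)[OF a(1)] U u A]
    by (rule scale(2)[OF Hom_Obj(2)[OF a(1)] U u iso_zero_object[OF a A]])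
qed

lemma iso_zero_object_iff:
  assumes "a \<in> hom A B" "iso a"
  shows "zero_object C A \<longleftrightarrow> zero_object C B"
  using iso_zero_object[OF assms] iso_zero_object[OF inverse_arr(1,4)[OF assms]] by blast

lemma zero_ends:
  assumes X: "X \<in> Obj C"
  shows "dom (from_zero C z X) = z" "cod (from_zero C z X) = X" "dom (to_zero C z X) = X" "cod (to_zero C z X) = z"
    "dom (Ident C X) = X" "cod (Ident C X) = X"
  using HomD[OF from_zero[OF X]] HomD[OF to_zero[OF X]] HomD[OF Ident_Hom[OF X]] by simp_all

context
  fixes F
  assumes F: "F \<in> Obj K"
begin

text \<open>If the subobject is zero, the quotient arrow \<open>g\<close> is an isomorphism, and its
  inverse carries the second vector to \<open>X\<close>. Sequences with nonzero subobject contribute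
  0, in keeping with the support of the unit.\<close>

lemma lunit_map_exists:
  assumes X: "X \<in> Obj C"
  shows "\<exists>h. linmap (sp (T one_fct F) X) (sp F X) h \<and>
    (\<forall>f g y. exact f g \<longrightarrow> cod f = X \<longrightarrow> zero_object C (dom f) \<longrightarrow> y \<in> el F (cod g) \<longrightarrow>
       h (inn one_fct F f g (one (dom f)) y) = ac F (inverse_arr g) y)"
proof -
  let ?U = "sp F X"
  have U: "?U \<in> Obj vect" by (rule sp_vect[OF F X])
  \<comment> \<open>The default 0 makes \<open>L f g\<close> linear for every exact pair, also where
    \<open>g\<close> has no inverse.\<close>
  define L where "L f g y = (if zero_object C (dom f) then ac F (inverse_arr g) y else \<zero>\<^bsub>?U\<^esub>)" for f g y
  have L: "linmap (sp F (cod g)) ?U (L f g)" if e: "exact f g" "cod f = X" for f g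
  proof (cases "zero_object C (dom f)")
    case True
    have g: "g \<in> hom X (cod g)" using exact_Hom(2)[OF e(1)] e(2) by simp
    note j = inverse_arr[OF g exact_zero_left_iso[OF e(1) True]]
    show ?thesis using True ac_linear[OF F j(1,4)] by (simp add: L_def[abs_def])
  next
    case False
    then show ?thesis using linmap_zero_map[OF U] by (simp add: L_def[abs_def])
  qed
  have "hall_family one_fct F X ?U (\<lambda>f g i y. scale (dom f) ?U (L f g y) i)"
  proof (rule hall_familyI[OF U _ _ _ one_fct_Obj F])
    fix f g y assume e: "exact f g" "cod f = X" and y: "y \<in> el F (cod g)"
    show "linmap (sp one_fct (dom f)) ?U (\<lambda>i. scale (dom f) ?U (L f g y) i)"
      by (rule scale(1)[OF exact_Obj(1)[OF e(1)] U linmap_closed[OF L[OF e] y]])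
  next
    fix f g i assume e: "exact f g" "cod f = X" and i: "i \<in> el one_fct (dom f)"
    show "linmap (sp F (cod g)) ?U (\<lambda>y. scale (dom f) ?U (L f g y) i)"
      using exact_Obj[OF e(1)] by (intro scale_linear[OF _ U sp_vect[OF F] L[OF e] i])
  next
    fix f g a c A D i y
    assume e: "exact f g" "cod f = X" and a: "a \<in> hom A (dom f)" "iso a" and c: "c \<in> hom (cod g) D" "iso c"
      and i: "i \<in> el one_fct A" and y: "y \<in> el F (cod g)"
    note H = exact_Hom[OF e(1), unfolded e(2)]
    note da = HomD(2)[OF Comp_Hom[OF a(1) H(1)]] and dc = HomD(3)[OF Comp_Hom[OF H(2) c(1)]]
    have e': "exact (f \<cdot> a) g" "cod (f \<cdot> a) = X" using exact_iso_left[OF e(1) a] HomD(3)[OF Comp_Hom[OF a(1) H(1)]] by simp_all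
    note Ly = linmap_closed[OF L[OF e'] y]
    have "L (f \<cdot> a) g y = L f (c \<cdot> g) (ac F c y)"
    proof (cases "zero_object C A")
      case True
      then have Z: "zero_object C (dom f)" by (rule iso_zero_object[OF a])
      note gi = exact_zero_left_iso[OF e(1) Z]
      \<comment> \<open>The inverse of \<open>c\<close> undoes the action of \<open>c\<close> on
        \<open>y\<close>, so both sides of the balancing relation reduce to the inverse of
        \<open>g\<close>.\<close>
      have "ac F (inverse_arr (c \<cdot> g)) (ac F c y) = ac F (inverse_arr g) (ac F (inverse_arr c) (ac F c y))"
        unfolding inverse_arr_comp[OF H(2) gi c]
        by (rule ac_comp[OF F inverse_arr(1,4)[OF c] inverse_arr(1,4)[OF H(2) gi] ac_closed[OF F c y]])
      then show ?thesis using True Z by (simp add: L_def da ac_inverse(1)[OF F c y])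
    next
      case False
      then show ?thesis using iso_zero_object_iff[OF a] by (simp add: L_def da)
    qed
    then show "scale (dom (f \<cdot> a)) ?U (L (f \<cdot> a) g y) i = scale (dom f) ?U (L f (c \<cdot> g) (ac F c y)) (ac one_fct a i)"
      using scale_ac[OF U Ly a i] by (simp add: da)
  qed
  from inn_universal[OF one_fct_Obj F X this] obtain h where h: "linmap (sp (T one_fct F) X) ?U h"
    "\<And>f g i y. exact f g \<Longrightarrow> cod f = X \<Longrightarrow> i \<in> el one_fct (dom f) \<Longrightarrow> y \<in> el F (cod g) \<Longrightarrow>
       h (inn one_fct F f g i y) = scale (dom f) ?U (L f g y) i" by blast
  have "h (inn one_fct F f g (one (dom f)) y) = ac F (inverse_arr g) y"
    if e: "exact f g" "cod f = X" and Z: "zero_object C (dom f)" and y: "y \<in> el F (cod g)" for f g y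
    unfolding h(2)[OF e one_closed[OF Z] y] scale(2)[OF zero_Obj[OF Z] U linmap_closed[OF L[OF e] y] Z] using Z by (simp add: L_def)
  with h(1) show ?thesis by blast
qed

text \<open>If the quotient is zero, \<open>f\<close> is an isomorphism and carries the first vector
  to \<open>X\<close> directly.\<close>

lemma runit_map_exists:
  assumes X: "X \<in> Obj C"
  shows "\<exists>h. linmap (sp (T F one_fct) X) (sp F X) h \<and>
    (\<forall>f g x. exact f g \<longrightarrow> cod f = X \<longrightarrow> zero_object C (cod g) \<longrightarrow> x \<in> el F (dom f) \<longrightarrow>
       h (inn F one_fct f g x (one (cod g))) = ac F f x)"
proof -
  let ?U = "sp F X"
  have U: "?U \<in> Obj vect" by (rule sp_vect[OF F X])
  define R where "R f g x = (if zero_object C (cod g) then ac F f x else \<zero>\<^bsub>?U\<^esub>)" for f g x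
  have R: "linmap (sp F (dom f)) ?U (R f g)" if e: "exact f g" "cod f = X" for f g
  proof (cases "zero_object C (cod g)")
    case True
    have f: "f \<in> hom (dom f) X" using exact_Hom(1)[OF e(1)] e(2) by simp
    show ?thesis using True ac_linear[OF F f exact_zero_right_iso[OF e(1) True]] by (simp add: R_def[abs_def])
  next
    case False
    then show ?thesis using linmap_zero_map[OF U] by (simp add: R_def[abs_def])
  qed
  have "hall_family F one_fct X ?U (\<lambda>f g x i. scale (cod g) ?U (R f g x) i)"
  proof (rule hall_familyI[OF U _ _ _ F one_fct_Obj])
    fix f g i assume e: "exact f g" "cod f = X" and i: "i \<in> el one_fct (cod g)"
    show "linmap (sp F (dom f)) ?U (\<lambda>x. scale (cod g) ?U (R f g x) i)"
      using exact_Obj[OF e(1)] by (intro scale_linear[OF _ U sp_vect[OF F] R[OF e] i])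
  next
    fix f g x assume e: "exact f g" "cod f = X" and x: "x \<in> el F (dom f)"
    show "linmap (sp one_fct (cod g)) ?U (\<lambda>i. scale (cod g) ?U (R f g x) i)"
      by (rule scale(1)[OF exact_Obj(3)[OF e(1)] U linmap_closed[OF R[OF e] x]])
  next
    fix f g a c A D x i
    assume e: "exact f g" "cod f = X" and a: "a \<in> hom A (dom f)" "iso a" and c: "c \<in> hom (cod g) D" "iso c"
      and x: "x \<in> el F A" and i: "i \<in> el one_fct (cod g)"
    note H = exact_Hom[OF e(1), unfolded e(2)]
    note da = HomD(2)[OF Comp_Hom[OF a(1) H(1)]] and dc = HomD(3)[OF Comp_Hom[OF H(2) c(1)]]
    note xa = ac_closed[OF F a x]
    note Rx = linmap_closed[OF R[OF e] xa]
    have "R (f \<cdot> a) g x = R f g (ac F a x)" "R f (c \<cdot> g) (ac F a x) = R f g (ac F a x)"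
      using ac_comp[OF F a H(1) exact_zero_right_iso[OF e(1)] x] iso_zero_object_iff[OF c] by (simp_all add: R_def dc)
    then show "scale (cod g) ?U (R (f \<cdot> a) g x) i = scale (cod (c \<cdot> g)) ?U (R f (c \<cdot> g) (ac F a x)) (ac one_fct c i)"
      using scale_ac[OF U Rx c i] by (simp add: dc)
  qed
  from inn_universal[OF F one_fct_Obj X this] obtain h where h: "linmap (sp (T F one_fct) X) ?U h"
    "\<And>f g x i. exact f g \<Longrightarrow> cod f = X \<Longrightarrow> x \<in> el F (dom f) \<Longrightarrow> i \<in> el one_fct (cod g) \<Longrightarrow>
       h (inn F one_fct f g x i) = scale (cod g) ?U (R f g x) i" by blast
  have "h (inn F one_fct f g x (one (cod g))) = ac F f x"
    if e: "exact f g" "cod f = X" and Z: "zero_object C (cod g)" and x: "x \<in> el F (dom f)" for f g x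
    unfolding h(2)[OF e x one_closed[OF Z]] scale(2)[OF zero_Obj[OF Z] U linmap_closed[OF R[OF e] x] Z] using Z by (simp add: R_def)
  with h(1) show ?thesis by blast
qed

text \<open>The standard symbols over the split sequences with \<open>z\<close> at one end;
  \<open>lun\<close> and \<open>run\<close> turn out to be the inverses of the unitors.\<close>

abbreviation lun where
  "lun X y \<equiv> inn one_fct F (from_zero C z X) (Ident C X) (one z) y"

abbreviation run where
  "run X x \<equiv> inn F one_fct (Ident C X) (to_zero C z X) x (one z)"

lemma lun_linear: "X \<in> Obj C \<Longrightarrow> linmap (sp F X) (sp (T one_fct F) X) (lun X)"
  using inn_linear_right[OF one_fct_Obj F exact_zero_left, of X "one z"] one_closed[OF zero_z] by (simp add: zero_ends)

lemma run_linear: "X \<in> Obj C \<Longrightarrow> linmap (sp F X) (sp (T F one_fct) X) (run X)"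
  using inn_linear_left[OF F one_fct_Obj exact_zero_right, of X "one z"] one_closed[OF zero_z] by (simp add: zero_ends)

lemma lun_natural:
  assumes i: "i \<in> hom X Y" "iso i" and y: "y \<in> el F X"
  shows "lun Y (ac F i y) = ac (T one_fct F) i (lun X y)"
proof -
  note o = Hom_Obj[OF i(1)] and j = inverse_arr[OF i] and oz = one_closed[OF zero_z]
  have e: "exact (from_zero C z Y) (inverse_arr i)"
    using exact_iso_right[OF exact_zero_left[OF o(2)] _ j(4), of X] j(1) Ident_right[OF j(1)] zero_ends[OF o(2)] by simp
  have "lun Y (ac F i y) = inn one_fct F (from_zero C z Y) (inverse_arr i) (one z) y"
    using inn_shift_right[OF one_fct_Obj F e _ i(2), of Y "one z" y] i(1) y oz j(3) HomD(3)[OF j(1)] zero_ends[OF o(2)] by simp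
  also have "\<dots> = ac (T one_fct F) i (lun X y)"
    using inn_action[OF one_fct_Obj F exact_zero_left[OF o(1)] _ i(2), of Y "one z" y] i(1) y oz zero_ends[OF o(1)]
      from_zero_eq[OF Comp_Hom[OF from_zero[OF o(1)] i(1)]] Ident_left[OF j(1)] by simp
  finally show ?thesis .
qed

lemma run_natural:
  assumes i: "i \<in> hom X Y" "iso i" and x: "x \<in> el F X"
  shows "run Y (ac F i x) = ac (T F one_fct) i (run X x)"
proof -
  note o = Hom_Obj[OF i(1)] and j = inverse_arr[OF i] and oz = one_closed[OF zero_z]
  have "run Y (ac F i x) = inn F one_fct i (to_zero C z Y) x (one z)"
    using inn_shift_left[OF F one_fct_Obj exact_zero_right[OF o(2)] _ i(2), of X x "one z"] i(1) x oz Ident_left[OF i(1)] zero_ends[OF o(2)] by simp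
  also have "\<dots> = ac (T F one_fct) i (run X x)"
    using inn_action[OF F one_fct_Obj exact_zero_right[OF o(1)] _ i(2), of Y x "one z"] i(1) x oz zero_ends[OF o(1)]
      to_zero_eq[OF Comp_Hom[OF j(1) to_zero[OF o(1)]]] Ident_right[OF i(1)] by simp
  finally show ?thesis .
qed

text \<open>Shifting the isomorphism from \<open>z\<close> to \<open>dom f\<close> and the
  isomorphism \<open>g\<close> brings every symbol with zero subobject to standard form.\<close>

lemma lun_exact:
  assumes e: "exact f g" and Z: "zero_object C (dom f)" and y: "y \<in> el F (cod g)"
  shows "inn one_fct F f g (one (dom f)) y = lun (cod f) (ac F (inverse_arr g) y)"
proof -
  let ?X = "cod f" and ?A = "dom f"
  note H = exact_Hom[OF e] and o = exact_Obj[OF e] and oz = one_closed[OF zero_z]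
  have gi: "iso g" by (rule exact_zero_left_iso[OF e Z])
  note j = inverse_arr[OF H(2) gi] and a = from_zero[OF o(1)] zero_object_iso[OF Z]
  note y' = ac_closed[OF F j(1,4) y]
  have "inn one_fct F f g (one ?A) y = inn one_fct F (from_zero C z ?X) g (one z) y"
    using inn_shift_left[OF one_fct_Obj F e a oz y] ac_one[OF zero_z a] from_zero_eq[OF Comp_Hom[OF a(1) H(1)]] by simp
  also have "\<dots> = lun ?X (ac F (inverse_arr g) y)"
    using inn_shift_right[OF one_fct_Obj F exact_zero_left[OF o(2)] _ gi, of "cod g" "one z" "ac F (inverse_arr g) y"]
      H(2) oz y' ac_inverse(2)[OF F H(2) gi y] Ident_right[OF H(2)] zero_ends[OF o(2)] by simp
  finally show ?thesis .
qed

lemma run_exact: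
  assumes e: "exact f g" and Z: "zero_object C (cod g)" and x: "x \<in> el F (dom f)"
  shows "inn F one_fct f g x (one (cod g)) = run (cod f) (ac F f x)"
proof -
  let ?X = "cod f" and ?D = "cod g"
  note H = exact_Hom[OF e] and o = exact_Obj[OF e] and oz = one_closed[OF zero_z]
  have fi: "iso f" by (rule exact_zero_right_iso[OF e Z])
  note c = from_zero[OF o(3)] zero_object_iso[OF Z]
  note x' = ac_closed[OF F H(1) fi x]
  \<comment> \<open>Both arrows end in a zero object, so they agree.\<close>
  have cg: "from_zero C z ?D \<cdot> to_zero C z ?X = g"
    by (rule zero_object_unique(2)[OF Z Comp_Hom[OF to_zero[OF o(2)] c(1)] H(2)])
  have e2: "exact (Ident C ?X) g"
    using exact_iso_right[OF exact_zero_right[OF o(2)] _ c(2), of ?D] c(1) zero_ends[OF o(2)] cg by simp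
  have "inn F one_fct f g x (one ?D) = inn F one_fct (Ident C ?X) g (ac F f x) (one ?D)"
    using inn_shift_left[OF F one_fct_Obj e2 _ fi, of "dom f" x "one ?D"] H(1) x one_closed[OF Z] Ident_left[OF H(1)] zero_ends[OF o(2)] by simp
  also have "\<dots> = run ?X (ac F f x)"
    using inn_shift_right[OF F one_fct_Obj exact_zero_right[OF o(2)] _ c(2), of ?D "ac F f x" "one z"]
      c(1) x' oz cg ac_one[OF zero_z c] zero_ends[OF o(2)] by simp
  finally show ?thesis .
qed

text \<open>The last clause, that \<open>lun X\<close> is onto, lets later arguments take an
  arbitrary vector in standard form without a further appeal to generators.\<close>

lemma lunitor_exists:
  "\<exists>a. a \<in> Hom K (T one_fct F) F \<and> iso_arr K a \<and> (\<forall>X\<in>Obj C. \<forall>y\<in>el F X. cmp a X (lun X y) = y) \<and>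
     (\<forall>X\<in>Obj C. \<forall>v\<in>el (T one_fct F) X. \<exists>y\<in>el F X. v = lun X y)"
proof -
  note O = T_Obj[OF one_fct_Obj F]
  obtain h where "\<forall>X\<in>Obj C. linmap (sp (T one_fct F) X) (sp F X) (h X) \<and>
    (\<forall>f g y. exact f g \<longrightarrow> cod f = X \<longrightarrow> zero_object C (dom f) \<longrightarrow> y \<in> el F (cod g) \<longrightarrow>
       h X (inn one_fct F f g (one (dom f)) y) = ac F (inverse_arr g) y)"
    using bchoice[OF ballI[OF lunit_map_exists]] ..
  note h = conjunct1[OF bspec[OF this]] conjunct2[OF bspec[OF this], rule_format]
  have hk: "h X (lun X y) = y" if X: "X \<in> Obj C" and y: "y \<in> el F X" for X y
    using h(2)[OF X exact_zero_left[OF X], of y] y zero_z zero_ends[OF X] ac_Ident[OF F X y] inverse_arr_Ident[OF X] by simp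
  have kh: "lun X (h X v) = v" if X: "X \<in> Obj C" and v: "v \<in> el (T one_fct F) X" for X v
  proof (rule inn_ext[OF one_fct_Obj F X sp_vect[OF O X] linmap_comp[OF h(1)[OF X] lun_linear[OF X]] linmap_id _ v])
    fix f g i y assume e: "exact f g" "cod f = X" and i: "i \<in> el one_fct (dom f)" and y: "y \<in> el F (cod g)"
    note l = inn_linear_left[OF one_fct_Obj F e(1) y, unfolded e(2)]
    show "lun X (h X (inn one_fct F f g i y)) = inn one_fct F f g i y"
    proof (rule one_ext_total[OF exact_Obj(1)[OF e(1)] sp_vect[OF O X] linmap_comp[OF l linmap_comp[OF h(1)[OF X] lun_linear[OF X]]] l _ i])
      assume Z: "zero_object C (dom f)"
      show "lun X (h X (inn one_fct F f g (one (dom f)) y)) = inn one_fct F f g (one (dom f)) y"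
        unfolding h(2)[OF X e Z y] unfolding lun_exact[OF e(1) Z y] e(2) ..
    qed
  qed
  have nat: "h Y (ac (T one_fct F) i v) = ac F i (h X v)"
    if i: "i \<in> hom X Y" "iso i" and v: "v \<in> el (T one_fct F) X" for X Y i v
  proof -
    note o = Hom_Obj[OF i(1)] and hv = linmap_closed[OF h(1)[OF Hom_Obj(1)[OF i(1)]] v]
    show ?thesis using lun_natural[OF i hv] kh[OF o(1) v] hk[OF o(2) ac_closed[OF F i hv]] by simp
  qed
  note I = K_iso_mk_nt[OF O F h(1) lun_linear nat kh hk]
  have "cmp (mk_nt (T one_fct F) F h) X (lun X y) = y" if X: "X \<in> Obj C" and y: "y \<in> el F X" for X y
    using hk[OF X y] cmp_mk_nt[OF X linmap_closed[OF lun_linear[OF X] y]] by simp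
  moreover have "\<exists>y\<in>el F X. v = lun X y" if X: "X \<in> Obj C" and v: "v \<in> el (T one_fct F) X" for X v
    using kh[OF X v] linmap_closed[OF h(1)[OF X] v] by (intro bexI[of _ "h X v"]) simp_all
  ultimately show ?thesis using I by blast
qed

lemma runitor_exists:
  "\<exists>a. a \<in> Hom K (T F one_fct) F \<and> iso_arr K a \<and> (\<forall>X\<in>Obj C. \<forall>x\<in>el F X. cmp a X (run X x) = x) \<and>
     (\<forall>X\<in>Obj C. \<forall>v\<in>el (T F one_fct) X. \<exists>x\<in>el F X. v = run X x)"
proof -
  note O = T_Obj[OF F one_fct_Obj]
  obtain h where "\<forall>X\<in>Obj C. linmap (sp (T F one_fct) X) (sp F X) (h X) \<and>
    (\<forall>f g x. exact f g \<longrightarrow> cod f = X \<longrightarrow> zero_object C (cod g) \<longrightarrow> x \<in> el F (dom f) \<longrightarrow>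
       h X (inn F one_fct f g x (one (cod g))) = ac F f x)"
    using bchoice[OF ballI[OF runit_map_exists]] ..
  note h = conjunct1[OF bspec[OF this]] conjunct2[OF bspec[OF this], rule_format]
  have hk: "h X (run X x) = x" if X: "X \<in> Obj C" and x: "x \<in> el F X" for X x
    using h(2)[OF X exact_zero_right[OF X], of x] x zero_z zero_ends[OF X] ac_Ident[OF F X x] by simp
  have kh: "run X (h X v) = v" if X: "X \<in> Obj C" and v: "v \<in> el (T F one_fct) X" for X v
  proof (rule inn_ext[OF F one_fct_Obj X sp_vect[OF O X] linmap_comp[OF h(1)[OF X] run_linear[OF X]] linmap_id _ v])
    fix f g x i assume e: "exact f g" "cod f = X" and x: "x \<in> el F (dom f)" and i: "i \<in> el one_fct (cod g)"
    note l = inn_linear_right[OF F one_fct_Obj e(1) x, unfolded e(2)]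
    show "run X (h X (inn F one_fct f g x i)) = inn F one_fct f g x i"
    proof (rule one_ext_total[OF exact_Obj(3)[OF e(1)] sp_vect[OF O X] linmap_comp[OF l linmap_comp[OF h(1)[OF X] run_linear[OF X]]] l _ i])
      assume Z: "zero_object C (cod g)"
      show "run X (h X (inn F one_fct f g x (one (cod g)))) = inn F one_fct f g x (one (cod g))"
        unfolding h(2)[OF X e Z x] unfolding run_exact[OF e(1) Z x] e(2) ..
    qed
  qed
  have nat: "h Y (ac (T F one_fct) i v) = ac F i (h X v)"
    if i: "i \<in> hom X Y" "iso i" and v: "v \<in> el (T F one_fct) X" for X Y i v
  proof -
    note o = Hom_Obj[OF i(1)] and hv = linmap_closed[OF h(1)[OF Hom_Obj(1)[OF i(1)]] v]
    show ?thesis using run_natural[OF i hv] kh[OF o(1) v] hk[OF o(2) ac_closed[OF F i hv]] by simp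
  qed
  note I = K_iso_mk_nt[OF O F h(1) run_linear nat kh hk]
  have "cmp (mk_nt (T F one_fct) F h) X (run X x) = x" if X: "X \<in> Obj C" and x: "x \<in> el F X" for X x
    using hk[OF X x] cmp_mk_nt[OF X linmap_closed[OF run_linear[OF X] x]] by simp
  moreover have "\<exists>x\<in>el F X. v = run X x" if X: "X \<in> Obj C" and v: "v \<in> el (T F one_fct) X" for X v
    using kh[OF X v] linmap_closed[OF h(1)[OF X] v] by (intro bexI[of _ "h X v"]) simp_all
  ultimately show ?thesis using I by blast
qed

definition lunitor where
  "lunitor = (SOME a. a \<in> Hom K (T one_fct F) F \<and> iso_arr K a \<and> (\<forall>X\<in>Obj C. \<forall>y\<in>el F X. cmp a X (lun X y) = y) \<and>
     (\<forall>X\<in>Obj C. \<forall>v\<in>el (T one_fct F) X. \<exists>y\<in>el F X. v = lun X y))"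

definition runitor where
  "runitor = (SOME a. a \<in> Hom K (T F one_fct) F \<and> iso_arr K a \<and> (\<forall>X\<in>Obj C. \<forall>x\<in>el F X. cmp a X (run X x) = x) \<and>
     (\<forall>X\<in>Obj C. \<forall>v\<in>el (T F one_fct) X. \<exists>x\<in>el F X. v = run X x))"

lemma lunitor: "lunitor \<in> Hom K (T one_fct F) F" "iso_arr K lunitor"
    "X \<in> Obj C \<Longrightarrow> y \<in> el F X \<Longrightarrow> cmp lunitor X (lun X y) = y"
    "X \<in> Obj C \<Longrightarrow> v \<in> el (T one_fct F) X \<Longrightarrow> \<exists>y\<in>el F X. v = lun X y"
  using someI_ex[OF lunitor_exists, folded lunitor_def] by blast+

lemma runitor: "runitor \<in> Hom K (T F one_fct) F" "iso_arr K runitor"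
    "X \<in> Obj C \<Longrightarrow> x \<in> el F X \<Longrightarrow> cmp runitor X (run X x) = x"
    "X \<in> Obj C \<Longrightarrow> v \<in> el (T F one_fct) X \<Longrightarrow> \<exists>x\<in>el F X. v = run X x"
  using someI_ex[OF runitor_exists, folded runitor_def] by blast+

end

text \<open>Every vector has the form \<open>lun F X y\<close>, and the tensor arrow acts on it
  through \<open>y\<close> alone.\<close>

lemma lunitor_natural:
  assumes t: "t \<in> Hom K F G"
  shows "lunitor G \<cdot>\<^bsub>K\<^esub> on_arr (hall_tensor C z) (Ident K one_fct, t) = t \<cdot>\<^bsub>K\<^esub> lunitor F"
proof -
  note O = K.Hom_Obj[OF t] and i = K.Ident_Hom[OF one_fct_Obj]
  note it = T_arr_Hom[OF i t] and l = lunitor[OF O(1)] and l' = lunitor[OF O(2)]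
  show ?thesis
  proof (rule K_eqI[OF K.Comp_Hom[OF it l'(1)] K.Comp_Hom[OF l(1) t]])
    fix X v assume X: "X \<in> Obj C" and v: "v \<in> el (T one_fct F) X"
    obtain y where y: "y \<in> el F X" "v = lun F X y" using l(4)[OF X v] by blast
    have "cmp (on_arr (hall_tensor C z) (Ident K one_fct, t)) X v = lun G X (cmp t X y)"
      using T_arr_inn[OF i t exact_zero_left[OF X], of "one z" y] one_closed[OF zero_z] y cmp_Ident[OF one_fct_Obj zero_Obj[OF zero_z] one_closed[OF zero_z]]
      by (simp add: zero_ends[OF X])
    then show "cmp (lunitor G \<cdot>\<^bsub>K\<^esub> on_arr (hall_tensor C z) (Ident K one_fct, t)) X v = cmp (t \<cdot>\<^bsub>K\<^esub> lunitor F) X v"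
      unfolding cmp_comp[OF it l'(1) X v] cmp_comp[OF l(1) t X v] using l(3)[OF X y(1)] l'(3)[OF X cmp_closed[OF t X y(1)]] y(2) by simp
  qed
qed

lemma runitor_natural:
  assumes t: "t \<in> Hom K F G"
  shows "runitor G \<cdot>\<^bsub>K\<^esub> on_arr (hall_tensor C z) (t, Ident K one_fct) = t \<cdot>\<^bsub>K\<^esub> runitor F"
proof -
  note O = K.Hom_Obj[OF t] and i = K.Ident_Hom[OF one_fct_Obj]
  note it = T_arr_Hom[OF t i] and l = runitor[OF O(1)] and l' = runitor[OF O(2)]
  show ?thesis
  proof (rule K_eqI[OF K.Comp_Hom[OF it l'(1)] K.Comp_Hom[OF l(1) t]])
    fix X v assume X: "X \<in> Obj C" and v: "v \<in> el (T F one_fct) X"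
    obtain x where x: "x \<in> el F X" "v = run F X x" using l(4)[OF X v] by blast
    have "cmp (on_arr (hall_tensor C z) (t, Ident K one_fct)) X v = run G X (cmp t X x)"
      using T_arr_inn[OF t i exact_zero_right[OF X], of x "one z"] one_closed[OF zero_z] x cmp_Ident[OF one_fct_Obj zero_Obj[OF zero_z] one_closed[OF zero_z]]
      by (simp add: zero_ends[OF X])
    then show "cmp (runitor G \<cdot>\<^bsub>K\<^esub> on_arr (hall_tensor C z) (t, Ident K one_fct)) X v = cmp (t \<cdot>\<^bsub>K\<^esub> runitor F) X v"
      unfolding cmp_comp[OF it l'(1) X v] cmp_comp[OF l(1) t X v] using l(3)[OF X x(1)] l'(3)[OF X cmp_closed[OF t X x(1)]] x(2) by simp
  qed
qed

section \<open>Triangle and pentagon\<close>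

abbreviation ten where
  "ten s t \<equiv> on_arr (hall_tensor C z) (s, t)"

text \<open>With the inner vector in the standard form \<open>run\<close>, the flag to be
  rebracketed is the one of \<open>flag3_unit\<close>; the associator moves the generator of the
  unit from the subobject to the quotient, where \<open>lunitor\<close> removes it.\<close>

lemma hall_triangle:
  assumes O: "F \<in> Obj K" "G \<in> Obj K"
  shows "ten (Ident K F) (lunitor G) \<cdot>\<^bsub>K\<^esub> associator F one_fct G = ten (runitor F) (Ident K G)"
proof -
  note I = one_fct_Obj and i = K.Ident_Hom[OF O(1)] K.Ident_Hom[OF O(2)]
  note a = associator[OF O(1) I O(2)] and l = lunitor[OF O(2)] and r = runitor[OF O(1)]
  note il = T_arr_Hom[OF i(1) l(1)] and ri = T_arr_Hom[OF r(1) i(2)]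
  note L = K.Comp_Hom[OF a(1) il]
  note O1 = T_Obj[OF O(1) I] and O2 = T_Obj[OF I O(2)]
  show ?thesis
  proof (rule K_eqI[OF L ri])
    fix X v assume X: "X \<in> Obj C" and v: "v \<in> el (T (T F one_fct) G) X"
    show "cmp (ten (Ident K F) (lunitor G) \<cdot>\<^bsub>K\<^esub> associator F one_fct G) X v = cmp (ten (runitor F) (Ident K G)) X v"
    proof (rule inn_ext[OF O1 O(2) X sp_vect[OF T_Obj[OF O] X] cmp_linear[OF L X] cmp_linear[OF ri X] _ v])
      fix f g u y assume e: "exact f g" "cod f = X" and u: "u \<in> el (T F one_fct) (dom f)" and y: "y \<in> el G (cod g)"
      note o = exact_Obj[OF e(1)] and oz = one_closed[OF zero_z]
      obtain x where x: "x \<in> el F (dom f)" "u = run F (dom f) x" using r(4)[OF o(1) u] by blast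
      \<comment> \<open>For this flag \<open>q\<close> is \<open>g\<close> itself and
        \<open>f \<cdot> f'\<close> is \<open>f\<close>, so the outer sequence is unchanged.\<close>
      note fl = flag3_unit[OF e(1)] and Z = zero_ends[OF o(1)] zero_ends[OF o(3)]
      have lu: "lun G (cod g) y \<in> el (T one_fct G) (cod g)" by (rule linmap_closed[OF lun_linear[OF O(2) o(3)] y])
      have "cmp (associator F one_fct G) (cod f) (inn (T F one_fct) G f g u y) = inn F (T one_fct G) f g x (lun G (cod g) y)"
        using a(3)[OF fl, of x "one z" y] x(1) y oz Ident_right[OF exact_Hom(1)[OF e(1)]] unfolding x(2) by (simp add: Z)
      then have "cmp (ten (Ident K F) (lunitor G) \<cdot>\<^bsub>K\<^esub> associator F one_fct G) (cod f) (inn (T F one_fct) G f g u y) = inn F G f g x y"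
        using cmp_comp[OF a(1) il o(2) inn_closed[OF O1 O(2) e(1) u y]] T_arr_inn[OF i(1) l(1) e(1) x(1) lu]
          cmp_Ident[OF O(1) o(1) x(1)] l(3)[OF o(3) y] by simp
      also have "\<dots> = cmp (ten (runitor F) (Ident K G)) (cod f) (inn (T F one_fct) G f g u y)"
        using T_arr_inn[OF r(1) i(2) e(1) u y] r(3)[OF o(1) x(1)] cmp_Ident[OF O(2) o(3) y] x(2) by simp
      finally show "cmp (ten (Ident K F) (lunitor G) \<cdot>\<^bsub>K\<^esub> associator F one_fct G) X (inn (T F one_fct) G f g u y) =
         cmp (ten (runitor F) (Ident K G)) X (inn (T F one_fct) G f g u y)" unfolding e(2) .
    qed
  qed
qed

text \<open>Each of the five associators is evaluated on one three-step flag cut out of a single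
  four-step filtration; once these flags share their arrows, both composites give literally the same
  symbol.\<close>

lemma hall_pentagon:
  assumes O: "E \<in> Obj K" "F \<in> Obj K" "G \<in> Obj K" "H \<in> Obj K"
  shows "associator E F (T G H) \<cdot>\<^bsub>K\<^esub> associator (T E F) G H =
    ten (Ident K E) (associator F G H) \<cdot>\<^bsub>K\<^esub> associator E (T F G) H \<cdot>\<^bsub>K\<^esub> ten (associator E F G) (Ident K H)"
proof -
  note OT = T_Obj[OF O(1,2)] T_Obj[OF O(2,3)] T_Obj[OF O(3,4)]
  note i = K.Ident_Hom[OF O(1)] K.Ident_Hom[OF O(4)]
  note a1 = associator[OF OT(1) O(3,4)] and a2 = associator[OF O(1,2) OT(3)]
  note b1 = associator[OF O(1-3)] and b2 = associator[OF O(1) OT(2) O(4)] and b3 = associator[OF O(2-4)]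
  note B1 = T_arr_Hom[OF b1(1) i(2)] and B3 = T_arr_Hom[OF i(1) b3(1)]
  note B = K.Comp_Hom[OF b2(1) B3]
  note L = K.Comp_Hom[OF a1(1) a2(1)] and R = K.Comp_Hom[OF B1 B]
  note O3 = T2_Obj(3)[OF O(1-3)] and O3' = T2_Obj(3)[OF O(2-4)]
  let ?l = "associator E F (T G H) \<cdot>\<^bsub>K\<^esub> associator (T E F) G H"
  let ?r = "ten (Ident K E) (associator F G H) \<cdot>\<^bsub>K\<^esub> associator E (T F G) H \<cdot>\<^bsub>K\<^esub> ten (associator E F G) (Ident K H)"
  have main: "cmp ?l (cod f1) (inn (T (T E F) G) H f1 g1 (inn (T E F) G f2 g2 (inn E F f3 g3 w x) y) t) =
      cmp ?r (cod f1) (inn (T (T E F) G) H f1 g1 (inn (T E F) G f2 g2 (inn E F f3 g3 w x) y) t)"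
    if e: "exact f1 g1" "exact f2 g2" "cod f2 = dom f1" "exact f3 g3" "cod f3 = dom f2"
      and w: "w \<in> el E (dom f3)" and x: "x \<in> el F (cod g3)"
      and y: "y \<in> el G (cod g2)" and t: "t \<in> el H (cod g1)" for f1 g1 f2 g2 f3 g3 w x y t
  proof -
    \<comment> \<open>Flags 1, 2 and 3 serve the longer composite: the filtration inside the third
      step, the first and third steps inside the whole, and the induced filtration of the quotient
      by the first step.\<close>
    obtain p h k where 1: "flag3 f2 g2 f3 g3 p h k" by (rule flag3_left[OF e(2,4,5)])
    note D1 = flag3D[OF 1] and E1 = flag3_ends[OF 1]
    obtain p' h' k' where 2: "flag3 f1 g1 (f2 \<cdot> f3) p p' h' k'" by (rule flag3_left[OF e(1) D1(4)]) (use E1 e(3) in simp)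
    note D2 = flag3D[OF 2] and E2 = flag3_ends[OF 2]
    obtain s m n where 3: "flag3 h' k' h k s m n" by (rule flag3_left[OF D2(5) D1(5)]) (use E1 E2 in simp)
    note D3 = flag3D[OF 3] and E3 = flag3_ends[OF 3]
    \<comment> \<open>The remaining two flags, for the shorter composite, are assembled from the
      same arrows.\<close>
    note A = flag3_refine(1)[OF 1 2 3] and A' = flag3_refine(2)[OF 1 2 3]
    note DA = flag3D[OF A] and EA = flag3_ends[OF A] and EA' = flag3_ends[OF A']
    let ?u = "inn E F f3 g3 w x"
    have u: "?u \<in> el (T E F) (dom f2)" using inn_closed[OF O(1,2) e(4) w x] e(5) by simp
    have uy: "inn (T E F) G f2 g2 ?u y \<in> el (T (T E F) G) (dom f1)" using inn_closed[OF OT(1) O(3) e(2) u y] e(3) by simp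
    have v: "inn (T (T E F) G) H f1 g1 (inn (T E F) G f2 g2 ?u y) t \<in> el (T (T (T E F) G) H) (cod f1)"
      by (rule inn_closed[OF O3 O(4) e(1) uy t])
    have yt: "inn G H m n y t \<in> el (T G H) (cod (s \<cdot> p'))"
      using inn_closed[OF O(3,4) D3(5), of y t] y t E1 E2 E3 EA by simp
    have xy: "inn F G h k x y \<in> el (T F G) (cod p)" using inn_closed[OF O(2,3) D1(5), of x y] x y E1 by simp
    have w': "w \<in> el E (dom (f2 \<cdot> f3))" using w E1 by simp
    have w2: "w \<in> el E (dom (f1 \<cdot> (f2 \<cdot> f3)))" using w E1 E2 by simp
    have xyt: "inn (T F G) H h' k' (inn F G h k x y) t \<in> el (T (T F G) H) (cod p')"
      using inn_closed[OF OT(2) O(4) D2(5), of "inn F G h k x y" t] xy t E2 by simp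
    have X: "cod f1 \<in> Obj C" by (rule exact_Obj(2)[OF e(1)])
    have "cmp ?l (cod f1) (inn (T (T E F) G) H f1 g1 (inn (T E F) G f2 g2 ?u y) t) =
       cmp (associator E F (T G H)) (cod f1) (inn (T E F) (T G H) (f1 \<cdot> f2) (s \<cdot> p') ?u (inn G H m n y t))"
      unfolding cmp_comp[OF a1(1) a2(1) X v] a1(3)[OF A u y t] ..
    also have "\<dots> = inn E (T F (T G H)) (f1 \<cdot> f2 \<cdot> f3) p' w (inn F (T G H) (h' \<cdot> h) s x (inn G H m n y t))"
      using a2(3)[OF A' w x yt] EA by simp
    \<comment> \<open>The common symbol has now been reached; the rest of the chain reads the longer
      composite backwards.\<close>
    also have "f1 \<cdot> f2 \<cdot> f3 = f1 \<cdot> (f2 \<cdot> f3)"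
      using Comp_assoc[of f3 "dom f3" "dom f2" f2 "dom f1" f1 "cod f1"] exact_Hom(1)[OF e(1)] exact_Hom(1)[OF e(2)] exact_Hom(1)[OF e(4)] e(3,5) by simp
    also have "inn F (T G H) (h' \<cdot> h) s x (inn G H m n y t) = cmp (associator F G H) (cod p') (inn (T F G) H h' k' (inn F G h k x y) t)"
      using b3(3)[OF 3, of x y t] x y t E1 E2 by simp
    also have "inn E (T F (T G H)) (f1 \<cdot> (f2 \<cdot> f3)) p' w \<dots> =
       cmp (ten (Ident K E) (associator F G H)) (cod f1) (inn E (T (T F G) H) (f1 \<cdot> (f2 \<cdot> f3)) p' w (inn (T F G) H h' k' (inn F G h k x y) t))"
      using T_arr_inn[OF i(1) b3(1) D2(4) w2 xyt] cmp_Ident[OF O(1) exact_Obj(1)[OF D2(4)] w2] E2 by simp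
    also have "inn E (T (T F G) H) (f1 \<cdot> (f2 \<cdot> f3)) p' w (inn (T F G) H h' k' (inn F G h k x y) t) =
       cmp (associator E (T F G) H) (cod f1) (inn (T E (T F G)) H f1 g1 (inn E (T F G) (f2 \<cdot> f3) p w (inn F G h k x y)) t)"
      by (rule b2(3)[OF 2 w' xy t, symmetric])
    also have "inn E (T F G) (f2 \<cdot> f3) p w (inn F G h k x y) = cmp (associator E F G) (dom f1) (inn (T E F) G f2 g2 ?u y)"
      using b1(3)[OF 1 w x y] e(3) by simp
    also have "inn (T E (T F G)) H f1 g1 \<dots> t = cmp (ten (associator E F G) (Ident K H)) (cod f1) (inn (T (T E F) G) H f1 g1 (inn (T E F) G f2 g2 ?u y) t)"
      unfolding T_arr_inn[OF b1(1) i(2) e(1) uy t] cmp_Ident[OF O(4) exact_Obj(3)[OF e(1)] t] ..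
    also have "cmp (ten (Ident K E) (associator F G H)) (cod f1) (cmp (associator E (T F G) H) (cod f1) \<dots>) =
       cmp ?r (cod f1) (inn (T (T E F) G) H f1 g1 (inn (T E F) G f2 g2 ?u y) t)"
      unfolding cmp_comp[OF B1 B X v] cmp_comp[OF b2(1) B3 X cmp_closed[OF B1 X v]] ..
    finally show ?thesis .
  qed
  show ?thesis
  proof (rule K_eqI[OF L R])
    \<comment> \<open>\<open>main\<close> covers nested symbols; one use of \<open>inn_ext\<close>
      for the outermost tensor product and one of \<open>inl_ext\<close> for the triple product
      inside reduce arbitrary vectors to them.\<close>
    fix X v assume X: "X \<in> Obj C" and v: "v \<in> el (T (T (T E F) G) H) X"
    note U = sp_vect[OF T_Obj[OF O(1) T2_Obj(4)[OF O(2-4)]] X]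
    show "cmp ?l X v = cmp ?r X v"
    proof (rule inn_ext[OF O3 O(4) X U cmp_linear[OF L X] cmp_linear[OF R X] _ v])
      fix f1 g1 u t assume e: "exact f1 g1" "cod f1 = X" and u: "u \<in> el (T (T E F) G) (dom f1)" and t: "t \<in> el H (cod g1)"
      note l = inn_linear_left[OF O3 O(4) e(1) t, unfolded e(2)]
      show "cmp ?l X (inn (T (T E F) G) H f1 g1 u t) = cmp ?r X (inn (T (T E F) G) H f1 g1 u t)"
      proof (rule inl_ext[OF O(1-3) exact_Obj(1)[OF e(1)] U linmap_comp[OF l cmp_linear[OF L X]] linmap_comp[OF l cmp_linear[OF R X]] _ u])
        fix f2 g2 f3 g3 w x y
        assume a: "exact f2 g2" "cod f2 = dom f1" "exact f3 g3" "cod f3 = dom f2"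
          "w \<in> el E (dom f3)" "x \<in> el F (cod g3)" "y \<in> el G (cod g2)"
        show "cmp ?l X (inn (T (T E F) G) H f1 g1 (inl E F G f2 g2 f3 g3 w x y) t) =
          cmp ?r X (inn (T (T E F) G) H f1 g1 (inl E F G f2 g2 f3 g3 w x y) t)"
          using main[OF e(1) a t] unfolding inl_def[OF O(1-3)] e(2) .
      qed
    qed
  qed
qed

lemma hall_monoidal: "monoidal_category K (hall_tensor C z) one_fct associator lunitor runitor"
  by (intro monoidal_category.intro monoidal_category_axioms.intro category_Fun hall_tensor_functor one_fct_Obj associator(1,2) associator_natural
      lunitor(1,2) lunitor_natural runitor(1,2) runitor_natural hall_pentagon hall_triangle)

end

theorem theorem2p49:
  fixes C :: "('o, 'a) cat" and z :: 'o and \<iota> :: "complex \<Rightarrow> 'v"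
  assumes "proto_abelian C"
    and "zero_object C z"
    and "finitary C z"
    and "inj \<iota>"
  shows "\<exists>\<alpha> l r. monoidal_category (Fun (S C z 1)) (hall_tensor C z) (hall_unit C z \<iota>) \<alpha> l r"
proof -
  interpret hall C z \<iota>
    using assms by (intro hall.intro pointed_proto_abelian.intro pointed_proto_abelian_axioms.intro complex_universe.intro hall_axioms.intro)
  show ?thesis using hall_monoidal by blast
qed

end
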